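(* Let $\Lambda$ be a basic and connected algebra with Jacobson radical $r$ satisfying $r^2=0$. If $\Lambda$ admits a unique $\tau$-tilting module, then $\Lambda$ is local.
   Context: All algebras are basic connected non-semisimple Artin algebras over a commutative Artin ring, and all modules are finitely generated left modules. $\tau$ denotes the Auslander-Reiten translation. A $\Lambda$-module $M$ is $\tau$-rigid if $\mathrm{Hom}_\Lambda(M,\tau M)=0$. A $\Lambda$-module $N$ is $\tau$-tilting if it is $\tau$-rigid and $|N|=|\Lambda|$, where $|N|$ is the number of pairwise non-isomorphic indecomposable direct summands of $N$. Uniqueness of $\tau$-tilting modules is understood up to isomorphism and multiplicity of summands (i.e. for basic $\tau$-tilting modules); it means that $\Lambda$ itself is the only one, equivalently that all indecomposable $\tau$-rigid modules are projective. *)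

theory Defs
  imports "HOL-Algebra.Module" "HOL-Algebra.Ideal_Product"
begin

section \<open>Left modules over a ring\<close>

text \<open>
  The locale \<^locale>\<open>module\<close> requires a commutative ring of scalars. The locale below has the same
  axioms over an arbitrary ring; the fields \<open>mult\<close> and \<open>one\<close> of the module record play no role.
\<close>

locale left_module = R?: ring R + M?: abelian_group M
  for R :: "('a, 'x) ring_scheme" (structure) and M :: "('a, 'm, 'y) module_scheme" (structure) +
  assumes smult_closed [simp, intro]:
      "\<lbrakk>a \<in> carrier R; x \<in> carrier M\<rbrakk> \<Longrightarrow> a \<odot>\<^bsub>M\<^esub> x \<in> carrier M"
    and smult_l_distr:
      "\<lbrakk>a \<in> carrier R; b \<in> carrier R; x \<in> carrier M\<rbrakk> \<Longrightarrow>
        (a \<oplus> b) \<odot>\<^bsub>M\<^esub> x = a \<odot>\<^bsub>M\<^esub> x \<oplus>\<^bsub>M\<^esub> b \<odot>\<^bsub>M\<^esub> x"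
    and smult_r_distr:
      "\<lbrakk>a \<in> carrier R; x \<in> carrier M; y \<in> carrier M\<rbrakk> \<Longrightarrow>
        a \<odot>\<^bsub>M\<^esub> (x \<oplus>\<^bsub>M\<^esub> y) = a \<odot>\<^bsub>M\<^esub> x \<oplus>\<^bsub>M\<^esub> a \<odot>\<^bsub>M\<^esub> y"
    and smult_assoc1:
      "\<lbrakk>a \<in> carrier R; b \<in> carrier R; x \<in> carrier M\<rbrakk> \<Longrightarrow>
        (a \<otimes> b) \<odot>\<^bsub>M\<^esub> x = a \<odot>\<^bsub>M\<^esub> (b \<odot>\<^bsub>M\<^esub> x)"
    and smult_one [simp]:
      "x \<in> carrier M \<Longrightarrow> \<one> \<odot>\<^bsub>M\<^esub> x = x"

lemma module_iff_left_module: "module R M \<longleftrightarrow> cring R \<and> left_module R M"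
  unfolding module_def left_module_def module_axioms_def left_module_axioms_def
  by (auto dest: cring.axioms(1))

definition fg_module :: "('a, 'x) ring_scheme \<Rightarrow> ('a, 'm, 'y) module_scheme \<Rightarrow> bool" where
  "fg_module R M \<longleftrightarrow> left_module R M \<and>
    (\<exists>S. finite S \<and> S \<subseteq> carrier M \<and>
      (\<forall>x\<in>carrier M. \<exists>c\<in>S \<rightarrow> carrier R. x = (\<Oplus>\<^bsub>M\<^esub>s\<in>S. c s \<odot>\<^bsub>M\<^esub> s)))"

definition make_module ::
    "'m set \<Rightarrow> 'm \<Rightarrow> ('m \<Rightarrow> 'm \<Rightarrow> 'm) \<Rightarrow> ('a \<Rightarrow> 'm \<Rightarrow> 'm) \<Rightarrow> ('a, 'm) module" where
  "make_module C z p s =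
    \<lparr>carrier = C, mult = (\<lambda>_ _. undefined), one = undefined, zero = z, add = p, smult = s\<rparr>"

definition regular :: "('a, 'x) ring_scheme \<Rightarrow> ('a, 'a) module" where
  "regular R = make_module (carrier R) \<zero>\<^bsub>R\<^esub> (add R) (mult R)"

abbreviation restrict_module ::
    "('a, 'm, 'y) module_scheme \<Rightarrow> 'm set \<Rightarrow> ('a, 'm, 'y) module_scheme" where
  "restrict_module M N \<equiv> M\<lparr>carrier := N\<rparr>"

definition quotient_module :: "('a, 'm, 'y) module_scheme \<Rightarrow> 'm set \<Rightarrow> ('a, 'm set) module" where
  "quotient_module M N =
    make_module (a_rcosets\<^bsub>M\<^esub> N) N (set_add M) (\<lambda>a C. \<Union>x\<in>C. N +>\<^bsub>M\<^esub> (a \<odot>\<^bsub>M\<^esub> x))"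

definition mod_hom ::
    "('a, 'x) ring_scheme \<Rightarrow> ('a, 'm, 'y) module_scheme \<Rightarrow> ('a, 'n, 'z) module_scheme \<Rightarrow> ('m \<Rightarrow> 'n) set"
  where
  "mod_hom R M N = {f \<in> carrier M \<rightarrow>\<^sub>E carrier N.
    (\<forall>x\<in>carrier M. \<forall>y\<in>carrier M. f (x \<oplus>\<^bsub>M\<^esub> y) = f x \<oplus>\<^bsub>N\<^esub> f y) \<and>
    (\<forall>a\<in>carrier R. \<forall>x\<in>carrier M. f (a \<odot>\<^bsub>M\<^esub> x) = a \<odot>\<^bsub>N\<^esub> f x)}"

definition mod_iso ::
    "('a, 'x) ring_scheme \<Rightarrow> ('a, 'm, 'y) module_scheme \<Rightarrow> ('a, 'n, 'z) module_scheme \<Rightarrow> bool" where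
  "mod_iso R M N \<longleftrightarrow> (\<exists>f\<in>mod_hom R M N. bij_betw f (carrier M) (carrier N))"


section \<open>A universe for finitely generated modules\<close>

text \<open>
  HOL cannot quantify over all types of module elements inside a formula. Every finitely generated
  module over a ring with elements of type \<open>'a\<close> has an isomorphic copy on the type of sets of
  functions \<open>nat \<Rightarrow> 'a\<close> (see \<open>fg_module_copy\<close>), so quantification over modules on this type
  covers all finitely generated modules up to isomorphism.
\<close>

type_synonym 'a fg_univ = "(nat \<Rightarrow> 'a) set"
type_synonym 'a fgm = "('a, 'a fg_univ) module"

lemma left_module_transport:
  fixes R :: "('a, 'x) ring_scheme" and M :: "('a, 'm, 'y) module_scheme" and \<phi> :: "'m \<Rightarrow> 'n"
  assumes M: "left_module R M" and inj: "inj_on \<phi> (carrier M)"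
  shows "\<exists>N :: ('a, 'n) module. left_module R N \<and> mod_iso R M N"
proof -
  interpret left_module R M by (rule M)
  define \<psi> where "\<psi> = inv_into (carrier M) \<phi>"
  have \<psi>: "\<psi> (\<phi> x) = x" if "x \<in> carrier M" for x
    using inj that by (simp add: \<psi>_def)
  define N :: "('a, 'n) module" where
    "N = make_module (\<phi> ` carrier M) (\<phi> \<zero>\<^bsub>M\<^esub>) (\<lambda>x y. \<phi> (\<psi> x \<oplus>\<^bsub>M\<^esub> \<psi> y)) (\<lambda>a x. \<phi> (a \<odot>\<^bsub>M\<^esub> \<psi> x))"
  have N: "carrier N = \<phi> ` carrier M" "\<zero>\<^bsub>N\<^esub> = \<phi> \<zero>\<^bsub>M\<^esub>"
    "\<And>x y. x \<oplus>\<^bsub>N\<^esub> y = \<phi> (\<psi> x \<oplus>\<^bsub>M\<^esub> \<psi> y)" "\<And>a x. a \<odot>\<^bsub>N\<^esub> x = \<phi> (a \<odot>\<^bsub>M\<^esub> \<psi> x)"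
    by (simp_all add: N_def make_module_def)
  have "abelian_group N"
  proof (rule abelian_groupI)
    fix x assume "x \<in> carrier N"
    then obtain y where "y \<in> carrier M" "x = \<phi> y" by (auto simp: N)
    then show "\<exists>y\<in>carrier N. y \<oplus>\<^bsub>N\<^esub> x = \<zero>\<^bsub>N\<^esub>"
      by (intro bexI[of _ "\<phi> (\<ominus>\<^bsub>M\<^esub> y)"]) (auto simp: N \<psi> M.l_neg)
  qed (auto simp: N \<psi> M.add.m_ac)
  then have "left_module R N"
    by (intro left_module.intro left_module_axioms.intro R.ring_axioms)
       (auto simp: N \<psi> smult_l_distr smult_r_distr smult_assoc1)
  moreover have "mod_iso R M N"
    unfolding mod_iso_def
  proof (rule bexI)
    show "bij_betw (restrict \<phi> (carrier M)) (carrier M) (carrier N)"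
      using inj by (auto simp: bij_betw_def N inj_on_def)
    show "restrict \<phi> (carrier M) \<in> mod_hom R M N"
      by (auto simp: mod_hom_def N \<psi>)
  qed
  ultimately show ?thesis by blast
qed

lemma fg_module_copy:
  fixes R :: "('a, 'x) ring_scheme" and M :: "('a, 'm, 'y) module_scheme"
  assumes "fg_module R M"
  shows "\<exists>N :: 'a fgm. left_module R N \<and> mod_iso R M N"
proof -
  obtain S where S: "finite S" "S \<subseteq> carrier M"
    and gen: "\<And>x. x \<in> carrier M \<Longrightarrow> \<exists>c\<in>S \<rightarrow> carrier R. x = (\<Oplus>\<^bsub>M\<^esub>s\<in>S. c s \<odot>\<^bsub>M\<^esub> s)"
    and M: "left_module R M"
    using assms unfolding fg_module_def by metis
  interpret left_module R M by (rule M)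
  obtain g :: "'m \<Rightarrow> nat" where g: "inj_on g S"
    using finite_imp_inj_to_nat_seg[OF S(1)] by blast
  define \<phi> where "\<phi> x = {c. (\<lambda>s. c (g s)) \<in> S \<rightarrow> carrier R \<and> x = (\<Oplus>\<^bsub>M\<^esub>s\<in>S. c (g s) \<odot>\<^bsub>M\<^esub> s)}" for x
  have ne: "\<phi> x \<noteq> {}" if x: "x \<in> carrier M" for x
  proof -
    obtain c where c: "c \<in> S \<rightarrow> carrier R" "x = (\<Oplus>\<^bsub>M\<^esub>s\<in>S. c s \<odot>\<^bsub>M\<^esub> s)"
      using gen[OF x] by blast
    have inv: "inv_into S g (g s) = s" if "s \<in> S" for s
      using g that by simp
    have "(\<Oplus>\<^bsub>M\<^esub>s\<in>S. c (inv_into S g (g s)) \<odot>\<^bsub>M\<^esub> s) = (\<Oplus>\<^bsub>M\<^esub>s\<in>S. c s \<odot>\<^bsub>M\<^esub> s)"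
      using c(1) S(2) by (intro M.finsum_cong') (auto simp: inv)
    then have "(\<lambda>n. c (inv_into S g n)) \<in> \<phi> x"
      using c by (auto simp: \<phi>_def inv)
    then show ?thesis by blast
  qed
  have "inj_on \<phi> (carrier M)"
  proof (rule inj_onI)
    fix x y assume "x \<in> carrier M" "y \<in> carrier M" and eq: "\<phi> x = \<phi> y"
    then obtain c where "c \<in> \<phi> x" "c \<in> \<phi> y" using ne by blast
    then show "x = y" by (simp add: \<phi>_def)
  qed
  then show ?thesis by (rule left_module_transport[OF M])
qed


section \<open>Direct sum decompositions\<close>

definition complementary ::
    "('a, 'x) ring_scheme \<Rightarrow> ('a, 'm, 'y) module_scheme \<Rightarrow> 'm set \<Rightarrow> 'm set \<Rightarrow> bool" where
  "complementary R M N N' \<longleftrightarrow> submodule N R M \<and> submodule N' R M \<and>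
    N \<inter> N' = {\<zero>\<^bsub>M\<^esub>} \<and> N <+>\<^bsub>M\<^esub> N' = carrier M"

definition indecomposable :: "('a, 'x) ring_scheme \<Rightarrow> ('a, 'm, 'y) module_scheme \<Rightarrow> bool" where
  "indecomposable R M \<longleftrightarrow> left_module R M \<and> carrier M \<noteq> {\<zero>\<^bsub>M\<^esub>} \<and>
    (\<forall>N N'. complementary R M N N' \<longrightarrow> N = {\<zero>\<^bsub>M\<^esub>} \<or> N' = {\<zero>\<^bsub>M\<^esub>})"

definition indecomposable_summands ::
    "('a, 'x) ring_scheme \<Rightarrow> ('a, 'm, 'y) module_scheme \<Rightarrow> 'm set set" where
  "indecomposable_summands R M =
    {N. (\<exists>N'. complementary R M N N') \<and> indecomposable R (restrict_module M N)}"

text \<open>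
  The number \<open>|M|\<close> of isomorphism classes of indecomposable direct summands of \<open>M\<close>. For finitely
  generated modules over an Artin algebra it is finite by the Krull-Schmidt theorem.
\<close>

definition num_summands :: "('a, 'x) ring_scheme \<Rightarrow> ('a, 'm, 'y) module_scheme \<Rightarrow> nat" where
  "num_summands R M = card (indecomposable_summands R M //
    {(N, N'). N \<in> indecomposable_summands R M \<and> N' \<in> indecomposable_summands R M \<and>
      mod_iso R (restrict_module M N) (restrict_module M N')})"

definition internal_direct_sum ::
    "('a, 'x) ring_scheme \<Rightarrow> ('a, 'm, 'y) module_scheme \<Rightarrow> 'i set \<Rightarrow> ('i \<Rightarrow> 'm set) \<Rightarrow> bool" where
  "internal_direct_sum R M I N \<longleftrightarrow> finite I \<and> (\<forall>i\<in>I. submodule (N i) R M) \<and>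
    (\<forall>x\<in>carrier M. \<exists>!c. c \<in> (\<Pi>\<^sub>E i\<in>I. N i) \<and> x = (\<Oplus>\<^bsub>M\<^esub>i\<in>I. c i))"

definition basic_module :: "('a, 'x) ring_scheme \<Rightarrow> ('a, 'm, 'y) module_scheme \<Rightarrow> bool" where
  "basic_module R M \<longleftrightarrow> left_module R M \<and>
    (\<exists>(n::nat) N. internal_direct_sum R M {..<n} N \<and>
      (\<forall>i<n. indecomposable R (restrict_module M (N i))) \<and>
      (\<forall>i<n. \<forall>j<n. i \<noteq> j \<longrightarrow> \<not> mod_iso R (restrict_module M (N i)) (restrict_module M (N j))))"

definition simple_module :: "('a, 'x) ring_scheme \<Rightarrow> ('a, 'm, 'y) module_scheme \<Rightarrow> bool" where
  "simple_module R M \<longleftrightarrow> left_module R M \<and> carrier M \<noteq> {\<zero>\<^bsub>M\<^esub>} \<and>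
    (\<forall>N. submodule N R M \<longrightarrow> N = {\<zero>\<^bsub>M\<^esub>} \<or> N = carrier M)"


section \<open>Artin algebras\<close>

definition artinian_ring :: "('a, 'x) ring_scheme \<Rightarrow> bool" where
  "artinian_ring R \<longleftrightarrow> ring R \<and>
    (\<forall>I :: nat \<Rightarrow> 'a set. (\<forall>n. submodule (I n) R (regular R) \<and> I (Suc n) \<subseteq> I n) \<longrightarrow>
      (\<exists>n. \<forall>m\<ge>n. I m = I n))"

locale artin_algebra = module R \<Lambda> + \<Lambda>?: ring \<Lambda>
  for R :: "('r, 'z) ring_scheme" (structure) and \<Lambda> :: "('r, 'a, 'x) module_scheme" (structure) +
  assumes artinian: "artinian_ring R"
    and finitely_generated: "fg_module R \<Lambda>"
    and smult_mult_left:
      "\<lbrakk>r \<in> carrier R; x \<in> carrier \<Lambda>; y \<in> carrier \<Lambda>\<rbrakk> \<Longrightarrow>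
        (r \<odot>\<^bsub>\<Lambda>\<^esub> x) \<otimes>\<^bsub>\<Lambda>\<^esub> y = r \<odot>\<^bsub>\<Lambda>\<^esub> (x \<otimes>\<^bsub>\<Lambda>\<^esub> y)"
    and smult_mult_right:
      "\<lbrakk>r \<in> carrier R; x \<in> carrier \<Lambda>; y \<in> carrier \<Lambda>\<rbrakk> \<Longrightarrow>
        x \<otimes>\<^bsub>\<Lambda>\<^esub> (r \<odot>\<^bsub>\<Lambda>\<^esub> y) = r \<odot>\<^bsub>\<Lambda>\<^esub> (x \<otimes>\<^bsub>\<Lambda>\<^esub> y)"

definition maximal_left_ideal :: "('a, 'x) ring_scheme \<Rightarrow> 'a set \<Rightarrow> bool" where
  "maximal_left_ideal R I \<longleftrightarrow> submodule I R (regular R) \<and> I \<noteq> carrier R \<and>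
    (\<forall>K. submodule K R (regular R) \<and> I \<subseteq> K \<longrightarrow> K = I \<or> K = carrier R)"

definition jacobson_radical :: "('a, 'x) ring_scheme \<Rightarrow> 'a set" where
  "jacobson_radical R = carrier R \<inter> \<Inter>{I. maximal_left_ideal R I}"

definition local_ring :: "('a, 'x) ring_scheme \<Rightarrow> bool" where
  "local_ring R \<longleftrightarrow> ring R \<and> (\<exists>!I. maximal_left_ideal R I)"

definition semisimple_ring :: "('a, 'x) ring_scheme \<Rightarrow> bool" where
  "semisimple_ring R \<longleftrightarrow> ring R \<and>
    (\<exists>(n::nat) N. internal_direct_sum R (regular R) {..<n} N \<and>
      (\<forall>i<n. simple_module R (restrict_module (regular R) (N i))))"

definition basic_ring :: "('a, 'x) ring_scheme \<Rightarrow> bool" where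
  "basic_ring R \<longleftrightarrow> ring R \<and> basic_module R (regular R)"

text \<open>A ring is connected if it is nonzero and not a product of two nonzero rings.\<close>

definition connected_ring :: "('a, 'x) ring_scheme \<Rightarrow> bool" where
  "connected_ring R \<longleftrightarrow> ring R \<and> carrier R \<noteq> {\<zero>\<^bsub>R\<^esub>} \<and>
    (\<forall>I J. ideal I R \<and> ideal J R \<and> I \<inter> J = {\<zero>\<^bsub>R\<^esub>} \<and> I <+>\<^bsub>R\<^esub> J = carrier R \<longrightarrow>
      I = {\<zero>\<^bsub>R\<^esub>} \<or> J = {\<zero>\<^bsub>R\<^esub>})"

text \<open>Right modules are represented as left modules over the opposite ring.\<close>

definition opposite :: "('a, 'x) ring_scheme \<Rightarrow> ('a, 'x) ring_scheme" where
  "opposite R = R\<lparr>mult := \<lambda>x y. y \<otimes>\<^bsub>R\<^esub> x\<rparr>"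


section \<open>The Auslander-Reiten translation\<close>

text \<open>Projective objects of the category of finitely generated modules.\<close>

definition projective :: "('a, 'x) ring_scheme \<Rightarrow> ('a, 'm, 'y) module_scheme \<Rightarrow> bool" where
  "projective R P \<longleftrightarrow> fg_module R P \<and>
    (\<forall>(X :: 'a fgm) (Y :: 'a fgm). \<forall>p\<in>mod_hom R X Y. \<forall>h\<in>mod_hom R P Y.
      fg_module R X \<and> fg_module R Y \<and> p ` carrier X = carrier Y \<longrightarrow>
      (\<exists>k\<in>mod_hom R P X. \<forall>x\<in>carrier P. p (k x) = h x))"

text \<open>An epimorphism is essential if it maps no proper submodule onto its codomain.\<close>

definition projective_cover ::
    "('a, 'x) ring_scheme \<Rightarrow> ('a, 'p, 'y) module_scheme \<Rightarrow> ('a, 'm, 'z) module_scheme \<Rightarrow>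
      ('p \<Rightarrow> 'm) \<Rightarrow> bool" where
  "projective_cover R P M p \<longleftrightarrow> projective R P \<and> p \<in> mod_hom R P M \<and>
    p ` carrier P = carrier M \<and>
    (\<forall>N. submodule N R P \<and> p ` N = carrier M \<longrightarrow> N = carrier P)"

text \<open>A minimal projective presentation \<open>P\<^sub>1 \<rightarrow> P\<^sub>0 \<rightarrow> M \<rightarrow> 0\<close> with maps \<open>f\<close> and \<open>p\<close>.\<close>

definition min_proj_presentation ::
    "('a, 'x) ring_scheme \<Rightarrow> ('a, 'm, 'y) module_scheme \<Rightarrow>
      'a fgm \<times> 'a fgm \<times> ('a fg_univ \<Rightarrow> 'a fg_univ) \<times> ('a fg_univ \<Rightarrow> 'm) \<Rightarrow> bool" where
  "min_proj_presentation R M = (\<lambda>(P1, P0, f, p).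
    projective_cover R P0 M p \<and>
    projective_cover R P1 (restrict_module P0 (a_kernel P0 M p)) f)"

text \<open>The right module \<open>Hom\<^sub>R(P, R)\<close>, with \<open>(\<phi>a)(x) = \<phi>(x)a\<close>.\<close>

definition ring_dual ::
    "('a, 'x) ring_scheme \<Rightarrow> ('a, 'm, 'y) module_scheme \<Rightarrow> ('a, 'm \<Rightarrow> 'a) module" where
  "ring_dual R P = make_module (mod_hom R P (regular R))
    (\<lambda>x\<in>carrier P. \<zero>\<^bsub>R\<^esub>)
    (\<lambda>\<phi> \<psi>. \<lambda>x\<in>carrier P. \<phi> x \<oplus>\<^bsub>R\<^esub> \<psi> x)
    (\<lambda>a \<phi>. \<lambda>x\<in>carrier P. \<phi> x \<otimes>\<^bsub>R\<^esub> a)"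

text \<open>
  The transpose, a left module over \<open>opposite R\<close>: the cokernel of
  \<open>Hom\<^sub>R(f, R) : Hom\<^sub>R(P\<^sub>0, R) \<rightarrow> Hom\<^sub>R(P\<^sub>1, R)\<close>. Minimal projective presentations are unique up to
  isomorphism, so the choice is immaterial.
\<close>

definition transpose_module ::
    "('a, 'x) ring_scheme \<Rightarrow> ('a, 'm, 'y) module_scheme \<Rightarrow> ('a, ('a fg_univ \<Rightarrow> 'a) set) module" where
  "transpose_module R M = (let (P1, P0, f, p) = SOME \<pi>. min_proj_presentation R M \<pi> in
    quotient_module (ring_dual R P1)
      ((\<lambda>\<phi>. \<lambda>x\<in>carrier P1. \<phi> (f x)) ` mod_hom R P0 (regular R)))"

text \<open>
  By Baer's criterion, extensions along inclusions of ideals suffice for injectivity, and ideals of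
  \<open>R\<close> have copies on the type \<open>'r fg_univ\<close>.
\<close>

definition injective :: "('r, 'x) ring_scheme \<Rightarrow> ('r, 'j, 'y) module_scheme \<Rightarrow> bool" where
  "injective R J \<longleftrightarrow> left_module R J \<and>
    (\<forall>(X :: 'r fgm) (Y :: 'r fgm). \<forall>i\<in>mod_hom R X Y. \<forall>h\<in>mod_hom R X J.
      left_module R X \<and> left_module R Y \<and> inj_on i (carrier X) \<longrightarrow>
      (\<exists>k\<in>mod_hom R Y J. \<forall>x\<in>carrier X. k (i x) = h x))"

definition injective_envelope ::
    "('r, 'x) ring_scheme \<Rightarrow> ('r, 's, 'y) module_scheme \<Rightarrow> ('r, 'j, 'z) module_scheme \<Rightarrow> bool" where
  "injective_envelope R S J \<longleftrightarrow> injective R J \<and>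
    (\<exists>i\<in>mod_hom R S J. inj_on i (carrier S) \<and>
      (\<forall>N. submodule N R J \<and> N \<inter> i ` carrier S = {\<zero>\<^bsub>J\<^esub>} \<longrightarrow> N = {\<zero>\<^bsub>J\<^esub>}))"

text \<open>A module over an \<open>R\<close>-algebra (or over its opposite) viewed as an \<open>R\<close>-module.\<close>

definition restrict_scalars ::
    "('r, 'a, 'x) module_scheme \<Rightarrow> ('a, 'm, 'y) module_scheme \<Rightarrow> ('r, 'm) module" where
  "restrict_scalars \<Lambda> X = make_module (carrier X) \<zero>\<^bsub>X\<^esub> (add X)
    (\<lambda>r x. (r \<odot>\<^bsub>\<Lambda>\<^esub> \<one>\<^bsub>\<Lambda>\<^esub>) \<odot>\<^bsub>X\<^esub> x)"

text \<open>
  For a right \<open>\<Lambda>\<close>-module \<open>X\<close>, the left \<open>\<Lambda>\<close>-module \<open>D X = Hom\<^sub>R(X, J)\<close> with \<open>(a\<phi>)(x) = \<phi>(xa)\<close>.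
  As \<open>X\<close> is represented as a left module over \<open>opposite \<Lambda>\<close>, the element \<open>xa\<close> is \<open>a \<odot>\<^bsub>X\<^esub> x\<close>.
\<close>

definition dual ::
    "('r, 'z) ring_scheme \<Rightarrow> ('r, 'a, 'x) module_scheme \<Rightarrow> ('r, 'j, 'w) module_scheme \<Rightarrow>
      ('a, 'm, 'y) module_scheme \<Rightarrow> ('a, 'm \<Rightarrow> 'j) module" where
  "dual R \<Lambda> J X = make_module (mod_hom R (restrict_scalars \<Lambda> X) J)
    (\<lambda>x\<in>carrier X. \<zero>\<^bsub>J\<^esub>)
    (\<lambda>\<phi> \<psi>. \<lambda>x\<in>carrier X. \<phi> x \<oplus>\<^bsub>J\<^esub> \<psi> x)
    (\<lambda>a \<phi>. \<lambda>x\<in>carrier X. \<phi> (a \<odot>\<^bsub>X\<^esub> x))"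

text \<open>
  Here and below, \<open>J\<close> is meant to be an injective envelope of \<open>R / rad R\<close> over \<open>R\<close>; it is unique up
  to isomorphism.
\<close>

definition tau ::
    "('r, 'z) ring_scheme \<Rightarrow> ('r, 'a, 'x) module_scheme \<Rightarrow> ('r, 'j, 'w) module_scheme \<Rightarrow>
      ('a, 'm, 'y) module_scheme \<Rightarrow> ('a, ('a fg_univ \<Rightarrow> 'a) set \<Rightarrow> 'j) module" where
  "tau R \<Lambda> J M = dual R \<Lambda> J (transpose_module \<Lambda> M)"

definition tau_rigid ::
    "('r, 'z) ring_scheme \<Rightarrow> ('r, 'a, 'x) module_scheme \<Rightarrow> ('r, 'j, 'w) module_scheme \<Rightarrow>
      ('a, 'm, 'y) module_scheme \<Rightarrow> bool" where
  "tau_rigid R \<Lambda> J M \<longleftrightarrow> fg_module \<Lambda> M \<and>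
    mod_hom \<Lambda> M (tau R \<Lambda> J M) = {\<lambda>x\<in>carrier M. \<zero>\<^bsub>tau R \<Lambda> J M\<^esub>}"

definition tau_tilting ::
    "('r, 'z) ring_scheme \<Rightarrow> ('r, 'a, 'x) module_scheme \<Rightarrow> ('r, 'j, 'w) module_scheme \<Rightarrow>
      ('a, 'm, 'y) module_scheme \<Rightarrow> bool" where
  "tau_tilting R \<Lambda> J M \<longleftrightarrow> tau_rigid R \<Lambda> J M \<and>
    num_summands \<Lambda> M = num_summands \<Lambda> (regular \<Lambda>)"

text \<open>Uniqueness is understood for basic modules and up to isomorphism.\<close>

definition unique_tau_tilting ::
    "('r, 'z) ring_scheme \<Rightarrow> ('r, 'a, 'x) module_scheme \<Rightarrow> ('r, 'j, 'w) module_scheme \<Rightarrow> bool" where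
  "unique_tau_tilting R \<Lambda> J \<longleftrightarrow>
    (\<exists>T :: 'a fgm. basic_module \<Lambda> T \<and> tau_tilting R \<Lambda> J T \<and>
      (\<forall>T' :: 'a fgm. basic_module \<Lambda> T' \<and> tau_tilting R \<Lambda> J T' \<longrightarrow> mod_iso \<Lambda> T' T))"

end

theory Submission
  imports Defs "HOL-Algebra.Multiplicative_Group"
begin

text \<open>
  Write \<open>1 = \<Sum> e\<^sub>i\<close> with primitive orthogonal idempotents. If \<open>\<Lambda>\<close> is connected and not local, then
  \<open>e\<^sub>i \<Lambda> e\<^sub>j \<noteq> 0\<close> for some \<open>i \<noteq> j\<close>, so a minimal left approximation \<open>\<Lambda>e\<^sub>i \<rightarrow> Q\<close> by sums of the
  \<open>\<Lambda>e\<^sub>l\<close> with \<open>l \<noteq> i\<close> is nonzero. With \<open>Y\<close> its cokernel, the mutation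
  \<open>T = Y \<oplus> \<Oplus>\<^sub>l\<^sub>\<noteq>\<^sub>i \<Lambda>e\<^sub>l\<close> of \<open>\<Lambda>\<close> is \<open>\<tau>\<close>-rigid, because every map \<open>\<Lambda>e\<^sub>i \<rightarrow> T\<close> factors through the
  approximation, which is also a minimal projective presentation of \<open>Y\<close>. As \<open>r\<^sup>2 = 0\<close>, the
  endomorphism ring of \<open>Y\<close> is local; so \<open>T\<close> is basic with as many indecomposable summands as \<open>\<Lambda>\<close>,
  but \<open>T\<close> is not projective. Hence \<open>\<Lambda>\<close> and \<open>T\<close> are two different basic \<open>\<tau>\<close>-tilting modules.
\<close>

section \<open>Linear maps and submodules\<close>

text \<open>\<open>tau\<close> is the dual of a cokernel, so \<open>Hom(M, tau M)\<close> is never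
  computed. A map \<open>M \<rightarrow> tau M\<close> is read as a balanced pairing of
  \<open>M\<close> with the dual of \<open>P1\<close> that vanishes on functionals factoring through
  \<open>f : P1 \<rightarrow> P0\<close>; dual bases show that such a pairing is zero once every map
  \<open>P1 \<rightarrow> M\<close> extends along \<open>f\<close>. Since \<open>tau\<close> picks
  its presentation by SOME, extension must be carried from one explicit presentation to all minimal
  ones. The hypothesis \<open>r\<^sup>2 = 0\<close> replaces several general theorems. A relation
  with coefficients in \<open>r\<close> is an element killed by \<open>r\<close>, which makes covers
  essential as Nakayama's lemma would. An endomorphism that is the identity modulo \<open>r\<close>
  has the form \<open>1 + N\<close> with \<open>N\<^sup>2 = 0\<close>. Idempotents lift modulo
  \<open>r\<close> by one explicit polynomial. \<open>T\<close> is given at once by generators and a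
  single relation, so maps out of it are determined by images of generators. Counting its summands
  needs the Krull-Schmidt property, and this is why locality of endomorphism rings is proved and not
  only indecomposability.\<close>

context left_module
begin

lemma smult_l_null [simp]:
  assumes "x \<in> carrier M"
  shows "\<zero>\<^bsub>R\<^esub> \<odot>\<^bsub>M\<^esub> x = \<zero>\<^bsub>M\<^esub>"
proof -
  have "\<zero>\<^bsub>R\<^esub> \<odot>\<^bsub>M\<^esub> x \<oplus>\<^bsub>M\<^esub> \<zero>\<^bsub>R\<^esub> \<odot>\<^bsub>M\<^esub> x = \<zero>\<^bsub>R\<^esub> \<odot>\<^bsub>M\<^esub> x"
    using smult_l_distr[of "\<zero>\<^bsub>R\<^esub>" "\<zero>\<^bsub>R\<^esub>" x] assms by simp
  then show ?thesis
    using assms by (metis M.add.r_cancel_one' smult_closed R.zero_closed)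
qed

lemma smult_r_null [simp]:
  assumes "a \<in> carrier R"
  shows "a \<odot>\<^bsub>M\<^esub> \<zero>\<^bsub>M\<^esub> = \<zero>\<^bsub>M\<^esub>"
proof -
  have "a \<odot>\<^bsub>M\<^esub> \<zero>\<^bsub>M\<^esub> \<oplus>\<^bsub>M\<^esub> a \<odot>\<^bsub>M\<^esub> \<zero>\<^bsub>M\<^esub> = a \<odot>\<^bsub>M\<^esub> \<zero>\<^bsub>M\<^esub>"
    using smult_r_distr[of a "\<zero>\<^bsub>M\<^esub>" "\<zero>\<^bsub>M\<^esub>"] assms by simp
  then show ?thesis
    using assms by (metis M.add.r_cancel_one' smult_closed M.zero_closed)
qed

lemma smult_l_minus:
  assumes "a \<in> carrier R" "x \<in> carrier M"
  shows "(\<ominus>\<^bsub>R\<^esub> a) \<odot>\<^bsub>M\<^esub> x = \<ominus>\<^bsub>M\<^esub> (a \<odot>\<^bsub>M\<^esub> x)"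
proof -
  have "(\<ominus>\<^bsub>R\<^esub> a) \<odot>\<^bsub>M\<^esub> x \<oplus>\<^bsub>M\<^esub> a \<odot>\<^bsub>M\<^esub> x = \<zero>\<^bsub>M\<^esub>"
    using assms smult_l_distr[of "\<ominus>\<^bsub>R\<^esub> a" a x] by (simp add: R.l_neg)
  then show ?thesis
    using assms by (simp add: M.minus_equality)
qed

lemma smult_r_minus:
  assumes "a \<in> carrier R" "x \<in> carrier M"
  shows "a \<odot>\<^bsub>M\<^esub> (\<ominus>\<^bsub>M\<^esub> x) = \<ominus>\<^bsub>M\<^esub> (a \<odot>\<^bsub>M\<^esub> x)"
proof -
  have "a \<odot>\<^bsub>M\<^esub> (\<ominus>\<^bsub>M\<^esub> x) \<oplus>\<^bsub>M\<^esub> a \<odot>\<^bsub>M\<^esub> x = \<zero>\<^bsub>M\<^esub>"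
    using assms smult_r_distr[of a "\<ominus>\<^bsub>M\<^esub> x" x] by (simp add: M.l_neg)
  then show ?thesis
    using assms by (simp add: M.minus_equality)
qed

lemma smult_l_diff:
  assumes "a \<in> carrier R" "b \<in> carrier R" "x \<in> carrier M"
  shows "(a \<ominus>\<^bsub>R\<^esub> b) \<odot>\<^bsub>M\<^esub> x = a \<odot>\<^bsub>M\<^esub> x \<ominus>\<^bsub>M\<^esub> b \<odot>\<^bsub>M\<^esub> x"
  using assms by (simp add: R.minus_eq M.minus_eq smult_l_distr smult_l_minus)

lemma smult_r_diff:
  assumes "a \<in> carrier R" "x \<in> carrier M" "y \<in> carrier M"
  shows "a \<odot>\<^bsub>M\<^esub> (x \<ominus>\<^bsub>M\<^esub> y) = a \<odot>\<^bsub>M\<^esub> x \<ominus>\<^bsub>M\<^esub> a \<odot>\<^bsub>M\<^esub> y"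
  using assms by (simp add: M.minus_eq smult_r_distr smult_r_minus)

lemma smult_finsum:
  assumes "finite A" "a \<in> carrier R" "f \<in> A \<rightarrow> carrier M"
  shows "a \<odot>\<^bsub>M\<^esub> (\<Oplus>\<^bsub>M\<^esub>i\<in>A. f i) = (\<Oplus>\<^bsub>M\<^esub>i\<in>A. a \<odot>\<^bsub>M\<^esub> f i)"
  using assms by (induct set: finite) (simp_all add: Pi_def smult_r_distr)

lemma finsum_smult:
  assumes "finite A" "x \<in> carrier M" "f \<in> A \<rightarrow> carrier R"
  shows "(\<Oplus>\<^bsub>R\<^esub>i\<in>A. f i) \<odot>\<^bsub>M\<^esub> x = (\<Oplus>\<^bsub>M\<^esub>i\<in>A. f i \<odot>\<^bsub>M\<^esub> x)"
  using assms by (induct set: finite) (simp_all add: Pi_def smult_l_distr)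

lemma diff_eq_zero_iff:
  assumes "x \<in> carrier M" "y \<in> carrier M"
  shows "x \<ominus>\<^bsub>M\<^esub> y = \<zero>\<^bsub>M\<^esub> \<longleftrightarrow> x = y"
proof
  assume "x \<ominus>\<^bsub>M\<^esub> y = \<zero>\<^bsub>M\<^esub>"
  then have "\<ominus>\<^bsub>M\<^esub> (\<ominus>\<^bsub>M\<^esub> y) = x"
    using assms by (intro M.minus_equality) (auto simp: M.minus_eq)
  then show "x = y" using assms by simp
qed (use assms in \<open>simp add: M.minus_eq M.r_neg\<close>)

lemma diff_add_cancel [simp]:
  assumes "x \<in> carrier M" "y \<in> carrier M"
  shows "x \<ominus>\<^bsub>M\<^esub> y \<oplus>\<^bsub>M\<^esub> y = x"
  using assms by (simp add: M.minus_eq M.a_assoc M.l_neg)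

lemma add_diff_cancel [simp]:
  assumes "x \<in> carrier M" "y \<in> carrier M"
  shows "y \<oplus>\<^bsub>M\<^esub> (x \<ominus>\<^bsub>M\<^esub> y) = x"
  using assms diff_add_cancel[of x y] by (simp add: M.a_comm)

lemma submoduleI:
  assumes "H \<subseteq> carrier M" "\<zero>\<^bsub>M\<^esub> \<in> H"
    and "\<And>a b. \<lbrakk>a \<in> H; b \<in> H\<rbrakk> \<Longrightarrow> a \<oplus>\<^bsub>M\<^esub> b \<in> H"
    and sm: "\<And>a x. \<lbrakk>a \<in> carrier R; x \<in> H\<rbrakk> \<Longrightarrow> a \<odot>\<^bsub>M\<^esub> x \<in> H"
  shows "submodule H R M"
proof -
  have "\<ominus>\<^bsub>M\<^esub> a \<in> H" if "a \<in> H" for a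
    using sm[of "\<ominus>\<^bsub>R\<^esub> \<one>\<^bsub>R\<^esub>" a] that assms(1) smult_l_minus[of "\<one>\<^bsub>R\<^esub>" a] by auto
  then show ?thesis
    using assms by (intro submodule.intro subgroup.intro submodule_axioms.intro) (simp_all add: a_inv_def)
qed

lemma submoduleD:
  assumes "submodule H R M"
  shows "H \<subseteq> carrier M" "\<zero>\<^bsub>M\<^esub> \<in> H"
    "\<And>a b. \<lbrakk>a \<in> H; b \<in> H\<rbrakk> \<Longrightarrow> a \<oplus>\<^bsub>M\<^esub> b \<in> H"
    "\<And>a. a \<in> H \<Longrightarrow> \<ominus>\<^bsub>M\<^esub> a \<in> H"
    "\<And>a b. \<lbrakk>a \<in> H; b \<in> H\<rbrakk> \<Longrightarrow> a \<ominus>\<^bsub>M\<^esub> b \<in> H"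
    "\<And>a x. \<lbrakk>a \<in> carrier R; x \<in> H\<rbrakk> \<Longrightarrow> a \<odot>\<^bsub>M\<^esub> x \<in> H"
proof -
  interpret H: submodule H R M by (rule assms)
  show 1: "H \<subseteq> carrier M" "\<zero>\<^bsub>M\<^esub> \<in> H"
    using H.subset H.one_closed by auto
  show 2: "a \<oplus>\<^bsub>M\<^esub> b \<in> H" if "a \<in> H" "b \<in> H" for a b
    using H.m_closed that by simp
  show 3: "\<ominus>\<^bsub>M\<^esub> a \<in> H" if "a \<in> H" for a
    using H.m_inv_closed that by (simp add: a_inv_def)
  show "a \<ominus>\<^bsub>M\<^esub> b \<in> H" if "a \<in> H" "b \<in> H" for a b
    using 2 3 that by (simp add: M.minus_eq)
qed (rule submodule.smult_closed[OF assms])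

lemma submodule_finsum:
  assumes "submodule H R M" "finite A" "f \<in> A \<rightarrow> H"
  shows "(\<Oplus>\<^bsub>M\<^esub>i\<in>A. f i) \<in> H"
  using assms(2,3)
proof (induct set: finite)
  case (insert i F)
  then have "(\<Oplus>\<^bsub>M\<^esub>i\<in>insert i F. f i) = f i \<oplus>\<^bsub>M\<^esub> (\<Oplus>\<^bsub>M\<^esub>i\<in>F. f i)"
    using submoduleD(1)[OF assms(1)] by (intro M.finsum_insert) auto
  then show ?case
    using insert submoduleD(3)[OF assms(1)] by auto
qed (simp add: submoduleD[OF assms(1)])

lemma submodule_is_left_module:
  assumes "submodule H R M"
  shows "left_module R (restrict_module M H)"
proof -
  note H = submoduleD[OF assms]
  have "abelian_group (restrict_module M H)"
  proof (rule abelian_groupI)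
    fix x assume "x \<in> carrier (restrict_module M H)"
    then show "\<exists>y\<in>carrier (restrict_module M H). y \<oplus>\<^bsub>restrict_module M H\<^esub> x = \<zero>\<^bsub>restrict_module M H\<^esub>"
      using H(1,4) by (intro bexI[of _ "\<ominus>\<^bsub>M\<^esub> x"]) (auto simp: M.l_neg subset_eq)
  qed (use H in \<open>auto simp: M.add.m_ac subset_eq\<close>)
  then show ?thesis
    using H by (intro left_module.intro left_module_axioms.intro R.ring_axioms)
      (auto simp: smult_l_distr smult_r_distr smult_assoc1 subset_eq)
qed

lemma submodule_of_submodule:
  assumes "submodule H R M"
  shows "submodule K R (restrict_module M H) \<longleftrightarrow> submodule K R M \<and> K \<subseteq> H"
proof -
  interpret H: left_module R "restrict_module M H" by (rule submodule_is_left_module[OF assms])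
  show ?thesis
  proof
    assume "submodule K R (restrict_module M H)"
    from H.submoduleD[OF this] show "submodule K R M \<and> K \<subseteq> H"
      using submoduleD(1)[OF assms] by (auto intro!: submoduleI)
  next
    assume "submodule K R M \<and> K \<subseteq> H"
    with submoduleD[of K] show "submodule K R (restrict_module M H)"
      by (auto intro!: H.submoduleI)
  qed
qed

lemma carrier_submodule: "submodule (carrier M) R M"
  by (rule submoduleI) auto

end

text \<open>Elements of \<open>mod_hom\<close> are extensional functions, which plain lambda terms
  and their composites are not. Linearity is split off so that maps can be composed, added and
  restricted freely; \<open>restrict_mod_hom\<close> returns to \<open>mod_hom\<close> where a
  definition asks for it.\<close>

definition lin ::
    "('a, 'x) ring_scheme \<Rightarrow> ('a, 'm, 'y) module_scheme \<Rightarrow> ('a, 'n, 'z) module_scheme \<Rightarrow> ('m \<Rightarrow> 'n) \<Rightarrow> bool"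
  where "lin R M N f \<longleftrightarrow> f \<in> carrier M \<rightarrow> carrier N \<and>
    (\<forall>x\<in>carrier M. \<forall>y\<in>carrier M. f (x \<oplus>\<^bsub>M\<^esub> y) = f x \<oplus>\<^bsub>N\<^esub> f y) \<and>
    (\<forall>a\<in>carrier R. \<forall>x\<in>carrier M. f (a \<odot>\<^bsub>M\<^esub> x) = a \<odot>\<^bsub>N\<^esub> f x)"

lemma linI:
  assumes "\<And>x. x \<in> carrier M \<Longrightarrow> f x \<in> carrier N"
    "\<And>x y. \<lbrakk>x \<in> carrier M; y \<in> carrier M\<rbrakk> \<Longrightarrow> f (x \<oplus>\<^bsub>M\<^esub> y) = f x \<oplus>\<^bsub>N\<^esub> f y"
    "\<And>a x. \<lbrakk>a \<in> carrier R; x \<in> carrier M\<rbrakk> \<Longrightarrow> f (a \<odot>\<^bsub>M\<^esub> x) = a \<odot>\<^bsub>N\<^esub> f x"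
  shows "lin R M N f"
  using assms by (auto simp: lin_def)

lemma linD:
  assumes "lin R M N f"
  shows lin_closed: "x \<in> carrier M \<Longrightarrow> f x \<in> carrier N"
    and lin_add: "\<lbrakk>x \<in> carrier M; y \<in> carrier M\<rbrakk> \<Longrightarrow> f (x \<oplus>\<^bsub>M\<^esub> y) = f x \<oplus>\<^bsub>N\<^esub> f y"
    and lin_smult: "\<lbrakk>a \<in> carrier R; x \<in> carrier M\<rbrakk> \<Longrightarrow> f (a \<odot>\<^bsub>M\<^esub> x) = a \<odot>\<^bsub>N\<^esub> f x"
  using assms by (auto simp: lin_def)

lemma mod_hom_iff: "f \<in> mod_hom R M N \<longleftrightarrow> lin R M N f \<and> f \<in> extensional (carrier M)"
  by (auto simp: mod_hom_def lin_def PiE_def)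

lemma mod_hom_lin: "f \<in> mod_hom R M N \<Longrightarrow> lin R M N f"
  by (simp add: mod_hom_iff)

lemma lin_cong:
  assumes "left_module R M" "lin R M N f" "\<And>x. x \<in> carrier M \<Longrightarrow> g x = f x"
  shows "lin R M N g"
proof -
  interpret left_module R M by fact
  show ?thesis using assms(2,3) by (auto simp: lin_def)
qed

lemma restrict_mod_hom:
  assumes "left_module R M" "lin R M N f"
  shows "restrict f (carrier M) \<in> mod_hom R M N"
  using lin_cong[OF assms] by (auto simp: mod_hom_iff)

lemma lin_comp: "\<lbrakk>lin R M N f; lin R N L g\<rbrakk> \<Longrightarrow> lin R M L (\<lambda>x. g (f x))"
  by (auto simp: lin_def Pi_iff)

lemma lin_id: "lin R M M (\<lambda>x. x)"
  by (auto simp: lin_def)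

lemma lin_restrict_domain:
  assumes "left_module R M" "submodule H R M" "lin R M N f"
  shows "lin R (restrict_module M H) N f"
  using left_module.submoduleD(1)[OF assms(1,2)] assms(3) by (auto simp: lin_def subset_eq)

lemma lin_restrict_codomain:
  assumes "\<And>x. x \<in> carrier M \<Longrightarrow> f x \<in> H" "lin R M N f"
  shows "lin R M (restrict_module N H) f"
  using assms by (auto simp: lin_def)

lemma lin_unrestrict_codomain:
  assumes "left_module R N" "submodule H R N" "lin R M (restrict_module N H) f"
  shows "lin R M N f"
  using left_module.submoduleD(1)[OF assms(1,2)] assms(3) by (auto simp: lin_def)

lemma lin_plus:
  assumes "left_module R N" "lin R M N f" "lin R M N g"
  shows "lin R M N (\<lambda>x. f x \<oplus>\<^bsub>N\<^esub> g x)"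
proof -
  interpret left_module R N by fact
  show ?thesis
    using linD[OF assms(2)] linD[OF assms(3)]
    by (intro linI) (auto simp: smult_r_distr M.add.m_ac)
qed

lemma lin_minus:
  assumes "left_module R N" "lin R M N f" "lin R M N g"
  shows "lin R M N (\<lambda>x. f x \<ominus>\<^bsub>N\<^esub> g x)"
proof -
  interpret left_module R N by fact
  show ?thesis
    using linD[OF assms(2)] linD[OF assms(3)]
    by (intro linI) (auto simp: smult_r_distr smult_r_minus M.minus_eq M.minus_add M.add.m_ac)
qed

locale module_hom = A?: left_module R A + B?: left_module R B
  for R :: "('a, 'x) ring_scheme" and A :: "('a, 'm, 'y) module_scheme"
    and B :: "('a, 'n, 'z) module_scheme" and f +
  assumes lin: "lin R A B f"
begin

lemmas closed [simp, intro] = lin_closed[OF lin]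
lemmas add = lin_add[OF lin]
lemmas smult = lin_smult[OF lin]

lemma zero [simp]: "f \<zero>\<^bsub>A\<^esub> = \<zero>\<^bsub>B\<^esub>"
  using add[of "\<zero>\<^bsub>A\<^esub>" "\<zero>\<^bsub>A\<^esub>"] by (simp add: B.M.add.r_cancel_one')

lemma uminus: "x \<in> carrier A \<Longrightarrow> f (\<ominus>\<^bsub>A\<^esub> x) = \<ominus>\<^bsub>B\<^esub> f x"
  using add[of "\<ominus>\<^bsub>A\<^esub> x" x] B.M.minus_equality by (simp add: A.M.l_neg)

lemma minus: "\<lbrakk>x \<in> carrier A; y \<in> carrier A\<rbrakk> \<Longrightarrow> f (x \<ominus>\<^bsub>A\<^esub> y) = f x \<ominus>\<^bsub>B\<^esub> f y"
  by (simp add: A.M.minus_eq B.M.minus_eq add uminus)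

lemma finsum:
  assumes "finite I" "g \<in> I \<rightarrow> carrier A"
  shows "f (\<Oplus>\<^bsub>A\<^esub>i\<in>I. g i) = (\<Oplus>\<^bsub>B\<^esub>i\<in>I. f (g i))"
  using assms by (induct set: finite) (simp_all add: Pi_def add)

lemma inj_iff: "inj_on f (carrier A) \<longleftrightarrow> (\<forall>x\<in>carrier A. f x = \<zero>\<^bsub>B\<^esub> \<longrightarrow> x = \<zero>\<^bsub>A\<^esub>)"
proof
  assume *: "\<forall>x\<in>carrier A. f x = \<zero>\<^bsub>B\<^esub> \<longrightarrow> x = \<zero>\<^bsub>A\<^esub>"
  show "inj_on f (carrier A)"
  proof (rule inj_onI)
    fix x y assume xy: "x \<in> carrier A" "y \<in> carrier A" "f x = f y"
    then have "f (x \<ominus>\<^bsub>A\<^esub> y) = \<zero>\<^bsub>B\<^esub>" by (simp add: minus B.diff_eq_zero_iff)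
    then have "x \<ominus>\<^bsub>A\<^esub> y = \<zero>\<^bsub>A\<^esub>" using * xy(1,2) by blast
    then show "x = y" using A.diff_eq_zero_iff xy(1,2) by blast
  qed
qed (auto simp: inj_on_def)

lemma image_submodule:
  assumes "submodule H R A"
  shows "submodule (f ` H) R B"
proof (rule B.submoduleI)
  note H = A.submoduleD[OF assms]
  show "f ` H \<subseteq> carrier B" using H(1) by auto
  show "\<zero>\<^bsub>B\<^esub> \<in> f ` H" using H(2) zero by (metis imageI)
  show "a \<oplus>\<^bsub>B\<^esub> b \<in> f ` H" if "a \<in> f ` H" "b \<in> f ` H" for a b
    using that H(1,3) by (auto simp: add[symmetric] subset_eq)
  show "a \<odot>\<^bsub>B\<^esub> x \<in> f ` H" if "a \<in> carrier R" "x \<in> f ` H" for a x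
    using that H(1,6) by (auto simp: smult[symmetric] subset_eq)
qed

lemma range_submodule: "submodule (f ` carrier A) R B"
  by (rule image_submodule[OF A.carrier_submodule])

lemma kernel_submodule: "submodule {x \<in> carrier A. f x = \<zero>\<^bsub>B\<^esub>} R A"
  by (rule A.submoduleI) (auto simp: add smult)

lemma inv_lin:
  assumes "bij_betw f (carrier A) (carrier B)"
  shows "lin R B A (inv_into (carrier A) f)"
proof -
  let ?g = "inv_into (carrier A) f"
  have g: "?g y \<in> carrier A" "f (?g y) = y" if "y \<in> carrier B" for y
    using assms that by (auto simp: bij_betw_def inv_into_into f_inv_into_f)
  have gf: "?g (f x) = x" if "x \<in> carrier A" for x
    using assms that by (auto simp: bij_betw_def)
  show ?thesis
  proof (rule linI)
    show "?g (x \<oplus>\<^bsub>B\<^esub> y) = ?g x \<oplus>\<^bsub>A\<^esub> ?g y" if "x \<in> carrier B" "y \<in> carrier B" for x y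
      using gf[of "?g x \<oplus>\<^bsub>A\<^esub> ?g y"] g that by (simp add: add)
    show "?g (a \<odot>\<^bsub>B\<^esub> x) = a \<odot>\<^bsub>A\<^esub> ?g x" if "a \<in> carrier R" "x \<in> carrier B" for a x
      using gf[of "a \<odot>\<^bsub>A\<^esub> ?g x"] g that by (simp add: smult)
  qed (use g in auto)
qed

end

lemma mod_isoI:
  assumes "left_module R A" "lin R A B f" "bij_betw f (carrier A) (carrier B)"
  shows "mod_iso R A B"
  unfolding mod_iso_def
  using restrict_mod_hom[OF assms(1,2)] assms(3)
  by (intro bexI[of _ "restrict f (carrier A)"]) (auto simp: bij_betw_def inj_on_def)

lemma mod_isoE:
  assumes "mod_iso R A B"
  obtains f where "lin R A B f" "bij_betw f (carrier A) (carrier B)"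
  using assms by (auto simp: mod_iso_def dest: mod_hom_lin)

lemma mod_iso_refl: "left_module R A \<Longrightarrow> mod_iso R A A"
  using mod_isoI[OF _ lin_id] by (simp add: bij_betw_def)

lemma mod_iso_sym:
  assumes "left_module R A" "left_module R B" "mod_iso R A B"
  shows "mod_iso R B A"
proof -
  obtain f where f: "lin R A B f" "bij_betw f (carrier A) (carrier B)"
    by (rule mod_isoE[OF assms(3)])
  interpret module_hom R A B f
    using assms f by (simp add: module_hom_def module_hom_axioms_def)
  show ?thesis
    by (rule mod_isoI[OF assms(2) inv_lin[OF f(2)] bij_betw_inv_into[OF f(2)]])
qed

lemma mod_iso_trans:
  assumes "left_module R A" "mod_iso R A B" "mod_iso R B C"
  shows "mod_iso R A C"
proof -
  obtain f g where fg: "lin R A B f" "bij_betw f (carrier A) (carrier B)"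
    "lin R B C g" "bij_betw g (carrier B) (carrier C)"
    using assms(2,3) by (elim mod_isoE) blast
  show ?thesis
    using mod_isoI[OF assms(1) lin_comp[OF fg(1,3)]] bij_betw_trans[OF fg(2,4)]
    by (simp add: o_def)
qed

lemma module_homI:
  "\<lbrakk>left_module R A; left_module R B; lin R A B f\<rbrakk> \<Longrightarrow> module_hom R A B f"
  by (simp add: module_hom_def module_hom_axioms_def)

section \<open>Quotients and generators\<close>

lemma (in left_module) quotient_module_facts:
  fixes N
  defines "Q \<equiv> quotient_module M N"
  assumes N: "submodule N R M"
  shows quotient_left_module: "left_module R Q"
    and quotient_lin: "lin R M Q (\<lambda>x. N +>\<^bsub>M\<^esub> x)"
    and quotient_carrier: "carrier Q = (\<lambda>x. N +>\<^bsub>M\<^esub> x) ` carrier M"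
    and quotient_zero_iff: "\<And>x. x \<in> carrier M \<Longrightarrow> N +>\<^bsub>M\<^esub> x = \<zero>\<^bsub>Q\<^esub> \<longleftrightarrow> x \<in> N"
proof -
  note ND = submoduleD[OF N]
  interpret N: abelian_subgroup N M
    using submodule.axioms(1)[OF N] M.abelian_group_axioms
    by (intro abelian_subgroupI3 additive_subgroup.intro)
  have eq: "N +>\<^bsub>M\<^esub> x = N +>\<^bsub>M\<^esub> y \<longleftrightarrow> x \<ominus>\<^bsub>M\<^esub> y \<in> N" if "x \<in> carrier M" "y \<in> carrier M" for x y
    using that N.a_rcos_module[of y x] N.a_repr_independence'[of x y] N.a_rcos_self[of x]
    by (auto simp: M.minus_eq)
  show car: "carrier Q = (\<lambda>x. N +>\<^bsub>M\<^esub> x) ` carrier M"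
    by (auto simp: Q_def quotient_module_def make_module_def A_RCOSETS_def')
  have zero: "\<zero>\<^bsub>Q\<^esub> = N +>\<^bsub>M\<^esub> \<zero>\<^bsub>M\<^esub>"
    using ND(1,2) N.a_rcos_const by (simp add: Q_def quotient_module_def make_module_def)
  have add: "(N +>\<^bsub>M\<^esub> x) \<oplus>\<^bsub>Q\<^esub> (N +>\<^bsub>M\<^esub> y) = N +>\<^bsub>M\<^esub> (x \<oplus>\<^bsub>M\<^esub> y)"
    if "x \<in> carrier M" "y \<in> carrier M" for x y
    using that N.a_rcos_sum by (simp add: Q_def quotient_module_def make_module_def)
  have smult: "a \<odot>\<^bsub>Q\<^esub> (N +>\<^bsub>M\<^esub> x) = N +>\<^bsub>M\<^esub> (a \<odot>\<^bsub>M\<^esub> x)"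
    if a: "a \<in> carrier R" and x: "x \<in> carrier M" for a x
  proof -
    \<comment> \<open>The action on cosets is defined as a union over all representatives. It
      collapses to one coset because \<open>a (z - x)\<close> lies in \<open>N\<close> for any two
      representatives \<open>z\<close> and \<open>x\<close>.\<close>
    have "N +>\<^bsub>M\<^esub> (a \<odot>\<^bsub>M\<^esub> z) = N +>\<^bsub>M\<^esub> (a \<odot>\<^bsub>M\<^esub> x)" if z: "z \<in> N +>\<^bsub>M\<^esub> x" for z
    proof -
      have zc: "z \<in> carrier M" using N.a_elemrcos_carrier x z by blast
      have "z \<ominus>\<^bsub>M\<^esub> x \<in> N" using N.a_rcos_module_imp[OF x z] by (simp add: M.minus_eq)
      then have "a \<odot>\<^bsub>M\<^esub> (z \<ominus>\<^bsub>M\<^esub> x) \<in> N" using ND(6) a by blast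
      then show ?thesis using a x zc by (simp add: eq smult_r_diff)
    qed
    then have "(\<Union>z\<in>N +>\<^bsub>M\<^esub> x. N +>\<^bsub>M\<^esub> (a \<odot>\<^bsub>M\<^esub> z)) = N +>\<^bsub>M\<^esub> (a \<odot>\<^bsub>M\<^esub> x)"
      using N.a_rcos_self[OF x] by blast
    then show ?thesis by (simp add: Q_def quotient_module_def make_module_def)
  qed
  have "abelian_group Q"
  proof (rule abelian_groupI)
    fix X assume "X \<in> carrier Q"
    then obtain x where "x \<in> carrier M" "X = N +>\<^bsub>M\<^esub> x" by (auto simp: car)
    then show "\<exists>Y\<in>carrier Q. Y \<oplus>\<^bsub>Q\<^esub> X = \<zero>\<^bsub>Q\<^esub>"
      by (intro bexI[of _ "N +>\<^bsub>M\<^esub> (\<ominus>\<^bsub>M\<^esub> x)"]) (auto simp: car zero add M.l_neg)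
  qed (auto simp: car add zero M.add.m_ac)
  then show "left_module R Q"
    by (intro left_module.intro left_module_axioms.intro R.ring_axioms)
      (auto simp: car add smult smult_l_distr smult_r_distr smult_assoc1)
  show "lin R M Q (\<lambda>x. N +>\<^bsub>M\<^esub> x)"
    by (rule linI) (auto simp: car add smult)
  show "N +>\<^bsub>M\<^esub> x = \<zero>\<^bsub>Q\<^esub> \<longleftrightarrow> x \<in> N" if "x \<in> carrier M" for x
    using eq[OF that M.zero_closed] diff_add_cancel[OF that M.zero_closed] that by (simp add: zero)
qed

lemma regular_simps [simp]:
  "carrier (regular R) = carrier R" "\<zero>\<^bsub>regular R\<^esub> = \<zero>\<^bsub>R\<^esub>" "add (regular R) = add R"
  "smult (regular R) = mult R"
  by (simp_all add: regular_def make_module_def)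

lemma (in ring) regular_left_module: "left_module R (regular R)"
proof -
  have "abelian_group (regular R)"
  proof (rule abelian_groupI)
    fix x assume "x \<in> carrier (regular R)"
    then show "\<exists>y\<in>carrier (regular R). y \<oplus>\<^bsub>regular R\<^esub> x = \<zero>\<^bsub>regular R\<^esub>"
      by (intro bexI[of _ "\<ominus> x"]) (auto simp: l_neg)
  qed (auto simp: add.m_ac)
  then show ?thesis
    by (intro left_module.intro left_module_axioms.intro ring_axioms)
      (auto simp: l_distr r_distr m_assoc)
qed

lemma finsum_regular: "(\<Oplus>\<^bsub>regular R\<^esub>i\<in>A. f i) = (\<Oplus>\<^bsub>R\<^esub>i\<in>A. f i)"
  by (simp add: finsum_def finprod_def)

text \<open>An indexed family rather than a set: equal or zero generators stay apart, and in
  \<open>presented\<close> one index carries a generator, an idempotent and a coefficient of the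
  relation at the same time.\<close>

definition generates ::
    "('a, 'x) ring_scheme \<Rightarrow> ('a, 'm, 'y) module_scheme \<Rightarrow> 'i set \<Rightarrow> ('i \<Rightarrow> 'm) \<Rightarrow> bool" where
  "generates R A I u \<longleftrightarrow> finite I \<and> u \<in> I \<rightarrow> carrier A \<and>
    (\<forall>y\<in>carrier A. \<exists>c\<in>I \<rightarrow> carrier R. y = (\<Oplus>\<^bsub>A\<^esub>k\<in>I. c k \<odot>\<^bsub>A\<^esub> u k))"

lemma generatesD:
  assumes "generates R A I u"
  shows "finite I" "u \<in> I \<rightarrow> carrier A"
  using assms by (auto simp: generates_def)

lemma generatesE:
  assumes "generates R A I u" "y \<in> carrier A"
  obtains c where "c \<in> I \<rightarrow> carrier R" "y = (\<Oplus>\<^bsub>A\<^esub>k\<in>I. c k \<odot>\<^bsub>A\<^esub> u k)"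
  using assms by (auto simp: generates_def)

lemma fg_module_iff_generates:
  "fg_module R M \<longleftrightarrow> left_module R M \<and> (\<exists>S. generates R M S (\<lambda>s. s))"
  unfolding fg_module_def generates_def by (auto simp: subset_eq)

context left_module
begin

lemma lcomb_closed:
  assumes "finite I" "c \<in> I \<rightarrow> carrier R" "u \<in> I \<rightarrow> carrier M"
  shows "(\<Oplus>\<^bsub>M\<^esub>k\<in>I. c k \<odot>\<^bsub>M\<^esub> u k) \<in> carrier M"
  using assms by (intro M.finsum_closed) auto

lemma lcomb_add:
  assumes "finite I" "c \<in> I \<rightarrow> carrier R" "d \<in> I \<rightarrow> carrier R" "u \<in> I \<rightarrow> carrier M"
  shows "(\<Oplus>\<^bsub>M\<^esub>k\<in>I. (c k \<oplus>\<^bsub>R\<^esub> d k) \<odot>\<^bsub>M\<^esub> u k) =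
    (\<Oplus>\<^bsub>M\<^esub>k\<in>I. c k \<odot>\<^bsub>M\<^esub> u k) \<oplus>\<^bsub>M\<^esub> (\<Oplus>\<^bsub>M\<^esub>k\<in>I. d k \<odot>\<^bsub>M\<^esub> u k)"
proof -
  have "(\<Oplus>\<^bsub>M\<^esub>k\<in>I. (c k \<oplus>\<^bsub>R\<^esub> d k) \<odot>\<^bsub>M\<^esub> u k) = (\<Oplus>\<^bsub>M\<^esub>k\<in>I. c k \<odot>\<^bsub>M\<^esub> u k \<oplus>\<^bsub>M\<^esub> d k \<odot>\<^bsub>M\<^esub> u k)"
    using assms by (intro M.finsum_cong') (auto simp: Pi_iff smult_l_distr)
  also have "\<dots> = (\<Oplus>\<^bsub>M\<^esub>k\<in>I. c k \<odot>\<^bsub>M\<^esub> u k) \<oplus>\<^bsub>M\<^esub> (\<Oplus>\<^bsub>M\<^esub>k\<in>I. d k \<odot>\<^bsub>M\<^esub> u k)"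
    using assms by (intro M.finsum_addf) (auto simp: Pi_iff)
  finally show ?thesis .
qed

lemma lcomb_smult:
  assumes "finite I" "c \<in> I \<rightarrow> carrier R" "a \<in> carrier R" "u \<in> I \<rightarrow> carrier M"
  shows "(\<Oplus>\<^bsub>M\<^esub>k\<in>I. (a \<otimes>\<^bsub>R\<^esub> c k) \<odot>\<^bsub>M\<^esub> u k) = a \<odot>\<^bsub>M\<^esub> (\<Oplus>\<^bsub>M\<^esub>k\<in>I. c k \<odot>\<^bsub>M\<^esub> u k)"
proof -
  have "(\<Oplus>\<^bsub>M\<^esub>k\<in>I. (a \<otimes>\<^bsub>R\<^esub> c k) \<odot>\<^bsub>M\<^esub> u k) = (\<Oplus>\<^bsub>M\<^esub>k\<in>I. a \<odot>\<^bsub>M\<^esub> (c k \<odot>\<^bsub>M\<^esub> u k))"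
    using assms by (intro M.finsum_cong') (auto simp: Pi_iff smult_assoc1)
  also have "\<dots> = a \<odot>\<^bsub>M\<^esub> (\<Oplus>\<^bsub>M\<^esub>k\<in>I. c k \<odot>\<^bsub>M\<^esub> u k)"
    using assms by (intro smult_finsum[symmetric]) (auto simp: Pi_iff)
  finally show ?thesis .
qed

lemma lcomb_zero:
  assumes "u \<in> I \<rightarrow> carrier M"
  shows "(\<Oplus>\<^bsub>M\<^esub>k\<in>I. \<zero>\<^bsub>R\<^esub> \<odot>\<^bsub>M\<^esub> u k) = \<zero>\<^bsub>M\<^esub>"
  using assms by (intro M.add.finprod_one_eqI) (auto simp: Pi_iff)

lemma lcomb_diff:
  assumes "finite I" "c \<in> I \<rightarrow> carrier R" "d \<in> I \<rightarrow> carrier R" "u \<in> I \<rightarrow> carrier M"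
  shows "(\<Oplus>\<^bsub>M\<^esub>k\<in>I. (c k \<ominus>\<^bsub>R\<^esub> d k) \<odot>\<^bsub>M\<^esub> u k) =
    (\<Oplus>\<^bsub>M\<^esub>k\<in>I. c k \<odot>\<^bsub>M\<^esub> u k) \<ominus>\<^bsub>M\<^esub> (\<Oplus>\<^bsub>M\<^esub>k\<in>I. d k \<odot>\<^bsub>M\<^esub> u k)"
proof -
  have "(\<Oplus>\<^bsub>M\<^esub>k\<in>I. (c k \<ominus>\<^bsub>R\<^esub> d k) \<odot>\<^bsub>M\<^esub> u k) \<oplus>\<^bsub>M\<^esub> (\<Oplus>\<^bsub>M\<^esub>k\<in>I. d k \<odot>\<^bsub>M\<^esub> u k) =
      (\<Oplus>\<^bsub>M\<^esub>k\<in>I. (c k \<ominus>\<^bsub>R\<^esub> d k \<oplus>\<^bsub>R\<^esub> d k) \<odot>\<^bsub>M\<^esub> u k)"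
    using assms by (intro lcomb_add[symmetric]) auto
  also have "\<dots> = (\<Oplus>\<^bsub>M\<^esub>k\<in>I. c k \<odot>\<^bsub>M\<^esub> u k)"
    using assms by (intro M.finsum_cong') (auto simp: Pi_iff R.minus_eq R.a_assoc R.l_neg)
  finally show ?thesis
    using assms lcomb_closed[of I "\<lambda>k. c k \<ominus>\<^bsub>R\<^esub> d k" u] lcomb_closed[of I c u] lcomb_closed[of I d u]
    by (smt (verit, best) M.add.inv_solve_right M.minus_eq PiE Pi_I R.minus_closed)
qed

lemma lcomb_delta:
  assumes "finite I" "i \<in> I" "u \<in> I \<rightarrow> carrier M" "a \<in> carrier R"
  shows "(\<Oplus>\<^bsub>M\<^esub>k\<in>I. (if i = k then a else \<zero>\<^bsub>R\<^esub>) \<odot>\<^bsub>M\<^esub> u k) = a \<odot>\<^bsub>M\<^esub> u i"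
proof -
  have "(\<Oplus>\<^bsub>M\<^esub>k\<in>I. (if i = k then a else \<zero>\<^bsub>R\<^esub>) \<odot>\<^bsub>M\<^esub> u k) =
      (\<Oplus>\<^bsub>M\<^esub>k\<in>I. if i = k then a \<odot>\<^bsub>M\<^esub> u k else \<zero>\<^bsub>M\<^esub>)"
    using assms by (intro M.finsum_cong') (auto simp: Pi_iff)
  also have "\<dots> = a \<odot>\<^bsub>M\<^esub> u i"
    using assms M.finsum_singleton[of i I "\<lambda>k. a \<odot>\<^bsub>M\<^esub> u k"] by (auto simp: Pi_iff)
  finally show ?thesis .
qed

lemma finsum_swap:
  assumes "finite I" "finite J" "\<And>i j. \<lbrakk>i \<in> I; j \<in> J\<rbrakk> \<Longrightarrow> f i j \<in> carrier M"
  shows "(\<Oplus>\<^bsub>M\<^esub>i\<in>I. \<Oplus>\<^bsub>M\<^esub>j\<in>J. f i j) = (\<Oplus>\<^bsub>M\<^esub>j\<in>J. \<Oplus>\<^bsub>M\<^esub>i\<in>I. f i j)"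
  using assms(1,3)
proof (induct set: finite)
  case (insert i I)
  have c: "(\<Oplus>\<^bsub>M\<^esub>i\<in>I. f i j) \<in> carrier M" if "j \<in> J" for j
    using insert that by (intro M.finsum_closed) auto
  have "(\<Oplus>\<^bsub>M\<^esub>i\<in>insert i I. \<Oplus>\<^bsub>M\<^esub>j\<in>J. f i j) = (\<Oplus>\<^bsub>M\<^esub>j\<in>J. f i j) \<oplus>\<^bsub>M\<^esub> (\<Oplus>\<^bsub>M\<^esub>j\<in>J. \<Oplus>\<^bsub>M\<^esub>i\<in>I. f i j)"
    using insert by (subst M.finsum_insert) (auto intro!: M.finsum_closed)
  also have "\<dots> = (\<Oplus>\<^bsub>M\<^esub>j\<in>J. f i j \<oplus>\<^bsub>M\<^esub> (\<Oplus>\<^bsub>M\<^esub>i\<in>I. f i j))"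
    using insert c by (intro M.finsum_addf[symmetric]) auto
  also have "\<dots> = (\<Oplus>\<^bsub>M\<^esub>j\<in>J. \<Oplus>\<^bsub>M\<^esub>i\<in>insert i I. f i j)"
    using insert c assms(2) by (intro M.finsum_cong') (auto intro!: M.finsum_closed)
  finally show ?case .
qed simp

lemma span_submodule:
  assumes "finite I" "u \<in> I \<rightarrow> carrier M"
  shows "submodule {\<Oplus>\<^bsub>M\<^esub>k\<in>I. c k \<odot>\<^bsub>M\<^esub> u k | c. c \<in> I \<rightarrow> carrier R} R M" (is "submodule ?S R M")
proof (rule submoduleI)
  show "?S \<subseteq> carrier M" using lcomb_closed[OF assms(1) _ assms(2)] by auto
  show "\<zero>\<^bsub>M\<^esub> \<in> ?S"
    using lcomb_zero[OF assms(2)] by (intro CollectI exI[of _ "\<lambda>_. \<zero>\<^bsub>R\<^esub>"]) auto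
  show "a \<oplus>\<^bsub>M\<^esub> b \<in> ?S" if "a \<in> ?S" "b \<in> ?S" for a b
  proof -
    from that obtain c d where "c \<in> I \<rightarrow> carrier R" "d \<in> I \<rightarrow> carrier R"
      "a = (\<Oplus>\<^bsub>M\<^esub>k\<in>I. c k \<odot>\<^bsub>M\<^esub> u k)" "b = (\<Oplus>\<^bsub>M\<^esub>k\<in>I. d k \<odot>\<^bsub>M\<^esub> u k)" by blast
    then show ?thesis
      using lcomb_add[OF assms(1) _ _ assms(2)] by (intro CollectI exI[of _ "\<lambda>k. c k \<oplus>\<^bsub>R\<^esub> d k"]) auto
  qed
  show "a \<odot>\<^bsub>M\<^esub> b \<in> ?S" if a: "a \<in> carrier R" and "b \<in> ?S" for a b
  proof -
    from that obtain c where "c \<in> I \<rightarrow> carrier R" "b = (\<Oplus>\<^bsub>M\<^esub>k\<in>I. c k \<odot>\<^bsub>M\<^esub> u k)" by blast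
    then show ?thesis
      using a lcomb_smult[OF assms(1) _ a assms(2)] by (intro CollectI exI[of _ "\<lambda>k. a \<otimes>\<^bsub>R\<^esub> c k"]) auto
  qed
qed

lemma span_base:
  assumes "finite I" "u \<in> I \<rightarrow> carrier M" "i \<in> I"
  shows "u i \<in> {\<Oplus>\<^bsub>M\<^esub>k\<in>I. c k \<odot>\<^bsub>M\<^esub> u k | c. c \<in> I \<rightarrow> carrier R}"
proof -
  have "u i = (\<Oplus>\<^bsub>M\<^esub>k\<in>I. (if i = k then \<one>\<^bsub>R\<^esub> else \<zero>\<^bsub>R\<^esub>) \<odot>\<^bsub>M\<^esub> u k)"
    using assms by (subst lcomb_delta) (auto simp: Pi_iff)
  then show ?thesis by (intro CollectI exI[of _ "\<lambda>k. if i = k then \<one>\<^bsub>R\<^esub> else \<zero>\<^bsub>R\<^esub>"]) auto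
qed

text \<open>Serves as the induction principle for generators: a property that defines a submodule
  holds everywhere once it holds at every \<open>u i\<close>.\<close>

lemma generated_subset:
  assumes "generates R M I u" "submodule H R M" "\<And>i. i \<in> I \<Longrightarrow> u i \<in> H"
  shows "H = carrier M"
proof
  show "carrier M \<subseteq> H"
  proof
    fix y assume "y \<in> carrier M"
    then obtain c where c: "c \<in> I \<rightarrow> carrier R" "y = (\<Oplus>\<^bsub>M\<^esub>k\<in>I. c k \<odot>\<^bsub>M\<^esub> u k)"
      by (rule generatesE[OF assms(1)])
    show "y \<in> H"
      unfolding c(2) using c(1) assms(3) generatesD(1)[OF assms(1)] submoduleD(6)[OF assms(2)]
      by (intro submodule_finsum[OF assms(2)]) auto
  qed
qed (rule submoduleD(1)[OF assms(2)])

text \<open>The span of the family is itself a submodule containing all \<open>u i\<close>, so the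
  third hypothesis can be applied to it.\<close>

lemma generatesI:
  assumes "finite I" "u \<in> I \<rightarrow> carrier M"
    "\<And>H. \<lbrakk>submodule H R M; \<And>i. i \<in> I \<Longrightarrow> u i \<in> H\<rbrakk> \<Longrightarrow> carrier M \<subseteq> H"
  shows "generates R M I u"
  using assms(3)[OF span_submodule[OF assms(1,2)] span_base[OF assms(1,2)]] assms(1,2)
  by (auto simp: generates_def)

lemma generates_fg_module:
  assumes "generates R M I u"
  shows "fg_module R M"
  unfolding fg_module_iff_generates
proof (intro conjI exI)
  show "generates R M (u ` I) (\<lambda>s. s)"
    using generatesD[OF assms] generated_subset[OF assms] by (intro generatesI) (auto simp: subset_eq)
qed (rule left_module_axioms)

end

context module_hom
begin

text \<open>A submodule of \<open>B\<close> containing the images has a preimage containing all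
  \<open>u i\<close>, and that preimage is all of \<open>A\<close>.\<close>

lemma generates_image:
  assumes "generates R A I u" "f ` carrier A = carrier B"
  shows "generates R B I (\<lambda>i. f (u i))"
proof (rule B.generatesI)
  show "finite I" "(\<lambda>i. f (u i)) \<in> I \<rightarrow> carrier B"
    using generatesD[OF assms(1)] closed by blast+
  fix H assume H: "submodule H R B" "\<And>i. i \<in> I \<Longrightarrow> f (u i) \<in> H"
  have "submodule {x \<in> carrier A. f x \<in> H} R A"
    using B.submoduleD[OF H(1)] by (intro A.submoduleI) (auto simp: add smult)
  then have "{x \<in> carrier A. f x \<in> H} = carrier A"
    using H(2) generatesD[OF assms(1)] by (intro A.generated_subset[OF assms(1)]) auto
  then show "carrier B \<subseteq> H" by (auto simp: assms(2)[symmetric])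
qed

lemma fg_image:
  assumes "fg_module R A" "f ` carrier A = carrier B"
  shows "fg_module R B"
proof -
  obtain S where "generates R A S (\<lambda>s. s)" using assms(1) by (auto simp: fg_module_iff_generates)
  from generates_image[OF this assms(2)] show ?thesis by (rule B.generates_fg_module)
qed

end

text \<open>The equalizer of two linear maps is a submodule, so \<open>generated_subset\<close>
  applies to it.\<close>

lemma lin_eq_on_generators:
  assumes "left_module R A" "left_module R B" "lin R A B f" "lin R A B g"
    and "generates R A I u" "\<And>i. i \<in> I \<Longrightarrow> f (u i) = g (u i)" "y \<in> carrier A"
  shows "f y = g y"
proof -
  interpret f: module_hom R A B f by (rule module_homI[OF assms(1-3)])
  interpret g: module_hom R A B g by (rule module_homI[OF assms(1,2,4)])
  have "submodule {x \<in> carrier A. f x = g x} R A"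
    by (rule f.A.submoduleI) (auto simp: f.add g.add f.smult g.smult)
  then have "{x \<in> carrier A. f x = g x} = carrier A"
    using assms(6) generatesD[OF assms(5)] by (intro f.A.generated_subset[OF assms(5)]) auto
  then show ?thesis using assms(7) by blast
qed

text \<open>The universal property of a generated module. An element has many coefficient families,
  and \<open>rel\<close> is exactly what makes the value independent of the family. The third
  conclusion is kept because later proofs evaluate the map on whole combinations.\<close>

lemma hom_from_generators:
  assumes A: "left_module R A" and X: "left_module R X"
    and gen: "generates R A I u" and y: "y \<in> I \<rightarrow> carrier X"
    and rel: "\<And>c. \<lbrakk>c \<in> I \<rightarrow> carrier R; (\<Oplus>\<^bsub>A\<^esub>k\<in>I. c k \<odot>\<^bsub>A\<^esub> u k) = \<zero>\<^bsub>A\<^esub>\<rbrakk> \<Longrightarrow>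
      (\<Oplus>\<^bsub>X\<^esub>k\<in>I. c k \<odot>\<^bsub>X\<^esub> y k) = \<zero>\<^bsub>X\<^esub>"
  obtains f where "lin R A X f" "\<And>k. k \<in> I \<Longrightarrow> f (u k) = y k"
    "\<And>c. c \<in> I \<rightarrow> carrier R \<Longrightarrow> f (\<Oplus>\<^bsub>A\<^esub>k\<in>I. c k \<odot>\<^bsub>A\<^esub> u k) = (\<Oplus>\<^bsub>X\<^esub>k\<in>I. c k \<odot>\<^bsub>X\<^esub> y k)"
proof -
  interpret A: left_module R A by (rule A)
  interpret X: left_module R X by (rule X)
  have I: "finite I" and u: "u \<in> I \<rightarrow> carrier A" using generatesD[OF gen] by auto
  \<comment> \<open>Some coefficient family of \<open>a\<close> is picked. Two families of the same
    element differ by a relation, which \<open>rel\<close> transports to \<open>X\<close>.\<close>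
  define f where "f a = (\<Oplus>\<^bsub>X\<^esub>k\<in>I. (SOME c. c \<in> I \<rightarrow> carrier R \<and> a = (\<Oplus>\<^bsub>A\<^esub>k\<in>I. c k \<odot>\<^bsub>A\<^esub> u k)) k \<odot>\<^bsub>X\<^esub> y k)" for a
  have f: "f (\<Oplus>\<^bsub>A\<^esub>k\<in>I. c k \<odot>\<^bsub>A\<^esub> u k) = (\<Oplus>\<^bsub>X\<^esub>k\<in>I. c k \<odot>\<^bsub>X\<^esub> y k)" if c: "c \<in> I \<rightarrow> carrier R" for c
  proof -
    let ?a = "\<Oplus>\<^bsub>A\<^esub>k\<in>I. c k \<odot>\<^bsub>A\<^esub> u k"
    define d where "d = (SOME c. c \<in> I \<rightarrow> carrier R \<and> ?a = (\<Oplus>\<^bsub>A\<^esub>k\<in>I. c k \<odot>\<^bsub>A\<^esub> u k))"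
    have d: "d \<in> I \<rightarrow> carrier R \<and> ?a = (\<Oplus>\<^bsub>A\<^esub>k\<in>I. d k \<odot>\<^bsub>A\<^esub> u k)"
      unfolding d_def by (rule someI[of _ c]) (use c in auto)
    have "(\<Oplus>\<^bsub>A\<^esub>k\<in>I. (d k \<ominus>\<^bsub>R\<^esub> c k) \<odot>\<^bsub>A\<^esub> u k) = \<zero>\<^bsub>A\<^esub>"
      using d c A.lcomb_diff[OF I _ c u, of d] A.diff_eq_zero_iff[of ?a ?a] A.lcomb_closed[OF I c u] by simp
    then have "(\<Oplus>\<^bsub>X\<^esub>k\<in>I. (d k \<ominus>\<^bsub>R\<^esub> c k) \<odot>\<^bsub>X\<^esub> y k) = \<zero>\<^bsub>X\<^esub>"
      using d c by (intro rel) auto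
    then have "(\<Oplus>\<^bsub>X\<^esub>k\<in>I. d k \<odot>\<^bsub>X\<^esub> y k) = (\<Oplus>\<^bsub>X\<^esub>k\<in>I. c k \<odot>\<^bsub>X\<^esub> y k)"
      using d c X.lcomb_diff[OF I _ c y, of d] X.lcomb_closed[OF I _ y] by (simp add: X.diff_eq_zero_iff)
    then show ?thesis by (simp add: f_def d_def)
  qed
  have lin: "lin R A X f"
  proof (rule linI)
    fix a assume "a \<in> carrier A"
    then show "f a \<in> carrier X"
      by (rule generatesE[OF gen]) (simp add: f X.lcomb_closed[OF I _ y])
  next
    fix a b assume a: "a \<in> carrier A" and b: "b \<in> carrier A"
    obtain c where c: "c \<in> I \<rightarrow> carrier R" "a = (\<Oplus>\<^bsub>A\<^esub>k\<in>I. c k \<odot>\<^bsub>A\<^esub> u k)"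
      by (rule generatesE[OF gen a])
    obtain d where d: "d \<in> I \<rightarrow> carrier R" "b = (\<Oplus>\<^bsub>A\<^esub>k\<in>I. d k \<odot>\<^bsub>A\<^esub> u k)"
      by (rule generatesE[OF gen b])
    show "f (a \<oplus>\<^bsub>A\<^esub> b) = f a \<oplus>\<^bsub>X\<^esub> f b"
      using c(1) d(1) f[of "\<lambda>k. c k \<oplus>\<^bsub>R\<^esub> d k"]
      by (simp add: c(2) d(2) f A.lcomb_add[OF I _ _ u] X.lcomb_add[OF I _ _ y] Pi_iff)
  next
    fix a b assume a: "a \<in> carrier R" and b: "b \<in> carrier A"
    obtain d where d: "d \<in> I \<rightarrow> carrier R" "b = (\<Oplus>\<^bsub>A\<^esub>k\<in>I. d k \<odot>\<^bsub>A\<^esub> u k)"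
      by (rule generatesE[OF gen b])
    show "f (a \<odot>\<^bsub>A\<^esub> b) = a \<odot>\<^bsub>X\<^esub> f b"
      using a d(1) f[of "\<lambda>k. a \<otimes>\<^bsub>R\<^esub> d k"]
      by (simp add: d(2) f A.lcomb_smult[OF I _ a u] X.lcomb_smult[OF I _ a y] Pi_iff)
  qed
  moreover have "f (u k) = y k" if k: "k \<in> I" for k
    using f[of "\<lambda>j. if k = j then \<one>\<^bsub>R\<^esub> else \<zero>\<^bsub>R\<^esub>"] k u y
    by (simp add: A.lcomb_delta[OF I k u] X.lcomb_delta[OF I k y] Pi_iff)
  ultimately show thesis using that f by blast
qed

section \<open>Modules given by generators and one relation\<close>

text \<open>
  \<open>A\<close> is the cokernel of \<open>R \<rightarrow> \<Oplus>\<^sub>k R\<epsilon>\<^sub>k\<close>, \<open>a \<mapsto> (a x\<^sub>k)\<^sub>k\<close>, and \<open>u\<^sub>k\<close> is the image of \<open>\<epsilon>\<^sub>k\<close>. For \<open>x = 0\<close>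
  this is the projective module \<open>\<Oplus>\<^sub>k R\<epsilon>\<^sub>k\<close>.
\<close>

definition presented ::
    "('a, 'x) ring_scheme \<Rightarrow> ('a, 'm, 'y) module_scheme \<Rightarrow> 'i set \<Rightarrow> ('i \<Rightarrow> 'a) \<Rightarrow> ('i \<Rightarrow> 'a) \<Rightarrow> ('i \<Rightarrow> 'm) \<Rightarrow> bool"
  where "presented R A I \<epsilon> x u \<longleftrightarrow> left_module R A \<and> generates R A I u \<and>
    \<epsilon> \<in> I \<rightarrow> carrier R \<and> x \<in> I \<rightarrow> carrier R \<and>
    (\<forall>k\<in>I. \<epsilon> k \<otimes>\<^bsub>R\<^esub> \<epsilon> k = \<epsilon> k \<and> x k \<otimes>\<^bsub>R\<^esub> \<epsilon> k = x k) \<and>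
    (\<forall>c\<in>I \<rightarrow> carrier R. (\<Oplus>\<^bsub>A\<^esub>k\<in>I. c k \<odot>\<^bsub>A\<^esub> u k) = \<zero>\<^bsub>A\<^esub> \<longleftrightarrow>
      (\<exists>a\<in>carrier R. \<forall>k\<in>I. c k \<otimes>\<^bsub>R\<^esub> \<epsilon> k = a \<otimes>\<^bsub>R\<^esub> x k))"

lemma presentedD:
  assumes "presented R A I \<epsilon> x u"
  shows "left_module R A" "generates R A I u" "finite I" "u \<in> I \<rightarrow> carrier A"
    "\<epsilon> \<in> I \<rightarrow> carrier R" "x \<in> I \<rightarrow> carrier R"
    "\<And>k. k \<in> I \<Longrightarrow> \<epsilon> k \<otimes>\<^bsub>R\<^esub> \<epsilon> k = \<epsilon> k" "\<And>k. k \<in> I \<Longrightarrow> x k \<otimes>\<^bsub>R\<^esub> \<epsilon> k = x k"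
    "\<And>c. c \<in> I \<rightarrow> carrier R \<Longrightarrow> (\<Oplus>\<^bsub>A\<^esub>k\<in>I. c k \<odot>\<^bsub>A\<^esub> u k) = \<zero>\<^bsub>A\<^esub> \<longleftrightarrow>
      (\<exists>a\<in>carrier R. \<forall>k\<in>I. c k \<otimes>\<^bsub>R\<^esub> \<epsilon> k = a \<otimes>\<^bsub>R\<^esub> x k)"
  using assms generatesD[of R A I u] by (auto simp: presented_def)

lemma presented_iso:
  assumes A: "presented R A I \<epsilon> x u" and B: "left_module R B"
    and f: "lin R A B f" "bij_betw f (carrier A) (carrier B)"
  shows "presented R B I \<epsilon> x (\<lambda>k. f (u k))"
proof -
  note D = presentedD[OF A]
  interpret module_hom R A B f by (rule module_homI[OF D(1) B f(1)])
  have inj: "f y = \<zero>\<^bsub>B\<^esub> \<longleftrightarrow> y = \<zero>\<^bsub>A\<^esub>" if "y \<in> carrier A" for y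
    using inj_iff f(2) that by (auto simp: bij_betw_def)
  have "f (\<Oplus>\<^bsub>A\<^esub>k\<in>I. c k \<odot>\<^bsub>A\<^esub> u k) = (\<Oplus>\<^bsub>B\<^esub>k\<in>I. c k \<odot>\<^bsub>B\<^esub> f (u k))"
    if "c \<in> I \<rightarrow> carrier R" for c
  proof -
    have "f (\<Oplus>\<^bsub>A\<^esub>k\<in>I. c k \<odot>\<^bsub>A\<^esub> u k) = (\<Oplus>\<^bsub>B\<^esub>k\<in>I. f (c k \<odot>\<^bsub>A\<^esub> u k))"
      using D(3,4) that by (intro finsum) (auto simp: Pi_iff)
    also have "\<dots> = (\<Oplus>\<^bsub>B\<^esub>k\<in>I. c k \<odot>\<^bsub>B\<^esub> f (u k))"
      using D(3,4) that by (intro B.M.finsum_cong') (auto simp: Pi_iff smult)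
    finally show ?thesis .
  qed
  then have "(\<Oplus>\<^bsub>B\<^esub>k\<in>I. c k \<odot>\<^bsub>B\<^esub> f (u k)) = \<zero>\<^bsub>B\<^esub> \<longleftrightarrow>
      (\<exists>a\<in>carrier R. \<forall>k\<in>I. c k \<otimes>\<^bsub>R\<^esub> \<epsilon> k = a \<otimes>\<^bsub>R\<^esub> x k)" if "c \<in> I \<rightarrow> carrier R" for c
    using D(9)[OF that] inj[OF A.lcomb_closed[OF D(3) that D(4)]] that by simp
  moreover have "generates R B I (\<lambda>k. f (u k))"
    using f(2) by (intro generates_image[OF D(2)]) (auto simp: bij_betw_def)
  ultimately show ?thesis
    using D B by (simp add: presented_def)
qed

text \<open>The free module of functions on \<open>I\<close> is divided by all \<open>c\<close> for
  which the products \<open>c k \<epsilon> k\<close> are a common left multiple of the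
  \<open>x k\<close>. The case \<open>a = 0\<close> puts every \<open>c\<close> with all
  \<open>c k \<epsilon> k = 0\<close> into the submodule and so cuts each free summand down to
  \<open>R \<epsilon> k\<close>; the other multipliers impose the relation.\<close>

lemma (in ring) exists_presented:
  fixes I :: "'i set"
  assumes I: "finite I" and \<epsilon>: "\<epsilon> \<in> I \<rightarrow> carrier R" and x: "x \<in> I \<rightarrow> carrier R"
    and idem: "\<And>k. k \<in> I \<Longrightarrow> \<epsilon> k \<otimes> \<epsilon> k = \<epsilon> k" and x\<epsilon>: "\<And>k. k \<in> I \<Longrightarrow> x k \<otimes> \<epsilon> k = x k"
  obtains A :: "'a fgm" and u where "presented R A I \<epsilon> x u"
proof -
  define F :: "('a, 'i \<Rightarrow> 'a) module" where
    "F = make_module (I \<rightarrow>\<^sub>E carrier R) (\<lambda>k\<in>I. \<zero>) (\<lambda>c d. \<lambda>k\<in>I. c k \<oplus> d k) (\<lambda>a c. \<lambda>k\<in>I. a \<otimes> c k)"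
  have F: "carrier F = I \<rightarrow>\<^sub>E carrier R" "\<zero>\<^bsub>F\<^esub> = (\<lambda>k\<in>I. \<zero>)"
    "\<And>c d. c \<oplus>\<^bsub>F\<^esub> d = (\<lambda>k\<in>I. c k \<oplus> d k)" "\<And>a c. a \<odot>\<^bsub>F\<^esub> c = (\<lambda>k\<in>I. a \<otimes> c k)"
    by (simp_all add: F_def make_module_def)
  have eq: "restrict f I = restrict g I \<longleftrightarrow> (\<forall>k\<in>I. f k = g k)" for f g :: "'i \<Rightarrow> 'a"
    by (metis restrict_apply' restrict_ext)
  have eq': "restrict f I = c \<longleftrightarrow> (\<forall>k\<in>I. f k = c k)" if "c \<in> I \<rightarrow>\<^sub>E carrier R" for f c
    using eq[of f c] that by (simp add: PiE_iff extensional_restrict)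
  have mem: "c k \<in> carrier R" if "c \<in> I \<rightarrow>\<^sub>E carrier R" "k \<in> I" for c k
    using that by blast
  have "abelian_group F"
  proof (rule abelian_groupI)
    fix c assume c: "c \<in> carrier F"
    show "\<exists>d\<in>carrier F. d \<oplus>\<^bsub>F\<^esub> c = \<zero>\<^bsub>F\<^esub>"
      using c by (intro bexI[of _ "\<lambda>k\<in>I. \<ominus> c k"]) (auto simp: F eq l_neg mem)
  qed (auto simp: F eq eq' mem a_ac)
  then interpret F: left_module R F
    by (intro left_module.intro left_module_axioms.intro ring_axioms)
      (auto simp: F eq eq' mem l_distr r_distr m_assoc)
  let ?N = "{c \<in> carrier F. \<exists>a\<in>carrier R. \<forall>k\<in>I. c k \<otimes> \<epsilon> k = a \<otimes> x k}"
  have N: "submodule ?N R F"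
  proof (rule F.submoduleI)
    show "\<zero>\<^bsub>F\<^esub> \<in> ?N"
      using \<epsilon> x by (auto simp: F Pi_iff intro!: bexI[of _ \<zero>])
    fix c d assume "c \<in> ?N" "d \<in> ?N"
    then obtain a b where cd: "c \<in> carrier F" "d \<in> carrier F" and "a \<in> carrier R" "\<forall>k\<in>I. c k \<otimes> \<epsilon> k = a \<otimes> x k"
      "b \<in> carrier R" "\<forall>k\<in>I. d k \<otimes> \<epsilon> k = b \<otimes> x k" by blast
    then have "\<forall>k\<in>I. (c k \<oplus> d k) \<otimes> \<epsilon> k = (a \<oplus> b) \<otimes> x k"
      using \<epsilon> x by (auto simp: F PiE_iff Pi_iff l_distr)
    with cd show "c \<oplus>\<^bsub>F\<^esub> d \<in> ?N"
      using \<open>a \<in> carrier R\<close> \<open>b \<in> carrier R\<close> by (auto simp: F PiE_iff intro!: bexI[of _ "a \<oplus> b"])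
  next
    fix r c assume r: "r \<in> carrier R" and "c \<in> ?N"
    then obtain a where c: "c \<in> carrier F" and a: "a \<in> carrier R" "\<forall>k\<in>I. c k \<otimes> \<epsilon> k = a \<otimes> x k" by blast
    then have "\<forall>k\<in>I. (r \<otimes> c k) \<otimes> \<epsilon> k = (r \<otimes> a) \<otimes> x k"
      using \<epsilon> x r by (auto simp: F PiE_iff Pi_iff m_assoc)
    with c r a show "r \<odot>\<^bsub>F\<^esub> c \<in> ?N"
      by (auto simp: F PiE_iff intro!: bexI[of _ "r \<otimes> a"])
  qed auto
  define Q where "Q = quotient_module F ?N"
  note Q = F.quotient_module_facts[OF N, folded Q_def]
  interpret q: module_hom R F Q "\<lambda>c. ?N +>\<^bsub>F\<^esub> c" by (rule module_homI[OF F.left_module_axioms Q(1,2)])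
  define \<delta> where "\<delta> k = (\<lambda>l\<in>I. if k = l then \<one> else \<zero>)" for k
  have \<delta>: "\<delta> \<in> I \<rightarrow> carrier F" by (auto simp: \<delta>_def F)
  have lc: "(\<Oplus>\<^bsub>F\<^esub>k\<in>I. c k \<odot>\<^bsub>F\<^esub> \<delta> k) = restrict c I" if c: "c \<in> I \<rightarrow> carrier R" for c
  proof
    fix l
    have cl: "(\<Oplus>\<^bsub>F\<^esub>k\<in>I. c k \<odot>\<^bsub>F\<^esub> \<delta> k) \<in> carrier F" by (rule F.lcomb_closed[OF I c \<delta>])
    show "(\<Oplus>\<^bsub>F\<^esub>k\<in>I. c k \<odot>\<^bsub>F\<^esub> \<delta> k) l = restrict c I l"
    proof (cases "l \<in> I")
      case True
      interpret ev: module_hom R F "regular R" "\<lambda>c. c l"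
        using True by (intro module_homI F.left_module_axioms regular_left_module linI) (auto simp: F)
      have "(\<Oplus>\<^bsub>F\<^esub>k\<in>I. c k \<odot>\<^bsub>F\<^esub> \<delta> k) l = (\<Oplus>k\<in>I. (c k \<odot>\<^bsub>F\<^esub> \<delta> k) l)"
        using ev.finsum[OF I, of "\<lambda>k. c k \<odot>\<^bsub>F\<^esub> \<delta> k"] c \<delta> by (simp add: finsum_regular Pi_iff)
      also have "\<dots> = (\<Oplus>k\<in>I. if l = k then c k else \<zero>)"
        using c True by (intro add.finprod_cong') (auto simp: F \<delta>_def Pi_iff)
      also have "\<dots> = c l" using c True I by (intro add.finprod_singleton) auto
      finally show ?thesis using True by simp
    qed (use cl in \<open>auto simp: F PiE_iff extensional_def\<close>)
  qed
  have "presented R Q I \<epsilon> x (\<lambda>k. ?N +>\<^bsub>F\<^esub> \<delta> k)"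
    unfolding presented_def
  proof (intro conjI ballI)
    have "generates R F I \<delta>"
      unfolding generates_def
    proof (intro conjI ballI I \<delta>)
      fix c assume "c \<in> carrier F"
      then show "\<exists>d\<in>I \<rightarrow> carrier R. c = (\<Oplus>\<^bsub>F\<^esub>k\<in>I. d k \<odot>\<^bsub>F\<^esub> \<delta> k)"
        using lc[of c] by (intro bexI[of _ c]) (auto simp: F PiE_iff extensional_restrict)
    qed
    then show "generates R Q I (\<lambda>k. ?N +>\<^bsub>F\<^esub> \<delta> k)"
      by (rule q.generates_image) (simp add: Q(3))
    fix c assume c: "c \<in> I \<rightarrow> carrier R"
    have "(\<Oplus>\<^bsub>Q\<^esub>k\<in>I. c k \<odot>\<^bsub>Q\<^esub> (?N +>\<^bsub>F\<^esub> \<delta> k)) = (\<Oplus>\<^bsub>Q\<^esub>k\<in>I. ?N +>\<^bsub>F\<^esub> (c k \<odot>\<^bsub>F\<^esub> \<delta> k))"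
      using c \<delta> by (intro q.B.M.finsum_cong') (auto simp: q.smult Pi_iff)
    also have "\<dots> = ?N +>\<^bsub>F\<^esub> (\<Oplus>\<^bsub>F\<^esub>k\<in>I. c k \<odot>\<^bsub>F\<^esub> \<delta> k)"
      using c \<delta> by (intro q.finsum[symmetric] I) (auto simp: Pi_iff)
    also have "\<dots> = \<zero>\<^bsub>Q\<^esub> \<longleftrightarrow> restrict c I \<in> ?N"
      unfolding lc[OF c] using c by (intro Q(4)) (auto simp: F restrict_PiE_iff)
    also have "\<dots> \<longleftrightarrow> (\<exists>a\<in>carrier R. \<forall>k\<in>I. c k \<otimes> \<epsilon> k = a \<otimes> x k)"
      using c by (auto simp: F)
    finally show "(\<Oplus>\<^bsub>Q\<^esub>k\<in>I. c k \<odot>\<^bsub>Q\<^esub> (?N +>\<^bsub>F\<^esub> \<delta> k)) = \<zero>\<^bsub>Q\<^esub> \<longleftrightarrow>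
      (\<exists>a\<in>carrier R. \<forall>k\<in>I. c k \<otimes> \<epsilon> k = a \<otimes> x k)" .
  qed (use assms Q(1) in auto)
  note pres = this
  \<comment> \<open>\<open>Q\<close> lives on cosets of functions. It is copied to the fixed type
    \<open>'a fg_univ\<close>, over which projectivity and the uniqueness of tilting modules
    quantify.\<close>
  have "fg_module R Q"
    by (rule left_module.generates_fg_module[OF Q(1) presentedD(2)[OF pres]])
  then obtain B :: "'a fgm" where B: "left_module R B" "mod_iso R Q B"
    using fg_module_copy by blast
  obtain f where "lin R Q B f" "bij_betw f (carrier Q) (carrier B)" by (rule mod_isoE[OF B(2)])
  then show thesis by (rule that[OF presented_iso[OF pres B(1)]])
qed

text \<open>The coefficient \<open>1 - \<epsilon> k\<close> at the single index \<open>k\<close> is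
  a relation, witnessed by the multiplier 0.\<close>

lemma presented_idem:
  assumes "presented R A I \<epsilon> x u" "k \<in> I"
  shows "\<epsilon> k \<odot>\<^bsub>A\<^esub> u k = u k"
proof -
  note D = presentedD[OF assms(1)]
  interpret left_module R A by (rule D(1))
  let ?a = "\<one>\<^bsub>R\<^esub> \<ominus>\<^bsub>R\<^esub> \<epsilon> k"
  have e: "\<epsilon> k \<in> carrier R" and u: "u k \<in> carrier A" using D assms(2) by blast+
  have "?a \<otimes>\<^bsub>R\<^esub> \<epsilon> k = \<zero>\<^bsub>R\<^esub>"
    using e D(7)[OF assms(2)] by (simp add: R.minus_eq R.l_distr R.l_minus R.r_neg)
  then have "(\<Oplus>\<^bsub>A\<^esub>l\<in>I. (if k = l then ?a else \<zero>\<^bsub>R\<^esub>) \<odot>\<^bsub>A\<^esub> u l) = \<zero>\<^bsub>A\<^esub>"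
    using e D(5,6) by (subst D(9)) (auto intro!: bexI[of _ "\<zero>\<^bsub>R\<^esub>"] simp: Pi_iff)
  then have "?a \<odot>\<^bsub>A\<^esub> u k = \<zero>\<^bsub>A\<^esub>"
    using e by (simp add: lcomb_delta[OF D(3) assms(2) D(4)])
  then show ?thesis
    using e u by (simp add: smult_l_diff diff_eq_zero_iff)
qed

text \<open>All relations follow from two kinds: \<open>\<epsilon> k\<close> fixes the generator at
  \<open>k\<close>, and the generators satisfy the relation \<open>x\<close>. Indeed
  \<open>c k y k = c k \<epsilon> k y k = a x k y k\<close> for a general relation \<open>c\<close>,
  and the sum is \<open>a\<close> times zero.\<close>

lemma hom_from_presented:
  assumes A: "presented R A I \<epsilon> x u" and X: "left_module R X" and y: "y \<in> I \<rightarrow> carrier X"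
    and \<epsilon>y: "\<And>k. k \<in> I \<Longrightarrow> \<epsilon> k \<odot>\<^bsub>X\<^esub> y k = y k"
    and rel: "(\<Oplus>\<^bsub>X\<^esub>k\<in>I. x k \<odot>\<^bsub>X\<^esub> y k) = \<zero>\<^bsub>X\<^esub>"
  obtains f where "lin R A X f" "\<And>k. k \<in> I \<Longrightarrow> f (u k) = y k"
    "\<And>c. c \<in> I \<rightarrow> carrier R \<Longrightarrow> f (\<Oplus>\<^bsub>A\<^esub>k\<in>I. c k \<odot>\<^bsub>A\<^esub> u k) = (\<Oplus>\<^bsub>X\<^esub>k\<in>I. c k \<odot>\<^bsub>X\<^esub> y k)"
proof -
  note D = presentedD[OF A]
  interpret left_module R X by (rule X)
  have "(\<Oplus>\<^bsub>X\<^esub>k\<in>I. c k \<odot>\<^bsub>X\<^esub> y k) = \<zero>\<^bsub>X\<^esub>"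
    if c: "c \<in> I \<rightarrow> carrier R" and c0: "(\<Oplus>\<^bsub>A\<^esub>k\<in>I. c k \<odot>\<^bsub>A\<^esub> u k) = \<zero>\<^bsub>A\<^esub>" for c
  proof -
    obtain a where a: "a \<in> carrier R" "\<And>k. k \<in> I \<Longrightarrow> c k \<otimes>\<^bsub>R\<^esub> \<epsilon> k = a \<otimes>\<^bsub>R\<^esub> x k"
      using D(9)[OF c] c0 by blast
    have "c k \<odot>\<^bsub>X\<^esub> y k = (a \<otimes>\<^bsub>R\<^esub> x k) \<odot>\<^bsub>X\<^esub> y k" if "k \<in> I" for k
    proof -
      have "c k \<odot>\<^bsub>X\<^esub> y k = (c k \<otimes>\<^bsub>R\<^esub> \<epsilon> k) \<odot>\<^bsub>X\<^esub> y k"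
        using \<epsilon>y[OF that] smult_assoc1[of "c k" "\<epsilon> k" "y k"] c D(5) y that by (simp add: Pi_iff)
      then show ?thesis using a that by simp
    qed
    then have "(\<Oplus>\<^bsub>X\<^esub>k\<in>I. c k \<odot>\<^bsub>X\<^esub> y k) = (\<Oplus>\<^bsub>X\<^esub>k\<in>I. (a \<otimes>\<^bsub>R\<^esub> x k) \<odot>\<^bsub>X\<^esub> y k)"
      using a(1) D(6) y by (intro M.finsum_cong') (auto simp: Pi_iff)
    also have "\<dots> = \<zero>\<^bsub>X\<^esub>"
      using lcomb_smult[OF D(3,6) a(1) y] rel a(1) by simp
    finally show ?thesis .
  qed
  from hom_from_generators[OF D(1) X D(2) y this] that show thesis by blast
qed

text \<open>With the zero relation the module is the direct sum of the
  \<open>R \<epsilon> k\<close>, so a map can be lifted generator by generator.\<close>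

lemma presented_projective:
  fixes A :: "('a, 'm, 'y) module_scheme"
  assumes A: "presented R A I \<epsilon> (\<lambda>_. \<zero>\<^bsub>R\<^esub>) u"
  shows "projective R A"
  unfolding projective_def
proof (intro conjI allI ballI impI)
  note D = presentedD[OF A]
  interpret A: left_module R A by (rule D(1))
  show "fg_module R A" by (rule A.generates_fg_module[OF D(2)])
  fix X Y :: "'a fgm" and p h
  assume p: "p \<in> mod_hom R X Y" and h: "h \<in> mod_hom R A Y"
    and *: "fg_module R X \<and> fg_module R Y \<and> p ` carrier X = carrier Y"
  have XY: "left_module R X" "left_module R Y" using * by (auto simp: fg_module_def)
  interpret p: module_hom R X Y p by (rule module_homI[OF XY mod_hom_lin[OF p]])
  interpret h: module_hom R A Y h by (rule module_homI[OF D(1) XY(2) mod_hom_lin[OF h]])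
  have "\<exists>y. y \<in> carrier X \<and> \<epsilon> k \<odot>\<^bsub>X\<^esub> y = y \<and> p y = h (u k)" if k: "k \<in> I" for k
  proof -
    have e: "\<epsilon> k \<in> carrier R" "u k \<in> carrier A" using D k by blast+
    obtain z where z: "z \<in> carrier X" "p z = h (u k)"
      using * e(2) by (metis h.closed image_iff)
    \<comment> \<open>A preimage \<open>z\<close> of \<open>h (u k)\<close> need not be fixed by
      \<open>\<epsilon> k\<close>, but \<open>\<epsilon> k z\<close> is, and it has the same image
      because \<open>u k\<close> is fixed.\<close>
    show ?thesis
      using e z presented_idem[OF A k] D(7)[OF k] p.A.smult_assoc1[of "\<epsilon> k" "\<epsilon> k" z, symmetric]
      by (intro exI[of _ "\<epsilon> k \<odot>\<^bsub>X\<^esub> z"]) (simp add: p.smult h.smult[symmetric])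
  qed
  then obtain y where y: "\<And>k. k \<in> I \<Longrightarrow> y k \<in> carrier X \<and> \<epsilon> k \<odot>\<^bsub>X\<^esub> y k = y k \<and> p (y k) = h (u k)"
    by metis
  obtain f where f: "lin R A X f" "\<And>k. k \<in> I \<Longrightarrow> f (u k) = y k"
    using y p.A.lcomb_zero[of y I] by (rule_tac hom_from_presented[OF A XY(1), of y]) (auto simp: Pi_iff)
  have "p (f a) = h a" if "a \<in> carrier A" for a
    using y f(2) by (intro lin_eq_on_generators[OF D(1) XY(2) lin_comp[OF f(1) p.lin] h.lin D(2) _ that]) auto
  then show "\<exists>k\<in>mod_hom R A X. \<forall>x\<in>carrier A. p (k x) = h x"
    using restrict_mod_hom[OF D(1) f(1)] by (intro bexI) auto
qed

section \<open>Projective modules and presentations\<close>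

text \<open>The lifting property freed from extensional functions; that \<open>Y\<close> is finitely
  generated follows from the surjection \<open>p\<close>.\<close>

lemma projective_lift:
  fixes X Y :: "'a fgm" and R :: "('a, 'x) ring_scheme" and P :: "('a, 'm, 'y) module_scheme"
  assumes P: "projective R P" and X: "fg_module R X" and Y: "left_module R Y"
    and p: "lin R X Y p" "p ` carrier X = carrier Y" and h: "lin R P Y h"
  obtains k where "lin R P X k" "\<And>x. x \<in> carrier P \<Longrightarrow> p (k x) = h x"
proof -
  have XP: "left_module R X" "left_module R P" using X P by (auto simp: fg_module_def projective_def)
  interpret p: module_hom R X Y p by (rule module_homI[OF XP(1) Y p(1)])
  interpret h: module_hom R P Y h by (rule module_homI[OF XP(2) Y h])
  have "\<exists>k\<in>mod_hom R P X. \<forall>x\<in>carrier P. restrict p (carrier X) (k x) = restrict h (carrier P) x"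
    using P X p.fg_image[OF X p(2)] restrict_mod_hom[OF XP(1) p(1)] restrict_mod_hom[OF XP(2) h] p(2)
    unfolding projective_def by (metis (no_types, lifting) image_restrict_eq)
  then obtain k where k: "k \<in> mod_hom R P X"
    and "\<And>x. x \<in> carrier P \<Longrightarrow> restrict p (carrier X) (k x) = h x" by auto
  then have "p (k x) = h x" if "x \<in> carrier P" for x
    using lin_closed[OF mod_hom_lin[OF k] that] that by (metis restrict_apply')
  with mod_hom_lin[OF k] show thesis by (rule that)
qed

text \<open>The surjection from the free module on a finite generating set \<open>S\<close> splits,
  and \<open>\<eta> s\<close> is the coordinate at \<open>s\<close> of the section.\<close>

lemma dual_basis:
  fixes P :: "('a, 'm, 'y) module_scheme" and R :: "('a, 'x) ring_scheme"
  assumes P: "projective R P"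
  obtains S \<eta> where "finite S" "S \<subseteq> carrier P" "\<And>s. s \<in> S \<Longrightarrow> lin R P (regular R) (\<eta> s)"
    "\<And>y. y \<in> carrier P \<Longrightarrow> y = (\<Oplus>\<^bsub>P\<^esub>s\<in>S. \<eta> s y \<odot>\<^bsub>P\<^esub> s)"
proof -
  have fg: "fg_module R P" using P by (simp add: projective_def)
  then interpret P: left_module R P by (simp add: fg_module_def)
  obtain S where gen: "generates R P S (\<lambda>s. s)" using fg by (auto simp: fg_module_iff_generates)
  have S: "finite S" "(\<lambda>s. s) \<in> S \<rightarrow> carrier P" using generatesD[OF gen] by auto
  obtain A :: "'a fgm" and u where A: "presented R A S (\<lambda>_. \<one>\<^bsub>R\<^esub>) (\<lambda>_. \<zero>\<^bsub>R\<^esub>) u"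
    by (rule P.exists_presented[OF S(1), of "\<lambda>_. \<one>\<^bsub>R\<^esub>" "\<lambda>_. \<zero>\<^bsub>R\<^esub>"]) auto
  note D = presentedD[OF A]
  have regular: "left_module R (regular R)" by (rule P.regular_left_module)
  obtain p where p: "lin R A P p"
    "\<And>c. c \<in> S \<rightarrow> carrier R \<Longrightarrow> p (\<Oplus>\<^bsub>A\<^esub>s\<in>S. c s \<odot>\<^bsub>A\<^esub> u s) = (\<Oplus>\<^bsub>P\<^esub>s\<in>S. c s \<odot>\<^bsub>P\<^esub> s)"
    using S P.lcomb_zero[OF S(2)] by (rule_tac hom_from_presented[OF A P.left_module_axioms S(2)]) (auto simp: Pi_iff)
  interpret A: left_module R A by (rule D(1))
  have surj: "p ` carrier A = carrier P"
  proof
    show "carrier P \<subseteq> p ` carrier A"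
    proof
      fix y assume "y \<in> carrier P"
      then obtain c where c: "c \<in> S \<rightarrow> carrier R" "y = (\<Oplus>\<^bsub>P\<^esub>s\<in>S. c s \<odot>\<^bsub>P\<^esub> s)" by (rule generatesE[OF gen])
      show "y \<in> p ` carrier A"
        using p(2)[OF c(1)] c(2) A.lcomb_closed[OF D(3) c(1) D(4)] by (intro image_eqI) auto
    qed
  qed (use lin_closed[OF p(1)] in blast)
  have "\<exists>k. lin R P A k \<and> (\<forall>y\<in>carrier P. p (k y) = y)"
  proof -
    \<comment> \<open>Lifting is only available along maps between modules on the fixed universe. So
      instead of the identity of \<open>P\<close> an isomorphism \<open>i\<close> onto a copy of
      \<open>P\<close> is lifted, and \<open>i\<close> is cancelled afterwards.\<close>
    obtain Q :: "'a fgm" where Q: "left_module R Q" "mod_iso R P Q" using fg_module_copy[OF fg] by blast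
    obtain i where i: "lin R P Q i" "bij_betw i (carrier P) (carrier Q)" by (rule mod_isoE[OF Q(2)])
    have "(\<lambda>x. i (p x)) ` carrier A = carrier Q"
      using surj bij_betw_imp_surj_on[OF i(2)] by (metis image_image)
    from projective_lift[OF P A.generates_fg_module[OF D(2)] Q(1) lin_comp[OF p(1) i(1)] this i(1)]
    obtain k where k: "lin R P A k" "\<And>y. y \<in> carrier P \<Longrightarrow> i (p (k y)) = i y" by blast
    moreover have "p (k y) = y" if "y \<in> carrier P" for y
      using inj_onD[OF bij_betw_imp_inj_on[OF i(2)] k(2)[OF that]]
        that lin_closed[OF p(1) lin_closed[OF k(1) that]] by blast
    ultimately show ?thesis by blast
  qed
  then obtain k where k: "lin R P A k" "\<And>y. y \<in> carrier P \<Longrightarrow> p (k y) = y" by blast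
  have "\<exists>f. lin R A (regular R) f \<and> (\<forall>c\<in>S \<rightarrow> carrier R. f (\<Oplus>\<^bsub>A\<^esub>t\<in>S. c t \<odot>\<^bsub>A\<^esub> u t) = c s)" if s: "s \<in> S" for s
  proof -
    let ?y = "\<lambda>t. if s = t then \<one>\<^bsub>R\<^esub> else \<zero>\<^bsub>R\<^esub>"
    interpret reg: left_module R "regular R" by (rule regular)
    obtain f where f: "lin R A (regular R) f"
      "\<And>c. c \<in> S \<rightarrow> carrier R \<Longrightarrow> f (\<Oplus>\<^bsub>A\<^esub>t\<in>S. c t \<odot>\<^bsub>A\<^esub> u t) = (\<Oplus>\<^bsub>regular R\<^esub>t\<in>S. c t \<odot>\<^bsub>regular R\<^esub> ?y t)"
      using reg.lcomb_zero[of ?y S] by (rule_tac hom_from_presented[OF A regular, of ?y]) auto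
    have "(\<Oplus>\<^bsub>regular R\<^esub>t\<in>S. c t \<odot>\<^bsub>regular R\<^esub> ?y t) = c s" if c: "c \<in> S \<rightarrow> carrier R" for c
    proof -
      have "(\<Oplus>\<^bsub>regular R\<^esub>t\<in>S. c t \<odot>\<^bsub>regular R\<^esub> ?y t) = (\<Oplus>\<^bsub>R\<^esub>t\<in>S. if s = t then c t else \<zero>\<^bsub>R\<^esub>)"
        unfolding finsum_regular using c by (intro P.R.finsum_cong') (auto simp: Pi_iff)
      also have "\<dots> = c s" using s S(1) c by (intro P.R.finsum_singleton) auto
      finally show ?thesis .
    qed
    with f show ?thesis by auto
  qed
  then have "\<forall>s\<in>S. \<exists>f. lin R A (regular R) f \<and> (\<forall>c\<in>S \<rightarrow> carrier R. f (\<Oplus>\<^bsub>A\<^esub>t\<in>S. c t \<odot>\<^bsub>A\<^esub> u t) = c s)"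
    by (rule ballI)
  from bchoice[OF this] obtain \<eta> where \<eta>: "\<And>s. s \<in> S \<Longrightarrow> lin R A (regular R) (\<eta> s)"
    "\<And>s c. \<lbrakk>s \<in> S; c \<in> S \<rightarrow> carrier R\<rbrakk> \<Longrightarrow> \<eta> s (\<Oplus>\<^bsub>A\<^esub>t\<in>S. c t \<odot>\<^bsub>A\<^esub> u t) = c s"
    by blast
  show thesis
  proof (rule that)
    show "lin R P (regular R) (\<lambda>y. \<eta> s (k y))" if "s \<in> S" for s
      by (rule lin_comp[OF k(1) \<eta>(1)[OF that]])
    fix y assume y: "y \<in> carrier P"
    obtain c where c: "c \<in> S \<rightarrow> carrier R" "k y = (\<Oplus>\<^bsub>A\<^esub>s\<in>S. c s \<odot>\<^bsub>A\<^esub> u s)"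
      by (rule generatesE[OF D(2) lin_closed[OF k(1) y]])
    have "y = (\<Oplus>\<^bsub>P\<^esub>s\<in>S. c s \<odot>\<^bsub>P\<^esub> s)" using k(2)[OF y] c p(2) by simp
    also have "\<dots> = (\<Oplus>\<^bsub>P\<^esub>s\<in>S. \<eta> s (k y) \<odot>\<^bsub>P\<^esub> s)"
      using c \<eta>(2)[OF _ c(1)] S by (intro P.M.finsum_cong') (auto simp: Pi_iff)
    finally show "y = (\<Oplus>\<^bsub>P\<^esub>s\<in>S. \<eta> s (k y) \<odot>\<^bsub>P\<^esub> s)" .
  qed (use S in auto)
qed

lemma min_proj_presentation_iff:
  "min_proj_presentation R M (P1, P0, f, p) \<longleftrightarrow> projective_cover R P0 M p \<and>
    projective_cover R P1 (restrict_module P0 {x \<in> carrier P0. p x = \<zero>\<^bsub>M\<^esub>}) f"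
  by (simp add: min_proj_presentation_def a_kernel_def')

text \<open>
  Comparing a projective presentation with a minimal one gives an endomorphism \<open>w\<close> of \<open>P\<^sub>1\<close> with
  \<open>f w = f\<close>. As \<open>f\<close> is essential, \<open>w\<close> is surjective, and so is a section of it; hence \<open>w\<close> is bijective.
\<close>

lemma presentation_extension_transfer:
  fixes P1 P0 Q1 Q0 M :: "'a fgm" and R :: "('a, 'x) ring_scheme"
  assumes M: "fg_module R M" and pres: "min_proj_presentation R M (P1, P0, f, p)"
    and Q: "projective R Q1" "projective R Q0"
    and p': "lin R Q0 M p'" "p' ` carrier Q0 = carrier M"
    and f': "lin R Q1 Q0 f'" "f' ` carrier Q1 = {y \<in> carrier Q0. p' y = \<zero>\<^bsub>M\<^esub>}"
    and ext: "\<And>g. lin R Q1 M g \<Longrightarrow> \<exists>h. lin R Q0 M h \<and> (\<forall>y\<in>carrier Q1. g y = h (f' y))"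
    and g: "lin R P1 M g"
  shows "\<exists>h. lin R P0 M h \<and> (\<forall>y\<in>carrier P1. g y = h (f y))"
proof -
  define K where "K = {x \<in> carrier P0. p x = \<zero>\<^bsub>M\<^esub>}"
  define L where "L = {x \<in> carrier Q0. p' x = \<zero>\<^bsub>M\<^esub>}"
  have P: "projective R P1" "projective R P0" and p: "lin R P0 M p" "p ` carrier P0 = carrier M"
    and f: "lin R P1 (restrict_module P0 K) f" "f ` carrier P1 = K"
    and ess: "\<And>N. \<lbrakk>submodule N R P1; f ` N = K\<rbrakk> \<Longrightarrow> N = carrier P1"
    using pres mod_hom_lin by (auto simp: min_proj_presentation_iff projective_cover_def K_def)
  have fg: "fg_module R P1" "fg_module R P0" "fg_module R Q1" "fg_module R Q0"
    using P Q by (auto simp: projective_def)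
  then interpret P1: left_module R P1 by (simp add: fg_module_def)
  interpret P0: left_module R P0 using fg by (simp add: fg_module_def)
  interpret Q1: left_module R Q1 using fg by (simp add: fg_module_def)
  interpret Q0: left_module R Q0 using fg by (simp add: fg_module_def)
  interpret M: left_module R M using M by (simp add: fg_module_def)
  interpret p: module_hom R P0 M p by unfold_locales (rule p)
  interpret p': module_hom R Q0 M p' by unfold_locales (rule p')
  have K: "submodule K R P0" unfolding K_def by (rule p.kernel_submodule)
  have L: "submodule L R Q0" unfolding L_def by (rule p'.kernel_submodule)
  interpret K: left_module R "restrict_module P0 K" by (rule P0.submodule_is_left_module[OF K])
  interpret L: left_module R "restrict_module Q0 L" by (rule Q0.submodule_is_left_module[OF L])
  have f0: "lin R P1 P0 f" by (rule lin_unrestrict_codomain[OF P0.left_module_axioms K f(1)])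
  interpret f: module_hom R P1 P0 f by unfold_locales (rule f0)
  have fK: "f y \<in> K" if "y \<in> carrier P1" for y using f(2) that by blast
  have fL: "lin R Q1 (restrict_module Q0 L) f'" "f' ` carrier Q1 = carrier (restrict_module Q0 L)"
    using f' by (auto simp: L_def intro!: lin_restrict_codomain)
  have f'0: "f' y \<in> carrier Q0 \<and> p' (f' y) = \<zero>\<^bsub>M\<^esub>" if "y \<in> carrier Q1" for y
    using f'(2) that by blast
  have fK': "f ` carrier P1 = carrier (restrict_module P0 K)" using f(2) by simp
  \<comment> \<open>\<open>a\<close> and \<open>b\<close> compare the two covers of \<open>M\<close>
    in both directions; \<open>c\<close> and \<open>c'\<close> will lift their restrictions to the
    kernels.\<close>
  obtain a where a: "lin R P0 Q0 a" "\<And>x. x \<in> carrier P0 \<Longrightarrow> p' (a x) = p x"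
    using projective_lift[OF P(2) fg(4) M.left_module_axioms p' p(1)] by blast
  obtain b where b: "lin R Q0 P0 b" "\<And>x. x \<in> carrier Q0 \<Longrightarrow> p (b x) = p' x"
    using projective_lift[OF Q(2) fg(2) M.left_module_axioms p p'(1)] by blast
  have "lin R P1 (restrict_module Q0 L) (\<lambda>y. a (f y))"
    using fK a(2) lin_closed[OF a(1)] by (intro lin_restrict_codomain lin_comp[OF f0 a(1)]) (auto simp: L_def K_def)
  then obtain c where c: "lin R P1 Q1 c" "\<And>y. y \<in> carrier P1 \<Longrightarrow> f' (c y) = a (f y)"
    using projective_lift[OF P(1) fg(3) L.left_module_axioms fL] by blast
  have "lin R Q1 (restrict_module P0 K) (\<lambda>y. b (f' y))"
    using f'0 b(2) lin_closed[OF b(1)]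
    by (intro lin_restrict_codomain lin_comp[OF f'(1) b(1)]) (simp add: K_def)
  then obtain c' where c': "lin R Q1 P1 c'" "\<And>y. y \<in> carrier Q1 \<Longrightarrow> f (c' y) = b (f' y)"
    using projective_lift[OF Q(1) fg(1) K.left_module_axioms f(1) fK'] by blast
  have ba: "b (a x) \<in> carrier P0" if "x \<in> carrier P0" for x
    using lin_closed[OF b(1) lin_closed[OF a(1) that]] .
  \<comment> \<open>Both \<open>b a\<close> and the identity lift \<open>p\<close>, so they differ
    by a map into the kernel of \<open>p\<close>. Its lift \<open>t\<close> along \<open>f\<close>
    is a homotopy.\<close>
  have "lin R P0 (restrict_module P0 K) (\<lambda>x. b (a x) \<ominus>\<^bsub>P0\<^esub> x)"
    using ba lin_closed[OF a(1)]
    by (intro lin_restrict_codomain lin_minus[OF P0.left_module_axioms lin_comp[OF a(1) b(1)] lin_id])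
      (auto simp: K_def p.minus a(2) b(2) M.diff_eq_zero_iff)
  then obtain t where t: "lin R P0 P1 t" "\<And>x. x \<in> carrier P0 \<Longrightarrow> f (t x) = b (a x) \<ominus>\<^bsub>P0\<^esub> x"
    using projective_lift[OF P(2) fg(1) K.left_module_axioms f(1) fK'] by blast
  \<comment> \<open>Correcting \<open>c' c\<close> by the homotopy makes \<open>f w = f\<close> hold
    exactly, because \<open>f c' c = b a f\<close> and \<open>f t f = b a f - f\<close>.\<close>
  define w where "w y = c' (c y) \<ominus>\<^bsub>P1\<^esub> t (f y)" for y
  have w: "lin R P1 P1 w"
    unfolding w_def by (rule lin_minus[OF P1.left_module_axioms lin_comp[OF c(1) c'(1)] lin_comp[OF f0 t(1)]])
  have fw: "f (w y) = f y" if y: "y \<in> carrier P1" for y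
  proof -
    have "f (w y) = b (a (f y)) \<ominus>\<^bsub>P0\<^esub> (b (a (f y)) \<ominus>\<^bsub>P0\<^esub> f y)"
      using y lin_closed[OF c(1) y] lin_closed[OF c'(1) lin_closed[OF c(1) y]] lin_closed[OF t(1), of "f y"]
      by (simp add: w_def f.minus c(2) c'(2) t(2))
    also have "\<dots> = f y"
      using y ba[of "f y"] by (simp add: P0.M.minus_eq P0.M.minus_add P0.M.a_assoc[symmetric] P0.M.r_neg)
    finally show ?thesis .
  qed
  interpret w: module_hom R P1 P1 w by unfold_locales (rule w)
  have onto: "v ` carrier P1 = carrier P1" if "lin R P1 P1 v" "\<And>y. y \<in> carrier P1 \<Longrightarrow> f (v y) = f y" for v
  proof (rule ess)
    interpret v: module_hom R P1 P1 v by unfold_locales (rule that(1))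
    show "submodule (v ` carrier P1) R P1" by (rule v.range_submodule)
    show "f ` v ` carrier P1 = K" using that(2) f(2) by (simp add: image_image)
  qed
  obtain v where v: "lin R P1 P1 v" "\<And>y. y \<in> carrier P1 \<Longrightarrow> w (v y) = y"
    using projective_lift[OF P(1) fg(1) P1.left_module_axioms w onto[OF w fw] lin_id] by blast
  have fv: "f (v y) = f y" if "y \<in> carrier P1" for y
    using fw[OF lin_closed[OF v(1) that]] v(2)[OF that] by metis
  have v_onto: "v ` carrier P1 = carrier P1"
    by (rule onto[OF v(1) fv])
  have vw: "v (w y) = y" if y: "y \<in> carrier P1" for y
  proof -
    obtain z where "z \<in> carrier P1" "y = v z" using v_onto y by blast
    then show ?thesis using v(2) by simp
  qed
  interpret g: module_hom R P1 M g by unfold_locales (rule g)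
  interpret v: module_hom R P1 P1 v by unfold_locales (rule v)
  obtain h where h: "lin R Q0 M h" "\<And>y. y \<in> carrier Q1 \<Longrightarrow> g (v (c' y)) = h (f' y)"
    using ext[OF lin_comp[OF c'(1) lin_comp[OF v(1) g]]] by blast
  \<comment> \<open>In \<open>g = g v w\<close> with \<open>w = c' c - t f\<close>, the first part
    is \<open>g v c' c = h f' c = h a f\<close> by the extension \<open>h\<close> on the other
    presentation, and the second part already factors through \<open>f\<close>.\<close>
  have "lin R P0 M (\<lambda>x. h (a x) \<ominus>\<^bsub>M\<^esub> g (v (t x)))"
    by (rule lin_minus[OF M.left_module_axioms lin_comp[OF a(1) h(1)] lin_comp[OF t(1) lin_comp[OF v(1) g]]])
  moreover have "g y = h (a (f y)) \<ominus>\<^bsub>M\<^esub> g (v (t (f y)))" if y: "y \<in> carrier P1" for y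
  proof -
    note cl = lin_closed[OF c(1) y] lin_closed[OF c'(1) lin_closed[OF c(1) y]] lin_closed[OF t(1) f.closed[OF y]]
    have "h (a (f y)) = g (v (c' (c y)))" using y cl by (simp add: h(2) c(2))
    then show ?thesis using vw[OF y] cl y by (simp add: w_def v.minus g.minus[symmetric])
  qed
  ultimately show ?thesis by blast
qed

section \<open>A criterion for rigidity\<close>

text \<open>Stated for groups and not for modules, because it is applied to additive maps between
  modules over different rings: from the dual over the opposite ring to \<open>R\<close>, and from
  \<open>M\<close> or the dual to \<open>J\<close>.\<close>

lemma additive_finsum:
  assumes "abelian_group A" "abelian_group B" "finite I" "g \<in> I \<rightarrow> carrier A"
    and f: "\<And>x. x \<in> carrier A \<Longrightarrow> f x \<in> carrier B"
      "\<And>x y. \<lbrakk>x \<in> carrier A; y \<in> carrier A\<rbrakk> \<Longrightarrow> f (x \<oplus>\<^bsub>A\<^esub> y) = f x \<oplus>\<^bsub>B\<^esub> f y"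
  shows "f (\<Oplus>\<^bsub>A\<^esub>i\<in>I. g i) = (\<Oplus>\<^bsub>B\<^esub>i\<in>I. f (g i))"
proof -
  interpret A: abelian_group A by fact
  interpret B: abelian_group B by fact
  have "f \<zero>\<^bsub>A\<^esub> = \<zero>\<^bsub>B\<^esub>"
    using f(1)[of "\<zero>\<^bsub>A\<^esub>"] f(2)[of "\<zero>\<^bsub>A\<^esub>" "\<zero>\<^bsub>A\<^esub>"] by (simp add: B.add.r_cancel_one')
  with assms(3,4) show ?thesis
    by (induct set: finite) (simp_all add: Pi_def f)
qed

lemma opposite_simps [simp]:
  "carrier (opposite R) = carrier R" "add (opposite R) = add R" "\<zero>\<^bsub>opposite R\<^esub> = \<zero>\<^bsub>R\<^esub>"
  "\<one>\<^bsub>opposite R\<^esub> = \<one>\<^bsub>R\<^esub>" "a \<otimes>\<^bsub>opposite R\<^esub> b = b \<otimes>\<^bsub>R\<^esub> a"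
  by (simp_all add: opposite_def)

lemma (in ring) opposite_ring: "ring (opposite R)"
proof (rule ringI)
  show "abelian_group (opposite R)"
    by (rule abelian_groupI) (auto simp: a_ac intro!: bexI[of _ "\<ominus> x" for x] l_neg)
  show "Group.monoid (opposite R)"
    by (rule monoidI) (auto simp: m_assoc)
qed (auto simp: l_distr r_distr)

lemma ring_dual_simps [simp]:
  "carrier (ring_dual R P) = mod_hom R P (regular R)"
  "\<zero>\<^bsub>ring_dual R P\<^esub> = (\<lambda>x\<in>carrier P. \<zero>\<^bsub>R\<^esub>)"
  "\<xi> \<oplus>\<^bsub>ring_dual R P\<^esub> \<zeta> = (\<lambda>x\<in>carrier P. \<xi> x \<oplus>\<^bsub>R\<^esub> \<zeta> x)"
  "a \<odot>\<^bsub>ring_dual R P\<^esub> \<xi> = (\<lambda>x\<in>carrier P. \<xi> x \<otimes>\<^bsub>R\<^esub> a)"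
  by (simp_all add: ring_dual_def make_module_def)

text \<open>The dual is a right module, hence a left module over the opposite ring. Extensionality
  reduces its equations to equations on the carrier, and negatives are obtained by acting with
  \<open>-1\<close>.\<close>

lemma (in left_module) ring_dual_left_module:
  "left_module (opposite R) (ring_dual R M)"
proof -
  interpret reg: left_module R "regular R" by (rule R.regular_left_module)
  have ext: "\<xi> x = undefined" if "\<xi> \<in> mod_hom R M (regular R)" "x \<notin> carrier M" for \<xi> x
    using that by (auto simp: mod_hom_iff extensional_def)
  have cl: "\<xi> x \<in> carrier R" if "\<xi> \<in> mod_hom R M (regular R)" "x \<in> carrier M" for \<xi> x
    using lin_closed[OF mod_hom_lin[OF that(1)] that(2)] by simp
  have [simp]: "restrict f (carrier M) = \<xi> \<longleftrightarrow> (\<forall>x\<in>carrier M. f x = \<xi> x)"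
    if "\<xi> \<in> mod_hom R M (regular R)" for f \<xi>
    using ext[OF that] by (auto simp: fun_eq_iff)
  have [simp]: "restrict f (carrier M) = restrict g (carrier M) \<longleftrightarrow> (\<forall>x\<in>carrier M. f x = g x)"
    for f g :: "'m \<Rightarrow> 'a"
    by (auto simp: fun_eq_iff)
  have mh: "restrict f (carrier M) \<in> mod_hom R M (regular R)" if "lin R M (regular R) f" for f
    by (rule restrict_mod_hom[OF left_module_axioms that])
  have zero: "lin R M (regular R) (\<lambda>x. \<zero>\<^bsub>R\<^esub>)" by (rule linI) auto
  have add: "lin R M (regular R) (\<lambda>x. \<xi> x \<oplus>\<^bsub>R\<^esub> \<zeta> x)"
    if "\<xi> \<in> mod_hom R M (regular R)" "\<zeta> \<in> mod_hom R M (regular R)" for \<xi> \<zeta>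
    using lin_plus[OF reg.left_module_axioms mod_hom_lin[OF that(1)] mod_hom_lin[OF that(2)]] by simp
  have smult: "lin R M (regular R) (\<lambda>x. \<xi> x \<otimes>\<^bsub>R\<^esub> a)"
    if "\<xi> \<in> mod_hom R M (regular R)" "a \<in> carrier R" for \<xi> a
    using that cl linD[OF mod_hom_lin[OF that(1)]]
    by (intro linI) (auto simp: R.l_distr R.m_assoc)
  have neg: "\<exists>\<zeta>\<in>mod_hom R M (regular R). \<forall>x\<in>carrier M. \<zeta> x = \<ominus>\<^bsub>R\<^esub> \<xi> x"
    if "\<xi> \<in> mod_hom R M (regular R)" for \<xi>
    using mh[OF smult[OF that, of "\<ominus>\<^bsub>R\<^esub> \<one>\<^bsub>R\<^esub>"]] cl[OF that]
    by (intro bexI[of _ "\<lambda>x\<in>carrier M. \<xi> x \<otimes>\<^bsub>R\<^esub> \<ominus>\<^bsub>R\<^esub> \<one>\<^bsub>R\<^esub>"]) (auto simp: R.r_minus)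
  have "abelian_group (ring_dual R M)"
  proof (rule abelian_groupI)
    fix \<xi> assume \<xi>: "\<xi> \<in> carrier (ring_dual R M)"
    obtain \<zeta> where "\<zeta> \<in> mod_hom R M (regular R)" "\<forall>x\<in>carrier M. \<zeta> x = \<ominus>\<^bsub>R\<^esub> \<xi> x"
      using neg \<xi> by auto
    then show "\<exists>\<zeta>\<in>carrier (ring_dual R M). \<zeta> \<oplus>\<^bsub>ring_dual R M\<^esub> \<xi> = \<zero>\<^bsub>ring_dual R M\<^esub>"
      using \<xi> cl by (intro bexI[of _ \<zeta>]) (auto simp: R.l_neg)
  qed (auto simp: mh zero add cl R.a_ac)
  then show ?thesis
    by (intro left_module.intro left_module_axioms.intro R.opposite_ring)
      (auto simp: mh add smult cl R.l_distr R.r_distr R.m_assoc)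
qed

text \<open>
  The map \<open>y \<mapsto> \<xi>(y)m\<close> extends to some \<open>h\<close> on \<open>P\<^sub>0\<close>; expanding \<open>\<xi>\<close> and \<open>h\<close> in dual bases turns
  \<open>\<Phi>(m, \<xi>)\<close> into a sum of terms \<open>\<Phi>(h(t), \<eta>\<^sub>t f)\<close>.
\<close>

lemma balanced_vanishes:
  fixes R :: "('a, 'x) ring_scheme" and P1 P0 :: "'a fgm" and M :: "'a fgm"
  assumes M: "left_module R M" and P: "projective R P1" "projective R P0" and f: "lin R P1 P0 f"
    and ext: "\<And>g. lin R P1 M g \<Longrightarrow> \<exists>h. lin R P0 M h \<and> (\<forall>y\<in>carrier P1. g y = h (f y))"
    and J: "left_module K J"
  defines "D \<equiv> ring_dual R P1"
  assumes closed: "\<And>m \<xi>. \<lbrakk>m \<in> carrier M; \<xi> \<in> carrier D\<rbrakk> \<Longrightarrow> \<Phi> m \<xi> \<in> carrier J"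
    and addl: "\<And>m m' \<xi>. \<lbrakk>m \<in> carrier M; m' \<in> carrier M; \<xi> \<in> carrier D\<rbrakk> \<Longrightarrow>
      \<Phi> (m \<oplus>\<^bsub>M\<^esub> m') \<xi> = \<Phi> m \<xi> \<oplus>\<^bsub>J\<^esub> \<Phi> m' \<xi>"
    and addr: "\<And>m \<xi> \<zeta>. \<lbrakk>m \<in> carrier M; \<xi> \<in> carrier D; \<zeta> \<in> carrier D\<rbrakk> \<Longrightarrow>
      \<Phi> m (\<xi> \<oplus>\<^bsub>D\<^esub> \<zeta>) = \<Phi> m \<xi> \<oplus>\<^bsub>J\<^esub> \<Phi> m \<zeta>"
    and bal: "\<And>a m \<xi>. \<lbrakk>a \<in> carrier R; m \<in> carrier M; \<xi> \<in> carrier D\<rbrakk> \<Longrightarrow>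
      \<Phi> (a \<odot>\<^bsub>M\<^esub> m) \<xi> = \<Phi> m (a \<odot>\<^bsub>D\<^esub> \<xi>)"
    and vanish: "\<And>m \<eta>. \<lbrakk>m \<in> carrier M; lin R P0 (regular R) \<eta>\<rbrakk> \<Longrightarrow>
      \<Phi> m (\<lambda>y\<in>carrier P1. \<eta> (f y)) = \<zero>\<^bsub>J\<^esub>"
    and m: "m \<in> carrier M" and \<xi>: "\<xi> \<in> carrier D"
  shows "\<Phi> m \<xi> = \<zero>\<^bsub>J\<^esub>"
proof -
  interpret M: left_module R M by (rule M)
  interpret J: left_module K J by (rule J)
  interpret P1: left_module R P1 using P(1) by (simp add: projective_def fg_module_def)
  interpret P0: left_module R P0 using P(2) by (simp add: projective_def fg_module_def)
  have reg: "left_module R (regular R)" by (rule M.regular_left_module)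
  interpret D: left_module "opposite R" D unfolding D_def by (rule P1.ring_dual_left_module)
  obtain S \<eta>1 where S: "finite S" "S \<subseteq> carrier P1" "\<And>s. s \<in> S \<Longrightarrow> lin R P1 (regular R) (\<eta>1 s)"
    and \<eta>1: "\<And>y. y \<in> carrier P1 \<Longrightarrow> y = (\<Oplus>\<^bsub>P1\<^esub>s\<in>S. \<eta>1 s y \<odot>\<^bsub>P1\<^esub> s)"
    using dual_basis[OF P(1)] by blast
  obtain T \<eta>0 where T: "finite T" "T \<subseteq> carrier P0" "\<And>t. t \<in> T \<Longrightarrow> lin R P0 (regular R) (\<eta>0 t)"
    and \<eta>0: "\<And>y. y \<in> carrier P0 \<Longrightarrow> y = (\<Oplus>\<^bsub>P0\<^esub>t\<in>T. \<eta>0 t y \<odot>\<^bsub>P0\<^esub> t)"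
    using dual_basis[OF P(2)] by blast
  define e where "e s = restrict (\<eta>1 s) (carrier P1)" for s
  have e: "e s \<in> carrier D" if "s \<in> S" for s
    unfolding e_def D_def using restrict_mod_hom[OF P1.left_module_axioms S(3)[OF that]] by simp
  have cl: "\<zeta> y \<in> carrier R" if "\<zeta> \<in> carrier D" "y \<in> carrier P1" for \<zeta> y
    using that lin_closed[OF mod_hom_lin] by (fastforce simp: D_def)
  \<comment> \<open>In the right module \<open>D\<close> one has
    \<open>\<zeta> = \<Sum> e s \<zeta>(s)\<close>, as seen by applying \<open>\<zeta>\<close> to
    the dual basis expansion of \<open>y\<close>. Balancedness then moves the scalars
    \<open>\<zeta>(s)\<close> over to \<open>m\<close>.\<close>
  have expand: "\<Phi> m \<zeta> = (\<Oplus>\<^bsub>J\<^esub>s\<in>S. \<Phi> (\<zeta> s \<odot>\<^bsub>M\<^esub> m) (e s))" if m: "m \<in> carrier M" and \<zeta>: "\<zeta> \<in> carrier D" for m \<zeta>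
  proof -
    interpret \<zeta>: module_hom R P1 "regular R" \<zeta>
      using \<zeta> by (intro module_homI P1.left_module_axioms reg mod_hom_lin) (simp add: D_def)
    have sm: "\<zeta> s \<odot>\<^bsub>D\<^esub> e s \<in> carrier D" if "s \<in> S" for s
      using e[OF that] cl[OF \<zeta>] S(2) that D.smult_closed[of "\<zeta> s" "e s"] by auto
    have "(\<Oplus>\<^bsub>D\<^esub>s\<in>S. \<zeta> s \<odot>\<^bsub>D\<^esub> e s) = \<zeta>"
    proof
      fix y
      have fin: "(\<Oplus>\<^bsub>D\<^esub>s\<in>S. \<zeta> s \<odot>\<^bsub>D\<^esub> e s) \<in> carrier D" using sm by (intro D.M.finsum_closed) auto
      show "(\<Oplus>\<^bsub>D\<^esub>s\<in>S. \<zeta> s \<odot>\<^bsub>D\<^esub> e s) y = \<zeta> y"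
      proof (cases "y \<in> carrier P1")
        case True
        have "(\<Oplus>\<^bsub>D\<^esub>s\<in>S. \<zeta> s \<odot>\<^bsub>D\<^esub> e s) y = (\<Oplus>\<^bsub>regular R\<^esub>s\<in>S. (\<zeta> s \<odot>\<^bsub>D\<^esub> e s) y)"
          using sm S(1) True cl
          by (intro additive_finsum[OF D.M.abelian_group_axioms \<zeta>.B.M.abelian_group_axioms, of S "\<lambda>s. \<zeta> s \<odot>\<^bsub>D\<^esub> e s" "\<lambda>\<zeta>. \<zeta> y"])
            (auto simp: D_def)
        also have "\<dots> = (\<Oplus>\<^bsub>regular R\<^esub>s\<in>S. \<zeta> (\<eta>1 s y \<odot>\<^bsub>P1\<^esub> s))"
          using True S cl[OF \<zeta>] lin_closed[OF S(3) True]
          by (intro \<zeta>.B.M.finsum_cong') (auto simp: D_def e_def \<zeta>.smult subset_eq)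
        also have "\<dots> = \<zeta> (\<Oplus>\<^bsub>P1\<^esub>s\<in>S. \<eta>1 s y \<odot>\<^bsub>P1\<^esub> s)"
          using True S lin_closed[OF S(3) True] by (intro \<zeta>.finsum[symmetric]) (auto simp: subset_eq)
        also have "\<dots> = \<zeta> y" using \<eta>1[OF True] by simp
        finally show ?thesis .
      next
        case False
        then show ?thesis using fin \<zeta> by (auto simp: D_def mod_hom_iff extensional_def)
      qed
    qed
    then have "\<Phi> m \<zeta> = \<Phi> m (\<Oplus>\<^bsub>D\<^esub>s\<in>S. \<zeta> s \<odot>\<^bsub>D\<^esub> e s)" by simp
    also have "\<dots> = (\<Oplus>\<^bsub>J\<^esub>s\<in>S. \<Phi> m (\<zeta> s \<odot>\<^bsub>D\<^esub> e s))"
      using sm m by (intro additive_finsum[OF D.M.abelian_group_axioms J.M.abelian_group_axioms S(1)] closed addr) auto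
    also have "\<dots> = (\<Oplus>\<^bsub>J\<^esub>s\<in>S. \<Phi> (\<zeta> s \<odot>\<^bsub>M\<^esub> m) (e s))"
      using S(2) e cl[OF \<zeta>] m by (intro J.M.finsum_cong') (auto simp: bal subset_eq closed)
    finally show ?thesis .
  qed
  have \<xi>l: "lin R P1 (regular R) \<xi>" using mod_hom_lin \<xi> by (simp add: D_def)
  have "lin R P1 M (\<lambda>y. \<xi> y \<odot>\<^bsub>M\<^esub> m)"
    using cl[OF \<xi>] m
    by (intro linI) (auto simp: lin_add[OF \<xi>l] lin_smult[OF \<xi>l] M.smult_l_distr M.smult_assoc1)
  from ext[OF this] obtain h where h: "lin R P0 M h" and hf: "\<And>y. y \<in> carrier P1 \<Longrightarrow> \<xi> y \<odot>\<^bsub>M\<^esub> m = h (f y)"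
    by blast
  interpret h: module_hom R P0 M h by (rule module_homI[OF P0.left_module_axioms M h])
  have hT: "h t \<in> carrier M" if "t \<in> T" for t using T(2) that by auto
  have fS: "f s \<in> carrier P0" if "s \<in> S" for s using S(2) that lin_closed[OF f] by auto
  have \<eta>0f: "\<eta>0 t (f s) \<in> carrier R" if "t \<in> T" "s \<in> S" for t s
    using lin_closed[OF T(3)[OF that(1)] fS[OF that(2)]] by simp
  have hfs: "h (f s) = (\<Oplus>\<^bsub>M\<^esub>t\<in>T. \<eta>0 t (f s) \<odot>\<^bsub>M\<^esub> h t)" if s: "s \<in> S" for s
  proof -
    have "h (f s) = h (\<Oplus>\<^bsub>P0\<^esub>t\<in>T. \<eta>0 t (f s) \<odot>\<^bsub>P0\<^esub> t)" using \<eta>0[OF fS[OF s]] by simp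
    also have "\<dots> = (\<Oplus>\<^bsub>M\<^esub>t\<in>T. h (\<eta>0 t (f s) \<odot>\<^bsub>P0\<^esub> t))"
      using T(1,2) \<eta>0f s by (intro h.finsum) (auto simp: subset_eq)
    also have "\<dots> = (\<Oplus>\<^bsub>M\<^esub>t\<in>T. \<eta>0 t (f s) \<odot>\<^bsub>M\<^esub> h t)"
      using T(2) \<eta>0f s hT by (intro M.M.finsum_cong') (auto simp: h.smult subset_eq)
    finally show ?thesis .
  qed
  define \<zeta> where "\<zeta> t = (\<lambda>y\<in>carrier P1. \<eta>0 t (f y))" for t
  have \<zeta>: "\<zeta> t \<in> carrier D" if "t \<in> T" for t
    unfolding \<zeta>_def D_def using restrict_mod_hom[OF P1.left_module_axioms lin_comp[OF f T(3)[OF that]]] by simp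
  have cl2: "\<Phi> (\<eta>0 t (f s) \<odot>\<^bsub>M\<^esub> h t) (e s) \<in> carrier J" if "t \<in> T" "s \<in> S" for t s
    using \<eta>0f[OF that] hT[OF that(1)] e[OF that(2)] by (intro closed) auto
  have "\<Phi> m \<xi> = (\<Oplus>\<^bsub>J\<^esub>s\<in>S. \<Phi> (h (f s)) (e s))"
    unfolding expand[OF m \<xi>] using S(2) hf fS e by (intro J.M.finsum_cong') (auto simp: closed subset_eq)
  also have "\<dots> = (\<Oplus>\<^bsub>J\<^esub>s\<in>S. \<Oplus>\<^bsub>J\<^esub>t\<in>T. \<Phi> (\<eta>0 t (f s) \<odot>\<^bsub>M\<^esub> h t) (e s))"
  proof (intro J.M.finsum_cong' refl)
    fix s assume s: "s \<in> S"
    show "\<Phi> (h (f s)) (e s) = (\<Oplus>\<^bsub>J\<^esub>t\<in>T. \<Phi> (\<eta>0 t (f s) \<odot>\<^bsub>M\<^esub> h t) (e s))"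
      unfolding hfs[OF s] using \<eta>0f hT e s
      by (intro additive_finsum[OF M.M.abelian_group_axioms J.M.abelian_group_axioms T(1), where f = "\<lambda>m. \<Phi> m (e s)"] closed addl) auto
  qed (use cl2 in \<open>auto intro!: J.M.finsum_closed\<close>)
  \<comment> \<open>After the exchange the inner sum over \<open>s\<close> is the expansion of
    \<open>\<Phi> (h t) (\<zeta> t)\<close>, where \<open>\<zeta> t\<close> is a functional that
    factors through \<open>f\<close>.\<close>
  also have "\<dots> = (\<Oplus>\<^bsub>J\<^esub>t\<in>T. \<Oplus>\<^bsub>J\<^esub>s\<in>S. \<Phi> (\<eta>0 t (f s) \<odot>\<^bsub>M\<^esub> h t) (e s))"
    using cl2 by (intro J.finsum_swap S(1) T(1)) auto
  also have "\<dots> = (\<Oplus>\<^bsub>J\<^esub>t\<in>T. \<Phi> (h t) (\<zeta> t))"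
  proof (intro J.M.finsum_cong' refl)
    fix t assume t: "t \<in> T"
    have "\<zeta> t s = \<eta>0 t (f s)" if "s \<in> S" for s using that S(2) by (auto simp: \<zeta>_def)
    then show "(\<Oplus>\<^bsub>J\<^esub>s\<in>S. \<Phi> (\<eta>0 t (f s) \<odot>\<^bsub>M\<^esub> h t) (e s)) = \<Phi> (h t) (\<zeta> t)"
      unfolding expand[OF hT[OF t] \<zeta>[OF t]] using cl2 t by (intro J.M.finsum_cong') auto
  qed (use hT \<zeta> in \<open>auto intro!: closed\<close>)
  also have "\<dots> = (\<Oplus>\<^bsub>J\<^esub>t\<in>T. \<zero>\<^bsub>J\<^esub>)"
    using vanish hT T(3) by (intro J.M.finsum_cong') (auto simp: \<zeta>_def)
  finally show ?thesis by simp
qed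

lemma restrict_scalars_simps [simp]:
  "carrier (restrict_scalars \<Lambda> X) = carrier X" "add (restrict_scalars \<Lambda> X) = add X"
  "\<zero>\<^bsub>restrict_scalars \<Lambda> X\<^esub> = \<zero>\<^bsub>X\<^esub>"
  "r \<odot>\<^bsub>restrict_scalars \<Lambda> X\<^esub> x = (r \<odot>\<^bsub>\<Lambda>\<^esub> \<one>\<^bsub>\<Lambda>\<^esub>) \<odot>\<^bsub>X\<^esub> x"
  by (simp_all add: restrict_scalars_def make_module_def)

lemma dual_simps [simp]:
  "carrier (dual R \<Lambda> J X) = mod_hom R (restrict_scalars \<Lambda> X) J"
  "\<zero>\<^bsub>dual R \<Lambda> J X\<^esub> = (\<lambda>x\<in>carrier X. \<zero>\<^bsub>J\<^esub>)"
  "\<phi> \<oplus>\<^bsub>dual R \<Lambda> J X\<^esub> \<psi> = (\<lambda>x\<in>carrier X. \<phi> x \<oplus>\<^bsub>J\<^esub> \<psi> x)"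
  "a \<odot>\<^bsub>dual R \<Lambda> J X\<^esub> \<phi> = (\<lambda>x\<in>carrier X. \<phi> (a \<odot>\<^bsub>X\<^esub> x))"
  by (simp_all add: dual_def make_module_def)

text \<open>One half of the classical equivalence between \<open>Hom(M, tau M) = 0\<close> and
  surjectivity of \<open>Hom(P0, M) \<rightarrow> Hom(P1, M)\<close>. The transpose is built on a
  presentation picked by SOME, so \<open>extends\<close> speaks of every minimal presentation, and
  \<open>ex\<close> ensures that the picked one is minimal.\<close>

lemma tau_rigidI:
  fixes R :: "('r, 'z) ring_scheme" and \<Lambda> :: "('r, 'a, 'x) module_scheme" and M :: "'a fgm"
    and J :: "('r, 'j, 'w) module_scheme"
  assumes alg: "artin_algebra R \<Lambda>" and J: "left_module R J" and fgM: "fg_module \<Lambda> M"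
    and ex: "min_proj_presentation \<Lambda> M \<pi>"
    and extends: "\<And>P1 P0 f p g. \<lbrakk>min_proj_presentation \<Lambda> M (P1, P0, f, p); lin \<Lambda> P1 M g\<rbrakk> \<Longrightarrow>
      \<exists>h. lin \<Lambda> P0 M h \<and> (\<forall>y\<in>carrier P1. g y = h (f y))"
  shows "tau_rigid R \<Lambda> J M"
proof -
  interpret artin_algebra R \<Lambda> by (rule alg)
  interpret J: left_module R J by (rule J)
  have M: "left_module \<Lambda> M" using fgM by (simp add: fg_module_def)
  interpret M: left_module \<Lambda> M by (rule M)
  obtain P1 P0 f p where \<pi>: "(SOME \<pi>. min_proj_presentation \<Lambda> M \<pi>) = (P1, P0, f, p)"
    by (rule prod_cases4)
  have min: "min_proj_presentation \<Lambda> M (P1, P0, f, p)"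
    using someI[of "min_proj_presentation \<Lambda> M", OF ex] by (simp only: \<pi>)
  then have P: "projective \<Lambda> P1" "projective \<Lambda> P0"
    and p: "lin \<Lambda> P0 M p"
    and fK: "lin \<Lambda> P1 (restrict_module P0 {x \<in> carrier P0. p x = \<zero>\<^bsub>M\<^esub>}) f"
    using mod_hom_lin by (auto simp: min_proj_presentation_iff projective_cover_def)
  interpret P1: left_module \<Lambda> P1 using P(1) by (simp add: projective_def fg_module_def)
  interpret P0: left_module \<Lambda> P0 using P(2) by (simp add: projective_def fg_module_def)
  interpret p: module_hom \<Lambda> P0 M p by (rule module_homI[OF P0.left_module_axioms M p])
  have f: "lin \<Lambda> P1 P0 f"
    by (rule lin_unrestrict_codomain[OF P0.left_module_axioms p.kernel_submodule fK])
  define D where "D = ring_dual \<Lambda> P1"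
  define N where "N = (\<lambda>\<phi>. \<lambda>x\<in>carrier P1. \<phi> (f x)) ` mod_hom \<Lambda> P0 (regular \<Lambda>)"
  define X where "X = quotient_module D N"
  have tau: "tau R \<Lambda> J M = dual R \<Lambda> J X"
    by (simp add: tau_def transpose_module_def \<pi> X_def D_def N_def)
  interpret D: left_module "opposite \<Lambda>" D unfolding D_def by (rule P1.ring_dual_left_module)
  interpret D0: left_module "opposite \<Lambda>" "ring_dual \<Lambda> P0" by (rule P0.ring_dual_left_module)
  have fcl: "f x \<in> carrier P0" if "x \<in> carrier P1" for x using lin_closed[OF f that] .
  have mh: "(\<lambda>x\<in>carrier P1. \<phi> (f x)) \<in> carrier D" if "\<phi> \<in> mod_hom \<Lambda> P0 (regular \<Lambda>)" for \<phi>
    using restrict_mod_hom[OF P1.left_module_axioms lin_comp[OF f mod_hom_lin[OF that]]] by (simp add: D_def)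
  \<comment> \<open>Linearity of the transposed map makes its range \<open>N\<close> a submodule of
    the dual, so that the facts about quotient modules apply to the transpose
    \<open>X\<close>.\<close>
  interpret F: module_hom "opposite \<Lambda>" "ring_dual \<Lambda> P0" D "\<lambda>\<phi>. \<lambda>x\<in>carrier P1. \<phi> (f x)"
  proof (unfold_locales, rule linI)
    fix \<phi> \<psi> assume "\<phi> \<in> carrier (ring_dual \<Lambda> P0)" "\<psi> \<in> carrier (ring_dual \<Lambda> P0)"
    show "(\<lambda>x\<in>carrier P1. (\<phi> \<oplus>\<^bsub>ring_dual \<Lambda> P0\<^esub> \<psi>) (f x)) =
      (\<lambda>x\<in>carrier P1. \<phi> (f x)) \<oplus>\<^bsub>D\<^esub> (\<lambda>x\<in>carrier P1. \<psi> (f x))"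
      by (rule ext) (simp add: D_def fcl)
  next
    fix a \<phi>
    show "(\<lambda>x\<in>carrier P1. (a \<odot>\<^bsub>ring_dual \<Lambda> P0\<^esub> \<phi>) (f x)) = a \<odot>\<^bsub>D\<^esub> (\<lambda>x\<in>carrier P1. \<phi> (f x))"
      by (rule ext) (simp add: D_def fcl)
  qed (simp add: mh)
  have N: "submodule N (opposite \<Lambda>) D" using F.range_submodule by (simp add: N_def)
  note X = D.quotient_module_facts[OF N, folded X_def]
  interpret X: left_module "opposite \<Lambda>" X by (rule X(1))
  interpret q: module_hom "opposite \<Lambda>" D X "\<lambda>\<xi>. N +>\<^bsub>D\<^esub> \<xi>" by unfold_locales (rule X(2))
  \<comment> \<open>\<open>\<phi>\<close> is uncurried to the pairing of \<open>m\<close> and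
    \<open>\<xi>\<close> with value \<open>\<phi> m (N + \<xi>)\<close>. Linearity of
    \<open>\<phi>\<close> over the algebra is balancedness, and functionals that factor through
    \<open>f\<close> lie in \<open>N\<close>, the zero coset.\<close>
  have "\<phi> m x = \<zero>\<^bsub>J\<^esub>" if \<phi>: "\<phi> \<in> mod_hom \<Lambda> M (dual R \<Lambda> J X)" and m: "m \<in> carrier M" and x: "x \<in> carrier X"
    for \<phi> m x
  proof -
    have \<phi>l: "lin R (restrict_scalars \<Lambda> X) J (\<phi> m)" if "m \<in> carrier M" for m
      using lin_closed[OF mod_hom_lin[OF \<phi>] that] by (simp add: mod_hom_iff)
    note \<phi>add = lin_add[OF mod_hom_lin[OF \<phi>]] and \<phi>smult = lin_smult[OF mod_hom_lin[OF \<phi>]]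
    obtain \<xi> where \<xi>: "\<xi> \<in> carrier D" "x = N +>\<^bsub>D\<^esub> \<xi>" using x X(3) by auto
    have "\<phi> m (N +>\<^bsub>D\<^esub> \<xi>) = \<zero>\<^bsub>J\<^esub>"
    proof (rule balanced_vanishes[OF M P f extends[OF min] J, where \<Phi> = "\<lambda>m \<xi>. \<phi> m (N +>\<^bsub>D\<^esub> \<xi>)", folded D_def])
      show "\<phi> m (N +>\<^bsub>D\<^esub> \<xi>) \<in> carrier J" if "m \<in> carrier M" "\<xi> \<in> carrier D" for m \<xi>
        using lin_closed[OF \<phi>l[OF that(1)]] q.closed[OF that(2)] by simp
      show "\<phi> (m \<oplus>\<^bsub>M\<^esub> m') (N +>\<^bsub>D\<^esub> \<xi>) = \<phi> m (N +>\<^bsub>D\<^esub> \<xi>) \<oplus>\<^bsub>J\<^esub> \<phi> m' (N +>\<^bsub>D\<^esub> \<xi>)"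
        if "m \<in> carrier M" "m' \<in> carrier M" "\<xi> \<in> carrier D" for m m' \<xi>
        using \<phi>add[OF that(1,2)] q.closed[OF that(3)] by simp
      show "\<phi> m (N +>\<^bsub>D\<^esub> (\<xi> \<oplus>\<^bsub>D\<^esub> \<zeta>)) = \<phi> m (N +>\<^bsub>D\<^esub> \<xi>) \<oplus>\<^bsub>J\<^esub> \<phi> m (N +>\<^bsub>D\<^esub> \<zeta>)"
        if "m \<in> carrier M" "\<xi> \<in> carrier D" "\<zeta> \<in> carrier D" for m \<xi> \<zeta>
        using lin_add[OF \<phi>l[OF that(1)]] q.add[OF that(2,3)] q.closed[OF that(2)] q.closed[OF that(3)] by simp
      show "\<phi> (a \<odot>\<^bsub>M\<^esub> m) (N +>\<^bsub>D\<^esub> \<xi>) = \<phi> m (N +>\<^bsub>D\<^esub> (a \<odot>\<^bsub>D\<^esub> \<xi>))"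
        if "a \<in> carrier \<Lambda>" "m \<in> carrier M" "\<xi> \<in> carrier D" for a m \<xi>
        using \<phi>smult[OF that(1,2)] q.closed[OF that(3)] q.smult[of a \<xi>] that(1,3) by simp
      show "\<phi> m (N +>\<^bsub>D\<^esub> (\<lambda>y\<in>carrier P1. \<eta> (f y))) = \<zero>\<^bsub>J\<^esub>"
        if m: "m \<in> carrier M" and \<eta>: "lin \<Lambda> P0 (regular \<Lambda>) \<eta>" for m \<eta>
      proof -
        have "(\<lambda>y\<in>carrier P1. \<eta> (f y)) = (\<lambda>y\<in>carrier P1. restrict \<eta> (carrier P0) (f y))"
          by (rule ext) (simp add: fcl)
        also have "\<dots> \<in> N"
          unfolding N_def by (rule imageI) (rule restrict_mod_hom[OF P0.left_module_axioms \<eta>])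
        finally have "N +>\<^bsub>D\<^esub> (\<lambda>y\<in>carrier P1. \<eta> (f y)) = \<zero>\<^bsub>X\<^esub>"
          using X(4) D.submoduleD(1)[OF N] by blast
        moreover have "\<phi> m \<zero>\<^bsub>X\<^esub> = \<zero>\<^bsub>J\<^esub>"
          using lin_add[OF \<phi>l[OF m], of "\<zero>\<^bsub>X\<^esub>" "\<zero>\<^bsub>X\<^esub>"] lin_closed[OF \<phi>l[OF m], of "\<zero>\<^bsub>X\<^esub>"]
          by (simp add: J.M.add.r_cancel_one')
        ultimately show ?thesis by simp
      qed
    qed (use m \<xi> in auto)
    then show ?thesis by (simp add: \<xi>(2))
  qed
  note vanish = this
  \<comment> \<open>\<open>tau_rigid\<close> is an equality of sets, so the zero map must also be
    shown to be a homomorphism.\<close>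
  have "(\<lambda>x\<in>carrier X. \<zero>\<^bsub>J\<^esub>) \<in> mod_hom R (restrict_scalars \<Lambda> X) J"
    by (auto simp: mod_hom_def)
  then have zero: "(\<lambda>m\<in>carrier M. \<zero>\<^bsub>dual R \<Lambda> J X\<^esub>) \<in> mod_hom \<Lambda> M (dual R \<Lambda> J X)"
    by (auto simp: mod_hom_def intro!: ext)
  have "\<phi> = (\<lambda>m\<in>carrier M. \<zero>\<^bsub>dual R \<Lambda> J X\<^esub>)" if \<phi>: "\<phi> \<in> mod_hom \<Lambda> M (dual R \<Lambda> J X)" for \<phi>
  proof (rule extensionalityI[of _ "carrier M"])
    fix m assume m: "m \<in> carrier M"
    have "\<phi> m \<in> extensional (carrier X)"
      using lin_closed[OF mod_hom_lin[OF \<phi>] m] by (simp add: mod_hom_iff)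
    then have "\<phi> m = (\<lambda>x\<in>carrier X. \<zero>\<^bsub>J\<^esub>)"
      by (rule extensionalityI) (auto simp: vanish[OF \<phi> m])
    then show "\<phi> m = (\<lambda>m\<in>carrier M. \<zero>\<^bsub>dual R \<Lambda> J X\<^esub>) m" using m by simp
  qed (use \<phi> in \<open>simp_all add: mod_hom_iff\<close>)
  with zero have "mod_hom \<Lambda> M (dual R \<Lambda> J X) = {\<lambda>m\<in>carrier M. \<zero>\<^bsub>dual R \<Lambda> J X\<^esub>}"
    by blast
  then show ?thesis using fgM by (simp add: tau_rigid_def tau)
qed

text \<open>\<open>Q\<close> has the generators of \<open>A\<close> without the relation, and the
  kernel of \<open>p\<close> is generated by \<open>s = \<Sum> x k w k\<close>. As the
  \<open>x k\<close> lie in \<open>r\<close>, the whole kernel is killed by \<open>r\<close>, which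
  gives essentiality directly.\<close>

lemma presented_cover:
  fixes R :: "('a, 'x) ring_scheme"
  assumes A: "presented R A I \<epsilon> x u" and r: "ideal r R"
    and rr: "\<And>a b. \<lbrakk>a \<in> r; b \<in> r\<rbrakk> \<Longrightarrow> a \<otimes>\<^bsub>R\<^esub> b = \<zero>\<^bsub>R\<^esub>" and x: "x \<in> I \<rightarrow> r"
  obtains Q :: "'a fgm" and w p where "presented R Q I \<epsilon> (\<lambda>_. \<zero>\<^bsub>R\<^esub>) w" "lin R Q A p" "p ` carrier Q = carrier A"
    "{y \<in> carrier Q. p y = \<zero>\<^bsub>A\<^esub>} = {a \<odot>\<^bsub>Q\<^esub> (\<Oplus>\<^bsub>Q\<^esub>k\<in>I. x k \<odot>\<^bsub>Q\<^esub> w k) | a. a \<in> carrier R}"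
    "\<And>N. \<lbrakk>submodule N R Q; p ` N = carrier A\<rbrakk> \<Longrightarrow> N = carrier Q"
proof -
  note D = presentedD[OF A]
  interpret A: left_module R A by (rule D(1))
  interpret r: ideal r R by (rule r)
  have xc: "x k \<in> carrier R" "x k \<in> r" and \<epsilon>c: "\<epsilon> k \<in> carrier R" and uc: "u k \<in> carrier A" if "k \<in> I" for k
    using that D(4,5,6) x by auto
  obtain Q :: "'a fgm" and w where Q: "presented R Q I \<epsilon> (\<lambda>_. \<zero>\<^bsub>R\<^esub>) w"
    by (rule A.exists_presented[OF D(3,5), of "\<lambda>_. \<zero>\<^bsub>R\<^esub>"]) (use \<epsilon>c D(7) in auto)
  note E = presentedD[OF Q]
  interpret Q: left_module R Q by (rule E(1))
  have wc: "w k \<in> carrier Q" if "k \<in> I" for k using E(4) that by blast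
  obtain p where p: "lin R Q A p" "\<And>k. k \<in> I \<Longrightarrow> p (w k) = u k"
    and plc: "\<And>c. c \<in> I \<rightarrow> carrier R \<Longrightarrow> p (\<Oplus>\<^bsub>Q\<^esub>k\<in>I. c k \<odot>\<^bsub>Q\<^esub> w k) = (\<Oplus>\<^bsub>A\<^esub>k\<in>I. c k \<odot>\<^bsub>A\<^esub> u k)"
    using presented_idem[OF A] A.lcomb_zero[OF D(4)]
    by (rule_tac hom_from_presented[OF Q D(1) D(4)]) blast+
  interpret p: module_hom R Q A p by (rule module_homI[OF E(1) D(1) p(1)])
  define s where "s = (\<Oplus>\<^bsub>Q\<^esub>k\<in>I. x k \<odot>\<^bsub>Q\<^esub> w k)"
  have s: "s \<in> carrier Q" unfolding s_def by (rule Q.lcomb_closed[OF D(3,6) E(4)])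
  have surj: "p ` carrier Q = carrier A"
    by (rule A.generated_subset[OF D(2) p.range_submodule]) (metis p(2) wc imageI)
  have ps: "p s = \<zero>\<^bsub>A\<^esub>"
    unfolding s_def plc[OF D(6)] using D(9)[OF D(6)] D(8) xc A.R.l_one by (metis A.R.one_closed)
  have ker: "{y \<in> carrier Q. p y = \<zero>\<^bsub>A\<^esub>} = {a \<odot>\<^bsub>Q\<^esub> s | a. a \<in> carrier R}"
  proof (intro equalityI subsetI)
    fix y assume "y \<in> {y \<in> carrier Q. p y = \<zero>\<^bsub>A\<^esub>}"
    then have y: "y \<in> carrier Q" "p y = \<zero>\<^bsub>A\<^esub>" by auto
    obtain c where c: "c \<in> I \<rightarrow> carrier R" "y = (\<Oplus>\<^bsub>Q\<^esub>k\<in>I. c k \<odot>\<^bsub>Q\<^esub> w k)" by (rule generatesE[OF E(2) y(1)])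
    then obtain a where a: "a \<in> carrier R" "\<And>k. k \<in> I \<Longrightarrow> c k \<otimes>\<^bsub>R\<^esub> \<epsilon> k = a \<otimes>\<^bsub>R\<^esub> x k"
      using D(9)[OF c(1)] plc[OF c(1)] y(2) by auto
    have "y = (\<Oplus>\<^bsub>Q\<^esub>k\<in>I. (a \<otimes>\<^bsub>R\<^esub> x k) \<odot>\<^bsub>Q\<^esub> w k)"
      unfolding c(2)
    proof (intro Q.M.finsum_cong' refl)
      fix k assume k: "k \<in> I"
      have ck: "c k \<in> carrier R" using c(1) k by blast
      show "c k \<odot>\<^bsub>Q\<^esub> w k = (a \<otimes>\<^bsub>R\<^esub> x k) \<odot>\<^bsub>Q\<^esub> w k"
        using Q.smult_assoc1[OF ck \<epsilon>c[OF k] wc[OF k]] presented_idem[OF Q k] a(2)[OF k] by simp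
    qed (use a(1) xc wc in auto)
    also have "\<dots> = a \<odot>\<^bsub>Q\<^esub> s" unfolding s_def by (rule Q.lcomb_smult[OF D(3,6) a(1) E(4)])
    finally show "y \<in> {a \<odot>\<^bsub>Q\<^esub> s | a. a \<in> carrier R}" using a(1) by blast
  next
    fix y assume "y \<in> {a \<odot>\<^bsub>Q\<^esub> s | a. a \<in> carrier R}"
    then show "y \<in> {y \<in> carrier Q. p y = \<zero>\<^bsub>A\<^esub>}" using s ps by (auto simp: p.smult)
  qed
  have rs: "b \<odot>\<^bsub>Q\<^esub> s = \<zero>\<^bsub>Q\<^esub>" if b: "b \<in> r" for b
  proof -
    have bc: "b \<in> carrier R" using r.a_subset b by blast
    have "b \<odot>\<^bsub>Q\<^esub> s = (\<Oplus>\<^bsub>Q\<^esub>k\<in>I. (b \<otimes>\<^bsub>R\<^esub> x k) \<odot>\<^bsub>Q\<^esub> w k)"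
      unfolding s_def by (rule Q.lcomb_smult[OF D(3,6) bc E(4), symmetric])
    also have "\<dots> = (\<Oplus>\<^bsub>Q\<^esub>k\<in>I. \<zero>\<^bsub>R\<^esub> \<odot>\<^bsub>Q\<^esub> w k)"
      using rr[OF b] xc wc by (intro Q.M.finsum_cong') auto
    finally show ?thesis using Q.lcomb_zero[OF E(4)] by simp
  qed
  have ess: "N = carrier Q" if N: "submodule N R Q" and pN: "p ` N = carrier A" for N
  proof -
    note NS = Q.submoduleD[OF N]
    \<comment> \<open>Surjectivity of \<open>p\<close> on \<open>N\<close> gives
      \<open>w k = n k + a k s\<close>. Multiplying by \<open>x k \<in> r\<close> removes the
      multiple of \<open>s\<close>; hence \<open>s = \<Sum> x k n k\<close> lies in
      \<open>N\<close>, and then so do all \<open>w k\<close>.\<close>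
    have "\<exists>n a. n \<in> N \<and> a \<in> carrier R \<and> w k = n \<oplus>\<^bsub>Q\<^esub> a \<odot>\<^bsub>Q\<^esub> s" if k: "k \<in> I" for k
    proof -
      obtain n where n: "n \<in> N" "p n = u k" using pN uc[OF k] by (metis imageE)
      have nc: "n \<in> carrier Q" using NS(1) n(1) by blast
      have "w k \<ominus>\<^bsub>Q\<^esub> n \<in> {y \<in> carrier Q. p y = \<zero>\<^bsub>A\<^esub>}"
        using nc wc[OF k] p(2)[OF k] n(2) uc[OF k] by (simp add: p.minus A.diff_eq_zero_iff)
      then obtain a where "a \<in> carrier R" "w k \<ominus>\<^bsub>Q\<^esub> n = a \<odot>\<^bsub>Q\<^esub> s" unfolding ker by blast
      then show ?thesis
        using Q.add_diff_cancel[OF wc[OF k] nc] n(1) by (intro exI[of _ n] exI[of _ a]) auto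
    qed
    then obtain n a where na: "\<And>k. k \<in> I \<Longrightarrow> n k \<in> N \<and> a k \<in> carrier R \<and> w k = n k \<oplus>\<^bsub>Q\<^esub> a k \<odot>\<^bsub>Q\<^esub> s"
      by metis
    have nc: "n k \<in> carrier Q" if "k \<in> I" for k using na[OF that] NS(1) by blast
    have "s = (\<Oplus>\<^bsub>Q\<^esub>k\<in>I. x k \<odot>\<^bsub>Q\<^esub> n k)"
      unfolding s_def
    proof (intro Q.M.finsum_cong' refl)
      fix k assume k: "k \<in> I"
      have "x k \<odot>\<^bsub>Q\<^esub> w k = x k \<odot>\<^bsub>Q\<^esub> n k \<oplus>\<^bsub>Q\<^esub> x k \<odot>\<^bsub>Q\<^esub> (a k \<odot>\<^bsub>Q\<^esub> s)"
        using na[OF k] nc[OF k] xc[OF k] s by (simp add: Q.smult_r_distr)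
      also have "x k \<odot>\<^bsub>Q\<^esub> (a k \<odot>\<^bsub>Q\<^esub> s) = \<zero>\<^bsub>Q\<^esub>"
        using na[OF k] xc[OF k] s rs[OF r.I_r_closed] by (simp add: Q.smult_assoc1[symmetric])
      finally show "x k \<odot>\<^bsub>Q\<^esub> w k = x k \<odot>\<^bsub>Q\<^esub> n k" using nc[OF k] xc[OF k] by simp
    qed (use nc xc in auto)
    also have "\<dots> \<in> N"
      using na xc NS(6) by (intro Q.submodule_finsum[OF N D(3)]) auto
    finally have "s \<in> N" .
    then have "w k \<in> N" if "k \<in> I" for k using na[OF that] NS(3,6) by metis
    then show "N = carrier Q" by (rule Q.generated_subset[OF E(2) N])
  qed
  show thesis using that[OF Q p(1) surj] ker ess unfolding s_def by blast
qed

text \<open>For projective \<open>A\<close> the cover of \<open>presented_cover\<close> splits. The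
  section is onto because the cover is essential, so the cover is injective and the element
  \<open>\<Sum> x k w k\<close> of its kernel is zero, which leaves only the zero relation. This
  detects that \<open>Y\<close> and \<open>T\<close> are not projective.\<close>

lemma presented_projective_relations:
  fixes R :: "('a, 'x) ring_scheme" and A P :: "'a fgm"
  assumes A: "presented R A I \<epsilon> x u" and r: "ideal r R"
    and rr: "\<And>a b. \<lbrakk>a \<in> r; b \<in> r\<rbrakk> \<Longrightarrow> a \<otimes>\<^bsub>R\<^esub> b = \<zero>\<^bsub>R\<^esub>" and x: "x \<in> I \<rightarrow> r"
    and P: "projective R P" and iso: "mod_iso R A P"
    and k: "k \<in> I"
  shows "x k = \<zero>\<^bsub>R\<^esub>"
proof -
  note D = presentedD[OF A]
  interpret A: left_module R A by (rule D(1))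
  obtain Q :: "'a fgm" and w p where Q: "presented R Q I \<epsilon> (\<lambda>_. \<zero>\<^bsub>R\<^esub>) w" and p: "lin R Q A p" "p ` carrier Q = carrier A"
    and ker: "{y \<in> carrier Q. p y = \<zero>\<^bsub>A\<^esub>} = {a \<odot>\<^bsub>Q\<^esub> (\<Oplus>\<^bsub>Q\<^esub>k\<in>I. x k \<odot>\<^bsub>Q\<^esub> w k) | a. a \<in> carrier R}"
    and ess: "\<And>N. \<lbrakk>submodule N R Q; p ` N = carrier A\<rbrakk> \<Longrightarrow> N = carrier Q"
    by (rule presented_cover[OF A r rr x]) blast+
  note E = presentedD[OF Q]
  interpret Q: left_module R Q by (rule E(1))
  have Pm: "left_module R P" using P by (simp add: projective_def fg_module_def)
  obtain \<phi> where \<phi>: "lin R A P \<phi>" "bij_betw \<phi> (carrier A) (carrier P)" by (rule mod_isoE[OF iso])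
  interpret \<phi>: module_hom R A P \<phi> by (rule module_homI[OF D(1) Pm \<phi>(1)])
  let ?\<psi> = "inv_into (carrier A) \<phi>"
  obtain h where h: "lin R P Q h" "\<And>y. y \<in> carrier P \<Longrightarrow> p (h y) = ?\<psi> y"
    using projective_lift[OF P Q.generates_fg_module[OF E(2)] D(1) p \<phi>.inv_lin[OF \<phi>(2)]] by blast
  have sec: "p (h (\<phi> a)) = a" if "a \<in> carrier A" for a
    using h(2)[OF \<phi>.closed[OF that]] inv_into_f_f[OF bij_betw_imp_inj_on[OF \<phi>(2)] that] by simp
  interpret h\<phi>: module_hom R A Q "\<lambda>a. h (\<phi> a)" by (rule module_homI[OF D(1) E(1) lin_comp[OF \<phi>(1) h(1)]])
  have "p ` (\<lambda>a. h (\<phi> a)) ` carrier A = carrier A" using sec by (simp add: image_image)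
  then have onto: "(\<lambda>a. h (\<phi> a)) ` carrier A = carrier Q" by (rule ess[OF h\<phi>.range_submodule])
  define s where "s = (\<Oplus>\<^bsub>Q\<^esub>k\<in>I. x k \<odot>\<^bsub>Q\<^esub> w k)"
  have s: "s \<in> carrier Q" unfolding s_def by (rule Q.lcomb_closed[OF D(3,6) E(4)])
  have "\<one>\<^bsub>R\<^esub> \<odot>\<^bsub>Q\<^esub> s \<in> {y \<in> carrier Q. p y = \<zero>\<^bsub>A\<^esub>}" unfolding ker s_def by blast
  then have ps: "p s = \<zero>\<^bsub>A\<^esub>" using s by simp
  obtain a where a: "a \<in> carrier A" "s = h (\<phi> a)" using onto s by blast
  then have "a = \<zero>\<^bsub>A\<^esub>" using sec ps by simp
  then have "s = \<zero>\<^bsub>Q\<^esub>" using a(2) h\<phi>.zero by simp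
  then have "\<exists>a\<in>carrier R. \<forall>k\<in>I. x k \<otimes>\<^bsub>R\<^esub> \<epsilon> k = a \<otimes>\<^bsub>R\<^esub> \<zero>\<^bsub>R\<^esub>"
    using E(9)[OF D(6)] by (simp add: s_def)
  then show ?thesis using D(8)[OF k] k by auto
qed

lemma presented_singleton:
  assumes A: "presented R A {i} \<epsilon> x u"
  shows "u i \<in> carrier A" "\<And>y. y \<in> carrier A \<Longrightarrow> \<exists>c\<in>carrier R. y = c \<odot>\<^bsub>A\<^esub> u i"
proof -
  note D = presentedD[OF A]
  interpret A: left_module R A by (rule D(1))
  show u: "u i \<in> carrier A" using D(4) by simp
  fix y assume "y \<in> carrier A"
  then obtain c where "c \<in> {i} \<rightarrow> carrier R" "y = (\<Oplus>\<^bsub>A\<^esub>k\<in>{i}. c k \<odot>\<^bsub>A\<^esub> u k)" by (rule generatesE[OF D(2)])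
  then show "\<exists>c\<in>carrier R. y = c \<odot>\<^bsub>A\<^esub> u i" using u by auto
qed

text \<open>The minimal presentation is \<open>\<Lambda> e \<rightarrow> \<Oplus> \<Lambda>
  \<epsilon> k \<rightarrow> A\<close>, the generator of \<open>\<Lambda> e\<close> going to the
  relation. \<open>ess1\<close> makes the first map essential onto the kernel. Maps
  \<open>\<Lambda> e \<rightarrow> A\<close> correspond to elements of \<open>e A\<close>, and
  \<open>factor\<close> says that they extend along the first map.\<close>

lemma tau_rigid_presented:
  fixes R :: "('r, 'z) ring_scheme" and \<Lambda> :: "('r, 'a, 'x) module_scheme" and A :: "'a fgm"
    and J :: "('r, 'j, 'w) module_scheme"
  assumes alg: "artin_algebra R \<Lambda>" and J: "left_module R J"
    and A: "presented \<Lambda> A I \<epsilon> x u" and r: "ideal r \<Lambda>"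
    and rr: "\<And>a b. \<lbrakk>a \<in> r; b \<in> r\<rbrakk> \<Longrightarrow> a \<otimes>\<^bsub>\<Lambda>\<^esub> b = \<zero>\<^bsub>\<Lambda>\<^esub>" and x: "x \<in> I \<rightarrow> r"
    and e: "e \<in> carrier \<Lambda>" "e \<otimes>\<^bsub>\<Lambda>\<^esub> e = e" and ex: "\<And>k. k \<in> I \<Longrightarrow> e \<otimes>\<^bsub>\<Lambda>\<^esub> x k = x k"
    and ess1: "\<And>a. \<lbrakk>a \<in> carrier \<Lambda>; a \<otimes>\<^bsub>\<Lambda>\<^esub> e = a; \<And>k. k \<in> I \<Longrightarrow> a \<otimes>\<^bsub>\<Lambda>\<^esub> x k = x k\<rbrakk> \<Longrightarrow>
      \<exists>b\<in>carrier \<Lambda>. b \<otimes>\<^bsub>\<Lambda>\<^esub> a = e"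
    and factor: "\<And>t. \<lbrakk>t \<in> carrier A; e \<odot>\<^bsub>A\<^esub> t = t\<rbrakk> \<Longrightarrow>
      \<exists>y\<in>I \<rightarrow> carrier A. t = (\<Oplus>\<^bsub>A\<^esub>k\<in>I. x k \<odot>\<^bsub>A\<^esub> y k)"
  shows "tau_rigid R \<Lambda> J A"
proof -
  note D = presentedD[OF A]
  interpret A: left_module \<Lambda> A by (rule D(1))
  obtain Q :: "'a fgm" and w p where Q: "presented \<Lambda> Q I \<epsilon> (\<lambda>_. \<zero>\<^bsub>\<Lambda>\<^esub>) w" and p: "lin \<Lambda> Q A p" "p ` carrier Q = carrier A"
    and ker': "{y \<in> carrier Q. p y = \<zero>\<^bsub>A\<^esub>} = {a \<odot>\<^bsub>Q\<^esub> (\<Oplus>\<^bsub>Q\<^esub>k\<in>I. x k \<odot>\<^bsub>Q\<^esub> w k) | a. a \<in> carrier \<Lambda>}"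
    and ess: "\<And>N. \<lbrakk>submodule N \<Lambda> Q; p ` N = carrier A\<rbrakk> \<Longrightarrow> N = carrier Q"
    by (rule presented_cover[OF A r rr x]) blast+
  note E = presentedD[OF Q]
  interpret Q: left_module \<Lambda> Q by (rule E(1))
  interpret p: module_hom \<Lambda> Q A p by (rule module_homI[OF E(1) D(1) p(1)])
  define s where "s = (\<Oplus>\<^bsub>Q\<^esub>k\<in>I. x k \<odot>\<^bsub>Q\<^esub> w k)"
  note ker = ker'[folded s_def]
  have s: "s \<in> carrier Q" unfolding s_def by (rule Q.lcomb_closed[OF D(3,6) E(4)])
  have xc: "x k \<in> carrier \<Lambda>" and wc: "w k \<in> carrier Q" if "k \<in> I" for k using D(6) E(4) that by auto
  have lcs: "(\<Oplus>\<^bsub>Q\<^esub>k\<in>I. (a \<otimes>\<^bsub>\<Lambda>\<^esub> x k) \<odot>\<^bsub>Q\<^esub> w k) = a \<odot>\<^bsub>Q\<^esub> s" if "a \<in> carrier \<Lambda>" for a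
    unfolding s_def by (rule Q.lcomb_smult[OF D(3,6) that E(4)])
  have es: "e \<odot>\<^bsub>Q\<^esub> s = s"
  proof -
    have "e \<odot>\<^bsub>Q\<^esub> s = (\<Oplus>\<^bsub>Q\<^esub>k\<in>I. (e \<otimes>\<^bsub>\<Lambda>\<^esub> x k) \<odot>\<^bsub>Q\<^esub> w k)" by (rule lcs[OF e(1), symmetric])
    also have "\<dots> = s" unfolding s_def using ex xc wc by (intro Q.M.finsum_cong') auto
    finally show ?thesis .
  qed
  \<comment> \<open>\<open>\<Lambda> e\<close> in presented form: a single generator indexed by the
    unit type, with the zero relation.\<close>
  obtain P :: "'a fgm" and v where P: "presented \<Lambda> P {()} (\<lambda>_. e) (\<lambda>_. \<zero>\<^bsub>\<Lambda>\<^esub>) v"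
    by (rule A.exists_presented[of "{()}" "\<lambda>_. e" "\<lambda>_. \<zero>\<^bsub>\<Lambda>\<^esub>"]) (use e in auto)
  note G = presentedD[OF P]
  interpret P: left_module \<Lambda> P by (rule G(1))
  note v = presented_singleton[OF P] presented_idem[OF P, of "()", simplified]
  obtain f where f: "lin \<Lambda> P Q f" "f (v ()) = s"
    using s es e by (rule_tac hom_from_presented[OF P E(1), of "\<lambda>_. s"]) auto
  interpret f: module_hom \<Lambda> P Q f by (rule module_homI[OF G(1) E(1) f(1)])
  define L where "L = {y \<in> carrier Q. p y = \<zero>\<^bsub>A\<^esub>}"
  have fim: "f ` carrier P = L"
  proof (intro equalityI subsetI)
    fix z assume "z \<in> f ` carrier P"
    then obtain y where y: "y \<in> carrier P" "z = f y" by blast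
    then obtain c where "c \<in> carrier \<Lambda>" "y = c \<odot>\<^bsub>P\<^esub> v ()" using v(2) by blast
    then have "z = c \<odot>\<^bsub>Q\<^esub> s" "c \<in> carrier \<Lambda>" using y(2) f.smult[OF _ v(1)] f(2) by auto
    then show "z \<in> L" unfolding L_def ker by blast
  next
    fix z assume "z \<in> L"
    then obtain c where "c \<in> carrier \<Lambda>" "z = c \<odot>\<^bsub>Q\<^esub> s" unfolding L_def ker by blast
    then have "z = f (c \<odot>\<^bsub>P\<^esub> v ())" "c \<odot>\<^bsub>P\<^esub> v () \<in> carrier P" using f.smult[OF _ v(1)] f(2) v(1) by auto
    then show "z \<in> f ` carrier P" by blast
  qed
  have fess: "N = carrier P" if N: "submodule N \<Lambda> P" and fN: "f ` N = L" for N
  proof -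
    note NS = P.submoduleD[OF N]
    have "s \<in> L" using fim f(2) v(1) by blast
    then obtain n where n: "n \<in> N" "f n = s" using fN by auto
    have "n \<in> carrier P" using n(1) NS(1) by blast
    then obtain c where c: "c \<in> carrier \<Lambda>" "n = c \<odot>\<^bsub>P\<^esub> v ()" using v(2) by blast
    \<comment> \<open>Replacing \<open>c\<close> by \<open>c e\<close> does not change its product
      with \<open>v ()\<close>, which \<open>e\<close> fixes, and it brings the coefficient into the
      form that \<open>ess1\<close> expects.\<close>
    define a where "a = c \<otimes>\<^bsub>\<Lambda>\<^esub> e"
    have a: "a \<in> carrier \<Lambda>" "a \<otimes>\<^bsub>\<Lambda>\<^esub> e = a" using c(1) e by (auto simp: a_def A.R.m_assoc)
    have na: "n = a \<odot>\<^bsub>P\<^esub> v ()" using c e v(1,3) by (simp add: a_def P.smult_assoc1)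
    have "a \<odot>\<^bsub>Q\<^esub> s = s" using n(2) na f.smult[OF a(1) v(1)] f(2) by simp
    then have "(\<Oplus>\<^bsub>Q\<^esub>k\<in>I. (a \<otimes>\<^bsub>\<Lambda>\<^esub> x k \<ominus>\<^bsub>\<Lambda>\<^esub> x k) \<odot>\<^bsub>Q\<^esub> w k) = \<zero>\<^bsub>Q\<^esub>"
      using a(1) xc s Q.lcomb_diff[OF D(3) _ D(6) E(4), of "\<lambda>k. a \<otimes>\<^bsub>\<Lambda>\<^esub> x k"] lcs[OF a(1)] s_def
      by (simp add: Pi_iff Q.diff_eq_zero_iff)
    then have "\<exists>b\<in>carrier \<Lambda>. \<forall>k\<in>I. (a \<otimes>\<^bsub>\<Lambda>\<^esub> x k \<ominus>\<^bsub>\<Lambda>\<^esub> x k) \<otimes>\<^bsub>\<Lambda>\<^esub> \<epsilon> k = b \<otimes>\<^bsub>\<Lambda>\<^esub> \<zero>\<^bsub>\<Lambda>\<^esub>"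
      using E(9)[of "\<lambda>k. a \<otimes>\<^bsub>\<Lambda>\<^esub> x k \<ominus>\<^bsub>\<Lambda>\<^esub> x k"] a(1) xc by (simp add: Pi_iff)
    then have z: "(a \<otimes>\<^bsub>\<Lambda>\<^esub> x k \<ominus>\<^bsub>\<Lambda>\<^esub> x k) \<otimes>\<^bsub>\<Lambda>\<^esub> \<epsilon> k = \<zero>\<^bsub>\<Lambda>\<^esub>" if "k \<in> I" for k using that by auto
    \<comment> \<open>Coordinates in \<open>Q\<close> are only determined after right multiplication
      by \<open>\<epsilon> k\<close>; nothing is lost here since
      \<open>x k \<epsilon> k = x k\<close>.\<close>
    have "a \<otimes>\<^bsub>\<Lambda>\<^esub> x k = x k" if k: "k \<in> I" for k
    proof -
      have \<epsilon>k: "\<epsilon> k \<in> carrier \<Lambda>" using D(5) k by blast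
      have "(a \<otimes>\<^bsub>\<Lambda>\<^esub> x k \<ominus>\<^bsub>\<Lambda>\<^esub> x k) \<otimes>\<^bsub>\<Lambda>\<^esub> \<epsilon> k = a \<otimes>\<^bsub>\<Lambda>\<^esub> x k \<ominus>\<^bsub>\<Lambda>\<^esub> x k"
        using a(1) xc[OF k] \<epsilon>k D(8)[OF k]
        by (simp add: A.R.minus_eq A.R.l_distr A.R.l_minus A.R.m_assoc)
      then have "a \<otimes>\<^bsub>\<Lambda>\<^esub> x k \<ominus>\<^bsub>\<Lambda>\<^esub> x k = \<zero>\<^bsub>\<Lambda>\<^esub>" using z[OF k] by (simp only:)
      then show ?thesis using a(1) xc[OF k] by simp
    qed
    then obtain b where b: "b \<in> carrier \<Lambda>" "b \<otimes>\<^bsub>\<Lambda>\<^esub> a = e" using ess1[OF a] by blast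
    have "b \<odot>\<^bsub>P\<^esub> n = v ()" using b a(1) v(1,3) by (simp add: na P.smult_assoc1[symmetric])
    then have "v () \<in> N" using NS(6)[OF b(1) n(1)] by simp
    then show ?thesis by (intro P.generated_subset[OF G(2) N]) auto
  qed
  have ker_res: "{y \<in> carrier Q. restrict p (carrier Q) y = \<zero>\<^bsub>A\<^esub>} = L" by (auto simp: L_def)
  have fL: "lin \<Lambda> P (restrict_module Q L) f"
    using fim by (intro lin_restrict_codomain[OF _ f(1)]) blast
  have proj: "projective \<Lambda> Q" "projective \<Lambda> P"
    by (rule presented_projective[OF Q], rule presented_projective[OF P])
  have min: "min_proj_presentation \<Lambda> A (P, Q, restrict f (carrier P), restrict p (carrier Q))"
    unfolding min_proj_presentation_iff ker_res projective_cover_def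
  proof (intro conjI allI impI)
    fix N assume "submodule N \<Lambda> Q \<and> restrict p (carrier Q) ` N = carrier A"
    moreover then have "restrict p (carrier Q) ` N = p ` N"
      using Q.submoduleD(1)[of N] by (intro image_cong) auto
    ultimately show "N = carrier Q" using ess by auto
  next
    fix N assume "submodule N \<Lambda> P \<and> restrict f (carrier P) ` N = carrier (restrict_module Q L)"
    moreover then have "restrict f (carrier P) ` N = f ` N"
      using P.submoduleD(1)[of N] by (intro image_cong) auto
    ultimately show "N = carrier P" using fess by auto
  qed (use proj p(2) fim restrict_mod_hom[OF E(1) p(1)] restrict_mod_hom[OF G(1) fL] in auto)
  have extends: "\<exists>h. lin \<Lambda> Q A h \<and> (\<forall>y\<in>carrier P. g y = h (f y))" if g: "lin \<Lambda> P A g" for g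
  proof -
    let ?t = "g (v ())"
    have t: "?t \<in> carrier A" "e \<odot>\<^bsub>A\<^esub> ?t = ?t"
      using lin_closed[OF g v(1)] lin_smult[OF g e(1) v(1)] v(3) by auto
    obtain y where y: "y \<in> I \<rightarrow> carrier A" "?t = (\<Oplus>\<^bsub>A\<^esub>k\<in>I. x k \<odot>\<^bsub>A\<^esub> y k)" using factor[OF t] by blast
    have \<epsilon>c: "\<epsilon> k \<in> carrier \<Lambda>" and yc: "y k \<in> carrier A" if "k \<in> I" for k using D(5) y(1) that by auto
    \<comment> \<open>The images are \<open>\<epsilon> k y k\<close> rather than \<open>y k\<close>,
      because the generator at \<open>k\<close> is fixed by \<open>\<epsilon> k\<close>. The sum
      against the \<open>x k\<close> stays the same by
      \<open>x k \<epsilon> k = x k\<close>.\<close>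
    obtain h where h: "lin \<Lambda> Q A h" and
      hlc: "\<And>c. c \<in> I \<rightarrow> carrier \<Lambda> \<Longrightarrow> h (\<Oplus>\<^bsub>Q\<^esub>k\<in>I. c k \<odot>\<^bsub>Q\<^esub> w k) = (\<Oplus>\<^bsub>A\<^esub>k\<in>I. c k \<odot>\<^bsub>A\<^esub> (\<epsilon> k \<odot>\<^bsub>A\<^esub> y k))"
    proof (rule hom_from_presented[OF Q D(1), of "\<lambda>k. \<epsilon> k \<odot>\<^bsub>A\<^esub> y k"])
      show "\<epsilon> k \<odot>\<^bsub>A\<^esub> (\<epsilon> k \<odot>\<^bsub>A\<^esub> y k) = \<epsilon> k \<odot>\<^bsub>A\<^esub> y k" if "k \<in> I" for k
        using A.smult_assoc1[OF \<epsilon>c[OF that] \<epsilon>c[OF that] yc[OF that]] D(7)[OF that] by simp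
      show "(\<Oplus>\<^bsub>A\<^esub>k\<in>I. \<zero>\<^bsub>\<Lambda>\<^esub> \<odot>\<^bsub>A\<^esub> (\<epsilon> k \<odot>\<^bsub>A\<^esub> y k)) = \<zero>\<^bsub>A\<^esub>"
        using \<epsilon>c yc by (intro A.lcomb_zero) auto
    qed (use \<epsilon>c yc in auto)
    have "h s = (\<Oplus>\<^bsub>A\<^esub>k\<in>I. x k \<odot>\<^bsub>A\<^esub> (\<epsilon> k \<odot>\<^bsub>A\<^esub> y k))" unfolding s_def by (rule hlc[OF D(6)])
    also have "\<dots> = ?t"
      unfolding y(2)
    proof (intro A.M.finsum_cong' refl)
      show "x k \<odot>\<^bsub>A\<^esub> (\<epsilon> k \<odot>\<^bsub>A\<^esub> y k) = x k \<odot>\<^bsub>A\<^esub> y k" if "k \<in> I" for k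
        using A.smult_assoc1[OF xc[OF that] \<epsilon>c[OF that] yc[OF that]] D(8)[OF that] by simp
    qed (use xc yc in auto)
    finally have "g y = h (f y)" if "y \<in> carrier P" for y
      by (intro lin_eq_on_generators[OF G(1) D(1) g lin_comp[OF f(1) h] G(2) _ that]) (simp add: f(2))
    then show ?thesis using h by blast
  qed
  show ?thesis
  proof (rule tau_rigidI[OF alg J A.generates_fg_module[OF D(2)] min])
    fix P1 P0 :: "'a fgm" and f1 p1 g
    assume m: "min_proj_presentation \<Lambda> A (P1, P0, f1, p1)" and g: "lin \<Lambda> P1 A g"
    show "\<exists>h. lin \<Lambda> P0 A h \<and> (\<forall>y\<in>carrier P1. g y = h (f1 y))"
      by (rule presentation_extension_transfer[OF A.generates_fg_module[OF D(2)] m proj(2,1) p f(1)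
        fim[unfolded L_def] extends g])
  qed
qed

section \<open>Modules with local endomorphism rings\<close>

text \<open>Locality of the endomorphism ring in the form used by exchange arguments: of
  \<open>f\<close> and \<open>1 - f\<close> at least one is invertible. Bijectivity suffices because
  inverses of bijective linear maps are linear.\<close>

definition local_end :: "('a, 'x) ring_scheme \<Rightarrow> ('a, 'm, 'y) module_scheme \<Rightarrow> bool" where
  "local_end R A \<longleftrightarrow> left_module R A \<and> carrier A \<noteq> {\<zero>\<^bsub>A\<^esub>} \<and>
    (\<forall>f. lin R A A f \<longrightarrow> bij_betw f (carrier A) (carrier A) \<or>
      bij_betw (\<lambda>a. a \<ominus>\<^bsub>A\<^esub> f a) (carrier A) (carrier A))"

lemma (in module_hom) bijI:
  assumes "\<And>y. \<lbrakk>y \<in> carrier A; f y = \<zero>\<^bsub>B\<^esub>\<rbrakk> \<Longrightarrow> y = \<zero>\<^bsub>A\<^esub>"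
    and "\<And>z. z \<in> carrier B \<Longrightarrow> \<exists>y\<in>carrier A. f y = z"
  shows "bij_betw f (carrier A) (carrier B)"
  unfolding bij_betw_def inj_iff using assms by (auto simp: image_iff)

text \<open>Endomorphisms of \<open>B\<close> are conjugated to endomorphisms of \<open>A\<close>,
  and conjugation is compatible with passing from \<open>f\<close> to \<open>1 - f\<close>.\<close>

lemma local_end_iso:
  assumes A: "local_end R A" and B: "left_module R B" and iso: "mod_iso R A B"
  shows "local_end R B"
proof -
  have lmA: "left_module R A" using A by (simp add: local_end_def)
  obtain \<phi> where \<phi>: "lin R A B \<phi>" "bij_betw \<phi> (carrier A) (carrier B)" by (rule mod_isoE[OF iso])
  interpret \<phi>: module_hom R A B \<phi> by (rule module_homI[OF lmA B \<phi>(1)])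
  define \<psi> where "\<psi> = inv_into (carrier A) \<phi>"
  have \<psi>: "lin R B A \<psi>" "bij_betw \<psi> (carrier B) (carrier A)"
    unfolding \<psi>_def by (rule \<phi>.inv_lin[OF \<phi>(2)], rule bij_betw_inv_into[OF \<phi>(2)])
  have \<phi>\<psi>: "\<phi> (\<psi> y) = y" if "y \<in> carrier B" for y
    unfolding \<psi>_def using bij_betw_inv_into_right[OF \<phi>(2) that] .
  interpret \<psi>: module_hom R B A \<psi> by (rule module_homI[OF B lmA \<psi>(1)])
  have conj: "bij_betw g (carrier B) (carrier B)"
    if g: "\<And>y. y \<in> carrier B \<Longrightarrow> g y = \<phi> (f (\<psi> y))" and f: "bij_betw f (carrier A) (carrier A)" for f g
  proof -
    have "bij_betw (\<phi> \<circ> (f \<circ> \<psi>)) (carrier B) (carrier B)"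
      by (rule bij_betw_trans[OF bij_betw_trans[OF \<psi>(2) f] \<phi>(2)])
    then show ?thesis by (rule bij_betw_cong[THEN iffD1, rotated]) (simp add: g)
  qed
  have "bij_betw f (carrier B) (carrier B) \<or> bij_betw (\<lambda>a. a \<ominus>\<^bsub>B\<^esub> f a) (carrier B) (carrier B)"
    if f: "lin R B B f" for f
  proof -
    have fc: "f y \<in> carrier B" if "y \<in> carrier B" for y using lin_closed[OF f that] .
    have "lin R A A (\<lambda>a. \<psi> (f (\<phi> a)))" by (rule lin_comp[OF lin_comp[OF \<phi>(1) f] \<psi>(1)])
    then consider "bij_betw (\<lambda>a. \<psi> (f (\<phi> a))) (carrier A) (carrier A)"
      | "bij_betw (\<lambda>a. a \<ominus>\<^bsub>A\<^esub> \<psi> (f (\<phi> a))) (carrier A) (carrier A)"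
      using A unfolding local_end_def by blast
    then show ?thesis
    proof cases
      case 1
      have "bij_betw f (carrier B) (carrier B)" by (rule conj[OF _ 1]) (simp add: \<phi>\<psi> fc)
      then show ?thesis ..
    next
      case 2
      have "bij_betw (\<lambda>a. a \<ominus>\<^bsub>B\<^esub> f a) (carrier B) (carrier B)"
        by (rule conj[OF _ 2]) (simp add: \<phi>\<psi> fc \<phi>.minus)
      then show ?thesis ..
    qed
  qed
  moreover have "carrier B \<noteq> {\<zero>\<^bsub>B\<^esub>}"
  proof
    assume *: "carrier B = {\<zero>\<^bsub>B\<^esub>}"
    have "x = \<zero>\<^bsub>A\<^esub>" if x: "x \<in> carrier A" for x
    proof -
      have "\<phi> x = \<phi> \<zero>\<^bsub>A\<^esub>" using \<phi>.closed[OF x] * by simp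
      then show ?thesis using inj_onD[OF bij_betw_imp_inj_on[OF \<phi>(2)]] x by auto
    qed
    then have "carrier A = {\<zero>\<^bsub>A\<^esub>}" using \<phi>.A.M.zero_closed by blast
    then show False using A by (simp add: local_end_def)
  qed
  ultimately show ?thesis using B by (simp add: local_end_def)
qed

section \<open>Direct summands and the Krull-Schmidt property\<close>

lemma complementary_projection:
  assumes M: "left_module R M" and c: "complementary R M N N'"
  obtains \<pi> where "lin R M M \<pi>" "\<And>y. y \<in> carrier M \<Longrightarrow> \<pi> y \<in> N" "\<And>y. y \<in> N \<Longrightarrow> \<pi> y = y"
    "\<And>y. y \<in> N' \<Longrightarrow> \<pi> y = \<zero>\<^bsub>M\<^esub>"
proof -
  interpret left_module R M by (rule M)
  have N: "submodule N R M" "submodule N' R M" "N \<inter> N' = {\<zero>\<^bsub>M\<^esub>}" "N <+>\<^bsub>M\<^esub> N' = carrier M"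
    using c by (auto simp: complementary_def)
  note S = submoduleD[OF N(1)] and S' = submoduleD[OF N(2)]
  have uniq: "a = b" if "a \<in> N" "b \<in> N" "a' \<in> N'" "b' \<in> N'" "a \<oplus>\<^bsub>M\<^esub> a' = b \<oplus>\<^bsub>M\<^esub> b'" for a b a' b'
  proof -
    have cl: "a \<in> carrier M" "b \<in> carrier M" "a' \<in> carrier M" "b' \<in> carrier M" using that S(1) S'(1) by auto
    have "a \<ominus>\<^bsub>M\<^esub> b = (a \<oplus>\<^bsub>M\<^esub> a') \<oplus>\<^bsub>M\<^esub> \<ominus>\<^bsub>M\<^esub> a' \<oplus>\<^bsub>M\<^esub> \<ominus>\<^bsub>M\<^esub> b"
      using cl by (simp add: M.a_assoc M.r_neg M.minus_eq)
    also have "\<dots> = (b \<oplus>\<^bsub>M\<^esub> b') \<oplus>\<^bsub>M\<^esub> \<ominus>\<^bsub>M\<^esub> a' \<oplus>\<^bsub>M\<^esub> \<ominus>\<^bsub>M\<^esub> b" using that(5) by simp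
    also have "\<dots> = (b \<oplus>\<^bsub>M\<^esub> \<ominus>\<^bsub>M\<^esub> b) \<oplus>\<^bsub>M\<^esub> (b' \<oplus>\<^bsub>M\<^esub> \<ominus>\<^bsub>M\<^esub> a')"
      using cl by (simp add: M.add.m_ac)
    also have "\<dots> = b' \<ominus>\<^bsub>M\<^esub> a'"
      using cl by (simp add: M.r_neg M.minus_eq)
    finally have "a \<ominus>\<^bsub>M\<^esub> b \<in> N \<inter> N'" using S(5)[OF that(1,2)] S'(5)[OF that(4,3)] by simp
    then show ?thesis using N(3) cl by (simp add: diff_eq_zero_iff)
  qed
  have ex: "\<exists>n. n \<in> N \<and> (\<exists>n'\<in>N'. y = n \<oplus>\<^bsub>M\<^esub> n')" if "y \<in> carrier M" for y
  proof -
    have "y \<in> N <+>\<^bsub>M\<^esub> N'" using that N(4) by simp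
    then show ?thesis by (auto simp: set_add_def')
  qed
  define \<pi> where "\<pi> y = (SOME n. n \<in> N \<and> (\<exists>n'\<in>N'. y = n \<oplus>\<^bsub>M\<^esub> n'))" for y
  have \<pi>: "\<pi> y \<in> N" "\<exists>n'\<in>N'. y = \<pi> y \<oplus>\<^bsub>M\<^esub> n'" if "y \<in> carrier M" for y
    using someI_ex[OF ex[OF that]] by (auto simp: \<pi>_def)
  have \<pi>_eq: "\<pi> (a \<oplus>\<^bsub>M\<^esub> a') = a" if a: "a \<in> N" "a' \<in> N'" for a a'
  proof -
    have "a \<oplus>\<^bsub>M\<^esub> a' \<in> carrier M" using a S(1) S'(1) by blast
    from \<pi>[OF this] obtain n' where "n' \<in> N'" "a \<oplus>\<^bsub>M\<^esub> a' = \<pi> (a \<oplus>\<^bsub>M\<^esub> a') \<oplus>\<^bsub>M\<^esub> n'" "\<pi> (a \<oplus>\<^bsub>M\<^esub> a') \<in> N" by blast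
    then show ?thesis using uniq[OF a(1) _ a(2)] by metis
  qed
  show thesis
  proof
    show "lin R M M \<pi>"
    proof (rule linI)
      show "\<pi> y \<in> carrier M" if "y \<in> carrier M" for y using \<pi>(1)[OF that] S(1) by blast
      fix y z assume y: "y \<in> carrier M" and z: "z \<in> carrier M"
      obtain y' where y': "y' \<in> N'" "y = \<pi> y \<oplus>\<^bsub>M\<^esub> y'" using \<pi>(2)[OF y] by blast
      obtain z' where z': "z' \<in> N'" "z = \<pi> z \<oplus>\<^bsub>M\<^esub> z'" using \<pi>(2)[OF z] by blast
      have cl: "\<pi> y \<in> carrier M" "\<pi> z \<in> carrier M" "y' \<in> carrier M" "z' \<in> carrier M"
        using \<pi>(1) y z y' z' S(1) S'(1) by auto
      have "y \<oplus>\<^bsub>M\<^esub> z = (\<pi> y \<oplus>\<^bsub>M\<^esub> y') \<oplus>\<^bsub>M\<^esub> (\<pi> z \<oplus>\<^bsub>M\<^esub> z')" using y'(2) z'(2) by simp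
      also have "\<dots> = (\<pi> y \<oplus>\<^bsub>M\<^esub> \<pi> z) \<oplus>\<^bsub>M\<^esub> (y' \<oplus>\<^bsub>M\<^esub> z')" using cl by (simp add: M.add.m_ac)
      finally show "\<pi> (y \<oplus>\<^bsub>M\<^esub> z) = \<pi> y \<oplus>\<^bsub>M\<^esub> \<pi> z"
        using \<pi>_eq[OF S(3) S'(3)] \<pi>(1) y z y'(1) z'(1) by simp
    next
      fix a y assume a: "a \<in> carrier R" and y: "y \<in> carrier M"
      obtain y' where y': "y' \<in> N'" "y = \<pi> y \<oplus>\<^bsub>M\<^esub> y'" using \<pi>(2)[OF y] by blast
      have cl: "\<pi> y \<in> carrier M" "y' \<in> carrier M" using \<pi>(1) y y' S(1) S'(1) by auto
      have "a \<odot>\<^bsub>M\<^esub> y = a \<odot>\<^bsub>M\<^esub> (\<pi> y \<oplus>\<^bsub>M\<^esub> y')" using y'(2) by simp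
      also have "\<dots> = a \<odot>\<^bsub>M\<^esub> \<pi> y \<oplus>\<^bsub>M\<^esub> a \<odot>\<^bsub>M\<^esub> y'" using a cl by (simp add: smult_r_distr)
      finally show "\<pi> (a \<odot>\<^bsub>M\<^esub> y) = a \<odot>\<^bsub>M\<^esub> \<pi> y"
        using \<pi>_eq[OF S(6)[OF a \<pi>(1)[OF y]] S'(6)[OF a y'(1)]] by simp
    qed
    show "\<pi> y \<in> N" if "y \<in> carrier M" for y by (rule \<pi>(1)[OF that])
    show "\<pi> y = y" if "y \<in> N" for y
    proof -
      have "y \<in> carrier M" using that S(1) by blast
      then show ?thesis using \<pi>_eq[OF that S'(2)] by simp
    qed
    show "\<pi> y = \<zero>\<^bsub>M\<^esub>" if "y \<in> N'" for y
    proof -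
      have "y \<in> carrier M" using that S'(1) by blast
      then show ?thesis using \<pi>_eq[OF S(2) that] by simp
    qed
  qed
qed

text \<open>An element \<open>y\<close> is corrected by the \<open>\<alpha> a\<close> with
  \<open>\<beta> (\<alpha> a) = \<beta> y\<close>, so that the rest lies in the kernel of
  \<open>\<beta>\<close>. The two parts meet in zero since the composite is injective.\<close>

lemma complementary_split:
  assumes A: "left_module R A" and M: "left_module R M" and \<alpha>: "lin R A M \<alpha>" and \<beta>: "lin R M A \<beta>"
    and bij: "bij_betw (\<lambda>a. \<beta> (\<alpha> a)) (carrier A) (carrier A)"
  shows "complementary R M (\<alpha> ` carrier A) {y \<in> carrier M. \<beta> y = \<zero>\<^bsub>A\<^esub>}"
proof -
  interpret A: left_module R A by (rule A)
  interpret M: left_module R M by (rule M)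
  interpret \<alpha>: module_hom R A M \<alpha> by (rule module_homI[OF A M \<alpha>])
  interpret \<beta>: module_hom R M A \<beta> by (rule module_homI[OF M A \<beta>])
  have inj: "a = \<zero>\<^bsub>A\<^esub>" if "a \<in> carrier A" "\<beta> (\<alpha> a) = \<zero>\<^bsub>A\<^esub>" for a
    using inj_onD[OF bij_betw_imp_inj_on[OF bij], of a "\<zero>\<^bsub>A\<^esub>"] that by simp
  show ?thesis
    unfolding complementary_def
  proof (intro conjI)
    show "submodule (\<alpha> ` carrier A) R M" by (rule \<alpha>.range_submodule)
    show "submodule {y \<in> carrier M. \<beta> y = \<zero>\<^bsub>A\<^esub>} R M" by (rule \<beta>.kernel_submodule)
    show "\<alpha> ` carrier A \<inter> {y \<in> carrier M. \<beta> y = \<zero>\<^bsub>A\<^esub>} = {\<zero>\<^bsub>M\<^esub>}"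
    proof (intro equalityI subsetI)
      fix y assume "y \<in> \<alpha> ` carrier A \<inter> {y \<in> carrier M. \<beta> y = \<zero>\<^bsub>A\<^esub>}"
      then obtain a where a: "a \<in> carrier A" "y = \<alpha> a" "\<beta> (\<alpha> a) = \<zero>\<^bsub>A\<^esub>" by auto
      have "a = \<zero>\<^bsub>A\<^esub>" by (rule inj[OF a(1,3)])
      then show "y \<in> {\<zero>\<^bsub>M\<^esub>}" using a(2) by simp
    next
      fix y assume "y \<in> {\<zero>\<^bsub>M\<^esub>}"
      then show "y \<in> \<alpha> ` carrier A \<inter> {y \<in> carrier M. \<beta> y = \<zero>\<^bsub>A\<^esub>}"
        using imageI[OF A.M.zero_closed, of \<alpha>] by simp
    qed
    show "\<alpha> ` carrier A <+>\<^bsub>M\<^esub> {y \<in> carrier M. \<beta> y = \<zero>\<^bsub>A\<^esub>} = carrier M"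
    proof (intro equalityI subsetI)
      fix y assume y: "y \<in> carrier M"
      have "\<beta> y \<in> (\<lambda>a. \<beta> (\<alpha> a)) ` carrier A" using bij_betw_imp_surj_on[OF bij] y by simp
      then obtain a where a: "a \<in> carrier A" "\<beta> y = \<beta> (\<alpha> a)" by blast
      have "y = \<alpha> a \<oplus>\<^bsub>M\<^esub> (y \<ominus>\<^bsub>M\<^esub> \<alpha> a)" using a(1) y by simp
      moreover have "y \<ominus>\<^bsub>M\<^esub> \<alpha> a \<in> {y \<in> carrier M. \<beta> y = \<zero>\<^bsub>A\<^esub>}"
        using a y by (simp add: \<beta>.minus A.diff_eq_zero_iff)
      ultimately show "y \<in> \<alpha> ` carrier A <+>\<^bsub>M\<^esub> {y \<in> carrier M. \<beta> y = \<zero>\<^bsub>A\<^esub>}"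
        unfolding set_add_def' using a(1) by blast
    qed (auto simp: set_add_def')
  qed
qed

text \<open>For the projection \<open>\<pi>\<close> onto \<open>N\<close> along \<open>N'\<close>,
  bijectivity of \<open>\<pi>\<close> forces \<open>N'\<close> to vanish, and bijectivity of
  \<open>1 - \<pi>\<close> forces \<open>N\<close> to vanish.\<close>

lemma local_end_indecomposable:
  assumes A: "local_end R A"
  shows "indecomposable R A"
proof -
  interpret left_module R A using A by (simp add: local_end_def)
  have "N = {\<zero>\<^bsub>A\<^esub>} \<or> N' = {\<zero>\<^bsub>A\<^esub>}" if c: "complementary R A N N'" for N N'
  proof -
    have S: "N \<subseteq> carrier A" "\<zero>\<^bsub>A\<^esub> \<in> N" "N' \<subseteq> carrier A" "\<zero>\<^bsub>A\<^esub> \<in> N'"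
      using c submoduleD(1,2) by (auto simp: complementary_def)
    obtain \<pi> where \<pi>: "lin R A A \<pi>" "\<And>y. y \<in> N \<Longrightarrow> \<pi> y = y" "\<And>y. y \<in> N' \<Longrightarrow> \<pi> y = \<zero>\<^bsub>A\<^esub>"
      by (rule complementary_projection[OF left_module_axioms c]) blast
    consider "bij_betw \<pi> (carrier A) (carrier A)" | "bij_betw (\<lambda>a. a \<ominus>\<^bsub>A\<^esub> \<pi> a) (carrier A) (carrier A)"
      using A \<pi>(1) unfolding local_end_def by blast
    then show ?thesis
    proof cases
      case 1
      have "y = \<zero>\<^bsub>A\<^esub>" if "y \<in> N'" for y
        using inj_onD[OF bij_betw_imp_inj_on[OF 1], of y "\<zero>\<^bsub>A\<^esub>"] \<pi>(3) S that by auto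
      then show ?thesis using S by blast
    next
      case 2
      have "y = \<zero>\<^bsub>A\<^esub>" if "y \<in> N" for y
        using inj_onD[OF bij_betw_imp_inj_on[OF 2], of y "\<zero>\<^bsub>A\<^esub>"] \<pi>(2) S that
        by (auto simp: M.minus_eq M.r_neg subset_eq)
      then show ?thesis using S by blast
    qed
  qed
  then show ?thesis using A by (simp add: indecomposable_def local_end_def)
qed

text \<open>The general identity that \<open>1 - \<alpha>\<rho>\<close> has inverse
  \<open>1 + \<alpha>u\<rho>\<close> if \<open>u\<close> is the inverse of
  \<open>1 - \<rho>\<alpha>\<close>. It explains the preimage \<open>z + \<alpha> v\<close> with
  \<open>v = u \<rho> z\<close>.\<close>

lemma bij_one_minus_swap:
  assumes A: "left_module R A" and M: "left_module R M" and \<alpha>: "lin R A M \<alpha>" and \<rho>: "lin R M A \<rho>"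
    and bij: "bij_betw (\<lambda>a. a \<ominus>\<^bsub>A\<^esub> \<rho> (\<alpha> a)) (carrier A) (carrier A)"
  shows "bij_betw (\<lambda>y. y \<ominus>\<^bsub>M\<^esub> \<alpha> (\<rho> y)) (carrier M) (carrier M)"
proof -
  interpret A: left_module R A by (rule A)
  interpret M: left_module R M by (rule M)
  interpret \<alpha>: module_hom R A M \<alpha> by (rule module_homI[OF A M \<alpha>])
  interpret \<rho>: module_hom R M A \<rho> by (rule module_homI[OF M A \<rho>])
  interpret h: module_hom R M M "\<lambda>y. y \<ominus>\<^bsub>M\<^esub> \<alpha> (\<rho> y)"
    by (rule module_homI[OF M M lin_minus[OF M lin_id lin_comp[OF \<rho> \<alpha>]]])
  show ?thesis
  proof (rule h.bijI)
    fix y assume y: "y \<in> carrier M" "y \<ominus>\<^bsub>M\<^esub> \<alpha> (\<rho> y) = \<zero>\<^bsub>M\<^esub>"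
    then have eq: "y = \<alpha> (\<rho> y)" using M.diff_eq_zero_iff[OF y(1), of "\<alpha> (\<rho> y)"] by simp
    have "\<rho> y \<ominus>\<^bsub>A\<^esub> \<rho> (\<alpha> (\<rho> y)) = \<zero>\<^bsub>A\<^esub>"
      using eq y(1) A.diff_eq_zero_iff[of "\<rho> y" "\<rho> y"] by simp
    then have "\<rho> y = \<zero>\<^bsub>A\<^esub>"
      using inj_onD[OF bij_betw_imp_inj_on[OF bij], of "\<rho> y" "\<zero>\<^bsub>A\<^esub>"] y(1) by (simp add: A.M.minus_eq A.M.r_neg)
    then show "y = \<zero>\<^bsub>M\<^esub>" using eq by simp
  next
    fix z assume z: "z \<in> carrier M"
    have "\<rho> z \<in> (\<lambda>a. a \<ominus>\<^bsub>A\<^esub> \<rho> (\<alpha> a)) ` carrier A" using bij_betw_imp_surj_on[OF bij] z by simp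
    then obtain v where v: "v \<in> carrier A" "v \<ominus>\<^bsub>A\<^esub> \<rho> (\<alpha> v) = \<rho> z" by auto
    let ?y = "z \<oplus>\<^bsub>M\<^esub> \<alpha> v"
    have "\<rho> ?y = (v \<ominus>\<^bsub>A\<^esub> \<rho> (\<alpha> v)) \<oplus>\<^bsub>A\<^esub> \<rho> (\<alpha> v)" using z v by (simp add: \<rho>.add)
    also have "\<dots> = v" using v(1) by (intro A.diff_add_cancel) auto
    finally have "?y \<ominus>\<^bsub>M\<^esub> \<alpha> (\<rho> ?y) = z"
      using z v(1) by (simp add: M.M.minus_eq M.M.a_assoc M.M.r_neg)
    then show "\<exists>y\<in>carrier M. y \<ominus>\<^bsub>M\<^esub> \<alpha> (\<rho> y) = z"
      using z v(1) by (intro bexI[of _ ?y]) auto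
  qed
qed

text \<open>
  If \<open>N\<close> is the image of the idempotent \<open>\<pi>\<close> and isomorphic to no component, then by induction on \<open>j\<close>
  all \<open>\<theta>\<^sub>j = 1 - \<pi> \<Sum>\<^sub>i\<^sub><\<^sub>j \<iota>\<^sub>i\<rho>\<^sub>i\<close> are bijective; but \<open>\<theta>\<^sub>n = 1 - \<pi>\<close> kills \<open>N\<close>.
\<close>

lemma summand_isomorphic_to_component:
  fixes A :: "nat \<Rightarrow> ('a, 'n, 'z) module_scheme"
  assumes M: "left_module R M"
    and \<iota>: "\<And>i. i < n \<Longrightarrow> lin R (A i) M (\<iota> i)" and \<rho>: "\<And>i. i < n \<Longrightarrow> lin R M (A i) (\<rho> i)"
    and sum: "\<And>y. y \<in> carrier M \<Longrightarrow> y = (\<Oplus>\<^bsub>M\<^esub>i\<in>{..<n}. \<iota> i (\<rho> i y))"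
    and loc: "\<And>i. i < n \<Longrightarrow> local_end R (A i)"
    and c: "complementary R M N N'" and N: "indecomposable R (restrict_module M N)"
  shows "\<exists>i<n. mod_iso R (A i) (restrict_module M N)"
proof (rule ccontr)
  assume no: "\<not> (\<exists>i<n. mod_iso R (A i) (restrict_module M N))"
  interpret M: left_module R M by (rule M)
  have A: "left_module R (A i)" if "i < n" for i using loc[OF that] by (simp add: local_end_def)
  have sN: "submodule N R M" using c by (simp add: complementary_def)
  note NS = M.submoduleD[OF sN]
  interpret N: left_module R "restrict_module M N" by (rule M.submodule_is_left_module[OF sN])
  obtain \<pi> where \<pi>: "lin R M M \<pi>" "\<And>y. y \<in> carrier M \<Longrightarrow> \<pi> y \<in> N" "\<And>y. y \<in> N \<Longrightarrow> \<pi> y = y"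
    by (rule complementary_projection[OF M c]) blast
  interpret \<pi>: module_hom R M M \<pi> by (rule module_homI[OF M M \<pi>(1)])
  have \<iota>\<rho>: "\<iota> i (\<rho> i y) \<in> carrier M" if "i < n" "y \<in> carrier M" for i y
    using lin_closed[OF \<iota>[OF that(1)] lin_closed[OF \<rho>[OF that(1)] that(2)]] .
  \<comment> \<open>Partial sums of the decomposition of the identity: \<open>S 0\<close> is zero
    and \<open>S n\<close> is the identity, so the maps \<open>\<theta> j\<close> interpolate
    between \<open>1\<close> and \<open>1 - \<pi>\<close>.\<close>
  define S where "S j y = (\<Oplus>\<^bsub>M\<^esub>i\<in>{..<j}. \<iota> i (\<rho> i y))" for j :: nat and y
  have S: "lin R M M (S j)" if "j \<le> n" for j
    using that
  proof (induction j)
    case 0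
    show ?case by (rule linI) (auto simp: S_def)
  next
    case (Suc j)
    have 1: "lin R M M (\<lambda>y. \<iota> j (\<rho> j y) \<oplus>\<^bsub>M\<^esub> S j y)"
      using Suc by (intro lin_plus[OF M] lin_comp[OF \<rho> \<iota>]) auto
    have 2: "S (Suc j) y = \<iota> j (\<rho> j y) \<oplus>\<^bsub>M\<^esub> S j y" if "y \<in> carrier M" for y
      unfolding S_def lessThan_Suc using \<iota>\<rho> that Suc.prems by (intro M.M.finsum_insert) auto
    show ?case by (rule lin_cong[OF M 1 2])
  qed
  have S_Suc: "S (Suc j) y = S j y \<oplus>\<^bsub>M\<^esub> \<iota> j (\<rho> j y)" if "j < n" "y \<in> carrier M" for j y
  proof -
    have "S (Suc j) y = \<iota> j (\<rho> j y) \<oplus>\<^bsub>M\<^esub> S j y"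
      unfolding S_def lessThan_Suc using \<iota>\<rho> that by (intro M.M.finsum_insert) auto
    then show ?thesis using \<iota>\<rho>[OF that] lin_closed[OF S, of j y] that by (simp add: M.M.a_comm)
  qed
  define \<theta> where "\<theta> j y = y \<ominus>\<^bsub>M\<^esub> \<pi> (S j y)" for j y
  have "bij_betw (\<theta> j) (carrier M) (carrier M)" if "j \<le> n" for j
    using that
  proof (induction j)
    case 0
    have "\<theta> 0 y = y" if "y \<in> carrier M" for y 
      using M.diff_add_cancel[OF that M.M.zero_closed] that by (simp add: \<theta>_def S_def)
    then show ?case by (intro bij_betw_cong[THEN iffD2, OF _ bij_betw_id]) simp
  next
    case (Suc j)
    then have j: "j < n" "j \<le> n" and bij: "bij_betw (\<theta> j) (carrier M) (carrier M)" by auto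
    have \<theta>: "lin R M M (\<theta> j)"
      unfolding \<theta>_def by (rule lin_minus[OF M lin_id lin_comp[OF S[OF j(2)] \<pi>(1)]])
    interpret \<theta>: module_hom R M M "\<theta> j" by (rule module_homI[OF M M \<theta>])
    interpret \<iota>: module_hom R "A j" M "\<iota> j" by (rule module_homI[OF A[OF j(1)] M \<iota>[OF j(1)]])
    interpret \<rho>: module_hom R M "A j" "\<rho> j" by (rule module_homI[OF M A[OF j(1)] \<rho>[OF j(1)]])
    define \<eta> where "\<eta> = inv_into (carrier M) (\<theta> j)"
    have \<eta>: "lin R M M \<eta>" unfolding \<eta>_def by (rule \<theta>.inv_lin[OF bij])
    have \<theta>\<eta>: "\<theta> j (\<eta> y) = y" if "y \<in> carrier M" for y
      unfolding \<eta>_def by (rule bij_betw_inv_into_right[OF bij that])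
    have \<eta>c: "\<eta> y \<in> carrier M" if "y \<in> carrier M" for y by (rule lin_closed[OF \<eta> that])
    \<comment> \<open>Chosen so that \<open>\<theta> (Suc j)\<close> is \<open>\<theta> j\<close>
      after \<open>1 - \<alpha> \<rho>\<^sub>j\<close>. By \<open>bij_one_minus_swap\<close> it
      suffices that \<open>1 - \<rho>\<^sub>j \<alpha>\<close> is bijective on \<open>A j\<close>,
      and by locality only a bijective \<open>\<rho>\<^sub>j \<alpha>\<close> has to be
      excluded.\<close>
    define \<alpha> where "\<alpha> a = \<eta> (\<pi> (\<iota> j a))" for a
    have \<alpha>: "lin R (A j) M \<alpha>"
      unfolding \<alpha>_def by (rule lin_comp[OF lin_comp[OF \<iota>.lin \<pi>(1)] \<eta>])
    have "\<not> bij_betw (\<lambda>a. \<rho> j (\<alpha> a)) (carrier (A j)) (carrier (A j))"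
    proof
      assume b: "bij_betw (\<lambda>a. \<rho> j (\<alpha> a)) (carrier (A j)) (carrier (A j))"
      \<comment> \<open>\<open>\<rho>\<^sub>j \<alpha>\<close> factors through \<open>N\<close> as
        \<open>\<beta> \<gamma>\<close>. If it is bijective, \<open>A j\<close> becomes a summand of
        the indecomposable \<open>N\<close>; then either \<open>A j\<close> is zero or
        \<open>N\<close> is isomorphic to it, and both are impossible.\<close>
      define \<gamma> where "\<gamma> a = \<pi> (\<iota> j a)" for a
      define \<beta> where "\<beta> y = \<rho> j (\<eta> y)" for y
      have b': "bij_betw (\<lambda>a. \<beta> (\<gamma> a)) (carrier (A j)) (carrier (A j))"
        using b by (simp add: \<alpha>_def \<beta>_def \<gamma>_def)
      have \<gamma>: "lin R (A j) (restrict_module M N) \<gamma>"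
        unfolding \<gamma>_def using \<pi>(2) by (intro lin_restrict_codomain lin_comp[OF \<iota>.lin \<pi>(1)]) auto
      have \<beta>: "lin R (restrict_module M N) (A j) \<beta>"
        unfolding \<beta>_def by (rule lin_restrict_domain[OF M sN lin_comp[OF \<eta> \<rho>.lin]])
      interpret \<gamma>: module_hom R "A j" "restrict_module M N" \<gamma>
        by (rule module_homI[OF A[OF j(1)] N.left_module_axioms \<gamma>])
      interpret \<beta>: module_hom R "restrict_module M N" "A j" \<beta>
        by (rule module_homI[OF N.left_module_axioms A[OF j(1)] \<beta>])
      have "complementary R (restrict_module M N) (\<gamma> ` carrier (A j))
          {y \<in> carrier (restrict_module M N). \<beta> y = \<zero>\<^bsub>A j\<^esub>}"
        by (rule complementary_split[OF A[OF j(1)] N.left_module_axioms \<gamma> \<beta> b'])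
      then have "\<gamma> ` carrier (A j) = {\<zero>\<^bsub>restrict_module M N\<^esub>} \<or>
          {y \<in> carrier (restrict_module M N). \<beta> y = \<zero>\<^bsub>A j\<^esub>} = {\<zero>\<^bsub>restrict_module M N\<^esub>}"
        using N unfolding indecomposable_def by blast
      then show False
      proof
        assume "\<gamma> ` carrier (A j) = {\<zero>\<^bsub>restrict_module M N\<^esub>}"
        then have "\<beta> (\<gamma> a) = \<zero>\<^bsub>A j\<^esub>" if "a \<in> carrier (A j)" for a
        proof -
          have "\<gamma> a = \<zero>\<^bsub>restrict_module M N\<^esub>"
            using \<open>\<gamma> ` carrier (A j) = _\<close> that by blast
          then show ?thesis using \<beta>.zero by simp
        qed
        then have "carrier (A j) = {\<zero>\<^bsub>A j\<^esub>}"
          using bij_betw_imp_surj_on[OF b'] \<iota>.A.M.zero_closed by fastforce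
        then show False using loc[OF j(1)] by (simp add: local_end_def)
      next
        assume ker: "{y \<in> carrier (restrict_module M N). \<beta> y = \<zero>\<^bsub>A j\<^esub>} = {\<zero>\<^bsub>restrict_module M N\<^esub>}"
        have "inj_on \<beta> (carrier (restrict_module M N))"
          unfolding \<beta>.inj_iff using ker by blast
        moreover have "\<beta> ` carrier (restrict_module M N) = carrier (A j)"
        proof (intro equalityI subsetI)
          fix a assume "a \<in> carrier (A j)"
          then have "a \<in> (\<lambda>a. \<beta> (\<gamma> a)) ` carrier (A j)" using bij_betw_imp_surj_on[OF b'] by simp
          then show "a \<in> \<beta> ` carrier (restrict_module M N)" using \<gamma>.closed by blast
        qed (use \<beta>.closed in blast)
        ultimately have "mod_iso R (restrict_module M N) (A j)"
          by (intro mod_isoI[OF N.left_module_axioms \<beta>]) (simp add: bij_betw_def)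
        then have "mod_iso R (A j) (restrict_module M N)"
          by (rule mod_iso_sym[OF N.left_module_axioms A[OF j(1)]])
        then show False using no j(1) by blast
      qed
    qed
    then have "bij_betw (\<lambda>a. a \<ominus>\<^bsub>A j\<^esub> \<rho> j (\<alpha> a)) (carrier (A j)) (carrier (A j))"
      using loc[OF j(1)] lin_comp[OF \<alpha> \<rho>.lin] unfolding local_end_def by blast
    then have "bij_betw (\<lambda>y. y \<ominus>\<^bsub>M\<^esub> \<alpha> (\<rho> j y)) (carrier M) (carrier M)"
      by (rule bij_one_minus_swap[OF A[OF j(1)] M \<alpha> \<rho>.lin])
    then have "bij_betw (\<theta> j \<circ> (\<lambda>y. y \<ominus>\<^bsub>M\<^esub> \<alpha> (\<rho> j y))) (carrier M) (carrier M)"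
      using bij by (rule bij_betw_trans)
    moreover have "(\<theta> j \<circ> (\<lambda>y. y \<ominus>\<^bsub>M\<^esub> \<alpha> (\<rho> j y))) y = \<theta> (Suc j) y" if y: "y \<in> carrier M" for y
    proof -
      have cl: "\<pi> (\<iota> j (\<rho> j y)) \<in> carrier M" "S j y \<in> carrier M" "\<iota> j (\<rho> j y) \<in> carrier M"
        using y lin_closed[OF S[OF j(2)] y] by auto
      have "\<theta> j (y \<ominus>\<^bsub>M\<^esub> \<alpha> (\<rho> j y)) = \<theta> j y \<ominus>\<^bsub>M\<^esub> \<pi> (\<iota> j (\<rho> j y))"
        using y cl \<eta>c by (simp add: \<theta>.minus \<alpha>_def \<theta>\<eta>)
      also have "\<dots> = \<theta> (Suc j) y"
        using y cl by (simp add: \<theta>_def S_Suc[OF j(1) y] \<pi>.add M.M.minus_eq M.M.minus_add M.M.a_assoc)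
      finally show ?thesis by simp
    qed
    ultimately show ?case by (rule bij_betw_cong[THEN iffD1, rotated])
  qed
  then have inj: "inj_on (\<theta> n) (carrier M)" by (simp add: bij_betw_def)
  have "y = \<zero>\<^bsub>M\<^esub>" if y: "y \<in> N" for y
  proof -
    have yc: "y \<in> carrier M" using y NS(1) by blast
    have "\<theta> n y = y \<ominus>\<^bsub>M\<^esub> y"
      using sum[OF yc] \<pi>(3)[OF y] by (simp add: \<theta>_def S_def)
    also have "\<dots> = \<zero>\<^bsub>M\<^esub>" using yc by (simp add: M.diff_eq_zero_iff)
    also have "\<dots> = \<theta> n \<zero>\<^bsub>M\<^esub>"
      using sum[OF M.M.zero_closed] M.diff_eq_zero_iff[of "\<zero>\<^bsub>M\<^esub>" "\<zero>\<^bsub>M\<^esub>"] by (simp add: \<theta>_def S_def)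
    finally show ?thesis using inj_onD[OF inj] yc by simp
  qed
  then have "N = {\<zero>\<^bsub>M\<^esub>}" using NS(2) by blast
  then show False using N by (simp add: indecomposable_def)
qed

text \<open>\<open>num_summands\<close> counts classes of all indecomposable summands of
  \<open>M\<close>, wherever they sit in it. \<open>summand_isomorphic_to_component\<close> puts
  each of them into the class of some \<open>N i\<close>, and \<open>noniso\<close> keeps these
  classes distinct.\<close>

lemma direct_sum_of_local:
  fixes A :: "nat \<Rightarrow> ('a, 'n, 'z) module_scheme"
  assumes M: "left_module R M"
    and \<iota>: "\<And>i. i < n \<Longrightarrow> lin R (A i) M (\<iota> i)" and \<rho>: "\<And>i. i < n \<Longrightarrow> lin R M (A i) (\<rho> i)"
    and \<rho>\<iota>: "\<And>i a. \<lbrakk>i < n; a \<in> carrier (A i)\<rbrakk> \<Longrightarrow> \<rho> i (\<iota> i a) = a"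
    and orth: "\<And>i j a. \<lbrakk>i < n; j < n; i \<noteq> j; a \<in> carrier (A j)\<rbrakk> \<Longrightarrow> \<rho> i (\<iota> j a) = \<zero>\<^bsub>A i\<^esub>"
    and sum: "\<And>y. y \<in> carrier M \<Longrightarrow> y = (\<Oplus>\<^bsub>M\<^esub>i\<in>{..<n}. \<iota> i (\<rho> i y))"
    and loc: "\<And>i. i < n \<Longrightarrow> local_end R (A i)"
    and noniso: "\<And>i j. \<lbrakk>i < n; j < n; mod_iso R (A i) (A j)\<rbrakk> \<Longrightarrow> i = j"
  shows "basic_module R M" "num_summands R M = n"
proof -
  interpret M: left_module R M by (rule M)
  have A: "left_module R (A i)" if "i < n" for i using loc[OF that] by (simp add: local_end_def)
  define N where "N i = \<iota> i ` carrier (A i)" for i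
  have \<iota>c: "\<iota> i a \<in> carrier M" if "i < n" "a \<in> carrier (A i)" for i a by (rule lin_closed[OF \<iota>[OF that(1)] that(2)])
  have \<rho>c: "\<rho> i y \<in> carrier (A i)" if "i < n" "y \<in> carrier M" for i y by (rule lin_closed[OF \<rho>[OF that(1)] that(2)])
  have bij: "bij_betw (\<lambda>a. \<rho> i (\<iota> i a)) (carrier (A i)) (carrier (A i))" if "i < n" for i
    by (intro bij_betw_cong[THEN iffD2, OF _ bij_betw_id]) (simp add: \<rho>\<iota> that)
  have compl: "complementary R M (N i) {y \<in> carrier M. \<rho> i y = \<zero>\<^bsub>A i\<^esub>}" if "i < n" for i
    unfolding N_def by (rule complementary_split[OF A[OF that] M \<iota>[OF that] \<rho>[OF that] bij[OF that]])
  have sN: "submodule (N i) R M" if "i < n" for i using compl[OF that] by (simp add: complementary_def)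
  have mN: "left_module R (restrict_module M (N i))" if "i < n" for i
    by (rule M.submodule_is_left_module[OF sN[OF that]])
  have iso: "mod_iso R (A i) (restrict_module M (N i))" if i: "i < n" for i
  proof (rule mod_isoI[OF A[OF i]])
    show "lin R (A i) (restrict_module M (N i)) (\<iota> i)"
      by (intro lin_restrict_codomain[OF _ \<iota>[OF i]]) (simp add: N_def)
    have "inj_on (\<iota> i) (carrier (A i))"
      by (rule inj_on_inverseI[of _ "\<rho> i"]) (rule \<rho>\<iota>[OF i])
    then show "bij_betw (\<iota> i) (carrier (A i)) (carrier (restrict_module M (N i)))"
      by (simp add: bij_betw_def N_def)
  qed
  have iso': "mod_iso R (restrict_module M (N i)) (A i)" if "i < n" for i
    by (rule mod_iso_sym[OF A[OF that] mN[OF that] iso[OF that]])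
  have indec: "indecomposable R (restrict_module M (N i))" if "i < n" for i
    by (rule local_end_indecomposable[OF local_end_iso[OF loc[OF that] mN[OF that] iso[OF that]]])
  have noniso': "i = j" if "i < n" "j < n" "mod_iso R (restrict_module M (N i)) (restrict_module M (N j))" for i j
    using mod_iso_trans[OF A[OF that(1)] mod_iso_trans[OF A[OF that(1)] iso[OF that(1)] that(3)] iso'[OF that(2)]]
    by (rule noniso[OF that(1,2)])
  have "internal_direct_sum R M {..<n} N"
    unfolding internal_direct_sum_def
  proof (intro conjI ballI)
    fix x assume x: "x \<in> carrier M"
    define c where "c = (\<lambda>i\<in>{..<n}. \<iota> i (\<rho> i x))"
    have c: "c \<in> (\<Pi>\<^sub>E i\<in>{..<n}. N i)" using \<rho>c x by (auto simp: c_def N_def)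
    have "(\<Oplus>\<^bsub>M\<^esub>i\<in>{..<n}. c i) = (\<Oplus>\<^bsub>M\<^esub>i\<in>{..<n}. \<iota> i (\<rho> i x))"
      using \<iota>c \<rho>c x by (intro M.M.finsum_cong') (auto simp: c_def)
    then have cx: "x = (\<Oplus>\<^bsub>M\<^esub>i\<in>{..<n}. c i)" using sum[OF x] by simp
    have uniq: "d = c" if d: "d \<in> (\<Pi>\<^sub>E i\<in>{..<n}. N i)" and dx: "x = (\<Oplus>\<^bsub>M\<^esub>i\<in>{..<n}. d i)" for d
    proof (rule PiE_ext[OF d c])
      fix j assume "j \<in> {..<n}"
      then have j: "j < n" by simp
      have "\<exists>a. a \<in> carrier (A i) \<and> d i = \<iota> i a" if "i < n" for i
        using PiE_mem[OF d, of i] that by (auto simp: N_def)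
      then obtain a where a: "\<And>i. i < n \<Longrightarrow> a i \<in> carrier (A i) \<and> d i = \<iota> i (a i)" by metis
      interpret \<rho>: module_hom R M "A j" "\<rho> j" by (rule module_homI[OF M A[OF j] \<rho>[OF j]])
      have "\<rho> j x = (\<Oplus>\<^bsub>A j\<^esub>i\<in>{..<n}. \<rho> j (d i))"
        unfolding dx using a \<iota>c by (intro \<rho>.finsum) auto
      also have "\<dots> = (\<Oplus>\<^bsub>A j\<^esub>i\<in>{..<n}. if j = i then \<rho> j (d i) else \<zero>\<^bsub>A j\<^esub>)"
        using a \<iota>c orth[OF j] by (intro \<rho>.B.M.finsum_cong') auto
      also have "\<dots> = \<rho> j (d j)"
        using j a \<iota>c by (intro \<rho>.B.M.finsum_singleton) auto
      also have "\<dots> = a j" using a[OF j] \<rho>\<iota>[OF j] by simp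
      finally show "d j = c j" using a[OF j] j by (simp add: c_def)
    qed
    show "\<exists>!c. c \<in> (\<Pi>\<^sub>E i\<in>{..<n}. N i) \<and> x = (\<Oplus>\<^bsub>M\<^esub>i\<in>{..<n}. c i)"
      by (rule ex1I[of _ c]) (use c cx uniq in blast)+
  qed (use sN in auto)
  then show "basic_module R M"
    unfolding basic_module_def using M indec noniso' by blast
  define T where "T = indecomposable_summands R M"
  define rel where "rel = {(N, N'). N \<in> T \<and> N' \<in> T \<and> mod_iso R (restrict_module M N) (restrict_module M N')}"
  have NT: "N i \<in> T" if "i < n" for i
    using compl[OF that] indec[OF that] by (auto simp: T_def indecomposable_summands_def)
  have mT: "left_module R (restrict_module M X)" if "X \<in> T" for X
    using that by (simp add: T_def indecomposable_summands_def indecomposable_def)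
  have eq: "equiv T rel"
  proof (rule equivI)
    show "rel \<subseteq> T \<times> T" by (auto simp: rel_def)
    show "refl_on T rel" by (rule refl_onI) (simp add: rel_def mod_iso_refl[OF mT])
    show "sym rel" by (rule symI) (use mod_iso_sym[OF mT mT] in \<open>simp add: rel_def\<close>)
    show "trans rel"
    proof (rule transI)
      fix X Y Z assume "(X, Y) \<in> rel" "(Y, Z) \<in> rel"
      then have "X \<in> T" "Z \<in> T" "mod_iso R (restrict_module M X) (restrict_module M Y)"
        "mod_iso R (restrict_module M Y) (restrict_module M Z)" by (auto simp: rel_def)
      then show "(X, Z) \<in> rel" using mod_iso_trans[OF mT] by (simp add: rel_def)
    qed
  qed
  have "T // rel = (\<lambda>i. rel `` {N i}) ` {..<n}"
  proof (intro equalityI subsetI)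
    fix C assume "C \<in> T // rel"
    then obtain X where X: "X \<in> T" "C = rel `` {X}" by (auto simp: quotient_def)
    then obtain X' where "complementary R M X X'" "indecomposable R (restrict_module M X)"
      by (auto simp: T_def indecomposable_summands_def)
    from summand_isomorphic_to_component[OF M \<iota> \<rho> sum loc this]
    obtain i where i: "i < n" "mod_iso R (A i) (restrict_module M X)" by blast
    have "mod_iso R (restrict_module M (N i)) (restrict_module M X)"
      by (rule mod_iso_trans[OF mN[OF i(1)] iso'[OF i(1)] i(2)])
    then have "(N i, X) \<in> rel" using NT[OF i(1)] X(1) by (simp add: rel_def)
    then have "C = rel `` {N i}" unfolding X(2) using equiv_class_eq[OF eq] by blast
    then show "C \<in> (\<lambda>i. rel `` {N i}) ` {..<n}" using i(1) by blast
  next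
    fix C assume "C \<in> (\<lambda>i. rel `` {N i}) ` {..<n}"
    then show "C \<in> T // rel" using NT by (auto simp: quotient_def)
  qed
  moreover have "inj_on (\<lambda>i. rel `` {N i}) {..<n}"
  proof (rule inj_onI)
    fix i j assume ij: "i \<in> {..<n}" "j \<in> {..<n}" "rel `` {N i} = rel `` {N j}"
    then have "(N i, N j) \<in> rel" using eq_equiv_class[OF _ eq NT, of "N i" j] by simp
    then show "i = j" using ij noniso'[of i j] by (simp add: rel_def)
  qed
  ultimately have "card (T // rel) = n" by (simp add: card_image)
  then show "num_summands R M = n" by (simp add: num_summands_def T_def rel_def)
qed

text \<open>Write \<open>h = 1 + N\<close>. Then \<open>N\<close> maps \<open>A\<close> into the set
  \<open>V\<close> of combinations with coefficients in \<open>r\<close>, and it kills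
  \<open>V\<close> because \<open>r V = 0\<close>. So \<open>N\<^sup>2 = 0\<close>, and
  \<open>1 - N\<close> is the inverse.\<close>

lemma unipotent_bij:
  assumes A: "left_module R A" and r: "ideal r R"
    and rr: "\<And>a b. \<lbrakk>a \<in> r; b \<in> r\<rbrakk> \<Longrightarrow> a \<otimes>\<^bsub>R\<^esub> b = \<zero>\<^bsub>R\<^esub>"
    and gen: "generates R A I u" and h: "lin R A A h"
    and unip: "\<And>k. k \<in> I \<Longrightarrow> \<exists>c\<in>I \<rightarrow> r. h (u k) \<ominus>\<^bsub>A\<^esub> u k = (\<Oplus>\<^bsub>A\<^esub>l\<in>I. c l \<odot>\<^bsub>A\<^esub> u l)"
  shows "bij_betw h (carrier A) (carrier A)"
proof -
  interpret A: left_module R A by (rule A)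
  interpret r: ideal r R by (rule r)
  interpret h: module_hom R A A h by (rule module_homI[OF A A h])
  have rc: "a \<in> carrier R" if "a \<in> r" for a using r.a_subset that by blast
  have I: "finite I" and u: "u \<in> I \<rightarrow> carrier A" using generatesD[OF gen] by auto
  define V where "V = {\<Oplus>\<^bsub>A\<^esub>l\<in>I. c l \<odot>\<^bsub>A\<^esub> u l | c. c \<in> I \<rightarrow> r}"
  have cR: "c \<in> I \<rightarrow> carrier R" if "c \<in> I \<rightarrow> r" for c using that rc by blast
  have VI: "(\<Oplus>\<^bsub>A\<^esub>l\<in>I. c l \<odot>\<^bsub>A\<^esub> u l) \<in> V" if "c \<in> I \<rightarrow> r" for c
    unfolding V_def using that by blast
  have V: "submodule V R A"
  proof (rule A.submoduleI)
    show "V \<subseteq> carrier A" unfolding V_def using A.lcomb_closed[OF I cR u] by auto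
    show "\<zero>\<^bsub>A\<^esub> \<in> V"
      using VI[of "\<lambda>_. \<zero>\<^bsub>R\<^esub>"] A.lcomb_zero[OF u] by simp
    fix a b assume "a \<in> V" "b \<in> V"
    then obtain c d where cd: "c \<in> I \<rightarrow> r" "d \<in> I \<rightarrow> r"
      "a = (\<Oplus>\<^bsub>A\<^esub>l\<in>I. c l \<odot>\<^bsub>A\<^esub> u l)" "b = (\<Oplus>\<^bsub>A\<^esub>l\<in>I. d l \<odot>\<^bsub>A\<^esub> u l)" unfolding V_def by blast
    then have "a \<oplus>\<^bsub>A\<^esub> b = (\<Oplus>\<^bsub>A\<^esub>l\<in>I. (c l \<oplus>\<^bsub>R\<^esub> d l) \<odot>\<^bsub>A\<^esub> u l)"
      using A.lcomb_add[OF I cR[OF cd(1)] cR[OF cd(2)] u] by simp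
    moreover have "(\<lambda>l. c l \<oplus>\<^bsub>R\<^esub> d l) \<in> I \<rightarrow> r" using cd by (auto intro: r.a_closed)
    ultimately show "a \<oplus>\<^bsub>A\<^esub> b \<in> V" by (simp only: VI)
  next
    fix a b assume a: "a \<in> carrier R" and "b \<in> V"
    then obtain c where c: "c \<in> I \<rightarrow> r" "b = (\<Oplus>\<^bsub>A\<^esub>l\<in>I. c l \<odot>\<^bsub>A\<^esub> u l)" unfolding V_def by blast
    then have "a \<odot>\<^bsub>A\<^esub> b = (\<Oplus>\<^bsub>A\<^esub>l\<in>I. (a \<otimes>\<^bsub>R\<^esub> c l) \<odot>\<^bsub>A\<^esub> u l)"
      using A.lcomb_smult[OF I cR[OF c(1)] a u] by simp
    moreover have "(\<lambda>l. a \<otimes>\<^bsub>R\<^esub> c l) \<in> I \<rightarrow> r" using c a by (auto intro: r.I_l_closed)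
    ultimately show "a \<odot>\<^bsub>A\<^esub> b \<in> V" by (simp only: VI)
  qed
  note VS = A.submoduleD[OF V]
  have rV: "b \<odot>\<^bsub>A\<^esub> z = \<zero>\<^bsub>A\<^esub>" if b: "b \<in> r" and "z \<in> V" for b z
  proof -
    obtain c where c: "c \<in> I \<rightarrow> r" "z = (\<Oplus>\<^bsub>A\<^esub>l\<in>I. c l \<odot>\<^bsub>A\<^esub> u l)" using \<open>z \<in> V\<close> unfolding V_def by blast
    have "b \<odot>\<^bsub>A\<^esub> z = (\<Oplus>\<^bsub>A\<^esub>l\<in>I. (b \<otimes>\<^bsub>R\<^esub> c l) \<odot>\<^bsub>A\<^esub> u l)"
      unfolding c(2) by (rule A.lcomb_smult[OF I cR[OF c(1)] rc[OF b] u, symmetric])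
    also have "\<dots> = (\<Oplus>\<^bsub>A\<^esub>l\<in>I. \<zero>\<^bsub>R\<^esub> \<odot>\<^bsub>A\<^esub> u l)"
      using rr[OF b] c(1) u by (intro A.M.finsum_cong') (auto simp: Pi_iff)
    finally show ?thesis using A.lcomb_zero[OF u] by simp
  qed
  have NV: "h y \<ominus>\<^bsub>A\<^esub> y \<in> V" if y: "y \<in> carrier A" for y
  proof -
    interpret N: module_hom R A A "\<lambda>y. h y \<ominus>\<^bsub>A\<^esub> y" by (rule module_homI[OF A A lin_minus[OF A h lin_id]])
    have "submodule {y \<in> carrier A. h y \<ominus>\<^bsub>A\<^esub> y \<in> V} R A"
      by (rule A.submoduleI) (use N.zero N.add N.smult VS in auto)
    moreover have "u k \<in> {y \<in> carrier A. h y \<ominus>\<^bsub>A\<^esub> y \<in> V}" if "k \<in> I" for k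
      using unip[OF that] u that by (auto simp: V_def)
    ultimately have "{y \<in> carrier A. h y \<ominus>\<^bsub>A\<^esub> y \<in> V} = carrier A" by (rule A.generated_subset[OF gen])
    then show ?thesis using y by blast
  qed
  \<comment> \<open>For \<open>c \<in> r\<close> one has \<open>h (c u) = c u + c (h u - u)\<close>,
    and the last term lies in \<open>r V = 0\<close>.\<close>
  have hV: "h z = z" if z: "z \<in> V" for z
  proof -
    obtain c where c: "c \<in> I \<rightarrow> r" "z = (\<Oplus>\<^bsub>A\<^esub>l\<in>I. c l \<odot>\<^bsub>A\<^esub> u l)" using z unfolding V_def by blast
    have "h z = (\<Oplus>\<^bsub>A\<^esub>l\<in>I. h (c l \<odot>\<^bsub>A\<^esub> u l))"
      unfolding c(2) using cR[OF c(1)] u by (intro h.finsum I) (auto simp: Pi_iff)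
    also have "\<dots> = z"
      unfolding c(2)
    proof (intro A.M.finsum_cong' refl)
      fix l assume l: "l \<in> I"
      have cl: "c l \<in> r" "c l \<in> carrier R" "u l \<in> carrier A" using c(1) cR[OF c(1)] u l by auto
      have "c l \<odot>\<^bsub>A\<^esub> h (u l) = c l \<odot>\<^bsub>A\<^esub> (u l \<oplus>\<^bsub>A\<^esub> (h (u l) \<ominus>\<^bsub>A\<^esub> u l))" using cl by simp
      also have "\<dots> = c l \<odot>\<^bsub>A\<^esub> u l \<oplus>\<^bsub>A\<^esub> c l \<odot>\<^bsub>A\<^esub> (h (u l) \<ominus>\<^bsub>A\<^esub> u l)"
        using cl by (intro A.smult_r_distr) auto
      also have "\<dots> = c l \<odot>\<^bsub>A\<^esub> u l" using cl rV[OF cl(1) NV] by simp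
      finally show "h (c l \<odot>\<^bsub>A\<^esub> u l) = c l \<odot>\<^bsub>A\<^esub> u l" using cl by (simp add: h.smult)
    qed (use cR[OF c(1)] u in \<open>auto simp: Pi_iff\<close>)
    finally show ?thesis .
  qed
  show ?thesis
  proof (rule h.bijI)
    fix y assume y: "y \<in> carrier A" "h y = \<zero>\<^bsub>A\<^esub>"
    have "\<ominus>\<^bsub>A\<^esub> y \<in> V" using NV[OF y(1)] y by (simp add: A.M.minus_eq)
    then have "y \<in> V" using VS(4)[of "\<ominus>\<^bsub>A\<^esub> y"] y(1) by simp
    then show "y = \<zero>\<^bsub>A\<^esub>" using hV y(2) by simp
  next
    fix z assume z: "z \<in> carrier A"
    let ?v = "h z \<ominus>\<^bsub>A\<^esub> z"
    have v: "?v \<in> V" "?v \<in> carrier A" using NV[OF z] VS(1) by auto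
    have "h (z \<ominus>\<^bsub>A\<^esub> ?v) = (z \<oplus>\<^bsub>A\<^esub> ?v) \<ominus>\<^bsub>A\<^esub> ?v" using z v hV[OF v(1)] by (simp add: h.minus)
    also have "\<dots> = z" using z v(2) by (simp add: A.M.minus_eq A.M.a_assoc A.M.r_neg)
    finally show "\<exists>y\<in>carrier A. h y = z" using z v(2) by blast
  qed
qed

text \<open>Endomorphisms of \<open>R \<epsilon>\<close> are right multiplications by elements
  \<open>a\<close> of the corner \<open>\<epsilon> R \<epsilon>\<close>. Outside \<open>r\<close>
  such an \<open>a\<close> is a unit of the corner and \<open>h\<close> is bijective; inside
  \<open>r\<close> the map \<open>1 - h\<close> is unipotent.\<close>

lemma local_end_singleton:
  assumes A: "presented R A {i} \<epsilon> (\<lambda>_. \<zero>\<^bsub>R\<^esub>) u" and r: "ideal r R"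
    and rr: "\<And>a b. \<lbrakk>a \<in> r; b \<in> r\<rbrakk> \<Longrightarrow> a \<otimes>\<^bsub>R\<^esub> b = \<zero>\<^bsub>R\<^esub>" and \<epsilon>r: "\<epsilon> i \<notin> r"
    and unit: "\<And>a. \<lbrakk>a \<in> carrier R; \<epsilon> i \<otimes>\<^bsub>R\<^esub> a = a; a \<otimes>\<^bsub>R\<^esub> \<epsilon> i = a; a \<notin> r\<rbrakk> \<Longrightarrow>
      \<exists>b\<in>carrier R. b \<otimes>\<^bsub>R\<^esub> a = \<epsilon> i \<and> a \<otimes>\<^bsub>R\<^esub> b = \<epsilon> i"
  shows "local_end R A"
proof -
  note D = presentedD[OF A]
  interpret A: left_module R A by (rule D(1))
  interpret r: ideal r R by (rule r)
  note u = presented_singleton[OF A]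
  have \<epsilon>u: "\<epsilon> i \<odot>\<^bsub>A\<^esub> u i = u i" by (rule presented_idem[OF A]) simp
  have \<epsilon>c: "\<epsilon> i \<in> carrier R" using D(5) by simp
  have rel: "c \<odot>\<^bsub>A\<^esub> u i = \<zero>\<^bsub>A\<^esub> \<longleftrightarrow> c \<otimes>\<^bsub>R\<^esub> \<epsilon> i = \<zero>\<^bsub>R\<^esub>" if "c \<in> carrier R" for c
    using D(9)[of "\<lambda>_. c"] that u(1) by (auto intro!: bexI[of _ "\<zero>\<^bsub>R\<^esub>"])
  have "bij_betw h (carrier A) (carrier A) \<or> bij_betw (\<lambda>a. a \<ominus>\<^bsub>A\<^esub> h a) (carrier A) (carrier A)"
    if h: "lin R A A h" for h
  proof -
    interpret h: module_hom R A A h by (rule module_homI[OF D(1) D(1) h])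
    obtain c where c: "c \<in> carrier R" "h (u i) = c \<odot>\<^bsub>A\<^esub> u i" using u(2)[OF h.closed[OF u(1)]] by blast
    define a where "a = \<epsilon> i \<otimes>\<^bsub>R\<^esub> c \<otimes>\<^bsub>R\<^esub> \<epsilon> i"
    have a: "a \<in> carrier R" "\<epsilon> i \<otimes>\<^bsub>R\<^esub> a = a" "a \<otimes>\<^bsub>R\<^esub> \<epsilon> i = a"
      using c(1) \<epsilon>c D(7)[of i] by (simp_all add: a_def A.R.m_assoc) (simp add: A.R.m_assoc[symmetric])
    have "h (u i) = \<epsilon> i \<odot>\<^bsub>A\<^esub> h (u i)" using h.smult[OF \<epsilon>c u(1)] \<epsilon>u by simp
    also have "\<dots> = \<epsilon> i \<odot>\<^bsub>A\<^esub> (c \<odot>\<^bsub>A\<^esub> (\<epsilon> i \<odot>\<^bsub>A\<^esub> u i))" using \<epsilon>u c(2) by simp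
    also have "\<dots> = a \<odot>\<^bsub>A\<^esub> u i" using c(1) \<epsilon>c u(1) by (simp add: a_def A.smult_assoc1)
    finally have hu: "h (u i) = a \<odot>\<^bsub>A\<^esub> u i" .
    have hcu: "h (d \<odot>\<^bsub>A\<^esub> u i) = (d \<otimes>\<^bsub>R\<^esub> a) \<odot>\<^bsub>A\<^esub> u i" if "d \<in> carrier R" for d
      using that a(1) u(1) by (simp add: h.smult hu A.smult_assoc1)
    show ?thesis
    proof (cases "a \<in> r")
      case False
      then obtain b where b: "b \<in> carrier R" "b \<otimes>\<^bsub>R\<^esub> a = \<epsilon> i" "a \<otimes>\<^bsub>R\<^esub> b = \<epsilon> i" using unit[OF a] by blast
      have "bij_betw h (carrier A) (carrier A)"
      proof (rule h.bijI)
        fix y assume y: "y \<in> carrier A" "h y = \<zero>\<^bsub>A\<^esub>"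
        obtain d where d: "d \<in> carrier R" "y = d \<odot>\<^bsub>A\<^esub> u i" using u(2)[OF y(1)] by blast
        have "d \<otimes>\<^bsub>R\<^esub> a \<otimes>\<^bsub>R\<^esub> \<epsilon> i = \<zero>\<^bsub>R\<^esub>" using y(2) hcu[OF d(1)] rel[of "d \<otimes>\<^bsub>R\<^esub> a"] d a(1) by simp
        then have "d \<otimes>\<^bsub>R\<^esub> a = \<zero>\<^bsub>R\<^esub>" using d(1) a(1,3) \<epsilon>c by (simp add: A.R.m_assoc)
        then have "d \<otimes>\<^bsub>R\<^esub> a \<otimes>\<^bsub>R\<^esub> b = \<zero>\<^bsub>R\<^esub>" using b(1) by simp
        then have "d \<otimes>\<^bsub>R\<^esub> \<epsilon> i = \<zero>\<^bsub>R\<^esub>" using d(1) a(1) b(1,3) by (simp add: A.R.m_assoc)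
        then show "y = \<zero>\<^bsub>A\<^esub>" using rel[OF d(1)] d(2) by simp
      next
        fix z assume "z \<in> carrier A"
        then obtain d where d: "d \<in> carrier R" "z = d \<odot>\<^bsub>A\<^esub> u i" using u(2) by blast
        have "h ((d \<otimes>\<^bsub>R\<^esub> b) \<odot>\<^bsub>A\<^esub> u i) = (d \<otimes>\<^bsub>R\<^esub> \<epsilon> i) \<odot>\<^bsub>A\<^esub> u i"
          using hcu[of "d \<otimes>\<^bsub>R\<^esub> b"] d(1) b a(1) by (simp add: A.R.m_assoc)
        also have "\<dots> = z" using d \<epsilon>c u(1) \<epsilon>u by (simp add: A.smult_assoc1)
        finally show "\<exists>y\<in>carrier A. h y = z" using d(1) b(1) u(1) by blast
      qed
      then show ?thesis ..
    next
      case True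
      interpret k: module_hom R A A "\<lambda>y. y \<ominus>\<^bsub>A\<^esub> h y"
        by (rule module_homI[OF D(1) D(1) lin_minus[OF D(1) lin_id h]])
      have "bij_betw (\<lambda>y. y \<ominus>\<^bsub>A\<^esub> h y) (carrier A) (carrier A)"
      proof (rule unipotent_bij[OF D(1) r rr D(2) k.lin])
        fix k assume "k \<in> {i}"
        then have k: "k = i" by simp
        have "u i \<ominus>\<^bsub>A\<^esub> h (u i) \<ominus>\<^bsub>A\<^esub> u i = \<ominus>\<^bsub>A\<^esub> h (u i)"
          using u(1) by (simp add: A.M.minus_eq A.M.a_assoc A.M.a_comm[of "\<ominus>\<^bsub>A\<^esub> h (u i)"] A.M.r_neg2 A.M.r_neg1)
        also have "\<dots> = (\<ominus>\<^bsub>R\<^esub> a) \<odot>\<^bsub>A\<^esub> u i" using a(1) u(1) by (simp add: hu A.smult_l_minus)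
        finally show "\<exists>c\<in>{i} \<rightarrow> r. u k \<ominus>\<^bsub>A\<^esub> h (u k) \<ominus>\<^bsub>A\<^esub> u k = (\<Oplus>\<^bsub>A\<^esub>l\<in>{i}. c l \<odot>\<^bsub>A\<^esub> u l)"
          using True a(1) u(1) k by (intro bexI[of _ "\<lambda>_. \<ominus>\<^bsub>R\<^esub> a"]) auto
      qed
      then show ?thesis ..
    qed
  qed
  moreover have "carrier A \<noteq> {\<zero>\<^bsub>A\<^esub>}"
  proof
    assume "carrier A = {\<zero>\<^bsub>A\<^esub>}"
    then have "\<one>\<^bsub>R\<^esub> \<odot>\<^bsub>A\<^esub> u i = \<zero>\<^bsub>A\<^esub>" using u(1) by auto
    then have "\<epsilon> i = \<zero>\<^bsub>R\<^esub>" using rel[of "\<one>\<^bsub>R\<^esub>"] \<epsilon>c by simp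
    then show False using \<epsilon>r by simp
  qed
  ultimately show ?thesis using D(1) by (simp add: local_end_def)
qed

text \<open>
  The cokernel \<open>Y\<close> of a minimal approximation. An endomorphism of \<open>Y\<close> lifts to a matrix \<open>H\<close> with
  \<open>xH = dx\<close>. By minimality of \<open>x\<close> the entries of \<open>H\<close> lie in \<open>r\<close> if \<open>d\<close> does, and otherwise
  inverting \<open>d\<close> yields an inverse of \<open>H\<close> modulo \<open>r\<close>.
\<close>

lemma local_end_cokernel:
  assumes A: "presented R A G \<epsilon> x u" and r: "ideal r R"
    and rr: "\<And>a b. \<lbrakk>a \<in> r; b \<in> r\<rbrakk> \<Longrightarrow> a \<otimes>\<^bsub>R\<^esub> b = \<zero>\<^bsub>R\<^esub>" and xr: "x \<in> G \<rightarrow> r"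
    and e: "e \<in> carrier R" "e \<otimes>\<^bsub>R\<^esub> e = e" and ex: "\<And>k. k \<in> G \<Longrightarrow> e \<otimes>\<^bsub>R\<^esub> x k = x k"
    and unit: "\<And>a. \<lbrakk>a \<in> carrier R; e \<otimes>\<^bsub>R\<^esub> a = a; a \<otimes>\<^bsub>R\<^esub> e = a; a \<notin> r\<rbrakk> \<Longrightarrow>
      \<exists>b\<in>carrier R. b \<otimes>\<^bsub>R\<^esub> a = e \<and> a \<otimes>\<^bsub>R\<^esub> b = e"
    and gen: "\<And>l y. \<lbrakk>l \<in> G; y \<in> carrier R; e \<otimes>\<^bsub>R\<^esub> y = y; y \<otimes>\<^bsub>R\<^esub> \<epsilon> l = y\<rbrakk> \<Longrightarrow>
      \<exists>h\<in>G \<rightarrow> carrier R. y = (\<Oplus>\<^bsub>R\<^esub>k\<in>G. x k \<otimes>\<^bsub>R\<^esub> h k) \<and>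
        (\<forall>k\<in>G. \<epsilon> k \<otimes>\<^bsub>R\<^esub> h k = h k \<and> h k \<otimes>\<^bsub>R\<^esub> \<epsilon> l = h k)"
    and min: "\<And>l h k. \<lbrakk>l \<in> G; h \<in> G \<rightarrow> carrier R; \<And>k. k \<in> G \<Longrightarrow> \<epsilon> k \<otimes>\<^bsub>R\<^esub> h k = h k \<and> h k \<otimes>\<^bsub>R\<^esub> \<epsilon> l = h k;
        (\<Oplus>\<^bsub>R\<^esub>k\<in>G. x k \<otimes>\<^bsub>R\<^esub> h k) = \<zero>\<^bsub>R\<^esub>; k \<in> G\<rbrakk> \<Longrightarrow> h k \<in> r"
    and nz: "carrier A \<noteq> {\<zero>\<^bsub>A\<^esub>}"
  shows "local_end R A"
proof -
  note D = presentedD[OF A]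
  interpret A: left_module R A by (rule D(1))
  interpret r: ideal r R by (rule r)
  interpret reg: left_module R "regular R" by (rule A.regular_left_module)
  have xc: "x k \<in> carrier R" "x k \<in> r" and \<epsilon>c: "\<epsilon> k \<in> carrier R" and uc: "u k \<in> carrier A" if "k \<in> G" for k
    using that D(4,5,6) xr by auto
  have \<epsilon>u: "\<epsilon> k \<odot>\<^bsub>A\<^esub> u k = u k" if "k \<in> G" for k by (rule presented_idem[OF A that])
  \<comment> \<open>\<open>H\<close> is the matrix of an endomorphism of
    \<open>\<Oplus> R \<epsilon> k\<close>. The equation \<open>x H = d x\<close> says that it
    carries the relation to a multiple of the relation, so that it descends to the cokernel
    \<open>A\<close>.\<close>
  define mat where "mat H d \<longleftrightarrow> (\<forall>k\<in>G. \<forall>l\<in>G. H k l \<in> carrier R \<and> \<epsilon> k \<otimes>\<^bsub>R\<^esub> H k l = H k l \<and> H k l \<otimes>\<^bsub>R\<^esub> \<epsilon> l = H k l) \<and>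
    d \<in> carrier R \<and> (\<forall>l\<in>G. (\<Oplus>\<^bsub>R\<^esub>k\<in>G. x k \<otimes>\<^bsub>R\<^esub> H k l) = d \<otimes>\<^bsub>R\<^esub> x l)" for H d
  have matD: "H k l \<in> carrier R" "\<epsilon> k \<otimes>\<^bsub>R\<^esub> H k l = H k l" "H k l \<otimes>\<^bsub>R\<^esub> \<epsilon> l = H k l"
    if "mat H d" "k \<in> G" "l \<in> G" for H d k l using that by (auto simp: mat_def)
  have matx: "d \<in> carrier R" "\<And>l. l \<in> G \<Longrightarrow> (\<Oplus>\<^bsub>R\<^esub>k\<in>G. x k \<otimes>\<^bsub>R\<^esub> H k l) = d \<otimes>\<^bsub>R\<^esub> x l"
    if "mat H d" for H d using that by (auto simp: mat_def)
  \<comment> \<open>From \<open>d d' = e\<close> follows \<open>x H H' = d d' x = x\<close>. So the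
    row \<open>x\<close> times the difference of \<open>H H'\<close> and the identity is zero,
    \<open>min\<close> puts the entries of the difference in \<open>r\<close>, and the composite is
    unipotent.\<close>
  have comp: "bij_betw (\<lambda>y. g' (g y)) (carrier A) (carrier A)"
    if g: "lin R A A g" and g': "lin R A A g'" and H: "mat H d" and H': "mat H' d'"
      and gu: "\<And>k. k \<in> G \<Longrightarrow> g (u k) = (\<Oplus>\<^bsub>A\<^esub>l\<in>G. H k l \<odot>\<^bsub>A\<^esub> u l)"
      and gu': "\<And>k. k \<in> G \<Longrightarrow> g' (u k) = (\<Oplus>\<^bsub>A\<^esub>l\<in>G. H' k l \<odot>\<^bsub>A\<^esub> u l)"
      and dd: "d \<otimes>\<^bsub>R\<^esub> d' = e"
    for g g' H H' d d'
  proof (rule unipotent_bij[OF D(1) r rr D(2) lin_comp[OF g g']])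
    fix k assume k: "k \<in> G"
    interpret g': module_hom R A A g' by (rule module_homI[OF D(1) D(1) g'])
    define K where "K k p = (\<Oplus>\<^bsub>R\<^esub>l\<in>G. H k l \<otimes>\<^bsub>R\<^esub> H' l p)" for k p
    \<comment> \<open>The identity matrix of \<open>\<Oplus> R \<epsilon> k\<close> has
      \<open>\<epsilon> k\<close>, not 1, on the diagonal.\<close>
    define \<delta> where "\<delta> k p = (if k = p then \<epsilon> k else \<zero>\<^bsub>R\<^esub>)" for k p
    define Z where "Z k p = K k p \<ominus>\<^bsub>R\<^esub> \<delta> k p" for k p
    have HH: "H k l \<otimes>\<^bsub>R\<^esub> H' l p \<in> carrier R" if "k \<in> G" "l \<in> G" "p \<in> G" for k l p
      using matD(1)[OF H that(1,2)] matD(1)[OF H' that(2,3)] by simp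
    have Kc: "K k p \<in> carrier R" if "k \<in> G" "p \<in> G" for k p
      unfolding K_def using HH that by (intro A.R.finsum_closed) auto
    have \<delta>c: "\<delta> k p \<in> carrier R" if "k \<in> G" "p \<in> G" for k p using that \<epsilon>c by (simp add: \<delta>_def)
    have Zc: "Z k p \<in> carrier R" if "k \<in> G" "p \<in> G" for k p using Kc[OF that] \<delta>c[OF that] by (simp add: Z_def)
    have "g' (g (u k)) = (\<Oplus>\<^bsub>A\<^esub>l\<in>G. g' (H k l \<odot>\<^bsub>A\<^esub> u l))"
      unfolding gu[OF k] using matD(1)[OF H k] uc by (intro g'.finsum D(3)) auto
    also have "\<dots> = (\<Oplus>\<^bsub>A\<^esub>l\<in>G. \<Oplus>\<^bsub>A\<^esub>p\<in>G. (H k l \<otimes>\<^bsub>R\<^esub> H' l p) \<odot>\<^bsub>A\<^esub> u p)"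
    proof (intro A.M.finsum_cong' refl)
      fix l assume l: "l \<in> G"
      have H'c: "(\<lambda>p. H' l p) \<in> G \<rightarrow> carrier R" using matD(1)[OF H' l] by auto
      show "g' (H k l \<odot>\<^bsub>A\<^esub> u l) = (\<Oplus>\<^bsub>A\<^esub>p\<in>G. (H k l \<otimes>\<^bsub>R\<^esub> H' l p) \<odot>\<^bsub>A\<^esub> u p)"
        unfolding g'.smult[OF matD(1)[OF H k l] uc[OF l]] gu'[OF l]
        by (rule A.lcomb_smult[OF D(3) H'c matD(1)[OF H k l] D(4), symmetric])
    qed (use HH k uc in \<open>auto intro!: A.M.finsum_closed\<close>)
    also have "\<dots> = (\<Oplus>\<^bsub>A\<^esub>p\<in>G. \<Oplus>\<^bsub>A\<^esub>l\<in>G. (H k l \<otimes>\<^bsub>R\<^esub> H' l p) \<odot>\<^bsub>A\<^esub> u p)"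
      using HH k uc by (intro A.finsum_swap D(3)) auto
    also have "\<dots> = (\<Oplus>\<^bsub>A\<^esub>p\<in>G. K k p \<odot>\<^bsub>A\<^esub> u p)"
    proof (intro A.M.finsum_cong' refl)
      fix p assume p: "p \<in> G"
      show "(\<Oplus>\<^bsub>A\<^esub>l\<in>G. (H k l \<otimes>\<^bsub>R\<^esub> H' l p) \<odot>\<^bsub>A\<^esub> u p) = K k p \<odot>\<^bsub>A\<^esub> u p"
        unfolding K_def using HH k p uc by (intro A.finsum_smult[symmetric] D(3)) auto
    qed (use Kc k uc in auto)
    finally have 1: "g' (g (u k)) = (\<Oplus>\<^bsub>A\<^esub>p\<in>G. K k p \<odot>\<^bsub>A\<^esub> u p)" .
    have 2: "u k = (\<Oplus>\<^bsub>A\<^esub>p\<in>G. \<delta> k p \<odot>\<^bsub>A\<^esub> u p)"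
      unfolding \<delta>_def A.lcomb_delta[OF D(3) k D(4) \<epsilon>c[OF k]] \<epsilon>u[OF k] ..
    have "g' (g (u k)) \<ominus>\<^bsub>A\<^esub> u k = (\<Oplus>\<^bsub>A\<^esub>p\<in>G. K k p \<odot>\<^bsub>A\<^esub> u p) \<ominus>\<^bsub>A\<^esub> (\<Oplus>\<^bsub>A\<^esub>p\<in>G. \<delta> k p \<odot>\<^bsub>A\<^esub> u p)"
      using 1 2 by simp
    also have "\<dots> = (\<Oplus>\<^bsub>A\<^esub>p\<in>G. Z k p \<odot>\<^bsub>A\<^esub> u p)"
      unfolding Z_def using Kc[OF k] \<delta>c[OF k] by (intro A.lcomb_diff[symmetric] D(3,4)) auto
    finally have diff: "g' (g (u k)) \<ominus>\<^bsub>A\<^esub> u k = (\<Oplus>\<^bsub>A\<^esub>p\<in>G. Z k p \<odot>\<^bsub>A\<^esub> u p)" .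
    have "Z k p \<in> r" if p: "p \<in> G" for p
    proof (rule min[OF p, of "\<lambda>k. Z k p"])
      have "\<epsilon> k \<otimes>\<^bsub>R\<^esub> K k p = K k p \<and> K k p \<otimes>\<^bsub>R\<^esub> \<epsilon> p = K k p" if k: "k \<in> G" for k
      proof
        have "\<epsilon> k \<otimes>\<^bsub>R\<^esub> K k p = (\<Oplus>\<^bsub>R\<^esub>l\<in>G. \<epsilon> k \<otimes>\<^bsub>R\<^esub> (H k l \<otimes>\<^bsub>R\<^esub> H' l p))"
          unfolding K_def using HH k p by (intro A.R.finsum_rdistr D(3) \<epsilon>c) auto
        also have "\<dots> = K k p"
          unfolding K_def using HH k p matD[OF H k] matD(1)[OF H'] \<epsilon>c[OF k]
          by (intro A.R.finsum_cong') (auto simp: A.R.m_assoc[symmetric])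
        finally show "\<epsilon> k \<otimes>\<^bsub>R\<^esub> K k p = K k p" .
        have "K k p \<otimes>\<^bsub>R\<^esub> \<epsilon> p = (\<Oplus>\<^bsub>R\<^esub>l\<in>G. (H k l \<otimes>\<^bsub>R\<^esub> H' l p) \<otimes>\<^bsub>R\<^esub> \<epsilon> p)"
          unfolding K_def using HH k p by (intro A.R.finsum_ldistr D(3) \<epsilon>c) auto
        also have "\<dots> = K k p"
          unfolding K_def using HH k p matD[OF H k] matD[OF H'] \<epsilon>c[OF p]
          by (intro A.R.finsum_cong') (auto simp: A.R.m_assoc)
        finally show "K k p \<otimes>\<^bsub>R\<^esub> \<epsilon> p = K k p" .
      qed
      then show "\<epsilon> k \<otimes>\<^bsub>R\<^esub> Z k p = Z k p \<and> Z k p \<otimes>\<^bsub>R\<^esub> \<epsilon> p = Z k p" if k: "k \<in> G" for k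
        using k p Kc[OF k p] \<epsilon>c D(7)
        by (simp add: Z_def \<delta>_def A.R.minus_eq A.R.r_distr A.R.l_distr A.R.l_minus A.R.r_minus)
      have "(\<Oplus>\<^bsub>R\<^esub>k\<in>G. x k \<otimes>\<^bsub>R\<^esub> K k p) = (\<Oplus>\<^bsub>R\<^esub>k\<in>G. \<Oplus>\<^bsub>R\<^esub>l\<in>G. x k \<otimes>\<^bsub>R\<^esub> (H k l \<otimes>\<^bsub>R\<^esub> H' l p))"
      proof (intro A.R.finsum_cong' refl)
        show "x k \<otimes>\<^bsub>R\<^esub> K k p = (\<Oplus>\<^bsub>R\<^esub>l\<in>G. x k \<otimes>\<^bsub>R\<^esub> (H k l \<otimes>\<^bsub>R\<^esub> H' l p))" if "k \<in> G" for k
          unfolding K_def using HH that p by (intro A.R.finsum_rdistr D(3) xc(1)) auto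
      qed (use HH p xc in \<open>auto intro!: A.R.finsum_closed\<close>)
      also have "\<dots> = (\<Oplus>\<^bsub>R\<^esub>l\<in>G. \<Oplus>\<^bsub>R\<^esub>k\<in>G. x k \<otimes>\<^bsub>R\<^esub> (H k l \<otimes>\<^bsub>R\<^esub> H' l p))"
        using HH p xc by (intro reg.finsum_swap[unfolded finsum_regular regular_simps] D(3)) auto
      also have "\<dots> = (\<Oplus>\<^bsub>R\<^esub>l\<in>G. d \<otimes>\<^bsub>R\<^esub> (x l \<otimes>\<^bsub>R\<^esub> H' l p))"
      proof (intro A.R.finsum_cong' refl)
        fix l assume l: "l \<in> G"
        have c: "H k l \<in> carrier R" "H' l p \<in> carrier R" if "k \<in> G" for k
          using matD(1)[OF H that l] matD(1)[OF H' l p] by auto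
        have "(\<Oplus>\<^bsub>R\<^esub>k\<in>G. x k \<otimes>\<^bsub>R\<^esub> (H k l \<otimes>\<^bsub>R\<^esub> H' l p)) = (\<Oplus>\<^bsub>R\<^esub>k\<in>G. (x k \<otimes>\<^bsub>R\<^esub> H k l) \<otimes>\<^bsub>R\<^esub> H' l p)"
          using c xc by (intro A.R.finsum_cong') (auto simp: A.R.m_assoc)
        also have "\<dots> = (\<Oplus>\<^bsub>R\<^esub>k\<in>G. x k \<otimes>\<^bsub>R\<^esub> H k l) \<otimes>\<^bsub>R\<^esub> H' l p"
          using c xc l by (intro A.R.finsum_ldistr[symmetric] D(3)) auto
        also have "\<dots> = d \<otimes>\<^bsub>R\<^esub> (x l \<otimes>\<^bsub>R\<^esub> H' l p)"
          using matx[OF H] l xc[OF l] c[OF l] by (simp add: A.R.m_assoc)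
        finally show "(\<Oplus>\<^bsub>R\<^esub>k\<in>G. x k \<otimes>\<^bsub>R\<^esub> (H k l \<otimes>\<^bsub>R\<^esub> H' l p)) = d \<otimes>\<^bsub>R\<^esub> (x l \<otimes>\<^bsub>R\<^esub> H' l p)" .
      qed (use matD(1)[OF H'] p xc matx(1)[OF H] in auto)
      also have "\<dots> = d \<otimes>\<^bsub>R\<^esub> (\<Oplus>\<^bsub>R\<^esub>l\<in>G. x l \<otimes>\<^bsub>R\<^esub> H' l p)"
        using matD(1)[OF H'] p xc matx(1)[OF H] by (intro A.R.finsum_rdistr[symmetric] D(3)) auto
      also have "\<dots> = x p"
        using matx[OF H'] matx(1)[OF H] p xc[OF p] dd ex[OF p] by (simp add: A.R.m_assoc[symmetric])
      finally have xK: "(\<Oplus>\<^bsub>R\<^esub>k\<in>G. x k \<otimes>\<^bsub>R\<^esub> K k p) = x p" .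
      have "(\<Oplus>\<^bsub>R\<^esub>k\<in>G. x k \<otimes>\<^bsub>R\<^esub> \<delta> k p) = (\<Oplus>\<^bsub>R\<^esub>k\<in>G. if p = k then x k else \<zero>\<^bsub>R\<^esub>)"
        using xc D(8) by (intro A.R.finsum_cong') (auto simp: \<delta>_def)
      also have "\<dots> = x p" using p xc D(3) by (intro A.R.finsum_singleton) auto
      finally have x\<delta>: "(\<Oplus>\<^bsub>R\<^esub>k\<in>G. x k \<otimes>\<^bsub>R\<^esub> \<delta> k p) = x p" .
      have xZc: "(\<Oplus>\<^bsub>R\<^esub>k\<in>G. x k \<otimes>\<^bsub>R\<^esub> Z k p) \<in> carrier R"
        using xc Zc p by (intro A.R.finsum_closed) auto
      have "x p = (\<Oplus>\<^bsub>R\<^esub>k\<in>G. x k \<otimes>\<^bsub>R\<^esub> Z k p \<oplus>\<^bsub>R\<^esub> x k \<otimes>\<^bsub>R\<^esub> \<delta> k p)"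
        unfolding xK[symmetric]
      proof (intro A.R.finsum_cong' refl)
        show "x k \<otimes>\<^bsub>R\<^esub> K k p = x k \<otimes>\<^bsub>R\<^esub> Z k p \<oplus>\<^bsub>R\<^esub> x k \<otimes>\<^bsub>R\<^esub> \<delta> k p" if "k \<in> G" for k
          using Kc[OF that p] \<delta>c[OF that p] xc[OF that]
          by (simp add: Z_def A.R.r_distr[symmetric] A.R.minus_eq A.R.a_assoc A.R.l_neg)
      qed (use xc Zc \<delta>c p in auto)
      also have "\<dots> = (\<Oplus>\<^bsub>R\<^esub>k\<in>G. x k \<otimes>\<^bsub>R\<^esub> Z k p) \<oplus>\<^bsub>R\<^esub> x p"
        unfolding x\<delta>[symmetric] using xc Zc \<delta>c p by (intro A.R.finsum_addf) auto
      finally show "(\<Oplus>\<^bsub>R\<^esub>k\<in>G. x k \<otimes>\<^bsub>R\<^esub> Z k p) = \<zero>\<^bsub>R\<^esub>"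
        using A.R.add.r_cancel_one'[OF xc(1)[OF p] xZc] by simp
    qed (use Zc p k in auto)
    then show "\<exists>c\<in>G \<rightarrow> r. g' (g (u k)) \<ominus>\<^bsub>A\<^esub> u k = (\<Oplus>\<^bsub>A\<^esub>l\<in>G. c l \<odot>\<^bsub>A\<^esub> u l)"
      using diff by (intro bexI[of _ "\<lambda>p. Z k p"]) auto
  qed
  \<comment> \<open>Coefficients of the \<open>h (u k)\<close> are squeezed between the idempotents
    to give \<open>H\<close>. Applying \<open>h\<close> to \<open>\<Sum> x k u k = 0\<close> shows
    that \<open>x H\<close> is again a relation, hence a multiple of \<open>x\<close>.\<close>
  have lift: "\<exists>H d. mat H d \<and> e \<otimes>\<^bsub>R\<^esub> d = d \<and> d \<otimes>\<^bsub>R\<^esub> e = d \<and> (\<forall>k\<in>G. h (u k) = (\<Oplus>\<^bsub>A\<^esub>l\<in>G. H k l \<odot>\<^bsub>A\<^esub> u l))"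
    if h: "lin R A A h" for h
  proof -
    interpret h: module_hom R A A h by (rule module_homI[OF D(1) D(1) h])
    have "\<forall>k\<in>G. \<exists>c. c \<in> G \<rightarrow> carrier R \<and> h (u k) = (\<Oplus>\<^bsub>A\<^esub>l\<in>G. c l \<odot>\<^bsub>A\<^esub> u l)"
      using generatesE[OF D(2) h.closed[OF uc]] by blast
    from bchoice[OF this] obtain c where
      c: "\<And>k. k \<in> G \<Longrightarrow> c k \<in> G \<rightarrow> carrier R \<and> h (u k) = (\<Oplus>\<^bsub>A\<^esub>l\<in>G. c k l \<odot>\<^bsub>A\<^esub> u l)" by blast
    have cc: "c k l \<in> carrier R" if "k \<in> G" "l \<in> G" for k l using c[OF that(1)] that(2) by blast
    define H where "H k l = \<epsilon> k \<otimes>\<^bsub>R\<^esub> c k l \<otimes>\<^bsub>R\<^esub> \<epsilon> l" for k l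
    have H: "H k l \<in> carrier R" "\<epsilon> k \<otimes>\<^bsub>R\<^esub> H k l = H k l" "H k l \<otimes>\<^bsub>R\<^esub> \<epsilon> l = H k l" if "k \<in> G" "l \<in> G" for k l
    proof -
      show "H k l \<in> carrier R" using cc[OF that] \<epsilon>c that by (simp add: H_def)
      show "H k l \<otimes>\<^bsub>R\<^esub> \<epsilon> l = H k l" using cc[OF that] \<epsilon>c D(7) that by (simp add: H_def A.R.m_assoc)
      show "\<epsilon> k \<otimes>\<^bsub>R\<^esub> H k l = H k l"
        using cc[OF that] \<epsilon>c D(7) that by (simp add: H_def A.R.m_assoc[symmetric])
    qed
    have hu: "h (u k) = (\<Oplus>\<^bsub>A\<^esub>l\<in>G. H k l \<odot>\<^bsub>A\<^esub> u l)" if k: "k \<in> G" for k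
    proof -
      have "h (u k) = \<epsilon> k \<odot>\<^bsub>A\<^esub> h (u k)" using h.smult[OF \<epsilon>c[OF k] uc[OF k]] \<epsilon>u[OF k] by simp
      also have "\<dots> = (\<Oplus>\<^bsub>A\<^esub>l\<in>G. \<epsilon> k \<odot>\<^bsub>A\<^esub> (c k l \<odot>\<^bsub>A\<^esub> u l))"
        using c[OF k] cc[OF k] uc \<epsilon>c[OF k] by (simp add: A.smult_finsum[OF D(3)] Pi_iff)
      also have "\<dots> = (\<Oplus>\<^bsub>A\<^esub>l\<in>G. H k l \<odot>\<^bsub>A\<^esub> u l)"
      proof (intro A.M.finsum_cong' refl)
        fix l assume l: "l \<in> G"
        have "c k l \<odot>\<^bsub>A\<^esub> u l = (c k l \<otimes>\<^bsub>R\<^esub> \<epsilon> l) \<odot>\<^bsub>A\<^esub> u l"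
          using cc[OF k l] \<epsilon>c[OF l] uc[OF l] \<epsilon>u[OF l] by (simp add: A.smult_assoc1)
        then show "\<epsilon> k \<odot>\<^bsub>A\<^esub> (c k l \<odot>\<^bsub>A\<^esub> u l) = H k l \<odot>\<^bsub>A\<^esub> u l"
          using cc[OF k l] \<epsilon>c[OF l] \<epsilon>c[OF k] uc[OF l] by (simp add: H_def A.smult_assoc1[symmetric] A.R.m_assoc)
      qed (use H k uc in auto)
      finally show ?thesis .
    qed
    define y where "y l = (\<Oplus>\<^bsub>R\<^esub>k\<in>G. x k \<otimes>\<^bsub>R\<^esub> H k l)" for l
    have yc: "y l \<in> carrier R" if "l \<in> G" for l
      unfolding y_def using H xc that by (intro A.R.finsum_closed) auto
    have "(\<Oplus>\<^bsub>A\<^esub>k\<in>G. x k \<odot>\<^bsub>A\<^esub> u k) = \<zero>\<^bsub>A\<^esub>"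
      using D(9)[OF D(6)] D(8) xc by (metis A.R.l_one A.R.one_closed)
    then have "\<zero>\<^bsub>A\<^esub> = h (\<Oplus>\<^bsub>A\<^esub>k\<in>G. x k \<odot>\<^bsub>A\<^esub> u k)" by simp
    also have "\<dots> = (\<Oplus>\<^bsub>A\<^esub>k\<in>G. h (x k \<odot>\<^bsub>A\<^esub> u k))"
      using xc uc by (intro h.finsum D(3)) auto
    also have "\<dots> = (\<Oplus>\<^bsub>A\<^esub>k\<in>G. \<Oplus>\<^bsub>A\<^esub>l\<in>G. (x k \<otimes>\<^bsub>R\<^esub> H k l) \<odot>\<^bsub>A\<^esub> u l)"
    proof (intro A.M.finsum_cong' refl)
      fix k assume k: "k \<in> G"
      have Hk: "H k \<in> G \<rightarrow> carrier R" using H(1)[OF k] by blast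
      show "h (x k \<odot>\<^bsub>A\<^esub> u k) = (\<Oplus>\<^bsub>A\<^esub>l\<in>G. (x k \<otimes>\<^bsub>R\<^esub> H k l) \<odot>\<^bsub>A\<^esub> u l)"
        unfolding h.smult[OF xc(1)[OF k] uc[OF k]] hu[OF k]
        by (rule A.lcomb_smult[OF D(3) Hk xc(1)[OF k] D(4), symmetric])
    qed (use H xc uc in \<open>auto intro!: A.M.finsum_closed\<close>)
    also have "\<dots> = (\<Oplus>\<^bsub>A\<^esub>l\<in>G. \<Oplus>\<^bsub>A\<^esub>k\<in>G. (x k \<otimes>\<^bsub>R\<^esub> H k l) \<odot>\<^bsub>A\<^esub> u l)"
      using H xc uc by (intro A.finsum_swap D(3)) auto
    also have "\<dots> = (\<Oplus>\<^bsub>A\<^esub>l\<in>G. y l \<odot>\<^bsub>A\<^esub> u l)"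
    proof (intro A.M.finsum_cong' refl)
      show "(\<Oplus>\<^bsub>A\<^esub>k\<in>G. (x k \<otimes>\<^bsub>R\<^esub> H k l) \<odot>\<^bsub>A\<^esub> u l) = y l \<odot>\<^bsub>A\<^esub> u l" if "l \<in> G" for l
        unfolding y_def using H xc uc that by (intro A.finsum_smult[symmetric] D(3)) auto
    qed (use yc uc in auto)
    finally have "\<exists>a\<in>carrier R. \<forall>l\<in>G. y l \<otimes>\<^bsub>R\<^esub> \<epsilon> l = a \<otimes>\<^bsub>R\<^esub> x l"
      using D(9)[of y] yc by auto
    then obtain a where a: "a \<in> carrier R" "\<And>l. l \<in> G \<Longrightarrow> y l \<otimes>\<^bsub>R\<^esub> \<epsilon> l = a \<otimes>\<^bsub>R\<^esub> x l" by blast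
    \<comment> \<open>The elements \<open>y l\<close> and \<open>x l\<close> are both fixed by
      \<open>e\<close> on the left, so \<open>a\<close> can be cut down to the corner
      \<open>e R e\<close> without disturbing \<open>y l = a x l\<close>.\<close>
    define d where "d = e \<otimes>\<^bsub>R\<^esub> a \<otimes>\<^bsub>R\<^esub> e"
    have d: "d \<in> carrier R" "e \<otimes>\<^bsub>R\<^esub> d = d" "d \<otimes>\<^bsub>R\<^esub> e = d"
      using a(1) e by (simp_all add: d_def A.R.m_assoc) (simp add: A.R.m_assoc[symmetric])
    have "y l = d \<otimes>\<^bsub>R\<^esub> x l" if l: "l \<in> G" for l
    proof -
      have "y l \<otimes>\<^bsub>R\<^esub> \<epsilon> l = (\<Oplus>\<^bsub>R\<^esub>k\<in>G. (x k \<otimes>\<^bsub>R\<^esub> H k l) \<otimes>\<^bsub>R\<^esub> \<epsilon> l)"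
        unfolding y_def using H l xc by (intro A.R.finsum_ldistr D(3) \<epsilon>c) auto
      also have "\<dots> = y l"
        unfolding y_def using H[OF _ l] xc \<epsilon>c[OF l] by (intro A.R.finsum_cong') (auto simp: A.R.m_assoc)
      finally have "y l = a \<otimes>\<^bsub>R\<^esub> x l" using a(2)[OF l] by simp
      moreover have "e \<otimes>\<^bsub>R\<^esub> y l = y l"
      proof -
        have "e \<otimes>\<^bsub>R\<^esub> y l = (\<Oplus>\<^bsub>R\<^esub>k\<in>G. e \<otimes>\<^bsub>R\<^esub> (x k \<otimes>\<^bsub>R\<^esub> H k l))"
          unfolding y_def using H l xc by (intro A.R.finsum_rdistr D(3) e) auto
        also have "\<dots> = y l"
          unfolding y_def using H[OF _ l] xc e(1) ex
          by (intro A.R.finsum_cong') (auto simp: A.R.m_assoc[symmetric])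
        finally show ?thesis .
      qed
      ultimately show ?thesis
        using a(1) e xc[OF l] ex[OF l] by (simp add: d_def A.R.m_assoc)
    qed
    then have "mat H d" using H d(1) by (simp add: mat_def y_def)
    then show ?thesis using d hu by blast
  qed
  \<comment> \<open>The converse of lifting: \<open>d x l\<close> lies in
    \<open>e R \<epsilon> l\<close>, so \<open>gen\<close> expresses it through the
    \<open>x k\<close>, and the coefficients form column \<open>l\<close> of
    \<open>H\<close>.\<close>
  have realize: "\<exists>g H. lin R A A g \<and> mat H d \<and> (\<forall>k\<in>G. g (u k) = (\<Oplus>\<^bsub>A\<^esub>l\<in>G. H k l \<odot>\<^bsub>A\<^esub> u l))"
    if d: "d \<in> carrier R" "e \<otimes>\<^bsub>R\<^esub> d = d" for d
  proof -
    have "\<forall>l\<in>G. \<exists>h. h \<in> G \<rightarrow> carrier R \<and> d \<otimes>\<^bsub>R\<^esub> x l = (\<Oplus>\<^bsub>R\<^esub>k\<in>G. x k \<otimes>\<^bsub>R\<^esub> h k) \<and>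
        (\<forall>k\<in>G. \<epsilon> k \<otimes>\<^bsub>R\<^esub> h k = h k \<and> h k \<otimes>\<^bsub>R\<^esub> \<epsilon> l = h k)"
    proof
      fix l assume l: "l \<in> G"
      have "d \<otimes>\<^bsub>R\<^esub> x l \<in> carrier R" "e \<otimes>\<^bsub>R\<^esub> (d \<otimes>\<^bsub>R\<^esub> x l) = d \<otimes>\<^bsub>R\<^esub> x l" "d \<otimes>\<^bsub>R\<^esub> x l \<otimes>\<^bsub>R\<^esub> \<epsilon> l = d \<otimes>\<^bsub>R\<^esub> x l"
        using d e xc[OF l] \<epsilon>c[OF l] D(8)[OF l] by (simp_all add: A.R.m_assoc) (simp add: A.R.m_assoc[symmetric])
      from gen[OF l this] show "\<exists>h. h \<in> G \<rightarrow> carrier R \<and> d \<otimes>\<^bsub>R\<^esub> x l = (\<Oplus>\<^bsub>R\<^esub>k\<in>G. x k \<otimes>\<^bsub>R\<^esub> h k) \<and>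
        (\<forall>k\<in>G. \<epsilon> k \<otimes>\<^bsub>R\<^esub> h k = h k \<and> h k \<otimes>\<^bsub>R\<^esub> \<epsilon> l = h k)" by blast
    qed
    from bchoice[OF this] obtain h where h: "\<And>l. l \<in> G \<Longrightarrow> h l \<in> G \<rightarrow> carrier R \<and>
        d \<otimes>\<^bsub>R\<^esub> x l = (\<Oplus>\<^bsub>R\<^esub>k\<in>G. x k \<otimes>\<^bsub>R\<^esub> h l k) \<and> (\<forall>k\<in>G. \<epsilon> k \<otimes>\<^bsub>R\<^esub> h l k = h l k \<and> h l k \<otimes>\<^bsub>R\<^esub> \<epsilon> l = h l k)"
      by blast
    define H where "H k l = h l k" for k l
    have H: "mat H d" unfolding mat_def H_def using h d(1) by auto
    have Hc: "H k l \<in> carrier R" if "k \<in> G" "l \<in> G" for k l by (rule matD(1)[OF H that])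
    define v where "v k = (\<Oplus>\<^bsub>A\<^esub>l\<in>G. H k l \<odot>\<^bsub>A\<^esub> u l)" for k
    have v: "v \<in> G \<rightarrow> carrier A" unfolding v_def using Hc uc by (auto intro!: A.M.finsum_closed)
    have smv: "a \<odot>\<^bsub>A\<^esub> v k = (\<Oplus>\<^bsub>A\<^esub>l\<in>G. (a \<otimes>\<^bsub>R\<^esub> H k l) \<odot>\<^bsub>A\<^esub> u l)" if "a \<in> carrier R" "k \<in> G" for a k
      unfolding v_def using Hc[OF that(2)] by (intro A.lcomb_smult[symmetric] D(3,4) that(1)) auto
    have \<epsilon>v: "\<epsilon> k \<odot>\<^bsub>A\<^esub> v k = v k" if k: "k \<in> G" for k
      unfolding smv[OF \<epsilon>c[OF k] k] unfolding v_def
      using matD[OF H k] uc by (intro A.M.finsum_cong') auto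
    have xv: "(\<Oplus>\<^bsub>A\<^esub>k\<in>G. x k \<odot>\<^bsub>A\<^esub> v k) = \<zero>\<^bsub>A\<^esub>"
    proof -
      have "(\<Oplus>\<^bsub>A\<^esub>k\<in>G. x k \<odot>\<^bsub>A\<^esub> v k) = (\<Oplus>\<^bsub>A\<^esub>k\<in>G. \<Oplus>\<^bsub>A\<^esub>l\<in>G. (x k \<otimes>\<^bsub>R\<^esub> H k l) \<odot>\<^bsub>A\<^esub> u l)"
        using smv xc uc Hc by (intro A.M.finsum_cong') (auto intro!: A.M.finsum_closed)
      also have "\<dots> = (\<Oplus>\<^bsub>A\<^esub>l\<in>G. \<Oplus>\<^bsub>A\<^esub>k\<in>G. (x k \<otimes>\<^bsub>R\<^esub> H k l) \<odot>\<^bsub>A\<^esub> u l)"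
        using Hc xc uc by (intro A.finsum_swap D(3)) auto
      also have "\<dots> = (\<Oplus>\<^bsub>A\<^esub>l\<in>G. (d \<otimes>\<^bsub>R\<^esub> x l) \<odot>\<^bsub>A\<^esub> u l)"
      proof (intro A.M.finsum_cong' refl)
        show "(\<Oplus>\<^bsub>A\<^esub>k\<in>G. (x k \<otimes>\<^bsub>R\<^esub> H k l) \<odot>\<^bsub>A\<^esub> u l) = (d \<otimes>\<^bsub>R\<^esub> x l) \<odot>\<^bsub>A\<^esub> u l" if "l \<in> G" for l
          unfolding matx(2)[OF H that, symmetric] using Hc xc uc that by (intro A.finsum_smult[symmetric] D(3)) auto
      qed (use d(1) xc uc in auto)
      also have "\<dots> = \<zero>\<^bsub>A\<^esub>"
        using D(9)[of "\<lambda>l. d \<otimes>\<^bsub>R\<^esub> x l"] d(1) xc \<epsilon>c D(8) by (auto simp: A.R.m_assoc)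
      finally show ?thesis .
    qed
    obtain g where "lin R A A g" "\<And>k. k \<in> G \<Longrightarrow> g (u k) = v k"
      by (rule hom_from_presented[OF A D(1) v \<epsilon>v xv]) blast+
    then show ?thesis using H unfolding v_def by blast
  qed
  have "bij_betw h (carrier A) (carrier A) \<or> bij_betw (\<lambda>a. a \<ominus>\<^bsub>A\<^esub> h a) (carrier A) (carrier A)"
    if h: "lin R A A h" for h
  proof -
    interpret h: module_hom R A A h by (rule module_homI[OF D(1) D(1) h])
    obtain H d where H: "mat H d" and d: "e \<otimes>\<^bsub>R\<^esub> d = d" "d \<otimes>\<^bsub>R\<^esub> e = d"
      and hu: "\<And>k. k \<in> G \<Longrightarrow> h (u k) = (\<Oplus>\<^bsub>A\<^esub>l\<in>G. H k l \<odot>\<^bsub>A\<^esub> u l)" using lift[OF h] by blast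
    have dc: "d \<in> carrier R" by (rule matx(1)[OF H])
    show ?thesis
    proof (cases "d \<in> r")
      case True
      \<comment> \<open>For \<open>d \<in> r\<close> the products \<open>d x l\<close> vanish since
        \<open>r\<^sup>2 = 0\<close>, so \<open>x H = 0\<close> and \<open>min\<close> applies to
        every column.\<close>
      have Hr: "H k l \<in> r" if "k \<in> G" "l \<in> G" for k l
      proof (rule min[OF that(2), of "\<lambda>k. H k l"])
        show "(\<Oplus>\<^bsub>R\<^esub>k\<in>G. x k \<otimes>\<^bsub>R\<^esub> H k l) = \<zero>\<^bsub>R\<^esub>"
          using matx(2)[OF H that(2)] rr[OF True xc(2)[OF that(2)]] by simp
      qed (use matD[OF H] that in auto)
      have "bij_betw (\<lambda>y. y \<ominus>\<^bsub>A\<^esub> h y) (carrier A) (carrier A)"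
      proof (rule unipotent_bij[OF D(1) r rr D(2) lin_minus[OF D(1) lin_id h]])
        fix k assume k: "k \<in> G"
        have Hk: "H k \<in> G \<rightarrow> carrier R" using matD(1)[OF H k] by blast
        have m1: "\<ominus>\<^bsub>R\<^esub> \<one>\<^bsub>R\<^esub> \<in> carrier R" by simp
        have "u k \<ominus>\<^bsub>A\<^esub> h (u k) \<ominus>\<^bsub>A\<^esub> u k = \<ominus>\<^bsub>A\<^esub> h (u k)"
          using uc[OF k] by (simp add: A.M.minus_eq A.M.a_assoc A.M.a_comm[of "\<ominus>\<^bsub>A\<^esub> h (u k)"] A.M.r_neg2 A.M.r_neg1)
        also have "\<dots> = (\<ominus>\<^bsub>R\<^esub> \<one>\<^bsub>R\<^esub>) \<odot>\<^bsub>A\<^esub> h (u k)" using uc[OF k] by (simp add: A.smult_l_minus)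
        also have "\<dots> = (\<Oplus>\<^bsub>A\<^esub>l\<in>G. (\<ominus>\<^bsub>R\<^esub> \<one>\<^bsub>R\<^esub> \<otimes>\<^bsub>R\<^esub> H k l) \<odot>\<^bsub>A\<^esub> u l)"
          unfolding hu[OF k] by (rule A.lcomb_smult[OF D(3) Hk m1 D(4), symmetric])
        finally show "\<exists>c\<in>G \<rightarrow> r. u k \<ominus>\<^bsub>A\<^esub> h (u k) \<ominus>\<^bsub>A\<^esub> u k = (\<Oplus>\<^bsub>A\<^esub>l\<in>G. c l \<odot>\<^bsub>A\<^esub> u l)"
          using Hr[OF k] by (intro bexI[of _ "\<lambda>l. \<ominus>\<^bsub>R\<^esub> \<one>\<^bsub>R\<^esub> \<otimes>\<^bsub>R\<^esub> H k l"]) (auto intro: r.I_l_closed)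
      qed
      then show ?thesis ..
    next
      case False
      then obtain b where b: "b \<in> carrier R" "b \<otimes>\<^bsub>R\<^esub> d = e" "d \<otimes>\<^bsub>R\<^esub> b = e" using unit[OF dc d] by blast
      \<comment> \<open>\<open>b\<close> inverts \<open>d\<close> but need not be fixed by
        \<open>e\<close> on the left, as \<open>realize\<close> demands of its argument;
        \<open>e b\<close> is, and it still inverts \<open>d\<close>.\<close>
      define d' where "d' = e \<otimes>\<^bsub>R\<^esub> b"
      have d': "d' \<in> carrier R" "e \<otimes>\<^bsub>R\<^esub> d' = d'" "d' \<otimes>\<^bsub>R\<^esub> d = e"
        using b(1,2) e dc by (simp_all add: d'_def A.R.m_assoc) (simp add: A.R.m_assoc[symmetric])
      have dd': "d \<otimes>\<^bsub>R\<^esub> d' = e"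
        using b(1,3) e(1) dc d(2) by (simp add: d'_def A.R.m_assoc[symmetric])
      obtain g H' where g: "lin R A A g" and H': "mat H' d'"
        and gu: "\<And>k. k \<in> G \<Longrightarrow> g (u k) = (\<Oplus>\<^bsub>A\<^esub>l\<in>G. H' k l \<odot>\<^bsub>A\<^esub> u l)" using realize[OF d'(1,2)] by blast
      \<comment> \<open>Both composites are bijective, one showing that \<open>h\<close> is
        injective and the other that it is onto. The map \<open>g\<close> is an inverse of
        \<open>h\<close> only up to unipotent maps.\<close>
      have gh: "bij_betw (\<lambda>y. g (h y)) (carrier A) (carrier A)" by (rule comp[OF h g H H' hu gu dd'])
      have hg: "bij_betw (\<lambda>y. h (g y)) (carrier A) (carrier A)" by (rule comp[OF g h H' H gu hu d'(3)])
      have "inj_on h (carrier A)"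
        using bij_betw_imp_inj_on[OF gh] by (rule inj_on_imageI2[of g, unfolded comp_def])
      moreover have "h ` carrier A = carrier A"
      proof (intro equalityI subsetI)
        fix z assume "z \<in> carrier A"
        then have "z \<in> (\<lambda>y. h (g y)) ` carrier A" using bij_betw_imp_surj_on[OF hg] by simp
        then show "z \<in> h ` carrier A" using lin_closed[OF g] by blast
      qed (use h.closed in blast)
      ultimately have "bij_betw h (carrier A) (carrier A)" by (simp add: bij_betw_def)
      then show ?thesis ..
    qed
  qed
  then show ?thesis using D(1) nz by (simp add: local_end_def)
qed

section \<open>Rings with square-zero radical\<close>

context ring
begin

lemma left_idealD:
  assumes "submodule I R (regular R)"
  shows "I \<subseteq> carrier R" "\<zero> \<in> I" "\<And>a b. \<lbrakk>a \<in> I; b \<in> I\<rbrakk> \<Longrightarrow> a \<oplus> b \<in> I"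
    "\<And>a x. \<lbrakk>a \<in> carrier R; x \<in> I\<rbrakk> \<Longrightarrow> a \<otimes> x \<in> I"
  using left_module.submoduleD[OF regular_left_module assms] by simp_all

lemma left_idealI:
  assumes "I \<subseteq> carrier R" "\<zero> \<in> I" "\<And>a b. \<lbrakk>a \<in> I; b \<in> I\<rbrakk> \<Longrightarrow> a \<oplus> b \<in> I"
    "\<And>a x. \<lbrakk>a \<in> carrier R; x \<in> I\<rbrakk> \<Longrightarrow> a \<otimes> x \<in> I"
  shows "submodule I R (regular R)"
  using assms by (intro left_module.submoduleI[OF regular_left_module]) auto

lemma left_ideal_minus:
  assumes "submodule I R (regular R)" "a \<in> I"
  shows "\<ominus> a \<in> I"
proof -
  have "a \<in> carrier R" using left_idealD(1)[OF assms(1)] assms(2) by blast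
  then have "\<ominus> a = \<ominus> \<one> \<otimes> a" by (simp add: l_minus)
  then show ?thesis using left_idealD(4)[OF assms(1) _ assms(2)] by simp
qed

lemma left_ideal_whole:
  assumes "submodule I R (regular R)" "\<one> \<in> I"
  shows "I = carrier R"
proof
  show "carrier R \<subseteq> I" using left_idealD(4)[OF assms(1) _ assms(2)] by auto
qed (rule left_idealD(1)[OF assms(1)])

lemma principal_left_ideal:
  assumes "x \<in> carrier R"
  shows "submodule {a \<otimes> x | a. a \<in> carrier R} R (regular R)"
proof (rule left_idealI)
  show "\<zero> \<in> {a \<otimes> x | a. a \<in> carrier R}" using assms by (auto intro!: exI[of _ \<zero>])
  show "a \<oplus> b \<in> {a \<otimes> x | a. a \<in> carrier R}" if "a \<in> {a \<otimes> x | a. a \<in> carrier R}" "b \<in> {a \<otimes> x | a. a \<in> carrier R}" for a b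
    using that assms by (auto simp: l_distr[symmetric])
  show "a \<otimes> b \<in> {a \<otimes> x | a. a \<in> carrier R}" if "a \<in> carrier R" "b \<in> {a \<otimes> x | a. a \<in> carrier R}" for a b
    using that assms by (auto simp: m_assoc[symmetric])
qed (use assms in auto)

text \<open>Maximality is applied to the left ideal \<open>I + R x\<close>.\<close>

lemma maximal_left_ideal_complement:
  assumes I: "maximal_left_ideal R I" and x: "x \<in> carrier R" "x \<notin> I"
  obtains i a where "i \<in> I" "a \<in> carrier R" "\<one> = i \<oplus> a \<otimes> x"
proof -
  have sI: "submodule I R (regular R)" using I by (simp add: maximal_left_ideal_def)
  note S = left_idealD[OF sI]
  define K where "K = {i \<oplus> a \<otimes> x | i a. i \<in> I \<and> a \<in> carrier R}"
  have "submodule K R (regular R)"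
  proof (rule left_idealI)
    show "K \<subseteq> carrier R" using S(1) x(1) by (auto simp: K_def)
    show "\<zero> \<in> K" unfolding K_def using S(2) x(1) by (intro CollectI exI[of _ \<zero>] exI[of _ \<zero>]) simp
    fix b c assume "b \<in> K" "c \<in> K"
    then obtain i a j d where h: "b = i \<oplus> a \<otimes> x" "c = j \<oplus> d \<otimes> x" "i \<in> I" "j \<in> I" "a \<in> carrier R" "d \<in> carrier R"
      unfolding K_def by blast
    then have "i \<in> carrier R" "j \<in> carrier R" using S(1) by auto
    then have "b \<oplus> c = (i \<oplus> j) \<oplus> (a \<oplus> d) \<otimes> x" using h x(1) by (simp add: l_distr a_ac)
    moreover have "i \<oplus> j \<in> I" "a \<oplus> d \<in> carrier R" using h S(3) by auto
    ultimately show "b \<oplus> c \<in> K" unfolding K_def by blast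
  next
    fix b c assume b: "b \<in> carrier R" and "c \<in> K"
    then obtain i a where h: "c = i \<oplus> a \<otimes> x" "i \<in> I" "a \<in> carrier R" unfolding K_def by blast
    then have "i \<in> carrier R" using S(1) by auto
    then have "b \<otimes> c = b \<otimes> i \<oplus> (b \<otimes> a) \<otimes> x" using h b x(1) by (simp add: r_distr m_assoc)
    moreover have "b \<otimes> i \<in> I" "b \<otimes> a \<in> carrier R" using h b S(4) by auto
    ultimately show "b \<otimes> c \<in> K" unfolding K_def by blast
  qed
  moreover have "I \<subseteq> K"
  proof
    fix i assume "i \<in> I"
    then have "i = i \<oplus> \<zero> \<otimes> x" "i \<in> I" using S(1) x(1) by auto
    then show "i \<in> K" unfolding K_def by blast
  qed
  moreover have "x \<in> K"
    unfolding K_def using S(2) x(1) by (intro CollectI exI[of _ \<zero>] exI[of _ \<one>]) simp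
  ultimately have "K = carrier R" using I x(2) unfolding maximal_left_ideal_def by blast
  then have "\<one> \<in> K" by simp
  then show thesis using that unfolding K_def by blast
qed

text \<open>An intersection of maximal left ideals is at first only a left ideal. For right
  multiplication by \<open>a\<close>, the left ideal \<open>K\<close> of all \<open>y\<close> with
  \<open>y a \<in> I\<close> is either everything or again maximal, so it contains the
  radical.\<close>

lemma jacobson_radical_ideal: "ideal (jacobson_radical R) R"
proof -
  let ?r = "jacobson_radical R"
  have mem: "x \<in> ?r \<longleftrightarrow> x \<in> carrier R \<and> (\<forall>I. maximal_left_ideal R I \<longrightarrow> x \<in> I)" for x
    by (auto simp: jacobson_radical_def)
  have sI: "submodule I R (regular R)" if "maximal_left_ideal R I" for I
    using that by (simp add: maximal_left_ideal_def)
  have sub: "submodule ?r R (regular R)"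
    by (rule left_idealI) (use left_idealD[OF sI] in \<open>auto simp: mem\<close>)
  have right: "x \<otimes> a \<in> ?r" if x: "x \<in> ?r" and a: "a \<in> carrier R" for x a
    unfolding mem
  proof (intro conjI allI impI)
    show "x \<otimes> a \<in> carrier R" using x a by (simp add: mem)
    fix I assume I: "maximal_left_ideal R I"
    note S = left_idealD[OF sI[OF I]]
    define K where "K = {y \<in> carrier R. y \<otimes> a \<in> I}"
    have sK: "submodule K R (regular R)"
      by (rule left_idealI) (use S a in \<open>auto simp: K_def l_distr m_assoc\<close>)
    show "x \<otimes> a \<in> I"
    proof (cases "K = carrier R")
      case True
      then show ?thesis using x by (auto simp: K_def mem)
    next
      case False
      have "maximal_left_ideal R K"
        unfolding maximal_left_ideal_def
      proof (intro conjI allI impI sK False)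
        fix L assume L: "submodule L R (regular R) \<and> K \<subseteq> L"
        note T = left_idealD[OF conjunct1[OF L]]
        show "L = K \<or> L = carrier R"
        proof (cases "L \<subseteq> K")
          case False
          then obtain l where l: "l \<in> L" "l \<notin> K" by blast
          have lc: "l \<in> carrier R" using l(1) T(1) by blast
          have "l \<otimes> a \<notin> I" using l lc by (simp add: K_def)
          \<comment> \<open>Multiplying \<open>1 = i + b l a\<close> by \<open>a\<close> on the left
            gives \<open>(1 - a b l) a = a i \<in> I\<close>. So \<open>1 - a b l\<close> lies in
            \<open>K\<close>, hence in \<open>L\<close>, and \<open>a b l\<close> lies in
            \<open>L\<close> as well.\<close>
          then obtain i b where ib: "i \<in> I" "b \<in> carrier R" "\<one> = i \<oplus> b \<otimes> (l \<otimes> a)"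
            using maximal_left_ideal_complement[OF I] lc a by blast
          have ic: "i \<in> carrier R" using ib(1) S(1) by blast
          have "a = a \<otimes> (i \<oplus> b \<otimes> (l \<otimes> a))" using r_one[OF a] ib(3)[symmetric] by simp
          also have "\<dots> = a \<otimes> i \<oplus> (a \<otimes> b \<otimes> l) \<otimes> a" using ic ib(2) lc a by (simp add: r_distr m_assoc)
          finally have eq: "a = a \<otimes> i \<oplus> (a \<otimes> b \<otimes> l) \<otimes> a" .
          let ?c = "a \<otimes> b \<otimes> l"
          have cc: "?c \<in> carrier R" "?c \<in> L" using ib(2) lc a l(1) T(4)[of "a \<otimes> b" l] by auto
          have "(\<one> \<ominus> ?c) \<otimes> a = a \<ominus> ?c \<otimes> a" using cc(1) a by (simp add: minus_eq l_distr l_minus)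
          also have "\<dots> = (a \<otimes> i \<oplus> ?c \<otimes> a) \<ominus> ?c \<otimes> a" by (rule arg_cong[OF eq, of "\<lambda>z. z \<ominus> ?c \<otimes> a"])
          also have "\<dots> = a \<otimes> i" using cc(1) a ic by (simp add: minus_eq a_assoc r_neg)
          finally have "\<one> \<ominus> ?c \<in> K" using S(4)[OF a ib(1)] cc(1) by (simp add: K_def)
          then have "\<one> \<ominus> ?c \<in> L" using L by blast
          then have "(\<one> \<ominus> ?c) \<oplus> ?c \<in> L" using T(3) cc(2) by blast
          then have "\<one> \<in> L" using cc(1) by (simp add: minus_eq a_assoc l_neg)
          then have "L = carrier R" using left_ideal_whole L by blast
          then show ?thesis ..
        qed (use L in blast)
      qed
      then have "x \<in> K" using x by (simp add: mem)
      then show ?thesis by (simp add: K_def)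
    qed
  qed
  show ?thesis
  proof (rule idealI[OF ring_axioms])
    show "subgroup ?r (add_monoid R)"
      using left_idealD[OF sub] left_ideal_minus[OF sub]
      by (intro subgroup.intro) (auto simp: a_inv_def[symmetric])
  qed (use right left_idealD(4)[OF sub] in auto)
qed

text \<open>If \<open>x\<close> were outside a maximal left ideal \<open>I\<close>, then
  \<open>1 - y \<in> I\<close> for some \<open>y = a x\<close>, hence
  \<open>1 - y\<^sup>2 = (1 + y) (1 - y) \<in> I\<close>. With \<open>y\<^sup>2 \<in> I\<close> this
  puts 1 into \<open>I\<close>.\<close>

lemma mem_jacobson_radical:
  assumes x: "x \<in> carrier R" and sq: "\<And>a. a \<in> carrier R \<Longrightarrow> (a \<otimes> x) \<otimes> (a \<otimes> x) \<in> jacobson_radical R"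
  shows "x \<in> jacobson_radical R"
proof -
  have "x \<in> I" if I: "maximal_left_ideal R I" for I
  proof (rule ccontr)
    assume "x \<notin> I"
    have sI: "submodule I R (regular R)" "I \<noteq> carrier R" using I by (auto simp: maximal_left_ideal_def)
    note S = left_idealD[OF sI(1)]
    obtain i a where ia: "i \<in> I" "a \<in> carrier R" "\<one> = i \<oplus> a \<otimes> x"
      by (rule maximal_left_ideal_complement[OF I x \<open>x \<notin> I\<close>])
    let ?y = "a \<otimes> x"
    have y: "?y \<in> carrier R" "i \<in> carrier R" using ia x S(1) by auto
    have i: "i = \<one> \<ominus> ?y" unfolding ia(3) using y by (simp add: minus_eq a_assoc r_neg)
    have "(\<one> \<oplus> ?y) \<otimes> i \<in> I" by (rule S(4)[OF _ ia(1)]) (use y in simp)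
    also have "(\<one> \<oplus> ?y) \<otimes> i = (\<one> \<oplus> ?y) \<ominus> (?y \<oplus> ?y \<otimes> ?y)"
      unfolding i using y(1) by (simp add: minus_eq r_distr l_distr r_minus minus_add a_ac)
    also have "\<dots> = \<one> \<ominus> ?y \<otimes> ?y"
      using y(1) by (simp add: minus_eq minus_add a_assoc r_neg1 r_neg2)
    finally have "\<one> \<ominus> ?y \<otimes> ?y \<in> I" .
    moreover have "?y \<otimes> ?y \<in> I" using sq[OF ia(2)] I by (auto simp: jacobson_radical_def)
    ultimately have "(\<one> \<ominus> ?y \<otimes> ?y) \<oplus> ?y \<otimes> ?y \<in> I" using S(3) by blast
    then have "\<one> \<in> I" using y(1) by (simp add: minus_eq a_assoc l_neg)
    then show False using left_ideal_whole[OF sI(1)] sI(2) by blast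
  qed
  then show ?thesis using x by (auto simp: jacobson_radical_def)
qed

text \<open>Without a minimal member, choosing ever smaller members produces a strictly descending
  chain.\<close>

lemma artinian_minimal:
  assumes art: "artinian_ring R" and S: "S \<noteq> {}" "\<And>L. L \<in> S \<Longrightarrow> submodule L R (regular R)"
  obtains L where "L \<in> S" "\<And>L'. \<lbrakk>L' \<in> S; L' \<subseteq> L\<rbrakk> \<Longrightarrow> L' = L"
proof (rule ccontr)
  assume "\<not> thesis"
  then have no: "\<forall>L\<in>S. \<exists>L'. L' \<in> S \<and> L' \<subset> L" using that by blast
  from bchoice[OF no] obtain f where f: "\<forall>L\<in>S. f L \<in> S \<and> f L \<subset> L" by blast
  obtain L0 where L0: "L0 \<in> S" using S(1) by blast
  define I where "I n = (f ^^ n) L0" for n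
  have I: "I n \<in> S" for n by (induction n) (use f L0 in \<open>auto simp: I_def\<close>)
  have dec: "I (Suc n) \<subset> I n" for n using f I[of n] by (simp add: I_def)
  have "\<forall>n. submodule (I n) R (regular R) \<and> I (Suc n) \<subseteq> I n" using S(2)[OF I] dec by blast
  then obtain n where n: "\<forall>m\<ge>n. I m = I n" using art unfolding artinian_ring_def by blast
  have "I (Suc n) = I n" by (rule n[rule_format]) simp
  then show False using dec[of n] by blast
qed

end

section \<open>Idempotents in left ideals of an Artinian ring with square-zero radical\<close>

locale radical_square_zero = ring R for R (structure) +
  fixes r
  assumes radical: "r = jacobson_radical R"
    and square_zero: "\<And>a b. \<lbrakk>a \<in> r; b \<in> r\<rbrakk> \<Longrightarrow> a \<otimes> b = \<zero>"
    and artinian: "artinian_ring R"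
    and nonzero: "carrier R \<noteq> {\<zero>}"
begin

sublocale r: ideal r R
  unfolding radical by (rule jacobson_radical_ideal)

lemma r_carrier: "a \<in> r \<Longrightarrow> a \<in> carrier R"
  using r.a_subset by blast

lemma one_not_in_radical: "\<one> \<notin> r"
proof
  assume "\<one> \<in> r"
  then have "\<one> = \<zero>" using square_zero[of \<one> \<one>] by simp
  then show False using nonzero one_zeroD by blast
qed

text \<open>A variant of Brauer's lemma. For \<open>K\<close> minimal among the left ideals inside
  \<open>L\<close> that are not inside \<open>r\<close>, some \<open>a \<in> K\<close> satisfies
  \<open>K a = K\<close>, so \<open>e a = a\<close> for some \<open>e \<in> K\<close>. This
  \<open>e\<close> is idempotent modulo \<open>r\<close> and is then corrected to a true
  idempotent.\<close>

lemma left_ideal_contains_idempotent: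
  assumes L: "submodule L R (regular R)" and "\<not> L \<subseteq> r"
  obtains g where "g \<in> L" "g \<otimes> g = g" "g \<notin> r"
proof -
  obtain K where K: "K \<in> {K. submodule K R (regular R) \<and> K \<subseteq> L \<and> \<not> K \<subseteq> r}"
    and Kmin: "\<And>K'. \<lbrakk>K' \<in> {K. submodule K R (regular R) \<and> K \<subseteq> L \<and> \<not> K \<subseteq> r}; K' \<subseteq> K\<rbrakk> \<Longrightarrow> K' = K"
    by (rule artinian_minimal[OF artinian, of "{K. submodule K R (regular R) \<and> K \<subseteq> L \<and> \<not> K \<subseteq> r}"])
      (use assms in blast)+
  then have sK: "submodule K R (regular R)" and KL: "K \<subseteq> L" and Kr: "\<not> K \<subseteq> r" by auto
  note S = left_idealD[OF sK]
  \<comment> \<open>Otherwise every product of two elements of \<open>K\<close> lies in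
    \<open>r\<close>, in particular every square \<open>(c x)\<^sup>2\<close>, and
    \<open>mem_jacobson_radical\<close> puts \<open>K\<close> inside \<open>r\<close>.\<close>
  have "\<exists>a\<in>K. \<exists>b\<in>K. b \<otimes> a \<notin> r"
  proof (rule ccontr)
    assume "\<not> ?thesis"
    then have no: "b \<otimes> a \<in> r" if "a \<in> K" "b \<in> K" for a b using that by blast
    have "x \<in> r" if x: "x \<in> K" for x
      unfolding radical
    proof (rule mem_jacobson_radical)
      show "x \<in> carrier R" using x S(1) by blast
      show "(c \<otimes> x) \<otimes> (c \<otimes> x) \<in> jacobson_radical R" if "c \<in> carrier R" for c
        using no[OF S(4)[OF that x] S(4)[OF that x]] by (simp add: radical)
    qed
    then show False using Kr by blast
  qed
  then obtain a b where ab: "a \<in> K" "b \<in> K" "b \<otimes> a \<notin> r" by blast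
  have ac: "a \<in> carrier R" "b \<in> carrier R" using ab S(1) by auto
  define Ka where "Ka = {b \<otimes> a | b. b \<in> K}"
  have "submodule Ka R (regular R)"
  proof (rule left_idealI)
    show "Ka \<subseteq> carrier R" using S(1) ac by (auto simp: Ka_def)
    show "\<zero> \<in> Ka" unfolding Ka_def using S(2) ac by (intro CollectI exI[of _ \<zero>]) simp
    show "x \<oplus> y \<in> Ka" if xy: "x \<in> Ka" "y \<in> Ka" for x y
    proof -
      obtain c d where cd: "c \<in> K" "d \<in> K" "x = c \<otimes> a" "y = d \<otimes> a" using xy unfolding Ka_def by blast
      then have "x \<oplus> y = (c \<oplus> d) \<otimes> a" using S(1) ac by (simp add: l_distr subset_eq)
      then show ?thesis unfolding Ka_def using S(3)[OF cd(1,2)] by blast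
    qed
    show "x \<otimes> y \<in> Ka" if xy: "x \<in> carrier R" "y \<in> Ka" for x y
    proof -
      obtain c where c: "c \<in> K" "y = c \<otimes> a" using xy unfolding Ka_def by blast
      then have "x \<otimes> y = (x \<otimes> c) \<otimes> a" using S(1) ac xy(1) by (simp add: m_assoc subset_eq)
      then show ?thesis unfolding Ka_def using S(4)[OF xy(1) c(1)] by blast
    qed
  qed
  moreover have "Ka \<subseteq> K" using S(1,4) ab(1) by (auto simp: Ka_def)
  moreover have "\<not> Ka \<subseteq> r" using ab by (auto simp: Ka_def)
  ultimately have "Ka = K" using KL by (intro Kmin) auto
  then have "a \<in> Ka" using ab(1) by simp
  then obtain e where e: "e \<in> K" "e \<otimes> a = a" unfolding Ka_def by (auto dest: sym)
  have ec: "e \<in> carrier R" using e(1) S(1) by blast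
  have anr: "a \<notin> r" using ab(3) r.I_l_closed[OF _ ac(2)] by blast
  \<comment> \<open>The left annihilator of \<open>a\<close> in \<open>K\<close>. It misses
    \<open>e\<close>, so by minimality of \<open>K\<close> it lies inside \<open>r\<close>; and it
    contains \<open>e e - e\<close> because \<open>e a = a\<close>.\<close>
  define A where "A = {x \<in> K. x \<otimes> a = \<zero>}"
  have "submodule A R (regular R)"
    by (rule left_idealI) (use S ac in \<open>auto simp: A_def l_distr m_assoc subset_eq\<close>)
  note sA = this
  have AK: "A \<noteq> K"
  proof
    assume "A = K"
    then have "e \<in> A" using e(1) by simp
    then have "a = \<zero>" using e(2) by (simp add: A_def)
    then show False using anr by simp
  qed
  have Ar: "A \<subseteq> r"
  proof (rule ccontr)
    assume "\<not> A \<subseteq> r"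
    moreover have "A \<subseteq> K" by (auto simp: A_def)
    ultimately have "A = K" using sA KL by (intro Kmin) auto
    then show False using AK by simp
  qed
  let ?m = "e \<otimes> e \<ominus> e"
  have "?m \<in> A"
  proof -
    have "e \<otimes> e \<in> K" using S(4)[OF ec e(1)] .
    then have "?m \<in> K" using S(3) left_ideal_minus[OF sK e(1)] by (simp add: minus_eq)
    moreover have "?m \<otimes> a = \<zero>" using e ec ac by (simp add: minus_eq l_distr l_minus m_assoc r_neg)
    ultimately show ?thesis by (simp add: A_def)
  qed
  then have mr: "?m \<in> r" using Ar by blast
  define m where "m = ?m"
  have m: "m \<in> r" "m \<in> carrier R" "m \<otimes> m = \<zero>" using mr square_zero ec by (auto simp: m_def)
  have ee: "e \<otimes> e = e \<oplus> m" using ec by (simp add: m_def minus_eq a_ac r_neg1 r_neg2)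
  have em: "e \<otimes> m = m \<otimes> e"
    using ec by (simp add: m_def minus_eq r_distr l_distr r_minus l_minus m_assoc)
  \<comment> \<open>This is \<open>3 e\<^sup>2 - 2 e\<^sup>3\<close>, the standard lift of an idempotent modulo a square-zero ideal.\<close>
  define g where "g = e \<oplus> m \<ominus> (e \<otimes> m \<oplus> e \<otimes> m)"
  have gK: "g \<in> K"
  proof -
    have "m \<in> K" using \<open>?m \<in> A\<close> by (simp add: A_def m_def)
    then show ?thesis
      unfolding g_def minus_eq by (intro S(3) left_ideal_minus[OF sK] S(4)[OF ec] e(1))
  qed
  \<comment> \<open>\<open>g = e + t\<close> with \<open>t \<in> r\<close>, so \<open>g\<close> is
    congruent to \<open>e\<close> modulo \<open>r\<close> and stays outside \<open>r\<close>
    together with \<open>e\<close>.\<close>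
  define t where "t = m \<ominus> (e \<otimes> m \<oplus> e \<otimes> m)"
  have tr: "t \<in> r" using m(1) r.I_l_closed[OF m(1) ec] by (simp add: t_def minus_eq r.a_closed)
  have tc: "t \<in> carrier R" by (rule r_carrier[OF tr])
  have get: "g = e \<oplus> t" using ec m by (simp add: g_def t_def minus_eq a_assoc)
  have gnr: "g \<notin> r"
  proof
    assume "g \<in> r"
    then have "g \<oplus> \<ominus> t \<in> r" using tr by (simp add: r.a_closed)
    also have "g \<oplus> \<ominus> t = e" using ec tc by (simp add: get a_assoc r_neg)
    finally have "e \<otimes> a \<in> r" using r.I_r_closed ac by blast
    then show False using e(2) anr by simp
  qed
  have eem: "e \<otimes> (e \<otimes> m) = e \<otimes> m"
    using ec m ee by (simp add: m_assoc[symmetric] l_distr)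
  have et: "e \<otimes> t = \<ominus> (e \<otimes> m)"
    using ec m(2) eem by (simp add: t_def minus_eq r_distr r_minus minus_add a_assoc[symmetric] r_neg)
  have te: "t \<otimes> e = \<ominus> (e \<otimes> m)"
  proof -
    have eme: "e \<otimes> m \<otimes> e = e \<otimes> m"
      using ec m(2) eem by (simp add: m_assoc em[symmetric])
    have "t \<otimes> e = m \<otimes> e \<ominus> (e \<otimes> m \<otimes> e \<oplus> e \<otimes> m \<otimes> e)"
      using ec m(2) by (simp add: t_def minus_eq l_distr l_minus)
    also have "\<dots> = \<ominus> (e \<otimes> m)"
      unfolding eme em[symmetric] using ec m(2) by (simp add: minus_eq minus_add a_assoc[symmetric] r_neg)
    finally show ?thesis .
  qed
  \<comment> \<open>Since \<open>e e m = e m\<close>, both \<open>e t\<close> and \<open>t e\<close>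
    equal \<open>- e m\<close>, while \<open>t t = 0\<close>; so the square is
    \<open>e + m - 2 e m\<close>, which is \<open>g\<close>.\<close>
  have "g \<otimes> g = e \<otimes> e \<oplus> e \<otimes> t \<oplus> (t \<otimes> e \<oplus> t \<otimes> t)"
    unfolding get using ec tc by (simp add: r_distr l_distr a_ac)
  also have "\<dots> = (e \<oplus> m) \<oplus> \<ominus> (e \<otimes> m) \<oplus> \<ominus> (e \<otimes> m)"
    using ec m(2) tc square_zero[OF tr tr] by (simp add: ee et te)
  also have "\<dots> = g" using ec m(2) by (simp add: g_def minus_eq minus_add a_assoc)
  finally have "g \<otimes> g = g" .
  then show thesis using that gK KL gnr by blast
qed

end

text \<open>The descending chain condition for finitely generated modules, by induction on the
  generators. When \<open>s\<close> is added, the chain is controlled by its trace on the span of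
  \<open>T\<close> and by the left ideals \<open>C n\<close> of coefficients of \<open>s\<close>
  that occur in it.\<close>

lemma (in left_module) chain_stabilizes_on_span:
  assumes art: "artinian_ring R" and T: "finite T" "T \<subseteq> carrier M"
    and I: "\<And>n. submodule (I n) R M" "\<And>n. I (Suc n) \<subseteq> (I n :: 'm set)"
  shows "\<exists>n. \<forall>m\<ge>n. I m \<inter> {\<Oplus>\<^bsub>M\<^esub>s\<in>T. c s \<odot>\<^bsub>M\<^esub> s | c. c \<in> T \<rightarrow> carrier R} =
    I n \<inter> {\<Oplus>\<^bsub>M\<^esub>s\<in>T. c s \<odot>\<^bsub>M\<^esub> s | c. c \<in> T \<rightarrow> carrier R}"
  using T
proof (induct T rule: finite_induct)
  case empty
  have "I m \<inter> {\<zero>\<^bsub>M\<^esub>} = {\<zero>\<^bsub>M\<^esub>}" for m using submoduleD(2)[OF I(1)] by blast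
  then show ?case by simp
next
  case (insert s T)
  define sp where "sp = {\<Oplus>\<^bsub>M\<^esub>s\<in>T. c s \<odot>\<^bsub>M\<^esub> s | c. c \<in> T \<rightarrow> carrier R}"
  have s: "s \<in> carrier M" and T: "(\<lambda>s. s) \<in> T \<rightarrow> carrier M" using insert.prems by auto
  have sub_sp: "submodule sp R M" unfolding sp_def by (rule span_submodule[OF insert.hyps(1) T])
  note SP = submoduleD[OF sub_sp] and SI = submoduleD[OF I(1)]
  have sp': "{\<Oplus>\<^bsub>M\<^esub>s\<in>insert s T. c s \<odot>\<^bsub>M\<^esub> s | c. c \<in> insert s T \<rightarrow> carrier R} =
      {a \<odot>\<^bsub>M\<^esub> s \<oplus>\<^bsub>M\<^esub> v | a v. a \<in> carrier R \<and> v \<in> sp}" (is "?L = ?R")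
  proof (intro equalityI subsetI)
    fix y assume "y \<in> ?L"
    then obtain c where c: "c \<in> insert s T \<rightarrow> carrier R" "y = (\<Oplus>\<^bsub>M\<^esub>s\<in>insert s T. c s \<odot>\<^bsub>M\<^esub> s)" by blast
    have "y = c s \<odot>\<^bsub>M\<^esub> s \<oplus>\<^bsub>M\<^esub> (\<Oplus>\<^bsub>M\<^esub>s\<in>T. c s \<odot>\<^bsub>M\<^esub> s)"
      unfolding c(2) using c(1) s T insert.hyps by (intro M.finsum_insert) auto
    moreover have "c s \<in> carrier R" "(\<Oplus>\<^bsub>M\<^esub>s\<in>T. c s \<odot>\<^bsub>M\<^esub> s) \<in> sp" using c(1) by (auto simp: sp_def)
    ultimately show "y \<in> ?R" by blast
  next
    fix y assume "y \<in> ?R"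
    then obtain a c where a: "a \<in> carrier R" and c: "c \<in> T \<rightarrow> carrier R" "y = a \<odot>\<^bsub>M\<^esub> s \<oplus>\<^bsub>M\<^esub> (\<Oplus>\<^bsub>M\<^esub>s\<in>T. c s \<odot>\<^bsub>M\<^esub> s)"
      unfolding sp_def by blast
    define d where "d = c(s := a)"
    have d: "d \<in> insert s T \<rightarrow> carrier R" using a c(1) by (auto simp: d_def)
    have "(\<Oplus>\<^bsub>M\<^esub>s\<in>insert s T. d s \<odot>\<^bsub>M\<^esub> s) = d s \<odot>\<^bsub>M\<^esub> s \<oplus>\<^bsub>M\<^esub> (\<Oplus>\<^bsub>M\<^esub>s\<in>T. d s \<odot>\<^bsub>M\<^esub> s)"
      using d s T insert.hyps by (intro M.finsum_insert) auto
    also have "(\<Oplus>\<^bsub>M\<^esub>s\<in>T. d s \<odot>\<^bsub>M\<^esub> s) = (\<Oplus>\<^bsub>M\<^esub>s\<in>T. c s \<odot>\<^bsub>M\<^esub> s)"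
      using c(1) T insert.hyps by (intro M.finsum_cong') (auto simp: d_def)
    finally have "y = (\<Oplus>\<^bsub>M\<^esub>s\<in>insert s T. d s \<odot>\<^bsub>M\<^esub> s)" using c(2) by (simp add: d_def)
    then show "y \<in> ?L" using d by blast
  qed
  obtain n1 where n1: "\<And>m. n1 \<le> m \<Longrightarrow> I m \<inter> sp = I n1 \<inter> sp"
    using insert.hyps(3) insert.prems unfolding sp_def by blast
  define C where "C n = {a \<in> carrier R. \<exists>v\<in>sp. a \<odot>\<^bsub>M\<^esub> s \<oplus>\<^bsub>M\<^esub> v \<in> I n}" for n
  have C: "submodule (C n) R (regular R)" for n
  proof (rule R.left_idealI)
    show "\<zero>\<^bsub>R\<^esub> \<in> C n" using s SP(2) SI(2)[of n] by (auto simp: C_def intro!: bexI[of _ "\<zero>\<^bsub>M\<^esub>"])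
    fix a b assume "a \<in> C n" "b \<in> C n"
    then obtain v w where h: "a \<in> carrier R" "b \<in> carrier R" "v \<in> sp" "w \<in> sp"
      "a \<odot>\<^bsub>M\<^esub> s \<oplus>\<^bsub>M\<^esub> v \<in> I n" "b \<odot>\<^bsub>M\<^esub> s \<oplus>\<^bsub>M\<^esub> w \<in> I n" by (auto simp: C_def)
    then have vw: "v \<in> carrier M" "w \<in> carrier M" using SP(1) by auto
    have "(a \<odot>\<^bsub>M\<^esub> s \<oplus>\<^bsub>M\<^esub> v) \<oplus>\<^bsub>M\<^esub> (b \<odot>\<^bsub>M\<^esub> s \<oplus>\<^bsub>M\<^esub> w) = (a \<oplus>\<^bsub>R\<^esub> b) \<odot>\<^bsub>M\<^esub> s \<oplus>\<^bsub>M\<^esub> (v \<oplus>\<^bsub>M\<^esub> w)"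
      using h(1,2) s vw by (simp add: smult_l_distr M.add.m_ac)
    then have "(a \<oplus>\<^bsub>R\<^esub> b) \<odot>\<^bsub>M\<^esub> s \<oplus>\<^bsub>M\<^esub> (v \<oplus>\<^bsub>M\<^esub> w) \<in> I n" using SI(3)[OF h(5,6)] by simp
    then show "a \<oplus>\<^bsub>R\<^esub> b \<in> C n" using h(1,2) SP(3)[OF h(3,4)] by (auto simp: C_def)
  next
    fix b a assume b: "b \<in> carrier R" and "a \<in> C n"
    then obtain v where h: "a \<in> carrier R" "v \<in> sp" "a \<odot>\<^bsub>M\<^esub> s \<oplus>\<^bsub>M\<^esub> v \<in> I n" by (auto simp: C_def)
    then have v: "v \<in> carrier M" using SP(1) by auto
    have "b \<odot>\<^bsub>M\<^esub> (a \<odot>\<^bsub>M\<^esub> s \<oplus>\<^bsub>M\<^esub> v) = (b \<otimes>\<^bsub>R\<^esub> a) \<odot>\<^bsub>M\<^esub> s \<oplus>\<^bsub>M\<^esub> b \<odot>\<^bsub>M\<^esub> v"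
      using b h(1) s v by (simp add: smult_r_distr smult_assoc1)
    then have "(b \<otimes>\<^bsub>R\<^esub> a) \<odot>\<^bsub>M\<^esub> s \<oplus>\<^bsub>M\<^esub> b \<odot>\<^bsub>M\<^esub> v \<in> I n" using SI(6)[OF b h(3)] by simp
    then show "b \<otimes>\<^bsub>R\<^esub> a \<in> C n" using b h(1) SP(6)[OF b h(2)] by (auto simp: C_def)
  qed (auto simp: C_def)
  have "C (Suc n) \<subseteq> C n" for n unfolding C_def using I(2)[of n] by blast
  then have "\<forall>n. submodule (C n) R (regular R) \<and> C (Suc n) \<subseteq> C n" using C by simp
  then obtain n2 where n2: "\<forall>m\<ge>n2. C m = C n2" using art unfolding artinian_ring_def by blast
  have mono: "I m \<subseteq> I n" if "n \<le> m" for n m by (rule lift_Suc_antimono_le[of I, OF I(2) that])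
  define n0 where "n0 = max n1 n2"
  have "I m \<inter> ?R = I n0 \<inter> ?R" if m: "m \<ge> n0" for m
  proof (intro equalityI subsetI)
    fix y assume "y \<in> I m \<inter> ?R"
    then show "y \<in> I n0 \<inter> ?R" using mono[OF m] by blast
  next
    fix y assume y: "y \<in> I n0 \<inter> ?R"
    then obtain a v where av: "a \<in> carrier R" "v \<in> sp" "y = a \<odot>\<^bsub>M\<^esub> s \<oplus>\<^bsub>M\<^esub> v" by blast
    have "a \<in> C n0" using av y by (auto simp: C_def)
    moreover have "C n0 = C n2" by (rule n2[rule_format]) (simp add: n0_def)
    moreover have "C m = C n2" by (rule n2[rule_format]) (use m in \<open>simp add: n0_def\<close>)
    ultimately have "a \<in> C m" by simp
    then obtain w where w: "w \<in> sp" "a \<odot>\<^bsub>M\<^esub> s \<oplus>\<^bsub>M\<^esub> w \<in> I m" by (auto simp: C_def)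
    have vw: "v \<in> carrier M" "w \<in> carrier M" using av(2) w(1) SP(1) by auto
    \<comment> \<open>\<open>y\<close> and an element of \<open>I m\<close> with the same
      coefficient at \<open>s\<close> differ by an element of the span of \<open>T\<close>, where
      the chain is already stable.\<close>
    have "v \<ominus>\<^bsub>M\<^esub> w = y \<ominus>\<^bsub>M\<^esub> (a \<odot>\<^bsub>M\<^esub> s \<oplus>\<^bsub>M\<^esub> w)"
    proof -
      have "y \<ominus>\<^bsub>M\<^esub> (a \<odot>\<^bsub>M\<^esub> s \<oplus>\<^bsub>M\<^esub> w) = (v \<oplus>\<^bsub>M\<^esub> a \<odot>\<^bsub>M\<^esub> s) \<oplus>\<^bsub>M\<^esub> (\<ominus>\<^bsub>M\<^esub> (a \<odot>\<^bsub>M\<^esub> s) \<oplus>\<^bsub>M\<^esub> \<ominus>\<^bsub>M\<^esub> w)"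
        using av(1) s vw by (simp add: av(3) M.minus_eq M.minus_add M.a_comm[of v])
      also have "\<dots> = v \<ominus>\<^bsub>M\<^esub> w" using av(1) s vw by (simp add: M.a_assoc M.r_neg2 M.minus_eq)
      finally show ?thesis by simp
    qed
    then have "v \<ominus>\<^bsub>M\<^esub> w \<in> I n0" using SI(5) y w(2) mono[OF m] by auto
    then have "v \<ominus>\<^bsub>M\<^esub> w \<in> I n0 \<inter> sp" using SP(5)[OF av(2) w(1)] by blast
    moreover have "I n0 \<inter> sp = I n1 \<inter> sp" by (rule n1) (simp add: n0_def)
    moreover have "I m \<inter> sp = I n1 \<inter> sp" by (rule n1) (use m in \<open>simp add: n0_def\<close>)
    ultimately have "v \<ominus>\<^bsub>M\<^esub> w \<in> I m" by blast
    then have "(a \<odot>\<^bsub>M\<^esub> s \<oplus>\<^bsub>M\<^esub> w) \<oplus>\<^bsub>M\<^esub> (v \<ominus>\<^bsub>M\<^esub> w) \<in> I m" using SI(3) w(2) by blast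
    moreover have "(a \<odot>\<^bsub>M\<^esub> s \<oplus>\<^bsub>M\<^esub> w) \<oplus>\<^bsub>M\<^esub> (v \<ominus>\<^bsub>M\<^esub> w) = y"
      using av(1,3) s vw by (simp add: M.a_assoc)
    ultimately show "y \<in> I m \<inter> ?R" using y by simp
  qed
  then show ?case unfolding sp' by blast
qed

section \<open>Artin algebras as Artinian rings\<close>

lemma artin_algebra_left_module: "artin_algebra R \<Lambda> \<Longrightarrow> left_module R \<Lambda>"
  using module_iff_left_module[of R \<Lambda>] by (simp add: artin_algebra_def)

lemma artin_algebra_ring: "artin_algebra R \<Lambda> \<Longrightarrow> ring \<Lambda>"
  by (simp add: artin_algebra_def)

lemma artin_algebra_smult:
  assumes "artin_algebra R \<Lambda>" "c \<in> carrier R" "y \<in> carrier \<Lambda>"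
  shows "c \<odot>\<^bsub>\<Lambda>\<^esub> y = (c \<odot>\<^bsub>\<Lambda>\<^esub> \<one>\<^bsub>\<Lambda>\<^esub>) \<otimes>\<^bsub>\<Lambda>\<^esub> y" "c \<odot>\<^bsub>\<Lambda>\<^esub> y = y \<otimes>\<^bsub>\<Lambda>\<^esub> (c \<odot>\<^bsub>\<Lambda>\<^esub> \<one>\<^bsub>\<Lambda>\<^esub>)"
proof -
  interpret artin_algebra R \<Lambda> by fact
  show "c \<odot>\<^bsub>\<Lambda>\<^esub> y = (c \<odot>\<^bsub>\<Lambda>\<^esub> \<one>\<^bsub>\<Lambda>\<^esub>) \<otimes>\<^bsub>\<Lambda>\<^esub> y" "c \<odot>\<^bsub>\<Lambda>\<^esub> y = y \<otimes>\<^bsub>\<Lambda>\<^esub> (c \<odot>\<^bsub>\<Lambda>\<^esub> \<one>\<^bsub>\<Lambda>\<^esub>)"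
    using assms(2,3) by (simp_all add: smult_mult_left smult_mult_right)
qed

text \<open>Left ideals of \<open>\<Lambda>\<close> are \<open>R\<close>-submodules because scalars
  act as multiplication by \<open>c 1\<close>, and \<open>\<Lambda>\<close> is finitely generated
  over the Artinian ring \<open>R\<close>.\<close>

lemma artin_algebra_artinian:
  assumes "artin_algebra R \<Lambda>"
  shows "artinian_ring \<Lambda>"
  unfolding artinian_ring_def
proof (intro conjI allI impI)
  show ring: "ring \<Lambda>" by (rule artin_algebra_ring[OF assms])
  interpret \<Lambda>: ring \<Lambda> by (rule ring)
  interpret M: left_module R \<Lambda> by (rule artin_algebra_left_module[OF assms])
  obtain S where gen: "generates R \<Lambda> S (\<lambda>s. s)"
    using assms by (auto simp: artin_algebra_def artin_algebra_axioms_def fg_module_iff_generates)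
  have S: "finite S" "S \<subseteq> carrier \<Lambda>" using generatesD[OF gen] by auto
  fix I
  assume I: "\<forall>n. submodule (I n) \<Lambda> (regular \<Lambda>) \<and> I (Suc n) \<subseteq> I n"
  have sub: "submodule (I n) R \<Lambda>" for n
  proof (rule M.submoduleI)
    have In: "submodule (I n) \<Lambda> (regular \<Lambda>)" using I by blast
    note D = \<Lambda>.left_idealD[OF In]
    show "I n \<subseteq> carrier \<Lambda>" "\<zero>\<^bsub>\<Lambda>\<^esub> \<in> I n" by (rule D)+
    show "a \<oplus>\<^bsub>\<Lambda>\<^esub> b \<in> I n" if "a \<in> I n" "b \<in> I n" for a b by (rule D(3)[OF that])
    show "a \<odot>\<^bsub>\<Lambda>\<^esub> b \<in> I n" if "a \<in> carrier R" "b \<in> I n" for a b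
    proof -
      have "b \<in> carrier \<Lambda>" using D(1) that(2) by blast
      then show ?thesis
        unfolding artin_algebra_smult(1)[OF assms that(1) \<open>b \<in> carrier \<Lambda>\<close>]
        using that by (intro D(4)) auto
    qed
  qed
  have span: "{\<Oplus>\<^bsub>\<Lambda>\<^esub>s\<in>S. c s \<odot>\<^bsub>\<Lambda>\<^esub> s | c. c \<in> S \<rightarrow> carrier R} = carrier \<Lambda>"
    by (rule M.generated_subset[OF gen M.span_submodule[OF S(1)] M.span_base[OF S(1)]]) (use S in auto)
  have art: "artinian_ring R" using assms by (simp add: artin_algebra_def artin_algebra_axioms_def)
  have dec: "I (Suc n) \<subseteq> I n" for n using I by blast
  obtain n where n: "\<forall>m\<ge>n. I m \<inter> carrier \<Lambda> = I n \<inter> carrier \<Lambda>"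
    using M.chain_stabilizes_on_span[where I = I, OF art S sub dec] unfolding span by blast
  have "I m = I n" if "n \<le> m" for m
    using n[rule_format, OF that] M.submoduleD(1)[OF sub] by blast
  then show "\<exists>n. \<forall>m\<ge>n. I m = I n" by blast
qed

text \<open>Coefficients from \<open>R\<close> become central elements \<open>c 1\<close> of
  \<open>\<Lambda>\<close>. Centrality is what later lets the elements \<open>e i s e j\<close>
  generate the corners under multiplication from the right.\<close>

lemma artin_algebra_central_generation:
  assumes "artin_algebra R \<Lambda>"
  obtains S where "finite S" "S \<subseteq> carrier \<Lambda>"
    "\<And>x. x \<in> carrier \<Lambda> \<Longrightarrow> \<exists>z\<in>S \<rightarrow> carrier \<Lambda>. x = (\<Oplus>\<^bsub>\<Lambda>\<^esub>s\<in>S. z s \<otimes>\<^bsub>\<Lambda>\<^esub> s) \<and>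
      (\<forall>s\<in>S. \<forall>y\<in>carrier \<Lambda>. z s \<otimes>\<^bsub>\<Lambda>\<^esub> y = y \<otimes>\<^bsub>\<Lambda>\<^esub> z s)"
proof -
  interpret \<Lambda>: ring \<Lambda> by (rule artin_algebra_ring[OF assms])
  interpret M: left_module R \<Lambda> by (rule artin_algebra_left_module[OF assms])
  obtain S where gen: "generates R \<Lambda> S (\<lambda>s. s)"
    using assms by (auto simp: artin_algebra_def artin_algebra_axioms_def fg_module_iff_generates)
  have S: "finite S" "S \<subseteq> carrier \<Lambda>" using generatesD[OF gen] by auto
  have "\<exists>z\<in>S \<rightarrow> carrier \<Lambda>. x = (\<Oplus>\<^bsub>\<Lambda>\<^esub>s\<in>S. z s \<otimes>\<^bsub>\<Lambda>\<^esub> s) \<and>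
      (\<forall>s\<in>S. \<forall>y\<in>carrier \<Lambda>. z s \<otimes>\<^bsub>\<Lambda>\<^esub> y = y \<otimes>\<^bsub>\<Lambda>\<^esub> z s)" if x: "x \<in> carrier \<Lambda>" for x
  proof -
    obtain c where c: "c \<in> S \<rightarrow> carrier R" "x = (\<Oplus>\<^bsub>\<Lambda>\<^esub>s\<in>S. c s \<odot>\<^bsub>\<Lambda>\<^esub> s)" by (rule generatesE[OF gen x])
    let ?z = "\<lambda>s. c s \<odot>\<^bsub>\<Lambda>\<^esub> \<one>\<^bsub>\<Lambda>\<^esub>"
    have cs: "c s \<in> carrier R" if "s \<in> S" for s using c(1) that by blast
    have zc: "?z s \<in> carrier \<Lambda>" if "s \<in> S" for s using cs[OF that] by simp
    have "x = (\<Oplus>\<^bsub>\<Lambda>\<^esub>s\<in>S. ?z s \<otimes>\<^bsub>\<Lambda>\<^esub> s)"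
      unfolding c(2)
    proof (intro \<Lambda>.finsum_cong' refl)
      show "c s \<odot>\<^bsub>\<Lambda>\<^esub> s = ?z s \<otimes>\<^bsub>\<Lambda>\<^esub> s" if "s \<in> S" for s
        using S(2) that by (intro artin_algebra_smult(1)[OF assms cs]) auto
    qed (use zc S(2) in auto)
    moreover have "?z s \<otimes>\<^bsub>\<Lambda>\<^esub> y = y \<otimes>\<^bsub>\<Lambda>\<^esub> ?z s" if "s \<in> S" "y \<in> carrier \<Lambda>" for s y
      by (rule trans[OF artin_algebra_smult(1)[OF assms cs[OF that(1)] that(2), symmetric]
        artin_algebra_smult(2)[OF assms cs[OF that(1)] that(2)]])
    ultimately show ?thesis using zc by (intro bexI[of _ ?z]) auto
  qed
  then show thesis by (rule that[OF S])
qed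

text \<open>\<open>e_primitive\<close> and \<open>e_noniso\<close> say on elements that the modules
  \<open>R e\<^sub>i\<close> are indecomposable and pairwise non-isomorphic: summands of
  \<open>R e\<^sub>i\<close> come from idempotents of \<open>e\<^sub>i R e\<^sub>i\<close>, and
  mutually inverse isomorphisms are right multiplications by \<open>a\<close> and
  \<open>b\<close>.\<close>

locale basic_decomposition = radical_square_zero +
  fixes n :: nat and e
  assumes e_closed [simp]: "\<And>i. i < n \<Longrightarrow> e i \<in> carrier R"
    and e_mult: "\<And>i j. \<lbrakk>i < n; j < n\<rbrakk> \<Longrightarrow> e i \<otimes> e j = (if i = j then e i else \<zero>)"
    and e_sum: "(\<Oplus>i\<in>{..<n}. e i) = \<one>"
    and e_nonzero: "\<And>i. i < n \<Longrightarrow> e i \<noteq> \<zero>"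
    and e_primitive: "\<And>i g. \<lbrakk>i < n; g \<in> carrier R; g \<otimes> g = g; e i \<otimes> g = g; g \<otimes> e i = g\<rbrakk> \<Longrightarrow> g = \<zero> \<or> g = e i"
    and e_noniso: "\<And>i j a b. \<lbrakk>i < n; j < n; a \<in> carrier R; b \<in> carrier R; a \<otimes> e j = a; e j \<otimes> b = b;
      b \<otimes> e i = b; a \<otimes> b = e i; b \<otimes> a = e j\<rbrakk> \<Longrightarrow> i = j"
begin

lemma e_idem: "i < n \<Longrightarrow> e i \<otimes> e i = e i"
  by (simp add: e_mult)

lemma e_not_in_radical: "i < n \<Longrightarrow> e i \<notin> r"
  using square_zero[of "e i" "e i"] e_idem e_nonzero by auto

text \<open>The left ideal \<open>R x\<close> contains an idempotent \<open>g = a x\<close> outside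
  \<open>r\<close>. As \<open>g e\<^sub>i = g\<close>, the element \<open>e\<^sub>i g\<close> is a
  nonzero idempotent of the corner, and primitivity makes it equal to
  \<open>e\<^sub>i\<close>.\<close>

lemma left_inverse:
  assumes i: "i < n" and x: "x \<in> carrier R" "x \<otimes> e i = x" "x \<notin> r"
  shows "\<exists>y\<in>carrier R. y \<otimes> x = e i"
proof -
  let ?L = "{a \<otimes> x | a. a \<in> carrier R}"
  have "x \<in> ?L" using x(1) by (intro CollectI exI[of _ \<one>]) simp
  then have "\<not> ?L \<subseteq> r" using x(3) by blast
  then obtain g where g: "g \<in> ?L" "g \<otimes> g = g" "g \<notin> r"
    by (rule left_ideal_contains_idempotent[OF principal_left_ideal[OF x(1)]])
  obtain a where a: "a \<in> carrier R" "g = a \<otimes> x" using g(1) by blast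
  have gc: "g \<in> carrier R" and ge: "g \<otimes> e i = g" using a x i by (auto simp: m_assoc)
  have ei: "e i \<in> carrier R" using i by simp
  have "(e i \<otimes> g) \<otimes> (e i \<otimes> g) = e i \<otimes> (g \<otimes> e i) \<otimes> g" using ei gc by (simp add: m_assoc)
  also have "\<dots> = e i \<otimes> g" using ge g(2) ei gc by (simp add: m_assoc)
  finally have 1: "(e i \<otimes> g) \<otimes> (e i \<otimes> g) = e i \<otimes> g" .
  have 2: "e i \<otimes> (e i \<otimes> g) = e i \<otimes> g" using ei gc e_idem[OF i] by (simp add: m_assoc[symmetric])
  have 3: "(e i \<otimes> g) \<otimes> e i = e i \<otimes> g" using ei gc ge by (simp add: m_assoc)
  have "e i \<otimes> g \<noteq> \<zero>"
  proof
    assume *: "e i \<otimes> g = \<zero>"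
    have "g = (g \<otimes> e i) \<otimes> g" using ge g(2) by simp
    also have "\<dots> = \<zero>" using * gc ei by (simp add: m_assoc)
    finally show False using g(3) by simp
  qed
  then have "e i \<otimes> g = e i" using e_primitive[OF i _ 1 2 3] ei gc by simp
  then have "(e i \<otimes> a) \<otimes> x = e i" using a ei x(1) by (simp add: m_assoc)
  then show ?thesis using ei a(1) by (intro bexI[of _ "e i \<otimes> a"]) auto
qed

text \<open>A left inverse \<open>y\<close> of \<open>x\<close> is again outside \<open>r\<close>
  and has a left inverse, which is forced to be \<open>x\<close>. So \<open>x\<close> induces an
  isomorphism between \<open>R e\<^sub>i\<close> and \<open>R e\<^sub>j\<close>. Consequently
  corners with distinct indices lie in \<open>r\<close>, and diagonal corners are local.\<close>

lemma unit_between: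
  assumes i: "i < n" and j: "j < n" and x: "x \<in> carrier R" "e i \<otimes> x = x" "x \<otimes> e j = x" "x \<notin> r"
  shows "i = j" "\<exists>b\<in>carrier R. b \<otimes> x = e i \<and> x \<otimes> b = e i"
proof -
  have c: "e i \<in> carrier R" "e j \<in> carrier R" using i j by auto
  obtain y0 where y0: "y0 \<in> carrier R" "y0 \<otimes> x = e j" using left_inverse[OF j x(1,3,4)] by blast
  define y where "y = e j \<otimes> y0 \<otimes> e i"
  have y: "y \<in> carrier R" "e j \<otimes> y = y" "y \<otimes> e i = y"
    using c y0(1) e_idem i j by (simp_all add: y_def m_assoc) (simp add: m_assoc[symmetric])
  have yx: "y \<otimes> x = e j" using c y0 x e_idem[OF j] by (simp add: y_def m_assoc)
  have "y \<notin> r" using yx r.I_r_closed[OF _ x(1), of y] e_not_in_radical[OF j] by auto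
  then obtain z0 where z0: "z0 \<in> carrier R" "z0 \<otimes> y = e i" using left_inverse[OF i y(1,3)] by blast
  have "z0 \<otimes> (y \<otimes> x) = e i \<otimes> x" using z0 y(1) x(1) by (simp add: m_assoc[symmetric])
  then have z0x: "z0 \<otimes> e j = x" using yx x(2) by simp
  have "x \<otimes> y = z0 \<otimes> (e j \<otimes> y)" using z0x z0(1) c(2) y(1) by (simp add: m_assoc[symmetric])
  then have xy: "x \<otimes> y = e i" using y(2) z0(2) by simp
  show "i = j" by (rule e_noniso[OF i j x(1) y(1) x(3) y(2,3) xy yx])
  then show "\<exists>b\<in>carrier R. b \<otimes> x = e i \<and> x \<otimes> b = e i" using y(1) xy yx by blast
qed

text \<open>With \<open>e i = 1\<close> every element outside \<open>r\<close> is left invertible,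
  so \<open>r\<close> contains every proper left ideal.\<close>

lemma local_if_single_idempotent:
  assumes "i < n" "e i = \<one>"
  shows "local_ring R"
proof -
  have r_sub: "submodule r R (regular R)"
    by (rule left_idealI) (auto simp: r_carrier r.a_closed r.I_l_closed)
  have whole: "K = carrier R" if K: "submodule K R (regular R)" "\<not> K \<subseteq> r" for K
  proof -
    obtain x where x: "x \<in> K" "x \<notin> r" using K(2) by blast
    have xc: "x \<in> carrier R" using left_idealD(1)[OF K(1)] x(1) by blast
    obtain y where "y \<in> carrier R" "y \<otimes> x = \<one>" using left_inverse[OF assms(1) xc _ x(2)] assms(2) xc by auto
    then have "\<one> \<in> K" using left_idealD(4)[OF K(1) _ x(1)] by metis
    then show ?thesis by (rule left_ideal_whole[OF K(1)])
  qed
  have rmax: "maximal_left_ideal R r"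
    unfolding maximal_left_ideal_def using r_sub whole one_not_in_radical by blast
  have "I = r" if I: "maximal_left_ideal R I" for I
  proof -
    have "r \<subseteq> I" using I by (auto simp: radical jacobson_radical_def)
    moreover have "I \<subseteq> r" using I whole[of I] by (auto simp: maximal_left_ideal_def)
    ultimately show ?thesis by blast
  qed
  then show ?thesis using rmax ring_axioms unfolding local_ring_def by blast
qed

text \<open>If all corners off the diagonal vanished, \<open>e 0\<close> would be central and would
  split the ring into two ideals. Connectedness then leaves only \<open>e 0 = 1\<close>, which makes
  the ring local.\<close>

lemma exists_connecting_element:
  assumes conn: "connected_ring R" and nonlocal: "\<not> local_ring R"
  obtains i j x where "i < n" "j < n" "i \<noteq> j" "x \<in> carrier R" "e i \<otimes> x = x" "x \<otimes> e j = x" "x \<noteq> \<zero>"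
proof (rule ccontr)
  note obtained = that
  assume no: "\<not> thesis"
  have zero: "x = \<zero>" if "i < n" "j < n" "i \<noteq> j" "x \<in> carrier R" "e i \<otimes> x = x" "x \<otimes> e j = x" for i j x
    by (rule ccontr) (rule notE[OF no obtained[OF that]])
  have ortho: "e i \<otimes> x \<otimes> e j = \<zero>" if "i < n" "j < n" "i \<noteq> j" "x \<in> carrier R" for i j x
    using that e_idem[of i] e_idem[of j] by (intro zero[of i j]) (simp_all add: m_assoc[symmetric], simp add: m_assoc)
  have n: "0 < n"
  proof (rule ccontr)
    assume "\<not> 0 < n"
    then have "\<one> = \<zero>" using e_sum by simp
    then show False using one_not_in_radical by simp
  qed
  have e0: "e 0 \<in> carrier R" using n by simp
  \<comment> \<open>Expanding 1 as the sum of the \<open>e i\<close>, on the right in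
    \<open>e 0 x\<close> and on the left in \<open>x e 0\<close>, leaves \<open>e 0 x e 0\<close> in
    both cases.\<close>
  have central: "e 0 \<otimes> x = x \<otimes> e 0" if x: "x \<in> carrier R" for x
  proof -
    have "e 0 \<otimes> x = e 0 \<otimes> x \<otimes> (\<Oplus>i\<in>{..<n}. e i)" using e0 x by (simp add: e_sum)
    also have "\<dots> = (\<Oplus>i\<in>{..<n}. e 0 \<otimes> x \<otimes> e i)" using e0 x by (intro finsum_rdistr) auto
    also have "\<dots> = (\<Oplus>i\<in>{..<n}. if 0 = i then e 0 \<otimes> x \<otimes> e 0 else \<zero>)"
      using e0 x n ortho[of 0] by (intro finsum_cong') auto
    also have "\<dots> = (\<Oplus>i\<in>{..<n}. e i \<otimes> (x \<otimes> e 0))"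
      using e0 x n ortho[of _ 0] by (intro finsum_cong') (auto simp: m_assoc[symmetric])
    also have "\<dots> = (\<Oplus>i\<in>{..<n}. e i) \<otimes> (x \<otimes> e 0)" using e0 x by (intro finsum_ldistr[symmetric]) auto
    also have "\<dots> = x \<otimes> e 0" using e0 x by (simp add: e_sum)
    finally show ?thesis .
  qed
  define I where "I = {x \<in> carrier R. x \<otimes> e 0 = x}"
  define J where "J = {x \<in> carrier R. x \<otimes> e 0 = \<zero>}"
  have idl: "ideal K R" if K: "submodule K R (regular R)" "\<And>x a. \<lbrakk>x \<in> K; a \<in> carrier R\<rbrakk> \<Longrightarrow> x \<otimes> a \<in> K" for K
  proof (rule idealI[OF ring_axioms])
    show "subgroup K (add_monoid R)"
      using left_idealD[OF K(1)] left_ideal_minus[OF K(1)]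
      by (intro subgroup.intro) (auto simp: a_inv_def[symmetric])
  qed (use K(2) left_idealD(4)[OF K(1)] in auto)
  have swap: "x \<otimes> a \<otimes> e 0 = x \<otimes> e 0 \<otimes> a" if "x \<in> carrier R" "a \<in> carrier R" for x a
    using that e0 central[of a] by (simp add: m_assoc)
  have "ideal I R"
  proof (rule idl)
    show "submodule I R (regular R)"
      by (rule left_idealI) (use e0 in \<open>auto simp: I_def l_distr m_assoc\<close>)
    show "x \<otimes> a \<in> I" if "x \<in> I" "a \<in> carrier R" for x a
      using that swap[of x a] by (simp add: I_def)
  qed
  moreover have "ideal J R"
  proof (rule idl)
    show "submodule J R (regular R)"
      by (rule left_idealI) (use e0 in \<open>auto simp: J_def l_distr m_assoc\<close>)
    show "x \<otimes> a \<in> J" if "x \<in> J" "a \<in> carrier R" for x a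
      using that swap[of x a] by (simp add: J_def)
  qed
  moreover have "I \<inter> J = {\<zero>}" using e0 by (auto simp: I_def J_def)
  moreover have "I <+>\<^bsub>R\<^esub> J = carrier R"
  proof (intro equalityI subsetI)
    fix x assume x: "x \<in> carrier R"
    have "x \<otimes> e 0 \<in> I" using x e0 e_idem[OF n] by (simp add: I_def m_assoc)
    moreover have "x \<ominus> x \<otimes> e 0 \<in> J"
      using x e0 e_idem[OF n] by (simp add: J_def minus_eq l_distr l_minus m_assoc r_neg)
    moreover have "x = x \<otimes> e 0 \<oplus> (x \<ominus> x \<otimes> e 0)"
      using x e0 by (simp add: minus_eq a_ac r_neg r_neg1 r_neg2)
    ultimately show "x \<in> I <+>\<^bsub>R\<^esub> J" unfolding set_add_def' by blast
  qed (auto simp: set_add_def' I_def J_def)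
  ultimately have "I = {\<zero>} \<or> J = {\<zero>}" using conn unfolding connected_ring_def by blast
  moreover have "e 0 \<in> I" using e0 e_idem[OF n] by (simp add: I_def)
  moreover have "\<one> \<ominus> e 0 \<in> J" using e0 e_idem[OF n] by (simp add: J_def minus_eq l_distr l_minus r_neg)
  ultimately have "e 0 = \<zero> \<or> \<one> \<ominus> e 0 = \<zero>" by blast
  then have "e 0 = \<one>" using e_nonzero[OF n] e0 by auto
  then show False using local_if_single_idempotent[OF n] nonlocal by blast
qed

end

text \<open>The idempotents are the components of 1 in the decomposition of the regular module.
  Uniqueness of components shows that \<open>e j\<close> acts on \<open>N i\<close> from the right
  as identity or as zero, so that \<open>N i = R e\<^sub>i\<close>.\<close>

lemma (in radical_square_zero) exists_basic_decomposition:
  assumes basic: "basic_ring R"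
  obtains n e where "basic_decomposition R r n e"
proof -
  interpret reg: left_module R "regular R" by (rule regular_left_module)
  obtain n :: nat and N where ds: "internal_direct_sum R (regular R) {..<n} N"
    and ind: "\<And>i. i < n \<Longrightarrow> indecomposable R (restrict_module (regular R) (N i))"
    and noniso: "\<And>i j. \<lbrakk>i < n; j < n; i \<noteq> j\<rbrakk> \<Longrightarrow>
      \<not> mod_iso R (restrict_module (regular R) (N i)) (restrict_module (regular R) (N j))"
    using basic unfolding basic_ring_def basic_module_def by blast
  have sN: "submodule (N i) R (regular R)" if "i < n" for i
    using ds that by (simp add: internal_direct_sum_def)
  note NS = left_idealD[OF sN]
  have uniq: "\<exists>!c. c \<in> (\<Pi>\<^sub>E i\<in>{..<n}. N i) \<and> x = (\<Oplus>i\<in>{..<n}. c i)" if "x \<in> carrier R" for x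
    using ds that by (simp add: internal_direct_sum_def finsum_regular)
  obtain e where e: "e \<in> (\<Pi>\<^sub>E i\<in>{..<n}. N i)" "\<one> = (\<Oplus>i\<in>{..<n}. e i)" using uniq[OF one_closed] by blast
  have eN: "e i \<in> N i" if "i < n" for i using e(1) that by (auto simp: PiE_iff)
  have ec: "e i \<in> carrier R" if "i < n" for i using NS(1)[OF that] eN[OF that] by blast
  have key: "x \<otimes> e j = (if i = j then x else \<zero>)" if i: "i < n" and j: "j < n" and x: "x \<in> N i" for i j x
  proof -
    have xc: "x \<in> carrier R" using NS(1)[OF i] x by blast
    \<comment> \<open>Two decompositions of the same \<open>x\<close>: \<open>c\<close> arises by
      multiplying the decomposition of 1 by \<open>x\<close>, while \<open>d\<close> has
      \<open>x\<close> itself as its only component.\<close>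
    define c where "c = (\<lambda>j\<in>{..<n}. x \<otimes> e j)"
    define d where "d = (\<lambda>j\<in>{..<n}. if i = j then x else \<zero>)"
    have "c \<in> (\<Pi>\<^sub>E i\<in>{..<n}. N i)" using NS(4) xc eN by (auto simp: c_def)
    moreover have "x = (\<Oplus>j\<in>{..<n}. c j)"
    proof -
      have "x = x \<otimes> (\<Oplus>j\<in>{..<n}. e j)" using e(2)[symmetric] xc by simp
      also have "\<dots> = (\<Oplus>j\<in>{..<n}. x \<otimes> e j)" using xc ec by (intro finsum_rdistr) auto
      also have "\<dots> = (\<Oplus>j\<in>{..<n}. c j)" using xc ec by (intro finsum_cong') (auto simp: c_def)
      finally show ?thesis .
    qed
    moreover have "d \<in> (\<Pi>\<^sub>E i\<in>{..<n}. N i)" using NS(2) x by (auto simp: d_def)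
    moreover have "x = (\<Oplus>j\<in>{..<n}. d j)"
    proof -
      have "(\<Oplus>j\<in>{..<n}. d j) = (\<Oplus>j\<in>{..<n}. if i = j then x else \<zero>)"
        using xc by (intro finsum_cong') (auto simp: d_def)
      also have "\<dots> = x" using i xc add.finprod_singleton[of i "{..<n}" "\<lambda>_. x"] by simp
      finally show ?thesis by simp
    qed
    ultimately have "c = d" using uniq[OF xc] by blast
    then have "c j = d j" by simp
    then show ?thesis using j by (simp add: c_def d_def)
  qed
  have N_iff: "y \<in> N i \<longleftrightarrow> y \<in> carrier R \<and> y \<otimes> e i = y" if i: "i < n" for i y
    using key[OF i i, of y] NS(1)[OF i] NS(4)[OF i, of y "e i"] eN[OF i] by auto
  have sub: "submodule K R (restrict_module (regular R) (N i))"
    if "i < n" "submodule K R (regular R)" "K \<subseteq> N i" for K i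
    using reg.submodule_of_submodule[OF sN[OF that(1)], of K] that(2,3) by simp
  have nz: "e i \<noteq> \<zero>" if i: "i < n" for i
  proof
    assume *: "e i = \<zero>"
    have "x = \<zero>" if "x \<in> N i" for x using that * N_iff[OF i, of x] by auto
    then have "N i = {\<zero>}" using NS(2)[OF i] by blast
    then show False using ind[OF i] by (simp add: indecomposable_def)
  qed
  have prim: "g = \<zero> \<or> g = e i"
    if i: "i < n" and g: "g \<in> carrier R" "g \<otimes> g = g" "e i \<otimes> g = g" "g \<otimes> e i = g" for i g
  proof -
    have ei: "e i \<in> carrier R" by (rule ec[OF i])
    have ee: "e i \<otimes> e i = e i" using key[OF i i eN[OF i]] by simp
    \<comment> \<open>Right multiplication by \<open>g\<close> is a projection of
      \<open>N i\<close>, with image \<open>A\<close> and kernel \<open>B\<close>.\<close>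
    define A where "A = {y \<in> N i. y \<otimes> g = y}"
    define B where "B = {y \<in> N i. y \<otimes> g = \<zero>}"
    have mem: "y \<in> carrier R" if "y \<in> N i" for y using NS(1)[OF i] that by blast
    have sA: "submodule A R (regular R)"
      by (rule left_idealI) (use mem NS[OF i] g(1) in \<open>auto simp: A_def l_distr m_assoc\<close>)
    have sB: "submodule B R (regular R)"
      by (rule left_idealI) (use mem NS[OF i] g(1) in \<open>auto simp: B_def l_distr m_assoc\<close>)
    have "complementary R (restrict_module (regular R) (N i)) A B"
      unfolding complementary_def
    proof (intro conjI)
      show "submodule A R (restrict_module (regular R) (N i))" by (rule sub[OF i sA]) (auto simp: A_def)
      show "submodule B R (restrict_module (regular R) (N i))" by (rule sub[OF i sB]) (auto simp: B_def)
      show "A \<inter> B = {\<zero>\<^bsub>restrict_module (regular R) (N i)\<^esub>}"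
        using NS(2)[OF i] g(1) by (auto simp: A_def B_def)
      show "A <+>\<^bsub>restrict_module (regular R) (N i)\<^esub> B = carrier (restrict_module (regular R) (N i))"
      proof (intro equalityI subsetI)
        fix y assume "y \<in> carrier (restrict_module (regular R) (N i))"
        then have y: "y \<in> N i" by simp
        have yc: "y \<in> carrier R" by (rule mem[OF y])
        have gN: "g \<in> N i" using N_iff[OF i] g by simp
        have yg: "y \<otimes> g \<in> N i" by (rule NS(4)[OF i yc gN])
        have "y \<otimes> g \<in> A" using yg yc g by (simp add: A_def m_assoc)
        moreover have "y \<ominus> y \<otimes> g \<in> B"
          using NS(3)[OF i y left_ideal_minus[OF sN[OF i] yg]] yc g
          by (simp add: B_def minus_eq l_distr l_minus m_assoc r_neg)
        moreover have "y = y \<otimes> g \<oplus> (y \<ominus> y \<otimes> g)" using yc g(1) by (simp add: minus_eq a_ac r_neg r_neg1 r_neg2)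
        ultimately show "y \<in> A <+>\<^bsub>restrict_module (regular R) (N i)\<^esub> B"
          unfolding set_add_def' by auto
      qed (use NS(3)[OF i] in \<open>auto simp: set_add_def' A_def B_def\<close>)
    qed
    then have "A = {\<zero>} \<or> B = {\<zero>}" using ind[OF i] unfolding indecomposable_def by simp
    moreover have "g \<in> A" using N_iff[OF i] g by (simp add: A_def)
    moreover have "e i \<ominus> g \<in> B"
      using N_iff[OF i] g ei ee by (simp add: B_def minus_eq l_distr l_minus r_neg)
    ultimately have "g = \<zero> \<or> e i \<ominus> g = \<zero>" by blast
    then show ?thesis using ei g(1) by auto
  qed
  have inj: "i = j"
    if i: "i < n" and j: "j < n" and a: "a \<in> carrier R" "a \<otimes> e j = a" and b: "b \<in> carrier R" "b \<otimes> e i = b"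
      and ab: "a \<otimes> b = e i" and ba: "b \<otimes> a = e j" for i j a b
  proof (rule ccontr)
    assume "i \<noteq> j"
    have "mod_iso R (restrict_module (regular R) (N i)) (restrict_module (regular R) (N j))"
    proof (rule mod_isoI[OF reg.submodule_is_left_module[OF sN[OF i]], of _ "\<lambda>y. y \<otimes> a"])
      have 1: "y \<otimes> a \<in> N j" if "y \<in> N i" for y
        using N_iff[OF j] N_iff[OF i] that a ec[OF j] by (simp add: m_assoc)
      have 2: "z \<otimes> b \<in> N i" if "z \<in> N j" for z
        using N_iff[OF j] N_iff[OF i] that b ec[OF i] by (simp add: m_assoc)
      show "lin R (restrict_module (regular R) (N i)) (restrict_module (regular R) (N j)) (\<lambda>y. y \<otimes> a)"
        by (rule linI) (use 1 a(1) N_iff[OF i] in \<open>auto simp: l_distr m_assoc\<close>)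
      have "bij_betw (\<lambda>y. y \<otimes> a) (N i) (N j)"
        by (rule bij_betw_byWitness[of _ "\<lambda>z. z \<otimes> b"])
          (use 1 2 a(1) b(1) ab ba N_iff[OF i] N_iff[OF j] in \<open>auto simp: m_assoc\<close>)
      then show "bij_betw (\<lambda>y. y \<otimes> a) (carrier (restrict_module (regular R) (N i)))
          (carrier (restrict_module (regular R) (N j)))" by simp
    qed
    then show False using noniso[OF i j \<open>i \<noteq> j\<close>] by blast
  qed
  have "basic_decomposition R r n e"
  proof (unfold_locales)
    show "e i \<in> carrier R" if "i < n" for i by (rule ec[OF that])
    show "e i \<otimes> e j = (if i = j then e i else \<zero>)" if "i < n" "j < n" for i j
      by (rule key[OF that eN[OF that(1)]])
    show "(\<Oplus>i\<in>{..<n}. e i) = \<one>" using e(2) by simp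
    show "e i \<noteq> \<zero>" if "i < n" for i by (rule nz[OF that])
    show "g = \<zero> \<or> g = e i" if "i < n" "g \<in> carrier R" "g \<otimes> g = g" "e i \<otimes> g = g" "g \<otimes> e i = g" for i g
      by (rule prim[OF that])
    show "i = j" if "i < n" "j < n" "a \<in> carrier R" "b \<in> carrier R" "a \<otimes> e j = a" "e j \<otimes> b = b"
      "b \<otimes> e i = b" "a \<otimes> b = e i" "b \<otimes> a = e j" for i j a b
      by (rule inj[OF that(1-3,5,4,7-9)])
  qed
  then show thesis by (rule that)
qed

section \<open>The mutation of the regular module\<close>

lemma presented_cong:
  assumes "presented R A I \<epsilon> x u" "\<And>k. k \<in> I \<Longrightarrow> \<epsilon>' k = \<epsilon> k" "\<And>k. k \<in> I \<Longrightarrow> x' k = x k"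
  shows "presented R A I \<epsilon>' x' u"
proof -
  have "(\<forall>k\<in>I. c k \<otimes>\<^bsub>R\<^esub> \<epsilon>' k = a \<otimes>\<^bsub>R\<^esub> x' k) \<longleftrightarrow> (\<forall>k\<in>I. c k \<otimes>\<^bsub>R\<^esub> \<epsilon> k = a \<otimes>\<^bsub>R\<^esub> x k)" for c a
    using assms(2,3) by simp
  moreover have "\<epsilon>' \<in> I \<rightarrow> carrier R" "x' \<in> I \<rightarrow> carrier R"
    using presentedD(5,6)[OF assms(1)] assms(2,3) by (auto simp: Pi_iff)
  ultimately show ?thesis using assms unfolding presented_def by simp
qed

lemma lin_zero: "left_module R B \<Longrightarrow> lin R A B (\<lambda>_. \<zero>\<^bsub>B\<^esub>)"
proof -
  assume "left_module R B"
  then interpret left_module R B .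
  show ?thesis by (rule linI) auto
qed

lemma lin_finsum:
  fixes n :: nat
  assumes A: "left_module R A" and B: "left_module R B" and f: "\<And>k. k < n \<Longrightarrow> lin R A B (f k)"
  shows "lin R A B (\<lambda>y. \<Oplus>\<^bsub>B\<^esub>k\<in>{..<n}. f k y)"
  using f
proof (induction n)
  case 0
  interpret left_module R B by (rule B)
  show ?case using lin_zero[OF B] by simp
next
  case (Suc n)
  interpret left_module R B by (rule B)
  have 1: "lin R A B (\<lambda>y. f n y \<oplus>\<^bsub>B\<^esub> (\<Oplus>\<^bsub>B\<^esub>k\<in>{..<n}. f k y))"
    by (rule lin_plus[OF B Suc.prems Suc.IH]) (use Suc.prems in auto)
  have 2: "(\<Oplus>\<^bsub>B\<^esub>k\<in>{..<Suc n}. f k y) = f n y \<oplus>\<^bsub>B\<^esub> (\<Oplus>\<^bsub>B\<^esub>k\<in>{..<n}. f k y)" if "y \<in> carrier A" for y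
    unfolding lessThan_Suc using lin_closed[OF Suc.prems that] by (intro M.finsum_insert) auto
  show ?case by (rule lin_cong[OF A 1 2])
qed

text \<open>The relation lives in block \<open>i\<close> only, so inclusions and projections between
  \<open>T\<close> and the blocks can be defined on generators. They satisfy the identities of a
  direct sum there, hence everywhere, and \<open>direct_sum_of_local\<close> applies.\<close>

lemma presented_blocks:
  fixes A :: "nat \<Rightarrow> ('a, 'n, 'z) module_scheme"
  assumes T: "presented R T I \<epsilon> x w" and b: "\<And>m. m \<in> I \<Longrightarrow> b m < n"
    and supp: "\<And>m. \<lbrakk>m \<in> I; b m \<noteq> i\<rbrakk> \<Longrightarrow> x m = \<zero>\<^bsub>R\<^esub>"
    and A: "\<And>k. k < n \<Longrightarrow> presented R (A k) {m \<in> I. b m = k} \<epsilon> x (u k)"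
    and loc: "\<And>k. k < n \<Longrightarrow> local_end R (A k)"
    and noniso: "\<And>k l. \<lbrakk>k < n; l < n; mod_iso R (A k) (A l)\<rbrakk> \<Longrightarrow> k = l"
  shows "basic_module R T \<and> num_summands R T = n"
proof -
  note D = presentedD[OF T] and DA = presentedD[OF A]
  interpret T: left_module R T by (rule D(1))
  have xc: "x m \<in> carrier R" and \<epsilon>c: "\<epsilon> m \<in> carrier R" and wc: "w m \<in> carrier T" if "m \<in> I" for m
    using D(4,5,6) that by auto
  have uc: "u k m \<in> carrier (A k)" if "k < n" "m \<in> I" "b m = k" for k m using DA(4)[OF that(1)] that by auto
  have relT: "(\<Oplus>\<^bsub>T\<^esub>m\<in>I. x m \<odot>\<^bsub>T\<^esub> w m) = \<zero>\<^bsub>T\<^esub>"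
    using D(9)[OF D(6)] D(8) xc by (auto intro!: bexI[of _ "\<one>\<^bsub>R\<^esub>"])
  have "\<exists>f. lin R (A k) T f \<and> (\<forall>m\<in>{m \<in> I. b m = k}. f (u k m) = w m)" if k: "k < n" for k
  proof -
    \<comment> \<open>The sum over block \<open>i\<close> is the full relation of \<open>T\<close>,
      all other terms being zero; over any other block every coefficient is zero.\<close>
    have "(\<Oplus>\<^bsub>T\<^esub>m\<in>{m \<in> I. b m = k}. x m \<odot>\<^bsub>T\<^esub> w m) = \<zero>\<^bsub>T\<^esub>"
    proof (cases "k = i")
      case True
      have "(\<Oplus>\<^bsub>T\<^esub>m\<in>{m \<in> I. b m = k}. x m \<odot>\<^bsub>T\<^esub> w m) = (\<Oplus>\<^bsub>T\<^esub>m\<in>I. x m \<odot>\<^bsub>T\<^esub> w m)"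
        using supp xc wc True D(3) by (intro T.M.add.finprod_mono_neutral_cong_left) auto
      then show ?thesis using relT by simp
    next
      case False
      then show ?thesis using supp wc by (intro T.M.add.finprod_one_eqI) auto
    qed
    note rel = this
    have wk: "w \<in> {m \<in> I. b m = k} \<rightarrow> carrier T" using wc by auto
    have \<epsilon>w: "\<epsilon> m \<odot>\<^bsub>T\<^esub> w m = w m" if "m \<in> {m \<in> I. b m = k}" for m
      using presented_idem[OF T] that by simp
    obtain f where "lin R (A k) T f" "\<And>m. m \<in> {m \<in> I. b m = k} \<Longrightarrow> f (u k m) = w m"
      by (rule hom_from_presented[OF A[OF k] D(1) wk \<epsilon>w rel]) blast+
    then show ?thesis by blast
  qed
  then have "\<forall>k\<in>{..<n}. \<exists>f. lin R (A k) T f \<and> (\<forall>m\<in>{m \<in> I. b m = k}. f (u k m) = w m)" by simp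
  from bchoice[OF this] obtain \<iota> where
    \<iota>: "\<And>k. k < n \<Longrightarrow> lin R (A k) T (\<iota> k)" "\<And>k m. \<lbrakk>k < n; m \<in> I; b m = k\<rbrakk> \<Longrightarrow> \<iota> k (u k m) = w m" by auto
  have "\<exists>f. lin R T (A k) f \<and> (\<forall>m\<in>I. f (w m) = (if b m = k then u k m else \<zero>\<^bsub>A k\<^esub>))" if k: "k < n" for k
  proof -
    interpret A: left_module R "A k" by (rule DA(1)[OF k])
    let ?y = "\<lambda>m. if b m = k then u k m else \<zero>\<^bsub>A k\<^esub>"
    have "(\<Oplus>\<^bsub>A k\<^esub>m\<in>{m \<in> I. b m = k}. x m \<odot>\<^bsub>A k\<^esub> u k m) = (\<Oplus>\<^bsub>A k\<^esub>m\<in>I. x m \<odot>\<^bsub>A k\<^esub> ?y m)"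
      using xc uc[OF k] D(3) by (intro A.M.add.finprod_mono_neutral_cong_left) auto
    moreover have "(\<Oplus>\<^bsub>A k\<^esub>m\<in>{m \<in> I. b m = k}. x m \<odot>\<^bsub>A k\<^esub> u k m) = \<zero>\<^bsub>A k\<^esub>"
      using DA(9)[OF k DA(6)[OF k]] DA(8)[OF k] xc by (auto intro!: bexI[of _ "\<one>\<^bsub>R\<^esub>"])
    ultimately have rel: "(\<Oplus>\<^bsub>A k\<^esub>m\<in>I. x m \<odot>\<^bsub>A k\<^esub> ?y m) = \<zero>\<^bsub>A k\<^esub>" by simp
    have y: "?y \<in> I \<rightarrow> carrier (A k)" using uc[OF k] by auto
    have \<epsilon>y: "\<epsilon> m \<odot>\<^bsub>A k\<^esub> ?y m = ?y m" if "m \<in> I" for m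
      using presented_idem[OF A[OF k], of m] \<epsilon>c[OF that] that by simp
    obtain f where "lin R T (A k) f" "\<And>m. m \<in> I \<Longrightarrow> f (w m) = ?y m"
      by (rule hom_from_presented[OF T DA(1)[OF k] y \<epsilon>y rel]) blast+
    then show ?thesis by blast
  qed
  then have "\<forall>k\<in>{..<n}. \<exists>f. lin R T (A k) f \<and> (\<forall>m\<in>I. f (w m) = (if b m = k then u k m else \<zero>\<^bsub>A k\<^esub>))" by simp
  from bchoice[OF this] obtain \<rho> where \<rho>: "\<And>k. k < n \<Longrightarrow> lin R T (A k) (\<rho> k)"
    "\<And>k m. \<lbrakk>k < n; m \<in> I\<rbrakk> \<Longrightarrow> \<rho> k (w m) = (if b m = k then u k m else \<zero>\<^bsub>A k\<^esub>)" by auto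
  have \<rho>\<iota>: "\<rho> k (\<iota> k a) = a" if "k < n" "a \<in> carrier (A k)" for k a
    by (rule lin_eq_on_generators[OF DA(1)[OF that(1)] DA(1)[OF that(1)] lin_comp[OF \<iota>(1) \<rho>(1)] lin_id DA(2) _ that(2)])
      (use that \<iota>(2) \<rho>(2) in auto)
  have orth: "\<rho> k (\<iota> l a) = \<zero>\<^bsub>A k\<^esub>" if "k < n" "l < n" "k \<noteq> l" "a \<in> carrier (A l)" for k l a
    by (rule lin_eq_on_generators[OF DA(1)[OF that(2)] DA(1)[OF that(1)] lin_comp[OF \<iota>(1) \<rho>(1)] lin_zero[OF DA(1)] DA(2) _ that(4)])
      (use that \<iota>(2) \<rho>(2) in auto)
  have sum: "y = (\<Oplus>\<^bsub>T\<^esub>k\<in>{..<n}. \<iota> k (\<rho> k y))" if y: "y \<in> carrier T" for y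
  proof (rule lin_eq_on_generators[OF D(1) D(1) lin_id lin_finsum[OF D(1) D(1)] D(2) _ y])
    show "lin R T T (\<lambda>y. \<iota> k (\<rho> k y))" if "k < n" for k by (rule lin_comp[OF \<rho>(1) \<iota>(1)]) (use that in auto)
    fix m assume m: "m \<in> I"
    have "(\<Oplus>\<^bsub>T\<^esub>k\<in>{..<n}. \<iota> k (\<rho> k (w m))) = (\<Oplus>\<^bsub>T\<^esub>k\<in>{..<n}. if b m = k then w m else \<zero>\<^bsub>T\<^esub>)"
    proof (intro T.M.finsum_cong' refl)
      fix k assume "k \<in> {..<n}"
      then have k: "k < n" by simp
      interpret \<iota>: module_hom R "A k" T "\<iota> k" by (rule module_homI[OF DA(1)[OF k] D(1) \<iota>(1)[OF k]])
      show "\<iota> k (\<rho> k (w m)) = (if b m = k then w m else \<zero>\<^bsub>T\<^esub>)"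
        using \<rho>(2)[OF k m] \<iota>(2)[OF k m] by simp
    qed (use wc[OF m] in auto)
    also have "\<dots> = w m" using b[OF m] wc[OF m] T.M.finsum_singleton[of "b m" "{..<n}" "\<lambda>_. w m"] by simp
    finally show "w m = (\<Oplus>\<^bsub>T\<^esub>k\<in>{..<n}. \<iota> k (\<rho> k (w m)))" by simp
  qed
  show ?thesis
    using direct_sum_of_local[OF D(1) \<iota>(1) \<rho>(1) \<rho>\<iota> orth sum loc noniso] by blast
qed

section \<open>Generators of the corners off the diagonal\<close>

context basic_decomposition
begin

text \<open>
  A generator \<open>x \<in> e\<^sub>i R e\<^sub>j\<close> is stored together with \<open>j\<close>, so that families of maps
  \<open>Re\<^sub>i \<rightarrow> Re\<^sub>j\<close> can be indexed by sets of such pairs.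
\<close>

definition rspan :: "('a \<times> nat) set \<Rightarrow> nat \<Rightarrow> 'a \<Rightarrow> bool" where
  "rspan G j y \<longleftrightarrow> (\<exists>h\<in>G \<rightarrow> carrier R. y = (\<Oplus>g\<in>G. fst g \<otimes> h g) \<and>
    (\<forall>g\<in>G. e (snd g) \<otimes> h g = h g \<and> h g \<otimes> e j = h g))"

definition corner :: "nat \<Rightarrow> ('a \<times> nat) set" where
  "corner i = {(x, j). j < n \<and> j \<noteq> i \<and> x \<in> carrier R \<and> e i \<otimes> x = x \<and> x \<otimes> e j = x}"

lemma cornerD:
  assumes "g \<in> corner i"
  shows "fst g \<in> carrier R" "snd g < n" "snd g \<noteq> i" "e i \<otimes> fst g = fst g" "fst g \<otimes> e (snd g) = fst g"
  using assms by (auto simp: corner_def)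

text \<open>An element outside \<open>r\<close> would make two distinct indices equal by
  \<open>unit_between\<close>.\<close>

lemma corner_in_radical:
  assumes "i < n" "g \<in> corner i"
  shows "fst g \<in> r"
  using unit_between(1)[OF assms(1) cornerD(2,1,4,5)[OF assms(2)]] cornerD(3)[OF assms(2)] by auto

lemma rspan_zero:
  assumes "j < n" "G \<subseteq> corner i"
  shows "rspan G j \<zero>"
proof -
  have c: "fst g \<in> carrier R" "snd g < n" if "g \<in> G" for g
    using cornerD[OF subsetD[OF assms(2) that]] by auto
  have "(\<Oplus>g\<in>G. fst g \<otimes> \<zero>) = \<zero>" using c by (intro add.finprod_one_eqI) auto
  then show ?thesis
    unfolding rspan_def using c assms(1) by (intro bexI[of _ "\<lambda>_. \<zero>"]) auto
qed

lemma rspan_add: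
  assumes "j < n" "finite G" "G \<subseteq> corner i" "rspan G j y" "rspan G j z"
  shows "rspan G j (y \<oplus> z)"
proof -
  obtain h k where h: "h \<in> G \<rightarrow> carrier R" "y = (\<Oplus>g\<in>G. fst g \<otimes> h g)" "\<forall>g\<in>G. e (snd g) \<otimes> h g = h g \<and> h g \<otimes> e j = h g"
    and k: "k \<in> G \<rightarrow> carrier R" "z = (\<Oplus>g\<in>G. fst g \<otimes> k g)" "\<forall>g\<in>G. e (snd g) \<otimes> k g = k g \<and> k g \<otimes> e j = k g"
    using assms(4,5) unfolding rspan_def by blast
  have c: "fst g \<in> carrier R" "e (snd g) \<in> carrier R" "h g \<in> carrier R" "k g \<in> carrier R" if "g \<in> G" for g
    using cornerD[OF subsetD[OF assms(3) that]] that h(1) k(1) by auto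
  have "y \<oplus> z = (\<Oplus>g\<in>G. fst g \<otimes> h g \<oplus> fst g \<otimes> k g)"
    unfolding h(2) k(2) using c by (intro finsum_addf[symmetric]) auto
  also have "\<dots> = (\<Oplus>g\<in>G. fst g \<otimes> (h g \<oplus> k g))"
    using c by (intro finsum_cong') (auto simp: r_distr)
  finally show ?thesis
    unfolding rspan_def using h k c assms(1) by (intro bexI[of _ "\<lambda>g. h g \<oplus> k g"]) (auto simp: l_distr r_distr)
qed

lemma rspan_mult:
  assumes "j < n" "l < n" "finite G" "G \<subseteq> corner i" "rspan G l y" "c \<in> carrier R" "c \<otimes> e j = c"
  shows "rspan G j (y \<otimes> c)"
proof -
  obtain h where h: "h \<in> G \<rightarrow> carrier R" "y = (\<Oplus>g\<in>G. fst g \<otimes> h g)" "\<forall>g\<in>G. e (snd g) \<otimes> h g = h g \<and> h g \<otimes> e l = h g"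
    using assms(5) unfolding rspan_def by blast
  have cl: "fst g \<in> carrier R" "e (snd g) \<in> carrier R" "h g \<in> carrier R" if "g \<in> G" for g
    using cornerD[OF subsetD[OF assms(4) that]] that h(1) by auto
  have "y \<otimes> c = (\<Oplus>g\<in>G. (fst g \<otimes> h g) \<otimes> c)"
    unfolding h(2) using cl assms by (intro finsum_ldistr) auto
  also have "\<dots> = (\<Oplus>g\<in>G. fst g \<otimes> (h g \<otimes> c))"
    using cl assms by (intro finsum_cong') (auto simp: m_assoc)
  finally have eq: "y \<otimes> c = (\<Oplus>g\<in>G. fst g \<otimes> (h g \<otimes> c))" .
  have "e (snd g) \<otimes> (h g \<otimes> c) = h g \<otimes> c \<and> (h g \<otimes> c) \<otimes> e j = h g \<otimes> c" if "g \<in> G" for g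
    using cl[OF that] h(3) assms(1,6,7) that by (simp add: m_assoc) (simp add: m_assoc[symmetric])
  then show ?thesis
    unfolding rspan_def using eq cl assms(6) by (intro bexI[of _ "\<lambda>g. h g \<otimes> c"]) auto
qed

lemma rspan_base:
  assumes "finite G" "G \<subseteq> corner i" "g \<in> G"
  shows "rspan G (snd g) (fst g)"
proof -
  have c: "fst g \<in> carrier R" "e (snd g) \<in> carrier R" "fst g \<otimes> e (snd g) = fst g" "snd g < n" if "g \<in> G" for g
    using cornerD[OF subsetD[OF assms(2) that]] by auto
  let ?h = "\<lambda>g'. if g = g' then e (snd g) else \<zero>"
  have "(\<Oplus>g'\<in>G. fst g' \<otimes> ?h g') = (\<Oplus>g'\<in>G. if g = g' then fst g' else \<zero>)"
    using c by (intro finsum_cong') auto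
  also have "\<dots> = fst g" using assms c by (intro finsum_singleton) auto
  finally show ?thesis
    unfolding rspan_def using c assms(3) e_idem by (intro bexI[of _ ?h]) auto
qed

lemma rspan_mono:
  assumes "rspan G j y" "G \<subseteq> G'" "finite G'" "G' \<subseteq> corner i \<union> {\<zero>} \<times> {..<n}" "j < n"
  shows "rspan G' j y"
proof -
  obtain h where h: "h \<in> G \<rightarrow> carrier R" "y = (\<Oplus>g\<in>G. fst g \<otimes> h g)" "\<forall>g\<in>G. e (snd g) \<otimes> h g = h g \<and> h g \<otimes> e j = h g"
    using assms(1) unfolding rspan_def by blast
  have c: "fst g \<in> carrier R" "e (snd g) \<in> carrier R" if "g \<in> G'" for g
  proof -
    have "g \<in> corner i \<or> g \<in> {\<zero>} \<times> {..<n}" using assms(4) that by blast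
    then show "fst g \<in> carrier R" "e (snd g) \<in> carrier R" using cornerD[of g i] by auto
  qed
  have hc: "h g \<in> carrier R" if "g \<in> G" for g using h(1) that by blast
  let ?h = "\<lambda>g. if g \<in> G then h g else \<zero>"
  have "y = (\<Oplus>g\<in>G'. fst g \<otimes> ?h g)"
    unfolding h(2) using assms(2,3) c hc by (intro add.finprod_mono_neutral_cong_left) auto
  then show ?thesis
    unfolding rspan_def using h(3) hc c assms(2,5) by (intro bexI[of _ ?h]) auto
qed

end

context basic_decomposition
begin

lemma rspan_finsum:
  assumes "finite S" "j < n" "finite G" "G \<subseteq> corner i" "\<And>s. s \<in> S \<Longrightarrow> rspan G j (f s)" "f \<in> S \<rightarrow> carrier R"
  shows "rspan G j (\<Oplus>s\<in>S. f s)"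
  using assms(1,5,6)
proof (induct rule: finite_induct)
  case empty
  then show ?case using rspan_zero[OF assms(2,4)] by simp
next
  case (insert s S)
  have "(\<Oplus>s\<in>insert s S. f s) = f s \<oplus> (\<Oplus>s\<in>S. f s)" using insert by (intro finsum_insert) auto
  moreover have "rspan G j (f s \<oplus> (\<Oplus>s\<in>S. f s))"
    using insert by (intro rspan_add[OF assms(2-4)]) auto
  ultimately show ?case by simp
qed

text \<open>Among the finite families whose right multiples give all
  \<open>e\<^sub>i R e\<^sub>j\<close> with \<open>j \<noteq> i\<close>, one of least size is taken.
  A relation with a coefficient outside \<open>r\<close> would make that coefficient invertible, and
  its generator could be dropped. This is the minimality of the approximation, in elements.\<close>

lemma exists_minimal_generators:
  assumes i: "i < n" and S: "finite S" "S \<subseteq> carrier R"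
    and cgen: "\<And>x. x \<in> carrier R \<Longrightarrow> \<exists>z\<in>S \<rightarrow> carrier R. x = (\<Oplus>s\<in>S. z s \<otimes> s) \<and>
      (\<forall>s\<in>S. \<forall>y\<in>carrier R. z s \<otimes> y = y \<otimes> z s)"
  obtains G where "finite G" "G \<subseteq> corner i"
    "\<And>j y. \<lbrakk>j < n; j \<noteq> i; y \<in> carrier R; e i \<otimes> y = y; y \<otimes> e j = y\<rbrakk> \<Longrightarrow> rspan G j y"
    "\<And>l h g. \<lbrakk>l < n; h \<in> G \<rightarrow> carrier R; \<And>g. g \<in> G \<Longrightarrow> e (snd g) \<otimes> h g = h g \<and> h g \<otimes> e l = h g;
      (\<Oplus>g\<in>G. fst g \<otimes> h g) = \<zero>; g \<in> G\<rbrakk> \<Longrightarrow> h g \<in> r"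
proof -
  define good where "good G \<longleftrightarrow> finite G \<and> G \<subseteq> corner i \<and>
    (\<forall>j y. j < n \<longrightarrow> j \<noteq> i \<longrightarrow> y \<in> carrier R \<longrightarrow> e i \<otimes> y = y \<longrightarrow> y \<otimes> e j = y \<longrightarrow> rspan G j y)" for G
  have ei: "e i \<in> carrier R" using i by simp
  \<comment> \<open>The corner parts of generators with central coefficients: a finite family that
    spans, from which a least one can be chosen.\<close>
  define G0 where "G0 = (\<lambda>(s, j). (e i \<otimes> s \<otimes> e j, j)) ` (S \<times> ({..<n} - {i}))"
  have G0: "finite G0" "G0 \<subseteq> corner i"
  proof -
    show "finite G0" using S(1) by (simp add: G0_def)
    show "G0 \<subseteq> corner i"
    proof
      fix g assume "g \<in> G0"
      then obtain s j where g: "g = (e i \<otimes> s \<otimes> e j, j)" "s \<in> S" "j < n" "j \<noteq> i" by (auto simp: G0_def)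
      have c: "s \<in> carrier R" "e j \<in> carrier R" using g S(2) by auto
      have "e i \<otimes> (e i \<otimes> s \<otimes> e j) = e i \<otimes> s \<otimes> e j"
        using c ei e_idem[OF i] by (simp add: m_assoc[symmetric])
      moreover have "e i \<otimes> s \<otimes> e j \<otimes> e j = e i \<otimes> s \<otimes> e j"
        using c ei e_idem[OF g(3)] by (simp add: m_assoc)
      ultimately show "g \<in> corner i" using g c ei by (simp add: corner_def)
    qed
  qed
  have "good G0"
    unfolding good_def
  proof (intro conjI allI impI G0)
    fix j y assume j: "j < n" "j \<noteq> i" and y: "y \<in> carrier R" "e i \<otimes> y = y" "y \<otimes> e j = y"
    have ej: "e j \<in> carrier R" using j by simp
    obtain z where z: "z \<in> S \<rightarrow> carrier R" "y = (\<Oplus>s\<in>S. z s \<otimes> s)"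
      "\<And>s y. \<lbrakk>s \<in> S; y \<in> carrier R\<rbrakk> \<Longrightarrow> z s \<otimes> y = y \<otimes> z s" using cgen[OF y(1)] by blast
    have c: "z s \<in> carrier R" "s \<in> carrier R" if "s \<in> S" for s using z(1) S(2) that by auto
    have "y = e i \<otimes> y \<otimes> e j" using y by simp
    also have "\<dots> = (\<Oplus>s\<in>S. e i \<otimes> (z s \<otimes> s)) \<otimes> e j"
    proof -
      have "e i \<otimes> y = (\<Oplus>s\<in>S. e i \<otimes> (z s \<otimes> s))"
        unfolding z(2) using c ei S(1) by (intro finsum_rdistr) auto
      then show ?thesis by simp
    qed
    also have "\<dots> = (\<Oplus>s\<in>S. e i \<otimes> (z s \<otimes> s) \<otimes> e j)"
      using c ei ej S(1) by (intro finsum_ldistr) auto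
    \<comment> \<open>\<open>z s\<close> is central, so it moves to the right of \<open>s\<close>,
      and then one factor of \<open>e j = e j e j\<close> moves to its left.\<close>
    also have "\<dots> = (\<Oplus>s\<in>S. (e i \<otimes> s \<otimes> e j) \<otimes> (z s \<otimes> e j))"
    proof (intro finsum_cong' refl)
      fix s assume s: "s \<in> S"
      note cs = c[OF s]
      have "e i \<otimes> (z s \<otimes> s) \<otimes> e j = e i \<otimes> (s \<otimes> z s) \<otimes> e j" using z(3)[OF s cs(2)] by simp
      also have "\<dots> = e i \<otimes> s \<otimes> (z s \<otimes> (e j \<otimes> e j))"
        using cs ei ej e_idem[OF j(1)] by (simp add: m_assoc)
      also have "\<dots> = e i \<otimes> s \<otimes> (z s \<otimes> e j \<otimes> e j)" using cs ej by (simp add: m_assoc)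
      also have "\<dots> = e i \<otimes> s \<otimes> (e j \<otimes> z s \<otimes> e j)" using z(3)[OF s ej] by simp
      also have "\<dots> = (e i \<otimes> s \<otimes> e j) \<otimes> (z s \<otimes> e j)" using cs ei ej by (simp add: m_assoc)
      finally show "e i \<otimes> (z s \<otimes> s) \<otimes> e j = (e i \<otimes> s \<otimes> e j) \<otimes> (z s \<otimes> e j)" .
    qed (use c ei ej in auto)
    also have "rspan G0 j \<dots>"
    proof (rule rspan_finsum[OF S(1) j(1) G0])
      fix s assume s: "s \<in> S"
      have "(e i \<otimes> s \<otimes> e j, j) \<in> G0" using s j by (auto simp: G0_def)
      from rspan_base[OF G0 this] have "rspan G0 j (e i \<otimes> s \<otimes> e j)" by simp
      then show "rspan G0 j ((e i \<otimes> s \<otimes> e j) \<otimes> (z s \<otimes> e j))"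
        by (rule rspan_mult[OF j(1) j(1) G0]) (use c[OF s] ej e_idem[OF j(1)] in \<open>auto simp: m_assoc\<close>)
    qed (use c ei ej in auto)
    finally show "rspan G0 j y" .
  qed
  then obtain G where G: "good G" and least: "\<And>G'. good G' \<Longrightarrow> card G \<le> card G'"
    using ex_has_least_nat[of good G0 card] by blast
  have fin: "finite G" and sub: "G \<subseteq> corner i"
    and span: "\<And>j y. \<lbrakk>j < n; j \<noteq> i; y \<in> carrier R; e i \<otimes> y = y; y \<otimes> e j = y\<rbrakk> \<Longrightarrow> rspan G j y"
    using G by (auto simp: good_def)
  have min: "h g \<in> r"
    if l: "l < n" and h: "h \<in> G \<rightarrow> carrier R" and he: "\<And>g. g \<in> G \<Longrightarrow> e (snd g) \<otimes> h g = h g \<and> h g \<otimes> e l = h g"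
      and sum: "(\<Oplus>g\<in>G. fst g \<otimes> h g) = \<zero>" and g: "g \<in> G" for l h g
  proof (rule ccontr)
    assume "h g \<notin> r"
    note cg = cornerD[OF subsetD[OF sub g]]
    have hg: "h g \<in> carrier R" using h g by blast
    have sl: "snd g = l"
      by (rule unit_between(1)[OF cg(2) l hg conjunct1[OF he[OF g]] conjunct2[OF he[OF g]] \<open>h g \<notin> r\<close>])
    obtain b where b: "b \<in> carrier R" "h g \<otimes> b = e l"
      using unit_between(2)[OF cg(2) l hg conjunct1[OF he[OF g]] conjunct2[OF he[OF g]] \<open>h g \<notin> r\<close>] sl by auto
    let ?G = "G - {g}"
    have sub': "?G \<subseteq> corner i" "finite ?G" using sub fin by auto
    have mem: "fst g' \<in> carrier R" "h g' \<in> carrier R" if "g' \<in> G" for g'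
      using cornerD(1)[OF subsetD[OF sub that]] h that by auto
    define s where "s = (\<Oplus>g\<in>?G. fst g \<otimes> h g)"
    have sc: "s \<in> carrier R" unfolding s_def using mem by (intro finsum_closed) auto
    have split: "(\<Oplus>g\<in>G. fst g \<otimes> k g) = fst g \<otimes> k g \<oplus> (\<Oplus>g\<in>?G. fst g \<otimes> k g)" if "k \<in> G \<rightarrow> carrier R" for k
    proof -
      have kc: "k g' \<in> carrier R" if "g' \<in> G" for g' using \<open>k \<in> G \<rightarrow> carrier R\<close> that by blast
      have "(\<Oplus>g\<in>insert g ?G. fst g \<otimes> k g) = fst g \<otimes> k g \<oplus> (\<Oplus>g\<in>?G. fst g \<otimes> k g)"
        using kc mem g sub'(2) by (intro finsum_insert) auto
      then show ?thesis using g by (simp add: insert_absorb)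
    qed
    have "fst g \<otimes> h g \<oplus> s = \<zero>" using sum split[OF h] by (simp add: s_def)
    then have xs: "fst g \<otimes> h g = \<ominus> s" using minus_equality[of "fst g \<otimes> h g" s] sc cg(1) hg by simp
    have rs: "rspan ?G l s"
      unfolding rspan_def using h he by (intro bexI[of _ h]) (auto simp: s_def)
    have el: "e l \<in> carrier R" using l by simp
    \<comment> \<open>Here \<open>fst g h g = - s\<close> with \<open>s\<close> spanned by the other
      generators. Multiplying by the inverse \<open>b\<close> of \<open>h g\<close> recovers
      \<open>fst g\<close>, so \<open>g\<close> is redundant.\<close>
    have "s \<otimes> (\<ominus> (b \<otimes> e l)) = \<ominus> s \<otimes> (b \<otimes> e l)" using sc b(1) el by (simp add: l_minus r_minus)
    also have "\<dots> = fst g \<otimes> (h g \<otimes> b) \<otimes> e l"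
      unfolding xs[symmetric] using cg(1) hg b(1) el by (simp add: m_assoc)
    also have "\<dots> = fst g" using cg(1,5) el sl e_idem[OF l] by (simp add: b(2) m_assoc)
    finally have "fst g = s \<otimes> (\<ominus> (b \<otimes> e l))" by simp
    moreover have "rspan ?G l (s \<otimes> (\<ominus> (b \<otimes> e l)))"
      using b(1) el e_idem[OF l] by (intro rspan_mult[OF l l sub'(2,1) rs]) (auto simp: l_minus m_assoc)
    ultimately have rg: "rspan ?G l (fst g)" by simp
    have "good ?G"
      unfolding good_def
    proof (intro conjI allI impI sub')
      fix j y assume j: "j < n" "j \<noteq> i" and y: "y \<in> carrier R" "e i \<otimes> y = y" "y \<otimes> e j = y"
      obtain k where k: "k \<in> G \<rightarrow> carrier R" "y = (\<Oplus>g\<in>G. fst g \<otimes> k g)"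
        "\<forall>g\<in>G. e (snd g) \<otimes> k g = k g \<and> k g \<otimes> e j = k g"
        using span[OF j y] unfolding rspan_def by blast
      have kg: "k g \<in> carrier R" "k g \<otimes> e j = k g" using k(1,3) g by auto
      have "rspan ?G j (fst g \<otimes> k g)" by (rule rspan_mult[OF j(1) l sub'(2,1) rg kg])
      moreover have "rspan ?G j (\<Oplus>g\<in>?G. fst g \<otimes> k g)"
        unfolding rspan_def using k by (intro bexI[of _ k]) auto
      ultimately show "rspan ?G j y"
        unfolding k(2) split[OF k(1)] by (rule rspan_add[OF j(1) sub'(2,1)])
    qed
    from least[OF this] show False using g fin card_Diff1_less[OF fin g] by simp
  qed
  show thesis
  proof (rule that)
    show "rspan G j y" if "j < n" "j \<noteq> i" "y \<in> carrier R" "e i \<otimes> y = y" "y \<otimes> e j = y" for j y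
      by (rule span[OF that])
    show "h g \<in> r" if "l < n" "h \<in> G \<rightarrow> carrier R" "\<And>g. g \<in> G \<Longrightarrow> e (snd g) \<otimes> h g = h g \<and> h g \<otimes> e l = h g"
      "(\<Oplus>g\<in>G. fst g \<otimes> h g) = \<zero>" "g \<in> G" for l h g
      by (rule min[of l h g, OF that])
  qed (rule fin sub)+
qed

section \<open>Indecomposable projectives and the regular module\<close>

lemma local_end_projective:
  assumes A: "presented R A {m} \<epsilon> (\<lambda>_. \<zero>) u" and k: "k < n" "\<epsilon> m = e k"
  shows "local_end R A"
  by (rule local_end_singleton[OF A r.ideal_axioms square_zero])
    (use e_not_in_radical unit_between(2)[OF k(1) k(1)] k in auto)

text \<open>An isomorphism and its inverse are described by ring elements \<open>a\<close> and
  \<open>d\<close> with \<open>a d e\<^sub>k = e\<^sub>k\<close>. Since \<open>e\<^sub>k\<close> is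
  not in \<open>r\<close>, neither is \<open>a\<close>, and \<open>unit_between\<close> identifies
  the indices.\<close>

lemma projective_noniso:
  assumes A: "presented R A {m} \<epsilon> (\<lambda>_. \<zero>) u" and k: "k < n" "\<epsilon> m = e k"
    and B: "presented R B {m'} \<epsilon>' (\<lambda>_. \<zero>) u'" and l: "l < n" "\<epsilon>' m' = e l"
    and iso: "mod_iso R A B"
  shows "k = l"
proof -
  note DA = presentedD[OF A] and DB = presentedD[OF B]
  note sA = presented_singleton[OF A] and sB = presented_singleton[OF B]
  interpret A: left_module R A by (rule DA(1))
  interpret B: left_module R B by (rule DB(1))
  have ec: "e k \<in> carrier R" "e l \<in> carrier R" using k l by auto
  have eu: "e k \<odot>\<^bsub>A\<^esub> u m = u m" "e l \<odot>\<^bsub>B\<^esub> u' m' = u' m'"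
    using presented_idem[OF A, of m] presented_idem[OF B, of m'] k(2) l(2) by auto
  obtain \<phi> where \<phi>: "lin R A B \<phi>" "bij_betw \<phi> (carrier A) (carrier B)" by (rule mod_isoE[OF iso])
  interpret \<phi>: module_hom R A B \<phi> by (rule module_homI[OF DA(1) DB(1) \<phi>(1)])
  define \<psi> where "\<psi> = inv_into (carrier A) \<phi>"
  have \<psi>: "lin R B A \<psi>" unfolding \<psi>_def by (rule \<phi>.inv_lin[OF \<phi>(2)])
  interpret \<psi>: module_hom R B A \<psi> by (rule module_homI[OF DB(1) DA(1) \<psi>])
  have \<psi>\<phi>: "\<psi> (\<phi> (u m)) = u m"
    unfolding \<psi>_def by (rule inv_into_f_f[OF bij_betw_imp_inj_on[OF \<phi>(2)] sA(1)])
  obtain c where c: "c \<in> carrier R" "\<phi> (u m) = c \<odot>\<^bsub>B\<^esub> u' m'" using sB(2)[OF \<phi>.closed[OF sA(1)]] by blast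
  obtain d where d: "d \<in> carrier R" "\<psi> (u' m') = d \<odot>\<^bsub>A\<^esub> u m" using sA(2)[OF \<psi>.closed[OF sB(1)]] by blast
  define a where "a = e k \<otimes> c \<otimes> e l"
  have a: "a \<in> carrier R" "e k \<otimes> a = a" "a \<otimes> e l = a"
    using c(1) ec e_idem k(1) l(1) by (simp_all add: a_def m_assoc) (simp add: m_assoc[symmetric])
  have "\<phi> (u m) = e k \<odot>\<^bsub>B\<^esub> (c \<odot>\<^bsub>B\<^esub> (e l \<odot>\<^bsub>B\<^esub> u' m'))"
    using \<phi>.smult[OF ec(1) sA(1)] eu c(2) by simp
  also have "\<dots> = a \<odot>\<^bsub>B\<^esub> u' m'" using ec c(1) sB(1) by (simp add: a_def B.smult_assoc1 m_assoc)
  finally have "u m = \<psi> (a \<odot>\<^bsub>B\<^esub> u' m')" using \<psi>\<phi> by simp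
  also have "\<dots> = (a \<otimes> d) \<odot>\<^bsub>A\<^esub> u m"
    using a(1) d sA(1) sB(1) by (simp add: \<psi>.smult A.smult_assoc1)
  finally have "(\<one> \<ominus> a \<otimes> d) \<odot>\<^bsub>A\<^esub> u m = \<zero>\<^bsub>A\<^esub>"
    using a(1) d(1) sA(1) by (simp add: A.smult_l_diff A.diff_eq_zero_iff)
  then have "(\<one> \<ominus> a \<otimes> d) \<otimes> e k = \<zero>"
    using DA(9)[of "\<lambda>_. \<one> \<ominus> a \<otimes> d"] a(1) d(1) sA(1) k(2) by auto
  then have "e k \<ominus> a \<otimes> d \<otimes> e k = \<zero>" using a(1) d(1) ec by (simp add: minus_eq l_distr l_minus)
  then have ek: "e k = a \<otimes> d \<otimes> e k" using a(1) d(1) ec by simp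
  have "a \<notin> r"
  proof
    assume "a \<in> r"
    then have "a \<otimes> d \<otimes> e k \<in> r" using d(1) ec(1) r.I_r_closed by simp
    then show False using ek e_not_in_radical[OF k(1)] by simp
  qed
  then show ?thesis by (rule unit_between(1)[OF k(1) l(1) a])
qed

lemma regular_presented: "presented R (regular R) {..<n} e (\<lambda>_. \<zero>) e"
proof -
  interpret reg: left_module R "regular R" by (rule regular_left_module)
  have "generates R (regular R) {..<n} e"
    unfolding generates_def
  proof (intro conjI ballI)
    fix y assume "y \<in> carrier (regular R)"
    then have y: "y \<in> carrier R" by simp
    have "y = y \<otimes> (\<Oplus>i\<in>{..<n}. e i)" using y by (simp add: e_sum)
    also have "\<dots> = (\<Oplus>i\<in>{..<n}. y \<otimes> e i)" using y by (intro finsum_rdistr) auto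
    finally show "\<exists>c\<in>{..<n} \<rightarrow> carrier R. y = (\<Oplus>\<^bsub>regular R\<^esub>k\<in>{..<n}. c k \<odot>\<^bsub>regular R\<^esub> e k)"
      using y by (intro bexI[of _ "\<lambda>_. y"]) (auto simp: finsum_regular)
  qed auto
  moreover have "(\<Oplus>i\<in>{..<n}. c i \<otimes> e i) = \<zero> \<longleftrightarrow> (\<forall>i\<in>{..<n}. c i \<otimes> e i = \<zero>)" if c: "c \<in> {..<n} \<rightarrow> carrier R" for c
  proof
    assume z: "(\<Oplus>i\<in>{..<n}. c i \<otimes> e i) = \<zero>"
    show "\<forall>i\<in>{..<n}. c i \<otimes> e i = \<zero>"
    proof
      fix j assume "j \<in> {..<n}"
      then have j: "j < n" by simp
      have cc: "c i \<in> carrier R" if "i < n" for i using c that by auto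
      have "\<zero> = (\<Oplus>i\<in>{..<n}. c i \<otimes> e i) \<otimes> e j" using z j by simp
      also have "\<dots> = (\<Oplus>i\<in>{..<n}. c i \<otimes> e i \<otimes> e j)" using cc j by (intro finsum_ldistr) auto
      also have "\<dots> = (\<Oplus>i\<in>{..<n}. if j = i then c i \<otimes> e i else \<zero>)"
        using cc j by (intro finsum_cong') (auto simp: m_assoc e_mult)
      also have "\<dots> = c j \<otimes> e j" using cc j by (intro finsum_singleton) auto
      finally show "c j \<otimes> e j = \<zero>" by simp
    qed
  next
    assume "\<forall>i\<in>{..<n}. c i \<otimes> e i = \<zero>"
    then show "(\<Oplus>i\<in>{..<n}. c i \<otimes> e i) = \<zero>" by (intro add.finprod_one_eqI) auto
  qed
  ultimately show ?thesis
    unfolding presented_def using reg.left_module_axioms e_idem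
    by (auto simp: finsum_regular intro: bexI[of _ \<zero>])
qed

lemma projective_blocks:
  assumes T: "presented R T {..<n} e (\<lambda>_. \<zero>) w"
  shows "basic_module R T \<and> num_summands R T = n"
proof -
  have "\<exists>(A :: 'a fgm) u. presented R A {k} e (\<lambda>_. \<zero>) u" if "k < n" for k
    by (rule exists_presented[of "{k}" e "\<lambda>_. \<zero>"]) (use that e_idem in auto)
  then have "\<forall>k\<in>{..<n}. \<exists>Au. presented R (fst Au :: 'a fgm) {k} e (\<lambda>_. \<zero>) (snd Au)" by fastforce
  from bchoice[OF this] obtain Au where
    Au: "\<And>k. k < n \<Longrightarrow> presented R (fst (Au k) :: 'a fgm) {k} e (\<lambda>_. \<zero>) (snd (Au k))" by auto
  have single: "{m \<in> {..<n}. m = k} = {k}" if "k < n" for k using that by auto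
  show ?thesis
  \<comment> \<open>Every generator is a block of its own. As the relation is zero, any index may
    stand for the block that carries it; 0 is an arbitrary choice.\<close>
  proof (rule presented_blocks[OF T, where b = "\<lambda>m. m" and A = "\<lambda>k. fst (Au k)" and u = "\<lambda>k. snd (Au k)" and i = 0])
    show "presented R (fst (Au k)) {m \<in> {..<n}. m = k} e (\<lambda>_. \<zero>) (snd (Au k))" if "k < n" for k
      unfolding single[OF that] by (rule Au[OF that])
    show "local_end R (fst (Au k))" if "k < n" for k by (rule local_end_projective[OF Au[OF that] that refl])
    show "k = l" if "k < n" "l < n" "mod_iso R (fst (Au k)) (fst (Au l))" for k l
      by (rule projective_noniso[OF Au[OF that(1)] that(1) refl Au[OF that(2)] that(2) refl that(3)])
  qed auto
qed

end

text \<open>The index set of the mutation joins the minimal generators \<open>G\<close>, which carry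
  the relation and yield \<open>Y\<close>, with one pair \<open>(0, j)\<close> for each
  \<open>j \<noteq> i\<close>, which yields the projective \<open>\<Lambda> e\<^sub>j\<close>. The
  nonzero \<open>x\<close> guarantees that \<open>G\<close> is nonempty, so that the relation is
  nonzero.\<close>

lemma exists_nonprojective_tau_tilting:
  fixes R :: "('r, 'z) ring_scheme" and \<Lambda> :: "('r, 'a, 'x) module_scheme"
    and J :: "('r, 'j, 'w) module_scheme"
  assumes alg: "artin_algebra R \<Lambda>" and J: "left_module R J"
    and dec: "basic_decomposition \<Lambda> r n e" and i: "i < n" and j: "j < n" "j \<noteq> i"
    and x: "x \<in> carrier \<Lambda>" "e i \<otimes>\<^bsub>\<Lambda>\<^esub> x = x" "x \<otimes>\<^bsub>\<Lambda>\<^esub> e j = x" "x \<noteq> \<zero>\<^bsub>\<Lambda>\<^esub>"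
  shows "\<exists>T :: 'a fgm. basic_module \<Lambda> T \<and> tau_rigid R \<Lambda> J T \<and> num_summands \<Lambda> T = n \<and>
    (\<forall>P :: 'a fgm. projective \<Lambda> P \<longrightarrow> \<not> mod_iso \<Lambda> T P)"
proof -
  interpret basic_decomposition \<Lambda> r n e by (rule dec)
  obtain S where S: "finite S" "S \<subseteq> carrier \<Lambda>"
    "\<And>x. x \<in> carrier \<Lambda> \<Longrightarrow> \<exists>z\<in>S \<rightarrow> carrier \<Lambda>. x = (\<Oplus>\<^bsub>\<Lambda>\<^esub>s\<in>S. z s \<otimes>\<^bsub>\<Lambda>\<^esub> s) \<and>
      (\<forall>s\<in>S. \<forall>y\<in>carrier \<Lambda>. z s \<otimes>\<^bsub>\<Lambda>\<^esub> y = y \<otimes>\<^bsub>\<Lambda>\<^esub> z s)"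
    using artin_algebra_central_generation[OF alg] by blast
  obtain G where G: "finite G" "G \<subseteq> corner i"
    and span: "\<And>j y. \<lbrakk>j < n; j \<noteq> i; y \<in> carrier \<Lambda>; e i \<otimes>\<^bsub>\<Lambda>\<^esub> y = y; y \<otimes>\<^bsub>\<Lambda>\<^esub> e j = y\<rbrakk> \<Longrightarrow> rspan G j y"
    and min: "\<And>l h g. \<lbrakk>l < n; h \<in> G \<rightarrow> carrier \<Lambda>; \<And>g. g \<in> G \<Longrightarrow> e (snd g) \<otimes>\<^bsub>\<Lambda>\<^esub> h g = h g \<and> h g \<otimes>\<^bsub>\<Lambda>\<^esub> e l = h g;
      (\<Oplus>\<^bsub>\<Lambda>\<^esub>g\<in>G. fst g \<otimes>\<^bsub>\<Lambda>\<^esub> h g) = \<zero>\<^bsub>\<Lambda>\<^esub>; g \<in> G\<rbrakk> \<Longrightarrow> h g \<in> r"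
    by (rule exists_minimal_generators[OF i S]) blast+
  have ei: "e i \<in> carrier \<Lambda>" using i by simp
  have cG: "fst g \<in> carrier \<Lambda>" "snd g < n" "snd g \<noteq> i" "e i \<otimes>\<^bsub>\<Lambda>\<^esub> fst g = fst g"
    "fst g \<otimes>\<^bsub>\<Lambda>\<^esub> e (snd g) = fst g" "fst g \<in> r" if "g \<in> G" for g
    using cornerD[OF subsetD[OF G(2) that]] corner_in_radical[OF i subsetD[OF G(2) that]] by auto
  \<comment> \<open>If \<open>fst g = 0\<close>, the coefficient \<open>e (snd g)\<close> at
    \<open>g\<close> alone would be a relation that is not in \<open>r\<close>, against
    \<open>min\<close>. Being nonzero keeps \<open>G\<close> apart from the pairs
    \<open>(0, j)\<close> and lets \<open>b\<close> read off the block from the first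
    component.\<close>
  have G_nz: "fst g \<noteq> \<zero>\<^bsub>\<Lambda>\<^esub>" if g: "g \<in> G" for g
  proof
    assume z: "fst g = \<zero>\<^bsub>\<Lambda>\<^esub>"
    let ?h = "\<lambda>g'. if g' = g then e (snd g) else \<zero>\<^bsub>\<Lambda>\<^esub>"
    have "?h g \<in> r"
    proof (rule min[of "snd g" ?h g, OF cG(2)[OF g] _ _ _ g])
      show "?h \<in> G \<rightarrow> carrier \<Lambda>" using cG(2)[OF g] by auto
      show "e (snd g') \<otimes>\<^bsub>\<Lambda>\<^esub> ?h g' = ?h g' \<and> ?h g' \<otimes>\<^bsub>\<Lambda>\<^esub> e (snd g) = ?h g'" if "g' \<in> G" for g'
        using cG(2)[OF that] cG(2)[OF g] e_idem by simp
      show "(\<Oplus>\<^bsub>\<Lambda>\<^esub>g\<in>G. fst g \<otimes>\<^bsub>\<Lambda>\<^esub> ?h g) = \<zero>\<^bsub>\<Lambda>\<^esub>"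
        by (rule add.finprod_one_eqI) (use z cG(1,2) g in simp)
    qed
    then show False using e_not_in_radical[OF cG(2)[OF g]] by simp
  qed
  have "G \<noteq> {}"
  proof
    assume "G = {}"
    then have "x = \<zero>\<^bsub>\<Lambda>\<^esub>" using span[OF j x(1-3)] by (simp add: rspan_def)
    then show False using x(4) by simp
  qed
  then obtain g0 where g0: "g0 \<in> G" by blast
  define Z where "Z = {\<zero>\<^bsub>\<Lambda>\<^esub>} \<times> ({..<n} - {i})"
  define I where "I = G \<union> Z"
  define \<epsilon> :: "'a \<times> nat \<Rightarrow> 'a" where "\<epsilon> g = e (snd g)" for g
  define b where "b g = (if fst g = \<zero>\<^bsub>\<Lambda>\<^esub> then snd g else i)" for g
  have cI: "fst g \<in> carrier \<Lambda>" "snd g < n" "snd g \<noteq> i" "e i \<otimes>\<^bsub>\<Lambda>\<^esub> fst g = fst g"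
    "fst g \<otimes>\<^bsub>\<Lambda>\<^esub> e (snd g) = fst g" "fst g \<in> r" "\<epsilon> g \<in> carrier \<Lambda>" "\<epsilon> g \<otimes>\<^bsub>\<Lambda>\<^esub> \<epsilon> g = \<epsilon> g" if "g \<in> I" for g
  proof -
    have "g \<in> G \<or> g \<in> Z" using that by (simp add: I_def)
    then show "fst g \<in> carrier \<Lambda>" "snd g < n" "snd g \<noteq> i" "e i \<otimes>\<^bsub>\<Lambda>\<^esub> fst g = fst g"
      "fst g \<otimes>\<^bsub>\<Lambda>\<^esub> e (snd g) = fst g" "fst g \<in> r"
      using cG[of g] ei by (auto simp: Z_def)
    then show "\<epsilon> g \<in> carrier \<Lambda>" "\<epsilon> g \<otimes>\<^bsub>\<Lambda>\<^esub> \<epsilon> g = \<epsilon> g" by (simp_all add: \<epsilon>_def e_idem)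
  qed
  have I_fin: "finite I" using G(1) by (simp add: I_def Z_def)
  have block_i: "{m \<in> I. b m = i} = G" using G_nz by (auto simp: I_def b_def Z_def)
  have block: "{m \<in> I. b m = k} = {(\<zero>\<^bsub>\<Lambda>\<^esub>, k)}" if "k < n" "k \<noteq> i" for k
    using G_nz that by (auto simp: I_def b_def Z_def)
  obtain T :: "'a fgm" and w where T: "presented \<Lambda> T I \<epsilon> fst w"
    by (rule exists_presented[OF I_fin, of \<epsilon> fst]) (use cI in \<open>auto simp: \<epsilon>_def Pi_iff\<close>)
  note D = presentedD[OF T]
  interpret T: left_module \<Lambda> T by (rule D(1))
  have "\<exists>Au. presented \<Lambda> (fst Au :: 'a fgm) {m \<in> I. b m = k} \<epsilon> fst (snd Au)" for k
  proof -
    obtain A :: "'a fgm" and u where "presented \<Lambda> A {m \<in> I. b m = k} \<epsilon> fst u"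
      by (rule exists_presented[of "{m \<in> I. b m = k}" \<epsilon> fst]) (use cI I_fin in \<open>auto simp: \<epsilon>_def Pi_iff\<close>)
    then show ?thesis by (intro exI[of _ "(A, u)"]) simp
  qed
  then have "\<forall>k. \<exists>Au. presented \<Lambda> (fst Au :: 'a fgm) {m \<in> I. b m = k} \<epsilon> fst (snd Au)" by blast
  from choice[OF this] obtain Au where
    Au: "\<And>k. presented \<Lambda> (fst (Au k) :: 'a fgm) {m \<in> I. b m = k} \<epsilon> fst (snd (Au k))" by blast
  define A where "A k = fst (Au k)" for k
  define u where "u k = snd (Au k)" for k
  have A: "presented \<Lambda> (A k) {m \<in> I. b m = k} \<epsilon> fst (u k)" for k using Au by (simp add: A_def u_def)
  have P: "presented \<Lambda> (A k) {(\<zero>\<^bsub>\<Lambda>\<^esub>, k)} \<epsilon> (\<lambda>_. \<zero>\<^bsub>\<Lambda>\<^esub>) (u k)" if "k < n" "k \<noteq> i" for k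
    by (rule presented_cong[OF A[of k, unfolded block[OF that]]]) auto
  have \<epsilon>P: "\<epsilon> (\<zero>\<^bsub>\<Lambda>\<^esub>, k) = e k" for k by (simp add: \<epsilon>_def)
  have Y: "presented \<Lambda> (A i) G \<epsilon> fst (u i)" using A[of i] by (simp add: block_i)
  note DY = presentedD[OF Y]
  have local_Y: "local_end \<Lambda> (A i)"
  proof (rule local_end_cokernel[OF Y r.ideal_axioms square_zero])
    show "fst \<in> G \<rightarrow> r" using cG(6) by blast
    show "e i \<in> carrier \<Lambda>" "e i \<otimes>\<^bsub>\<Lambda>\<^esub> e i = e i" using ei e_idem[OF i] by auto
    show "e i \<otimes>\<^bsub>\<Lambda>\<^esub> fst k = fst k" if "k \<in> G" for k by (rule cG(4)[OF that])
    show "\<exists>b\<in>carrier \<Lambda>. b \<otimes>\<^bsub>\<Lambda>\<^esub> a = e i \<and> a \<otimes>\<^bsub>\<Lambda>\<^esub> b = e i"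
      if "a \<in> carrier \<Lambda>" "e i \<otimes>\<^bsub>\<Lambda>\<^esub> a = a" "a \<otimes>\<^bsub>\<Lambda>\<^esub> e i = a" "a \<notin> r" for a
      by (rule unit_between(2)[OF i i that])
    show "\<exists>h\<in>G \<rightarrow> carrier \<Lambda>. y = (\<Oplus>\<^bsub>\<Lambda>\<^esub>k\<in>G. fst k \<otimes>\<^bsub>\<Lambda>\<^esub> h k) \<and>
        (\<forall>k\<in>G. \<epsilon> k \<otimes>\<^bsub>\<Lambda>\<^esub> h k = h k \<and> h k \<otimes>\<^bsub>\<Lambda>\<^esub> \<epsilon> l = h k)"
      if "l \<in> G" "y \<in> carrier \<Lambda>" "e i \<otimes>\<^bsub>\<Lambda>\<^esub> y = y" "y \<otimes>\<^bsub>\<Lambda>\<^esub> \<epsilon> l = y" for l y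
      using span[OF cG(2,3)[OF that(1)] that(2,3)] that(4) by (simp add: rspan_def \<epsilon>_def)
    show "h k \<in> r" if "l \<in> G" "h \<in> G \<rightarrow> carrier \<Lambda>"
      "\<And>k. k \<in> G \<Longrightarrow> \<epsilon> k \<otimes>\<^bsub>\<Lambda>\<^esub> h k = h k \<and> h k \<otimes>\<^bsub>\<Lambda>\<^esub> \<epsilon> l = h k"
      "(\<Oplus>\<^bsub>\<Lambda>\<^esub>k\<in>G. fst k \<otimes>\<^bsub>\<Lambda>\<^esub> h k) = \<zero>\<^bsub>\<Lambda>\<^esub>" "k \<in> G" for l h k
      by (rule min[of "snd l" h k, OF cG(2)[OF that(1)] that(2) that(3)[unfolded \<epsilon>_def] that(4,5)])
    \<comment> \<open>If \<open>Y\<close> were zero, the unit vector at \<open>g0\<close> would be a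
      relation, so that \<open>e (snd g0)\<close> would be a multiple of \<open>fst g0\<close> and
      lie in \<open>r\<close>.\<close>
    show "carrier (A i) \<noteq> {\<zero>\<^bsub>A i\<^esub>}"
    proof
      assume zero: "carrier (A i) = {\<zero>\<^bsub>A i\<^esub>}"
      interpret Y: left_module \<Lambda> "A i" by (rule DY(1))
      have uz: "u i k = \<zero>\<^bsub>A i\<^esub>" if "k \<in> G" for k using DY(4) zero that by blast
      let ?c = "\<lambda>k. if k = g0 then \<one>\<^bsub>\<Lambda>\<^esub> else \<zero>\<^bsub>\<Lambda>\<^esub>"
      have "(\<Oplus>\<^bsub>A i\<^esub>k\<in>G. ?c k \<odot>\<^bsub>A i\<^esub> u i k) = \<zero>\<^bsub>A i\<^esub>"
        using uz by (intro Y.M.add.finprod_one_eqI) auto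
      then obtain a where a: "a \<in> carrier \<Lambda>" "\<And>k. k \<in> G \<Longrightarrow> ?c k \<otimes>\<^bsub>\<Lambda>\<^esub> \<epsilon> k = a \<otimes>\<^bsub>\<Lambda>\<^esub> fst k"
        using DY(9)[of ?c] by auto
      have "e (snd g0) = a \<otimes>\<^bsub>\<Lambda>\<^esub> fst g0" using a(2)[OF g0] cG(2)[OF g0] by (simp add: \<epsilon>_def)
      also have "\<dots> \<in> r" by (rule r.I_l_closed[OF cG(6)[OF g0] a(1)])
      finally show False using e_not_in_radical[OF cG(2)[OF g0]] by simp
    qed
  qed
  \<comment> \<open>A projective \<open>Y\<close> would have only the zero relation. This also
    separates \<open>Y\<close> from the projective blocks when the summands are compared.\<close>
  have Y_not_projective: "\<not> mod_iso \<Lambda> (A i) Q" if "projective \<Lambda> Q" for Q :: "'a fgm"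
  proof
    assume iso: "mod_iso \<Lambda> (A i) Q"
    have "fst \<in> G \<rightarrow> r" using cG(6) by blast
    then have "fst g0 = \<zero>\<^bsub>\<Lambda>\<^esub>"
      using presented_projective_relations[OF Y r.ideal_axioms square_zero _ that iso g0] by blast
    then show False using G_nz[OF g0] by simp
  qed
  have lmA: "left_module \<Lambda> (A k)" for k by (rule presentedD(1)[OF A])
  have basic: "basic_module \<Lambda> T \<and> num_summands \<Lambda> T = n"
  proof (rule presented_blocks[OF T, where b = b and A = A and u = u and i = i])
    show "b m < n" if "m \<in> I" for m using cI(2)[OF that] i by (simp add: b_def)
    show "fst m = \<zero>\<^bsub>\<Lambda>\<^esub>" if "m \<in> I" "b m \<noteq> i" for m using that(2) by (simp add: b_def split: if_splits)
    show "presented \<Lambda> (A k) {m \<in> I. b m = k} \<epsilon> fst (u k)" for k by (rule A)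
    show "local_end \<Lambda> (A k)" if k: "k < n" for k
    proof (cases "k = i")
      case True
      then show ?thesis using local_Y by simp
    next
      case False
      show ?thesis by (rule local_end_projective[OF P[OF k False] k \<epsilon>P])
    qed
    show "k = l" if k: "k < n" and l: "l < n" and iso: "mod_iso \<Lambda> (A k) (A l)" for k l
    proof (cases "k = i \<or> l = i")
      case True
      show ?thesis
      proof (rule ccontr)
        assume "k \<noteq> l"
        with True consider "k = i" "l \<noteq> i" | "l = i" "k \<noteq> i" by auto
        then show False
        proof cases
          case 1
          then show False using Y_not_projective[OF presented_projective[OF P[OF l 1(2)]]] iso by simp
        next
          case 2
          then show False
            using Y_not_projective[OF presented_projective[OF P[OF k 2(2)]]] mod_iso_sym[OF lmA lmA iso] by simp
        qed
      qed
    next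
      case False
      then have "k \<noteq> i" "l \<noteq> i" by auto
      then show ?thesis
        using projective_noniso[OF P[OF k] k \<epsilon>P P[OF l] l \<epsilon>P iso] by simp
    qed
  qed
  have rigid: "tau_rigid R \<Lambda> J T"
  proof (rule tau_rigid_presented[OF alg J T r.ideal_axioms square_zero])
    show "fst \<in> I \<rightarrow> r" using cI(6) by blast
    show "e i \<in> carrier \<Lambda>" "e i \<otimes>\<^bsub>\<Lambda>\<^esub> e i = e i" using ei e_idem[OF i] by auto
    show "e i \<otimes>\<^bsub>\<Lambda>\<^esub> fst k = fst k" if "k \<in> I" for k by (rule cI(4)[OF that])
    show "\<exists>b\<in>carrier \<Lambda>. b \<otimes>\<^bsub>\<Lambda>\<^esub> a = e i"
      if a: "a \<in> carrier \<Lambda>" "a \<otimes>\<^bsub>\<Lambda>\<^esub> e i = a" "\<And>k. k \<in> I \<Longrightarrow> a \<otimes>\<^bsub>\<Lambda>\<^esub> fst k = fst k" for a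
    proof (rule left_inverse[OF i a(1,2)])
      \<comment> \<open>\<open>r\<close> annihilates \<open>fst g0\<close> since
        \<open>r\<^sup>2 = 0\<close>, whereas \<open>a\<close> fixes it and it is nonzero.\<close>
      show "a \<notin> r"
      proof
        assume "a \<in> r"
        then have "a \<otimes>\<^bsub>\<Lambda>\<^esub> fst g0 = \<zero>\<^bsub>\<Lambda>\<^esub>" using square_zero cG(6)[OF g0] by blast
        then show False using a(3)[of g0] g0 G_nz[OF g0] by (simp add: I_def)
      qed
    qed
    \<comment> \<open>The approximation property. The coefficient of \<open>t\<close> at
      \<open>l\<close> can be taken in the corner \<open>e\<^sub>i \<Lambda> e\<^sub>j\<close> with
      \<open>j = snd l\<close>. No index in \<open>I\<close> has second component \<open>i\<close>,
      so each of these corners is spanned by \<open>G\<close>.\<close>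
    show "\<exists>y\<in>I \<rightarrow> carrier T. t = (\<Oplus>\<^bsub>T\<^esub>k\<in>I. fst k \<odot>\<^bsub>T\<^esub> y k)"
      if t: "t \<in> carrier T" "e i \<odot>\<^bsub>T\<^esub> t = t" for t
    proof -
      obtain c where c: "c \<in> I \<rightarrow> carrier \<Lambda>" "t = (\<Oplus>\<^bsub>T\<^esub>l\<in>I. c l \<odot>\<^bsub>T\<^esub> w l)" by (rule generatesE[OF D(2) t(1)])
      have cc: "c l \<in> carrier \<Lambda>" and wc: "w l \<in> carrier T" if "l \<in> I" for l using c(1) D(4) that by auto
      define d where "d l = e i \<otimes>\<^bsub>\<Lambda>\<^esub> c l \<otimes>\<^bsub>\<Lambda>\<^esub> \<epsilon> l" for l
      have dc: "d l \<in> carrier \<Lambda>" if "l \<in> I" for l using cc[OF that] ei cI(7)[OF that] by (simp add: d_def)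
      have "t = (\<Oplus>\<^bsub>T\<^esub>l\<in>I. (e i \<otimes>\<^bsub>\<Lambda>\<^esub> c l) \<odot>\<^bsub>T\<^esub> w l)"
        using t(2) T.lcomb_smult[OF I_fin c(1) ei D(4)] c(2) by simp
      also have "\<dots> = (\<Oplus>\<^bsub>T\<^esub>l\<in>I. d l \<odot>\<^bsub>T\<^esub> w l)"
      proof (intro T.M.finsum_cong' refl)
        fix l assume l: "l \<in> I"
        show "(e i \<otimes>\<^bsub>\<Lambda>\<^esub> c l) \<odot>\<^bsub>T\<^esub> w l = d l \<odot>\<^bsub>T\<^esub> w l"
          using cc[OF l] wc[OF l] cI(7)[OF l] ei presented_idem[OF T l] by (simp add: d_def T.smult_assoc1)
      qed (use dc wc in auto)
      finally have td: "t = (\<Oplus>\<^bsub>T\<^esub>l\<in>I. d l \<odot>\<^bsub>T\<^esub> w l)" .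
      have "\<forall>l\<in>I. \<exists>h. h \<in> I \<rightarrow> carrier \<Lambda> \<and> d l = (\<Oplus>\<^bsub>\<Lambda>\<^esub>g\<in>I. fst g \<otimes>\<^bsub>\<Lambda>\<^esub> h g)"
      proof
        fix l assume l: "l \<in> I"
        have "e i \<otimes>\<^bsub>\<Lambda>\<^esub> d l = d l" using cc[OF l] ei cI(7)[OF l] e_idem[OF i] by (simp add: d_def m_assoc[symmetric])
        moreover have "d l \<otimes>\<^bsub>\<Lambda>\<^esub> e (snd l) = d l"
          using cc[OF l] ei cI(7,8)[OF l] by (simp add: d_def m_assoc \<epsilon>_def)
        ultimately have "rspan G (snd l) (d l)" by (rule span[OF cI(2,3)[OF l] dc[OF l]])
        then have "rspan I (snd l) (d l)"
          by (rule rspan_mono[OF _ _ I_fin, of _ _ _ i]) (use G(2) cI(2)[OF l] in \<open>auto simp: I_def Z_def\<close>)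
        then show "\<exists>h. h \<in> I \<rightarrow> carrier \<Lambda> \<and> d l = (\<Oplus>\<^bsub>\<Lambda>\<^esub>g\<in>I. fst g \<otimes>\<^bsub>\<Lambda>\<^esub> h g)"
          unfolding rspan_def by blast
      qed
      from bchoice[OF this] obtain h where h: "\<And>l. l \<in> I \<Longrightarrow> h l \<in> I \<rightarrow> carrier \<Lambda>"
        and hd: "\<And>l. l \<in> I \<Longrightarrow> d l = (\<Oplus>\<^bsub>\<Lambda>\<^esub>g\<in>I. fst g \<otimes>\<^bsub>\<Lambda>\<^esub> h l g)" by blast
      have hc: "h l g \<in> carrier \<Lambda>" if "l \<in> I" "g \<in> I" for l g using h[OF that(1)] that(2) by blast
      \<comment> \<open>For each generator \<open>g\<close> the right-hand coefficients are
        collected over all \<open>l\<close>; exchanging the two sums turns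
        \<open>\<Sum> fst g y g\<close> back into \<open>t\<close>.\<close>
      define y where "y g = (\<Oplus>\<^bsub>T\<^esub>l\<in>I. h l g \<odot>\<^bsub>T\<^esub> w l)" for g
      have y: "y \<in> I \<rightarrow> carrier T" unfolding y_def using hc wc by (auto intro!: T.M.finsum_closed)
      have "(\<Oplus>\<^bsub>T\<^esub>g\<in>I. fst g \<odot>\<^bsub>T\<^esub> y g) = (\<Oplus>\<^bsub>T\<^esub>g\<in>I. \<Oplus>\<^bsub>T\<^esub>l\<in>I. (fst g \<otimes>\<^bsub>\<Lambda>\<^esub> h l g) \<odot>\<^bsub>T\<^esub> w l)"
      proof (intro T.M.finsum_cong' refl)
        fix g assume g: "g \<in> I"
        show "fst g \<odot>\<^bsub>T\<^esub> y g = (\<Oplus>\<^bsub>T\<^esub>l\<in>I. (fst g \<otimes>\<^bsub>\<Lambda>\<^esub> h l g) \<odot>\<^bsub>T\<^esub> w l)"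
          unfolding y_def using hc g by (intro T.lcomb_smult[symmetric] I_fin cI(1) D(4)) auto
      next
        show "(\<lambda>g. \<Oplus>\<^bsub>T\<^esub>l\<in>I. (fst g \<otimes>\<^bsub>\<Lambda>\<^esub> h l g) \<odot>\<^bsub>T\<^esub> w l) \<in> I \<rightarrow> carrier T"
          by (intro Pi_I T.M.finsum_closed T.smult_closed m_closed cI(1) hc wc)
      qed
      also have "\<dots> = (\<Oplus>\<^bsub>T\<^esub>l\<in>I. \<Oplus>\<^bsub>T\<^esub>g\<in>I. (fst g \<otimes>\<^bsub>\<Lambda>\<^esub> h l g) \<odot>\<^bsub>T\<^esub> w l)"
        by (intro T.finsum_swap I_fin T.smult_closed m_closed cI(1) hc wc)
      also have "\<dots> = (\<Oplus>\<^bsub>T\<^esub>l\<in>I. d l \<odot>\<^bsub>T\<^esub> w l)"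
      proof (intro T.M.finsum_cong' refl)
        fix l assume l: "l \<in> I"
        show "(\<Oplus>\<^bsub>T\<^esub>g\<in>I. (fst g \<otimes>\<^bsub>\<Lambda>\<^esub> h l g) \<odot>\<^bsub>T\<^esub> w l) = d l \<odot>\<^bsub>T\<^esub> w l"
          unfolding hd[OF l] by (intro T.finsum_smult[symmetric] I_fin wc l Pi_I m_closed cI(1) hc)
      next
        show "(\<lambda>l. d l \<odot>\<^bsub>T\<^esub> w l) \<in> I \<rightarrow> carrier T" by (intro Pi_I T.smult_closed dc wc)
      qed
      finally have "t = (\<Oplus>\<^bsub>T\<^esub>g\<in>I. fst g \<odot>\<^bsub>T\<^esub> y g)" using td by simp
      then show ?thesis using y by blast
    qed
  qed
  have "\<not> mod_iso \<Lambda> T Q" if "projective \<Lambda> Q" for Q :: "'a fgm"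
  proof
    assume iso: "mod_iso \<Lambda> T Q"
    have "fst \<in> I \<rightarrow> r" using cI(6) by blast
    moreover have "g0 \<in> I" using g0 by (simp add: I_def)
    ultimately have "fst g0 = \<zero>\<^bsub>\<Lambda>\<^esub>"
      using presented_projective_relations[OF T r.ideal_axioms square_zero _ that iso] by blast
    then show False using G_nz[OF g0] by simp
  qed
  then show ?thesis using basic rigid by blast
qed

text \<open>The case \<open>e = 0\<close> with zero ideal of the general criterion: the presentation
  is \<open>0 \<rightarrow> Q \<rightarrow> A\<close>, so there is nothing to extend.\<close>

lemma tau_rigid_projective:
  fixes R :: "('r, 'z) ring_scheme" and \<Lambda> :: "('r, 'a, 'x) module_scheme" and A :: "'a fgm"
    and J :: "('r, 'j, 'w) module_scheme"
  assumes alg: "artin_algebra R \<Lambda>" and J: "left_module R J"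
    and A: "presented \<Lambda> A I \<epsilon> (\<lambda>_. \<zero>\<^bsub>\<Lambda>\<^esub>) u"
  shows "tau_rigid R \<Lambda> J A"
proof -
  interpret \<Lambda>: ring \<Lambda> by (rule artin_algebra_ring[OF alg])
  interpret A: left_module \<Lambda> A by (rule presentedD(1)[OF A])
  have zero: "ideal {\<zero>\<^bsub>\<Lambda>\<^esub>} \<Lambda>" by (rule \<Lambda>.zeroideal)
  show ?thesis
  proof (rule tau_rigid_presented[OF alg J A zero, where e = "\<zero>\<^bsub>\<Lambda>\<^esub>"])
    show "\<exists>b\<in>carrier \<Lambda>. b \<otimes>\<^bsub>\<Lambda>\<^esub> a = \<zero>\<^bsub>\<Lambda>\<^esub>" if "a \<in> carrier \<Lambda>" for a
      using that by (intro bexI[of _ "\<zero>\<^bsub>\<Lambda>\<^esub>"]) auto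
    show "\<exists>y\<in>I \<rightarrow> carrier A. t = (\<Oplus>\<^bsub>A\<^esub>k\<in>I. \<zero>\<^bsub>\<Lambda>\<^esub> \<odot>\<^bsub>A\<^esub> y k)"
      if "t \<in> carrier A" "\<zero>\<^bsub>\<Lambda>\<^esub> \<odot>\<^bsub>A\<^esub> t = t" for t
      using that A.lcomb_zero[of "\<lambda>_. \<zero>\<^bsub>A\<^esub>" I] by (intro bexI[of _ "\<lambda>_. \<zero>\<^bsub>A\<^esub>"]) auto
  qed auto
qed

theorem theorem3:
  fixes R :: "'r ring" and \<Lambda> :: "('r, 'a) module" and J :: "('r, 'j) module"
  assumes "artin_algebra R \<Lambda>"
    and "injective_envelope R (quotient_module (regular R) (jacobson_radical R)) J"
    and "basic_ring \<Lambda>"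
    and "connected_ring \<Lambda>"
    and "\<not> semisimple_ring \<Lambda>"
    and "ideal_prod \<Lambda> (jacobson_radical \<Lambda>) (jacobson_radical \<Lambda>) = {\<zero>\<^bsub>\<Lambda>\<^esub>}"
    and "unique_tau_tilting R \<Lambda> J"
  shows "local_ring \<Lambda>"
proof (rule ccontr)
  assume nonlocal: "\<not> local_ring \<Lambda>"
  have J: "left_module R J" using assms(2) by (simp add: injective_envelope_def injective_def)
  define r where "r = jacobson_radical \<Lambda>"
  have "radical_square_zero \<Lambda> r"
  proof (intro radical_square_zero.intro radical_square_zero_axioms.intro)
    show "a \<otimes>\<^bsub>\<Lambda>\<^esub> b = \<zero>\<^bsub>\<Lambda>\<^esub>" if "a \<in> r" "b \<in> r" for a b
      using ideal_prod.prod[of a r b r \<Lambda>] that assms(6) by (simp add: r_def)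
    show "carrier \<Lambda> \<noteq> {\<zero>\<^bsub>\<Lambda>\<^esub>}" using assms(4) by (simp add: connected_ring_def)
  qed (use artin_algebra_ring[OF assms(1)] artin_algebra_artinian[OF assms(1)] r_def in auto)
  then interpret radical_square_zero \<Lambda> r .
  obtain n e where dec: "basic_decomposition \<Lambda> r n e" by (rule exists_basic_decomposition[OF assms(3)])
  interpret basic_decomposition \<Lambda> r n e by (rule dec)
  obtain i j x where ij: "i < n" "j < n" "i \<noteq> j"
    and x: "x \<in> carrier \<Lambda>" "e i \<otimes>\<^bsub>\<Lambda>\<^esub> x = x" "x \<otimes>\<^bsub>\<Lambda>\<^esub> e j = x" "x \<noteq> \<zero>\<^bsub>\<Lambda>\<^esub>"
    by (rule exists_connecting_element[OF assms(4) nonlocal])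
  \<comment> \<open>\<open>tau_tilting\<close> compares with the regular module, whose number of
    summands is found by the same Krull-Schmidt argument as for \<open>T\<close>.\<close>
  have num: "num_summands \<Lambda> (regular \<Lambda>) = n" using projective_blocks[OF regular_presented] by simp
  obtain T :: "'a fgm" where T: "basic_module \<Lambda> T" "tau_rigid R \<Lambda> J T" "num_summands \<Lambda> T = n"
    and T_not_projective: "\<And>P :: 'a fgm. projective \<Lambda> P \<Longrightarrow> \<not> mod_iso \<Lambda> T P"
    using exists_nonprojective_tau_tilting[OF assms(1) J dec ij(1,2) ij(3)[symmetric] x] by blast
  \<comment> \<open>The regular module lives on the type \<open>'a\<close>, while uniqueness speaks
    about modules on \<open>'a fg_univ\<close>. \<open>L\<close> has the same presentation on the
    latter type and takes its place.\<close>
  obtain L :: "'a fgm" and w where L: "presented \<Lambda> L {..<n} e (\<lambda>_. \<zero>\<^bsub>\<Lambda>\<^esub>) w"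
    by (rule exists_presented[of "{..<n}" e "\<lambda>_. \<zero>\<^bsub>\<Lambda>\<^esub>"]) (auto simp: e_idem)
  have "tau_tilting R \<Lambda> J T" using T num by (simp add: tau_tilting_def)
  moreover have "tau_tilting R \<Lambda> J L" "basic_module \<Lambda> L"
    using projective_blocks[OF L] tau_rigid_projective[OF assms(1) J L] num by (simp_all add: tau_tilting_def)
  \<comment> \<open>Uniqueness makes both \<open>T\<close> and \<open>L\<close> isomorphic to one
    module, so \<open>T\<close> would be isomorphic to the projective \<open>L\<close>.\<close>
  ultimately obtain T0 :: "'a fgm" where T0: "basic_module \<Lambda> T0" "mod_iso \<Lambda> T T0" "mod_iso \<Lambda> L T0"
    using assms(7) T(1) unfolding unique_tau_tilting_def by blast
  have lm: "left_module \<Lambda> T" "left_module \<Lambda> T0" "left_module \<Lambda> L"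
    using T(1) T0(1) presentedD(1)[OF L] by (auto simp: basic_module_def)
  have "mod_iso \<Lambda> T L"
    by (rule mod_iso_trans[OF lm(1) T0(2) mod_iso_sym[OF lm(3,2) T0(3)]])
  then show False using T_not_projective[OF presented_projective[OF L]] by blast
qed

end
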